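(* Let $\mathfrak g$ be a complete dg Lie algebra. There is a canonical isomorphism (of simplicial sets) $$\mathrm{MC}(\mathfrak g\otimes C_\bullet)\cong\hom_{\mathsf{dgLie}}(\mathfrak{mc}_\bullet,\mathfrak g),$$ natural in $\mathfrak g$.
   Context: Work over a field $\mathbb K$ of characteristic $0$. Cochain complexes are $\mathbb Z$-graded with differential of degree $+1$; Koszul sign rule; $s$ is a formal element of degree $1$. **Complete dg Lie algebras.** A complete dg Lie algebra is a dg Lie algebra $\mathfrak g$ with a descending filtration, $F_1\mathfrak g=\mathfrak g$, $dF_n\mathfrak g\subseteq F_n\mathfrak g$, $[F_n\mathfrak g,F_m\mathfrak g]\subseteq F_{n+m}\mathfrak g$, $\mathfrak g\cong\varprojlim_n\mathfrak g/F_n\mathfrak g$. $\hom_{\mathsf{dgLie}}$ denotes dg Lie algebra morphisms compatible with the filtrations. A dg Lie algebra is an $L_\infty$-algebra with $\ell_2=[\,,]$, $\ell_n=0$ for $n\ge3$. For a complete $L_\infty$-algebra, $\mathrm{MC}$ denotes the set of degree $1$ elements $x$ with $dx+\sum_{n\ge2}\frac1{n!}\ell_n(x,\dots,x)=0$. **Dupont contraction.** $\Omega_n=\mathbb K[t_0,\dots,t_n,dt_0,\dots,dt_n]/(\sum t_i=1,\sum dt_i=0)$ is the simplicial commutative dg algebra of polynomial forms on $\Delta^n$. $C_n\subset\Omega_n$ is the (simplicial) subcomplex spanned by $\omega_I=k!\sum_{j=0}^k(-1)^jt_{i_j}dt_{i_0}\cdots\widehat{dt_{i_j}}\cdots dt_{i_k}$,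 $I=\{i_0<\cdots<i_k\}\subseteq\{0,\dots,n\}$; $i_n$ is the inclusion; $p_n(\alpha)=\sum_I(\int_{\Delta^I}\alpha)\,\omega_I$, where $\int_{\Delta^I}$ is integration of the restriction of $\alpha$ to the face with vertices $I$, with $\int_{\Delta^n}t_1^{a_1}\cdots t_n^{a_n}dt_1\cdots dt_n=\frac{a_1!\cdots a_n!}{(a_1+\cdots+a_n+n)!}$; and $h_n=\sum_{k=0}^{n-1}\sum_{i_0<\cdots<i_k}(-1)^k\omega_{i_0\dots i_k}h^{i_k}\cdots h^{i_0}$, where $h^i\alpha$ is obtained by integrating over $u\in[0,1]$ (with $du$ moved to the front) the pullback of $\alpha$ along $(u,t)\mapsto ut+(1-u)e_i$, $e_i$ the $i$-th vertex. These maps are simplicial and satisfy $p_\bullet i_\bullet=1$, $1-i_\bullet p_\bullet=dh_\bullet+h_\bullet d$, $h_\bullet i_\bullet=0$, $p_\bullet h_\bullet=0$, $h_\bullet^2=0$. **Transferred $L_\infty$-structure.** $\mathfrak g\otimes\Omega_n$ means the completed tensor product $\varprojlim_k(\mathfrak g/F_k\mathfrak g\otimes\Omega_n)$, with bracket extended by the product of $\Omega_n$. The contraction $(1\otimes i_\bullet,1\otimes p_\bullet,1\otimes h_\bullet)$ and the Homotopy Transfer Theorem give a simplicial $L_\infty$-structure on $\mathfrak g\otimes C_\bullet$: for a contraction $(i,p,h)$ ($dh+hd=1-ip$, side conditions) of an $L_\infty$-algebra $V$ onto $W$, regard the structure of $V$ as a codifferential $d+\delta$ on $S^c(V[1])=\bigoplus_{n\ge1}V[1]^{\odot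 n}$ ($V[1]^k=V^{k+1}$), $d$ induced by the differential and $\delta$ by the brackets $\ell_n$, $n\ge 2$, normalised so that the operations agree with $d,\ell_n$ on $V[1]^0=V^1$; let $H$ be the operator equal on $V[1]^{\odot n}$ to the map induced by $\frac1{n!}\sum_{\sigma\in S_n}\sigma^{-1}\big(\sum_{j=1}^n1^{\otimes j-1}\otimes h\otimes(ip)^{\otimes n-j}\big)\sigma$; the structure on $W$ is the codifferential $d+S(p)\,\delta\sum_{k\ge0}(-H\delta)^kS(i)$. $\mathrm{MC}(\mathfrak g\otimes C_\bullet)$ is taken with this structure. **The cosimplicial dg Lie algebra $\mathfrak{mc}_\bullet$.** The Homotopy Transfer Theorem applied to the commutative algebra $\Omega_n$ gives a simplicial $C_\infty$-algebra structure on $C_\bullet$. Dually, $sC_\bullet^\vee$ is a cosimplicial coalgebra over the bar construction $\mathrm B\mathit{Lie}$ of the operad $\mathit{Lie}$, and $\mathfrak{mc}_\bullet=\widehat\Omega_\pi(sC_\bullet^\vee)$ is its complete cobar construction with respect to the canonical twisting morphism $\pi:\mathrm B\mathit{Lie}\to\mathit{Lie}$: as a graded Lie algebra $\mathfrak{mc}_n=\widehat{\mathit{Lie}}(sC_n^\vee)=\prod_{k\ge1}\mathit{Lie}(k)\otimes_{S_k}(sC_n^\vee)^{\otimes k}$, filtered by bracket length, with differential minus the continuous derivation determined by the dual structure maps. Explicitly: on $C_n[1]$ write $|a|'=|a|-1$, $\beta(a,b)=(-1)^{|a|'}ab$ on $\Omega_n[1]$, $J_1=i_n$, $J_k=-h_n\sum_{r+q=k}\beta(J_r\otimes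 J_q)$, $b_1=d$, $b_k=p_n\sum_{r+q=k}\beta(J_r\otimes J_q)$ for $k\ge2$ (Koszul signs). These $b_k$ are the transferred $C_\infty$-operations, which vanish on shuffles. With $\{e_a\}$ the basis $\{\omega_I\}$ of $C_n$ and $\xi_a=se_a^\vee$ (degree $1-|e_a|$), the differential of $\mathfrak{mc}_n\subset\widehat T(sC_n^\vee)$ is the continuous derivation with $$\sum_ad\xi_a\otimes e_a=-\sum_{k\ge1}\sum_{a_1,\dots,a_k}(-1)^{\epsilon}\,\xi_{a_1}\cdots\xi_{a_k}\otimes b_k(e_{a_1},\dots,e_{a_k}),\quad \epsilon=\sum_j|\xi_{a_j}|+\sum_{i<j}|e_{a_i}|'|\xi_{a_j}|.$$ The cosimplicial structure is induced by the simplicial structure of $C_\bullet$. *)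

theory Defs
  imports Complex_Main "HOL-Library.Poly_Mapping" "HOL-Library.Function_Algebras"
    "HOL-Library.FuncSet" "HOL-Combinatorics.Permutations"
begin

section \<open>Conventions\<close>

text \<open>
  The ground field is a type \<open>'k\<close> of class \<open>field_char_0\<close>.  A vector space with a chosen
  basis \<open>'b\<close> (the forms \<open>\<Omega>\<^sub>n\<close>, the complex \<open>C\<^sub>n\<close>, the symmetric words below) is represented
  by finitely supported functions \<open>'b \<Rightarrow>\<^sub>0 'k\<close>.
  A \<open>\<int>\<close>-graded vector space is the family of its homogeneous components: all elements
  are homogeneous, and maps, filtrations and limits are taken degree by degree.
\<close>

definition sg :: "int \<Rightarrow> 'k::comm_ring_1" where
  "sg m = (if even m then 1 else - 1)"

definition cscale :: "'k::comm_ring_1 \<Rightarrow> ('b \<Rightarrow>\<^sub>0 'k) \<Rightarrow> ('b \<Rightarrow>\<^sub>0 'k)" where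
  "cscale c \<alpha> = Poly_Mapping.map ((*) c) \<alpha>"

text \<open>Linear extension of a map given on the basis.\<close>

definition lin :: "('a \<Rightarrow> ('b \<Rightarrow>\<^sub>0 'k)) \<Rightarrow> ('a \<Rightarrow>\<^sub>0 'k::comm_ring_1) \<Rightarrow> ('b \<Rightarrow>\<^sub>0 'k)" where
  "lin f \<alpha> = (\<Sum>x\<in>Poly_Mapping.keys \<alpha>. cscale (Poly_Mapping.lookup \<alpha> x) (f x))"


section \<open>Complete dg Lie algebras\<close>

text \<open>\<open>gr g d\<close> is the component of degree \<open>d\<close>; \<open>fil g n d\<close> is the component of degree \<open>d\<close>
  of \<open>F\<^sub>n g\<close>.  Only \<open>n \<ge> 1\<close> is used.\<close>

record ('k, 'v) fdgl =
  scl :: "'k \<Rightarrow> 'v \<Rightarrow> 'v"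
  gr  :: "int \<Rightarrow> 'v set"
  dif :: "'v \<Rightarrow> 'v"
  brk :: "'v \<Rightarrow> 'v \<Rightarrow> 'v"
  fil :: "nat \<Rightarrow> int \<Rightarrow> 'v set"

text \<open>The last two axioms are injectivity and surjectivity of the canonical map from \<open>g\<close> to
  the inverse limit of the quotients \<open>g / F\<^sub>n g\<close>.\<close>

locale complete_dg_lie =
  fixes g :: "('k::field_char_0, 'v::ab_group_add) fdgl"
  assumes vs: "vector_space (scl g)"
    and gr_subspace: "\<And>d. module.subspace (scl g) (gr g d)"
    and gr_independent: "\<And>D x. finite D \<Longrightarrow> (\<And>d. d \<in> D \<Longrightarrow> x d \<in> gr g d) \<Longrightarrow>
          (\<Sum>d\<in>D. x d) = 0 \<Longrightarrow> (\<And>d. d \<in> D \<Longrightarrow> x d = 0)"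
    and dif_degree: "\<And>d x. x \<in> gr g d \<Longrightarrow> dif g x \<in> gr g (d + 1)"
    and dif_add: "\<And>d x y. x \<in> gr g d \<Longrightarrow> y \<in> gr g d \<Longrightarrow> dif g (x + y) = dif g x + dif g y"
    and dif_scl: "\<And>d c x. x \<in> gr g d \<Longrightarrow> dif g (scl g c x) = scl g c (dif g x)"
    and dif_dif: "\<And>d x. x \<in> gr g d \<Longrightarrow> dif g (dif g x) = 0"
    and brk_degree: "\<And>d e x y. x \<in> gr g d \<Longrightarrow> y \<in> gr g e \<Longrightarrow> brk g x y \<in> gr g (d + e)"
    and brk_add: "\<And>d e x y z. x \<in> gr g d \<Longrightarrow> y \<in> gr g d \<Longrightarrow> z \<in> gr g e \<Longrightarrow>
          brk g (x + y) z = brk g x z + brk g y z"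
    and brk_scl: "\<And>d e c x y. x \<in> gr g d \<Longrightarrow> y \<in> gr g e \<Longrightarrow>
          brk g (scl g c x) y = scl g c (brk g x y)"
    and brk_antisym: "\<And>d e x y. x \<in> gr g d \<Longrightarrow> y \<in> gr g e \<Longrightarrow>
          brk g x y = - scl g (sg (d * e)) (brk g y x)"
    and brk_jacobi: "\<And>d e f x y z. x \<in> gr g d \<Longrightarrow> y \<in> gr g e \<Longrightarrow> z \<in> gr g f \<Longrightarrow>
          brk g x (brk g y z) = brk g (brk g x y) z + scl g (sg (d * e)) (brk g y (brk g x z))"
    and dif_brk: "\<And>d e x y. x \<in> gr g d \<Longrightarrow> y \<in> gr g e \<Longrightarrow>
          dif g (brk g x y) = brk g (dif g x) y + scl g (sg d) (brk g x (dif g y))"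
    and fil_subspace: "\<And>n d. 1 \<le> n \<Longrightarrow> module.subspace (scl g) (fil g n d)"
    and fil_one: "\<And>d. fil g 1 d = gr g d"
    and fil_descending: "\<And>n d. 1 \<le> n \<Longrightarrow> fil g (Suc n) d \<subseteq> fil g n d"
    and dif_fil: "\<And>n d x. 1 \<le> n \<Longrightarrow> x \<in> fil g n d \<Longrightarrow> dif g x \<in> fil g n (d + 1)"
    and brk_fil: "\<And>n m d e x y. 1 \<le> n \<Longrightarrow> 1 \<le> m \<Longrightarrow> x \<in> fil g n d \<Longrightarrow> y \<in> fil g m e \<Longrightarrow>
          brk g x y \<in> fil g (n + m) (d + e)"
    and complete_inj: "\<And>d x. x \<in> gr g d \<Longrightarrow> (\<And>n. 1 \<le> n \<Longrightarrow> x \<in> fil g n d) \<Longrightarrow> x = 0"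
    and complete_surj: "\<And>d x. (\<And>n. 1 \<le> n \<Longrightarrow> x n \<in> gr g d) \<Longrightarrow>
          (\<And>n. 1 \<le> n \<Longrightarrow> x (Suc n) - x n \<in> fil g n d) \<Longrightarrow>
          (\<exists>y\<in>gr g d. \<forall>n\<ge>1. y - x n \<in> fil g n d)"

definition elts :: "('k, 'v) fdgl \<Rightarrow> 'v set" where
  "elts g = (\<Union>d. gr g d)"

text \<open>Morphisms are extensional, so that equality of functions is equality of morphisms.\<close>

definition dgl_hom ::
  "('k, 'v::ab_group_add) fdgl \<Rightarrow> ('k, 'w::ab_group_add) fdgl \<Rightarrow> ('v \<Rightarrow> 'w) set" where
  "dgl_hom g h = {f \<in> extensional (elts g).
     (\<forall>d. \<forall>x\<in>gr g d. f x \<in> gr h d) \<and>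
     (\<forall>d. \<forall>x\<in>gr g d. \<forall>y\<in>gr g d. f (x + y) = f x + f y) \<and>
     (\<forall>d c. \<forall>x\<in>gr g d. f (scl g c x) = scl h c (f x)) \<and>
     (\<forall>d. \<forall>x\<in>gr g d. f (dif g x) = dif h (f x)) \<and>
     (\<forall>d e. \<forall>x\<in>gr g d. \<forall>y\<in>gr g e. f (brk g x y) = brk h (f x) (f y)) \<and>
     (\<forall>n\<ge>1. \<forall>d. \<forall>x\<in>fil g n d. f x \<in> fil h n d)}"

text \<open>\<open>y\<close> is the sum of the family \<open>f\<close> over \<open>A\<close> in degree \<open>e\<close>, for the topology of the
  filtration.\<close>

definition has_csum ::
  "('k, 'v::ab_group_add) fdgl \<Rightarrow> int \<Rightarrow> ('i \<Rightarrow> 'v) \<Rightarrow> 'i set \<Rightarrow> 'v \<Rightarrow> bool" where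
  "has_csum g e f A y \<longleftrightarrow> y \<in> gr g e \<and>
     (\<forall>n\<ge>1. \<exists>S0. finite S0 \<and> S0 \<subseteq> A \<and>
        (\<forall>S. finite S \<and> S0 \<subseteq> S \<and> S \<subseteq> A \<longrightarrow> (\<Sum>i\<in>S. f i) - y \<in> fil g n e))"

definition csum ::
  "('k, 'v::ab_group_add) fdgl \<Rightarrow> int \<Rightarrow> ('i \<Rightarrow> 'v) \<Rightarrow> 'i set \<Rightarrow> 'v" where
  "csum g e f A = (THE y. has_csum g e f A y)"


section \<open>Polynomial forms on simplices\<close>

text \<open>
  Using \<open>\<Sum>t\<^sub>i = 1\<close> and \<open>\<Sum>dt\<^sub>i = 0\<close> to eliminate \<open>t\<^sub>0\<close> and \<open>dt\<^sub>0\<close>, the algebra \<open>\<Omega>\<^sub>n\<close> has as basis the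
  monomials \<open>t\<^sup>a dt\<^sub>A\<close> in \<open>t\<^sub>1, \<dots>, t\<^sub>n\<close>, encoded as pairs \<open>(a, A)\<close>; the factors of
  \<open>dt\<^sub>A\<close> are in increasing order of their indices.  The variable with index \<open>0\<close> is
  thereby free, and is the parameter \<open>u\<close> in the definition of \<open>h\<^sup>i\<close>.
\<close>

type_synonym fmono = "(nat \<Rightarrow>\<^sub>0 nat) \<times> nat set"
type_synonym 'k form = "fmono \<Rightarrow>\<^sub>0 'k"

definition form_basis :: "nat \<Rightarrow> fmono set" where
  "form_basis n = {(a, A). Poly_Mapping.keys a \<subseteq> {1..n} \<and> A \<subseteq> {1..n}}"

definition mdeg :: "fmono \<Rightarrow> int" where
  "mdeg m = int (card (snd m))"

definition form_one :: "'k::field_char_0 form" where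
  "form_one = Poly_Mapping.single (0, {}) 1"

definition var :: "nat \<Rightarrow> 'k::field_char_0 form" where
  "var i = Poly_Mapping.single (Poly_Mapping.single i 1, {}) 1"

definition wedge_mono :: "fmono \<Rightarrow> fmono \<Rightarrow> 'k::field_char_0 form" where
  "wedge_mono x y = (if snd x \<inter> snd y = {}
     then Poly_Mapping.single (fst x + fst y, snd x \<union> snd y)
            ((- 1) ^ card {(i, j). i \<in> snd x \<and> j \<in> snd y \<and> j < i})
     else 0)"

definition wedge :: "'k::field_char_0 form \<Rightarrow> 'k form \<Rightarrow> 'k form" where
  "wedge \<alpha> \<beta> = lin (\<lambda>x. lin (wedge_mono x) \<beta>) \<alpha>"

definition wedges :: "'k::field_char_0 form list \<Rightarrow> 'k form" where
  "wedges \<alpha>s = foldr wedge \<alpha>s form_one"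

definition dform :: "'k::field_char_0 form \<Rightarrow> 'k form" where
  "dform = lin (\<lambda>(a, A). \<Sum>i\<in>Poly_Mapping.keys a - A.
     Poly_Mapping.single (a - Poly_Mapping.single i 1, insert i A)
       (of_nat (Poly_Mapping.lookup a i) * (- 1) ^ card {j \<in> A. j < i}))"

text \<open>The dg algebra morphism with \<open>t\<^sub>i \<mapsto> s i\<close> for functions \<open>s i\<close> (forms of degree \<open>0\<close>).\<close>

definition pullback :: "(nat \<Rightarrow> 'k::field_char_0 form) \<Rightarrow> 'k form \<Rightarrow> 'k form" where
  "pullback s = lin (\<lambda>(a, A). wedges
     (concat (map (\<lambda>i. replicate (Poly_Mapping.lookup a i) (s i))
                (sorted_list_of_set (Poly_Mapping.keys a)))
      @ map (\<lambda>i. dform (s i)) (sorted_list_of_set A)))"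

text \<open>The barycentric coordinate \<open>t\<^sub>j\<close> of \<open>\<Omega>\<^sub>n\<close>, for \<open>0 \<le> j \<le> n\<close>.\<close>

definition bary :: "nat \<Rightarrow> nat \<Rightarrow> 'k::field_char_0 form" where
  "bary n j = (if j = 0 then form_one - (\<Sum>i=1..n. var i) else var j)"

definition simplex_map :: "nat \<Rightarrow> nat \<Rightarrow> (nat \<Rightarrow> nat) \<Rightarrow> bool" where
  "simplex_map m n \<phi> \<longleftrightarrow> \<phi> \<in> {0..m} \<rightarrow> {0..n} \<and> mono_on {0..m} \<phi>"

text \<open>The map \<open>\<Omega>\<^sub>n \<rightarrow> \<Omega>\<^sub>m\<close> induced by \<open>\<phi>: [m] \<rightarrow> [n]\<close>.\<close>

definition form_map :: "nat \<Rightarrow> (nat \<Rightarrow> nat) \<Rightarrow> 'k::field_char_0 form \<Rightarrow> 'k form" where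
  "form_map m \<phi> = pullback (\<lambda>i. \<Sum>j | j \<le> m \<and> \<phi> j = i. bary m j)"

definition simplex_integral :: "nat \<Rightarrow> 'k::field_char_0 form \<Rightarrow> 'k" where
  "simplex_integral k \<alpha> = (\<Sum>x | x \<in> Poly_Mapping.keys \<alpha> \<and> snd x = {1..k}.
     Poly_Mapping.lookup \<alpha> x * (\<Prod>i=1..k. fact (Poly_Mapping.lookup (fst x) i))
       / fact ((\<Sum>i=1..k. Poly_Mapping.lookup (fst x) i) + k))"


section \<open>The Dupont contraction\<close>

text \<open>\<open>C\<^sub>n\<close> is given in coordinates with respect to its basis \<open>\<omega>\<^sub>I\<close>, \<open>I\<close> a face; the inclusion
  \<open>i\<^sub>n\<close> is then \<open>lin (omega n)\<close>.\<close>

definition faces :: "nat \<Rightarrow> nat set set" where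
  "faces n = {I. I \<subseteq> {0..n} \<and> I \<noteq> {}}"

definition cdeg :: "nat set \<Rightarrow> int" where
  "cdeg I = int (card I) - 1"

definition omega :: "nat \<Rightarrow> nat set \<Rightarrow> 'k::field_char_0 form" where
  "omega n I = (let l = sorted_list_of_set I in
     \<Sum>j<length l. cscale (fact (length l - 1) * (- 1) ^ j)
       (wedges (bary n (l ! j) # map (\<lambda>i. dform (bary n i)) (take j l @ drop (Suc j) l))))"

definition dupont_p :: "nat \<Rightarrow> 'k::field_char_0 form \<Rightarrow> (nat set \<Rightarrow>\<^sub>0 'k)" where
  "dupont_p n \<alpha> = (\<Sum>I\<in>faces n. Poly_Mapping.single I
     (simplex_integral (card I - 1) (form_map (card I - 1) (\<lambda>j. sorted_list_of_set I ! j) \<alpha>)))"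

text \<open>Since \<open>du\<close> has index \<open>0\<close>, it already is the first factor of any monomial containing it.\<close>

definition fibre_integral :: "'k::field_char_0 form \<Rightarrow> 'k form" where
  "fibre_integral = lin (\<lambda>(a, A). if 0 \<in> A
     then Poly_Mapping.single (a - Poly_Mapping.single 0 (Poly_Mapping.lookup a 0), A - {0})
            (1 / of_nat (Poly_Mapping.lookup a 0 + 1))
     else 0)"

definition h_vertex :: "nat \<Rightarrow> 'k::field_char_0 form \<Rightarrow> 'k form" where
  "h_vertex i \<alpha> = fibre_integral
     (pullback (\<lambda>j. wedge (var 0) (var j) + (if j = i then form_one - var 0 else 0)) \<alpha>)"

text \<open>\<open>fold\<close> applies \<open>h\<^sup>i\<close> for the smallest vertex first.\<close>

definition dupont_h :: "nat \<Rightarrow> 'k::field_char_0 form \<Rightarrow> 'k form" where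
  "dupont_h n \<alpha> = (\<Sum>I | I \<subseteq> {0..n} \<and> 1 \<le> card I \<and> card I \<le> n.
     cscale ((- 1) ^ (card I - 1)) (wedge (omega n I) (fold h_vertex (sorted_list_of_set I) \<alpha>)))"

definition C_d :: "nat \<Rightarrow> nat set \<Rightarrow> (nat set \<Rightarrow>\<^sub>0 'k::field_char_0)" where
  "C_d n I = dupont_p n (dform (omega n I))"

text \<open>The map \<open>C\<^sub>n \<rightarrow> C\<^sub>m\<close> induced by \<open>\<phi>: [m] \<rightarrow> [n]\<close>, on basis elements.\<close>

definition C_map :: "nat \<Rightarrow> nat \<Rightarrow> (nat \<Rightarrow> nat) \<Rightarrow> nat set \<Rightarrow> (nat set \<Rightarrow>\<^sub>0 'k::field_char_0)" where
  "C_map m n \<phi> I = dupont_p m (form_map m \<phi> (omega n I))"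


section \<open>Completed tensor products\<close>

text \<open>
  Let \<open>E\<close> be a graded vector space with basis \<open>B\<close>.  For complete \<open>g\<close>, an element of degree \<open>D\<close>
  of the inverse limit of the \<open>(g / F\<^sub>k g) \<otimes> E\<close> is a family \<open>z\<close> of coefficients in \<open>g\<close> that,
  for each \<open>k\<close>, has only finitely many members outside \<open>F\<^sub>k g\<close>; it stands for \<open>\<Sum>z b \<otimes> b\<close>.
\<close>

definition ctensor ::
  "('k, 'v::ab_group_add) fdgl \<Rightarrow> 'b set \<Rightarrow> ('b \<Rightarrow> int) \<Rightarrow> int \<Rightarrow> ('b \<Rightarrow> 'v) set" where
  "ctensor g B deg D = {z. (\<forall>b\<in>B. z b \<in> gr g (D - deg b)) \<and> (\<forall>b. b \<notin> B \<longrightarrow> z b = 0) \<and>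
     (\<forall>k\<ge>1. finite {b \<in> B. z b \<notin> fil g k (D - deg b)})}"

text \<open>\<open>1 \<otimes> T\<close> on elements of degree \<open>D\<close>, where \<open>T\<close> has degree \<open>t\<close> and is given on the basis
  \<open>B\<close>.\<close>

definition tensor_op ::
  "('k::field_char_0, 'v::ab_group_add) fdgl \<Rightarrow> 'b set \<Rightarrow> ('b \<Rightarrow> int) \<Rightarrow> ('c \<Rightarrow> int) \<Rightarrow> int \<Rightarrow>
   ('b \<Rightarrow> ('c \<Rightarrow>\<^sub>0 'k)) \<Rightarrow> int \<Rightarrow> ('b \<Rightarrow> 'v) \<Rightarrow> ('c \<Rightarrow> 'v)" where
  "tensor_op g B degB degC t T D z = (\<lambda>c. csum g (D + t - degC c)
     (\<lambda>b. scl g (sg (t * (D - degB b)) * Poly_Mapping.lookup (T b) c) (z b)) B)"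

text \<open>The bracket of elements of degrees \<open>D\<close> and \<open>E\<close> of \<open>g \<otimes> \<Omega>\<^sub>n\<close>.\<close>

definition tensor_brk ::
  "('k::field_char_0, 'v::ab_group_add) fdgl \<Rightarrow> nat \<Rightarrow> int \<Rightarrow> int \<Rightarrow>
   (fmono \<Rightarrow> 'v) \<Rightarrow> (fmono \<Rightarrow> 'v) \<Rightarrow> (fmono \<Rightarrow> 'v)" where
  "tensor_brk g n D E z w = (\<lambda>m. csum g (D + E - mdeg m)
     (\<lambda>(b, c). scl g (sg (mdeg b * (E - mdeg c)) * Poly_Mapping.lookup (wedge_mono b c) m)
        (brk g (z b) (w c)))
     (form_basis n \<times> form_basis n))"


section \<open>Homotopy transfer\<close>

text \<open>
  A letter \<open>(D, z)\<close> is an element \<open>z\<close> of degree \<open>D\<close> of \<open>V\<close>, hence of degree \<open>D - 1\<close> of \<open>V[1]\<close>.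
  The space \<open>S\<^sup>c(V[1])\<close> is the quotient of the vector space with basis the nonempty words by
  the relations expressing multilinearity and graded commutativity (with Koszul signs).
  The operators below are given on words; they respect these relations, and so does the
  projection to words of length one by which the operations on \<open>W\<close> are read off.
\<close>

type_synonym 'a letter = "int \<times> 'a"
type_synonym ('a, 'k) words = "'a letter list \<Rightarrow>\<^sub>0 'k"

definition sdeg :: "'a letter \<Rightarrow> int" where
  "sdeg x = fst x - 1"

definition S_map :: "('a letter \<Rightarrow> 'b letter) \<Rightarrow> ('a, 'k::field_char_0) words \<Rightarrow> ('b, 'k) words" where
  "S_map f = lin (\<lambda>w. Poly_Mapping.single (map f w) 1)"

text \<open>The coderivation with only component \<open>l : V[1] \<odot> V[1] \<rightarrow> V[1]\<close>, of degree \<open>1\<close>.  The sign is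
  that of moving the letters at positions \<open>i < j\<close> to the front.\<close>

definition S_delta :: "('a letter \<Rightarrow> 'a letter \<Rightarrow> 'a letter) \<Rightarrow>
    ('a, 'k::field_char_0) words \<Rightarrow> ('a, 'k) words" where
  "S_delta l = lin (\<lambda>w. \<Sum>j<length w. \<Sum>i<j.
     Poly_Mapping.single (l (w ! i) (w ! j) # nths w (- {i, j}))
       (sg (sdeg (w ! i) * (\<Sum>k<i. sdeg (w ! k)) + sdeg (w ! j) * (\<Sum>k\<in>{..<j} - {i}. sdeg (w ! k)))))"

definition S_perm :: "(nat \<Rightarrow> nat) \<Rightarrow> ('a, 'k::field_char_0) words \<Rightarrow> ('a, 'k) words" where
  "S_perm \<sigma> = lin (\<lambda>w. Poly_Mapping.single (map (\<lambda>i. w ! \<sigma> i) [0..<length w])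
     (\<Prod>(i, j) | i < j \<and> j < length w \<and> \<sigma> j < \<sigma> i. sg (sdeg (w ! \<sigma> i) * sdeg (w ! \<sigma> j))))"

text \<open>The sum of the maps \<open>1\<^bsup>\<otimes>j\<^esup> \<otimes> h \<otimes> (ip)\<^bsup>\<otimes>n-1-j\<^esup>\<close>, \<open>0 \<le> j < n\<close>, on words of length \<open>n\<close>, for
  \<open>h\<close> of degree \<open>-1\<close> and \<open>ip\<close> of degree \<open>0\<close>.\<close>

definition S_h1 :: "('a letter \<Rightarrow> 'a letter) \<Rightarrow> ('a letter \<Rightarrow> 'a letter) \<Rightarrow>
    ('a, 'k::field_char_0) words \<Rightarrow> ('a, 'k) words" where
  "S_h1 h ip = lin (\<lambda>w. \<Sum>j<length w.
     Poly_Mapping.single (take j w @ h (w ! j) # map ip (drop (Suc j) w)) (sg (\<Sum>k<j. sdeg (w ! k))))"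

definition S_H :: "('a letter \<Rightarrow> 'a letter) \<Rightarrow> ('a letter \<Rightarrow> 'a letter) \<Rightarrow>
    ('a, 'k::field_char_0) words \<Rightarrow> ('a, 'k) words" where
  "S_H h ip = lin (\<lambda>w. cscale (1 / fact (length w))
     (\<Sum>\<sigma> | \<sigma> permutes {..<length w}.
        S_perm (inv \<sigma>) (S_h1 h ip (S_perm \<sigma> (Poly_Mapping.single w 1)))))"

text \<open>The perturbation \<open>S(p) \<delta> \<Sum>\<^sub>k (-H\<delta>)\<^sup>k S(i)\<close> on a word of length \<open>N\<close>: as \<open>\<delta>\<close> lowers the length
  by one, the terms with \<open>k \<ge> N\<close> vanish.\<close>

definition transfer_word :: "('b letter \<Rightarrow> 'a letter) \<Rightarrow> ('a letter \<Rightarrow> 'b letter) \<Rightarrow>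
    ('a letter \<Rightarrow> 'a letter) \<Rightarrow> ('a letter \<Rightarrow> 'a letter \<Rightarrow> 'a letter) \<Rightarrow>
    'b letter list \<Rightarrow> ('b, 'k::field_char_0) words" where
  "transfer_word i p h l w = S_map p (S_delta l (\<Sum>k<length w.
     ((\<lambda>c. - S_H h (i \<circ> p) (S_delta l c)) ^^ k) (S_map i (Poly_Mapping.single w 1))))"

text \<open>\<open>V = g \<otimes> \<Omega>\<^sub>n\<close> and \<open>W = g \<otimes> C\<^sub>n\<close>.\<close>

definition V_i :: "('k::field_char_0, 'v::ab_group_add) fdgl \<Rightarrow> nat \<Rightarrow>
    (nat set \<Rightarrow> 'v) letter \<Rightarrow> (fmono \<Rightarrow> 'v) letter" where
  "V_i g n = (\<lambda>(D, z). (D, tensor_op g (faces n) cdeg mdeg 0 (omega n) D z))"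

definition V_p :: "('k::field_char_0, 'v::ab_group_add) fdgl \<Rightarrow> nat \<Rightarrow>
    (fmono \<Rightarrow> 'v) letter \<Rightarrow> (nat set \<Rightarrow> 'v) letter" where
  "V_p g n = (\<lambda>(D, z). (D, tensor_op g (form_basis n) mdeg cdeg 0
     (\<lambda>m. dupont_p n (Poly_Mapping.single m 1)) D z))"

definition V_h :: "('k::field_char_0, 'v::ab_group_add) fdgl \<Rightarrow> nat \<Rightarrow>
    (fmono \<Rightarrow> 'v) letter \<Rightarrow> (fmono \<Rightarrow> 'v) letter" where
  "V_h g n = (\<lambda>(D, z). (D - 1, tensor_op g (form_basis n) mdeg mdeg (- 1)
     (\<lambda>m. dupont_h n (Poly_Mapping.single m 1)) D z))"

text \<open>The bracket shifted to \<open>V[1]\<close>; the sign makes it graded symmetric, and equal to the bracket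
  on \<open>V\<^sup>1\<close>.\<close>

definition V_l :: "('k::field_char_0, 'v::ab_group_add) fdgl \<Rightarrow> nat \<Rightarrow>
    (fmono \<Rightarrow> 'v) letter \<Rightarrow> (fmono \<Rightarrow> 'v) letter \<Rightarrow> (fmono \<Rightarrow> 'v) letter" where
  "V_l g n = (\<lambda>(D, z) (E, w). (D + E, (\<lambda>m. scl g (sg (D - 1)) (tensor_brk g n D E z w m))))"

definition W_d :: "('k::field_char_0, 'v::ab_group_add) fdgl \<Rightarrow> nat \<Rightarrow> int \<Rightarrow>
    (nat set \<Rightarrow> 'v) \<Rightarrow> (nat set \<Rightarrow> 'v)" where
  "W_d g n D z = (\<lambda>I. dif g (z I)) + tensor_op g (faces n) cdeg cdeg 1 (C_d n) D z"

text \<open>The \<open>L\<^sub>\<infinity>\<close>-operations of \<open>g \<otimes> C\<^sub>n\<close>, as maps \<open>W[1]\<^bsup>\<odot>k\<^esup> \<rightarrow> W[1]\<close>; the arity \<open>k\<close> is the length of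
  the word.\<close>

definition W_l :: "('k::field_char_0, 'v::ab_group_add) fdgl \<Rightarrow> nat \<Rightarrow>
    (nat set \<Rightarrow> 'v) letter list \<Rightarrow> (nat set \<Rightarrow> 'v)" where
  "W_l g n w = (if length w = 1 then W_d g n (fst (hd w)) (snd (hd w))
     else (let c = transfer_word (V_i g n) (V_p g n) (V_h g n) (V_l g n) w in
       (\<lambda>I. \<Sum>x | x \<in> Poly_Mapping.keys c \<and> length x = 1.
          scl g (Poly_Mapping.lookup c x) (snd (hd x) I))))"

definition MC :: "('k::field_char_0, 'v::ab_group_add) fdgl \<Rightarrow> nat \<Rightarrow> (nat set \<Rightarrow> 'v) set" where
  "MC g n = {x \<in> ctensor g (faces n) cdeg 1. \<forall>I\<in>faces n.
     has_csum g (2 - cdeg I) (\<lambda>k. scl g (1 / fact k) (W_l g n (replicate k (1, x)) I)) {1..} 0}"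

definition MC_act :: "('k::field_char_0, 'v::ab_group_add) fdgl \<Rightarrow> nat \<Rightarrow> nat \<Rightarrow> (nat \<Rightarrow> nat) \<Rightarrow>
    (nat set \<Rightarrow> 'v) \<Rightarrow> (nat set \<Rightarrow> 'v)" where
  "MC_act g m n \<phi> x = tensor_op g (faces n) cdeg cdeg 0 (C_map m n \<phi>) 1 x"

definition MC_map :: "('v \<Rightarrow> 'w) \<Rightarrow> (nat set \<Rightarrow> 'v::zero) \<Rightarrow> (nat set \<Rightarrow> 'w)" where
  "MC_map f x = (\<lambda>I. f (x I))"


section \<open>The cosimplicial dg Lie algebra mc\<close>

definition sbeta :: "'k::field_char_0 form \<Rightarrow> 'k form \<Rightarrow> 'k form" where
  "sbeta \<alpha> \<gamma> = wedge (lin (\<lambda>m. Poly_Mapping.single m (sg (mdeg m - 1))) \<alpha>) \<gamma>"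

text \<open>\<open>J\<^sub>k\<close> and \<open>b\<^sub>k\<close> on basis elements of \<open>C\<^sub>n\<close>; the arity \<open>k\<close> is the length of the list.\<close>

function C_J :: "nat \<Rightarrow> nat set list \<Rightarrow> 'k::field_char_0 form" where
  "C_J n w = (if length w = 0 then 0 else if length w = 1 then omega n (hd w)
     else - dupont_h n (\<Sum>r\<in>{1..<length w}. sbeta (C_J n (take r w)) (C_J n (drop r w))))"
  by pat_completeness auto
termination by (relation "measure (\<lambda>(n, w). length w)") auto

declare C_J.simps [simp del]

definition C_b :: "nat \<Rightarrow> nat set list \<Rightarrow> (nat set \<Rightarrow>\<^sub>0 'k::field_char_0)" where
  "C_b n w = (if length w = 1 then C_d n (hd w)
     else dupont_p n (\<Sum>r\<in>{1..<length w}. sbeta (C_J n (take r w)) (C_J n (drop r w))))"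

text \<open>Elements of the completed tensor algebra on the generators \<open>\<xi>\<^sub>I\<close>, \<open>I\<close> a face, are series
  in words of faces.\<close>

type_synonym 'k tseries = "nat set list \<Rightarrow> 'k"

definition xdeg :: "nat set \<Rightarrow> int" where
  "xdeg I = 1 - cdeg I"

definition wdeg :: "nat set list \<Rightarrow> int" where
  "wdeg w = (\<Sum>I\<leftarrow>w. xdeg I)"

definition xi :: "nat set \<Rightarrow> 'k::field_char_0 tseries" where
  "xi I = (\<lambda>w. if w = [I] then 1 else 0)"

definition tscl :: "'k::field_char_0 \<Rightarrow> 'k tseries \<Rightarrow> 'k tseries" where
  "tscl c s = (\<lambda>w. c * s w)"

text \<open>The graded commutator.\<close>

definition tbrk :: "'k::field_char_0 tseries \<Rightarrow> 'k tseries \<Rightarrow> 'k tseries" where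
  "tbrk s t = (\<lambda>w. \<Sum>i\<le>length w. s (take i w) * t (drop i w)
     - sg (wdeg (take i w) * wdeg (drop i w)) * t (take i w) * s (drop i w))"

text \<open>\<open>lie_part n k d\<close> is the part of bracket length \<open>k\<close> and degree \<open>d\<close> of the free graded Lie
  algebra on the \<open>\<xi>\<^sub>I\<close>, realised (in characteristic \<open>0\<close>) as the Lie subalgebra of the tensor
  algebra that they generate.\<close>

inductive lie_part :: "nat \<Rightarrow> nat \<Rightarrow> int \<Rightarrow> 'k::field_char_0 tseries \<Rightarrow> bool"
  for n :: nat where
  gen: "I \<in> faces n \<Longrightarrow> lie_part n 1 (xdeg I) (xi I)"
| zero: "lie_part n k d 0"
| add: "lie_part n k d s \<Longrightarrow> lie_part n k d t \<Longrightarrow> lie_part n k d (s + t)"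
| scl: "lie_part n k d s \<Longrightarrow> lie_part n k d (tscl c s)"
| brk: "lie_part n k d s \<Longrightarrow> lie_part n l e t \<Longrightarrow> lie_part n (k + l) (d + e) (tbrk s t)"

definition mc_gr :: "nat \<Rightarrow> int \<Rightarrow> ('k::field_char_0 tseries) set" where
  "mc_gr n d = {s. s [] = 0 \<and> (\<forall>k\<ge>1. lie_part n k d (\<lambda>w. if length w = k then s w else 0))}"

text \<open>The coefficient of the word \<open>v\<close> in \<open>d \<xi>\<^sub>I\<close>.\<close>

definition dxi :: "nat \<Rightarrow> nat set \<Rightarrow> 'k::field_char_0 tseries" where
  "dxi n I v = (if v \<noteq> [] \<and> set v \<subseteq> faces n
     then - (sg ((\<Sum>j<length v. xdeg (v ! j))
                 + (\<Sum>j<length v. \<Sum>i<j. (cdeg (v ! i) - 1) * xdeg (v ! j)))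
             * Poly_Mapping.lookup (C_b n v) I)
     else 0)"

text \<open>The continuous derivation extending \<open>\<xi>\<^sub>I \<mapsto> d \<xi>\<^sub>I\<close>: the coefficient of \<open>w\<close> collects all
  ways in which a factor \<open>v\<close> of \<open>w = u v z\<close> arises from a letter \<open>I\<close> of \<open>u I z\<close>.\<close>

definition mc_dif :: "nat \<Rightarrow> 'k::field_char_0 tseries \<Rightarrow> 'k tseries" where
  "mc_dif n s = (\<lambda>w. \<Sum>j\<le>length w. \<Sum>i<j. \<Sum>I\<in>faces n.
     sg (wdeg (take i w)) * s (take i w @ I # drop j w) * dxi n I (drop i (take j w)))"

definition mc :: "nat \<Rightarrow> ('k::field_char_0, 'k tseries) fdgl" where
  "mc n = \<lparr>scl = tscl, gr = mc_gr n, dif = mc_dif n, brk = tbrk,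
     fil = (\<lambda>k d. {s \<in> mc_gr n d. \<forall>w. length w < k \<longrightarrow> s w = 0})\<rparr>"

text \<open>The map \<open>mc\<^sub>m \<rightarrow> mc\<^sub>n\<close> induced by \<open>\<phi>: [m] \<rightarrow> [n]\<close>: on generators it is dual to the map
  \<open>C\<^sub>n \<rightarrow> C\<^sub>m\<close>, that is \<open>\<xi>\<^sub>J \<mapsto> \<Sum>\<^sub>I (C_map m n \<phi> I)\<^sub>J \<xi>\<^sub>I\<close>, and it is extended to a continuous
  morphism of algebras.\<close>

definition mc_map :: "nat \<Rightarrow> nat \<Rightarrow> (nat \<Rightarrow> nat) \<Rightarrow> 'k::field_char_0 tseries \<Rightarrow> 'k tseries" where
  "mc_map m n \<phi> s = (\<lambda>w. if set w \<subseteq> faces n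
     then (\<Sum>v | set v \<subseteq> faces m \<and> length v = length w.
             s v * (\<Prod>i<length w. Poly_Mapping.lookup (C_map m n \<phi> (w ! i)) (v ! i)))
     else 0)"

definition hom_act :: "nat \<Rightarrow> nat \<Rightarrow> (nat \<Rightarrow> nat) \<Rightarrow>
    ('k::field_char_0 tseries \<Rightarrow> 'v) \<Rightarrow> ('k tseries \<Rightarrow> 'v)" where
  "hom_act m n \<phi> f =
     compose (elts (mc m :: ('k, 'k tseries) fdgl)) f (mc_map m n \<phi>)"


section \<open>Simplicial sets and the canonical map\<close>

text \<open>\<open>act m n \<phi> : X n \<rightarrow> X m\<close> is the map induced by \<open>\<phi>: [m] \<rightarrow> [n]\<close>; the last axiom says that it only
  depends on the restriction of \<open>\<phi>\<close> to \<open>{0..m}\<close>.\<close>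

definition simplicial_set ::
  "(nat \<Rightarrow> 'a set) \<Rightarrow> (nat \<Rightarrow> nat \<Rightarrow> (nat \<Rightarrow> nat) \<Rightarrow> 'a \<Rightarrow> 'a) \<Rightarrow> bool" where
  "simplicial_set X act \<longleftrightarrow>
     (\<forall>m n \<phi>. simplex_map m n \<phi> \<longrightarrow> (\<forall>x\<in>X n. act m n \<phi> x \<in> X m)) \<and>
     (\<forall>n. \<forall>x\<in>X n. act n n id x = x) \<and>
     (\<forall>l m n \<phi> \<psi>. simplex_map m n \<phi> \<longrightarrow> simplex_map l m \<psi> \<longrightarrow>
        (\<forall>x\<in>X n. act l m \<psi> (act m n \<phi> x) = act l n (\<phi> \<circ> \<psi>) x)) \<and>
     (\<forall>m n \<phi> \<phi>'. simplex_map m n \<phi> \<longrightarrow> simplex_map m n \<phi>' \<longrightarrow> (\<forall>j\<le>m. \<phi> j = \<phi>' j) \<longrightarrow>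
        (\<forall>x\<in>X n. act m n \<phi> x = act m n \<phi>' x))"

definition simplicial_iso ::
  "(nat \<Rightarrow> 'a set) \<Rightarrow> (nat \<Rightarrow> nat \<Rightarrow> (nat \<Rightarrow> nat) \<Rightarrow> 'a \<Rightarrow> 'a) \<Rightarrow>
   (nat \<Rightarrow> 'b set) \<Rightarrow> (nat \<Rightarrow> nat \<Rightarrow> (nat \<Rightarrow> nat) \<Rightarrow> 'b \<Rightarrow> 'b) \<Rightarrow> (nat \<Rightarrow> 'a \<Rightarrow> 'b) \<Rightarrow> bool" where
  "simplicial_iso X actX Y actY F \<longleftrightarrow>
     simplicial_set X actX \<and> simplicial_set Y actY \<and>
     (\<forall>n. bij_betw (F n) (X n) (Y n)) \<and>
     (\<forall>m n \<phi>. simplex_map m n \<phi> \<longrightarrow>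
        (\<forall>x\<in>X n. F m (actX m n \<phi> x) = actY m n \<phi> (F n x)))"

text \<open>The canonical map sends a morphism \<open>f\<close> to \<open>\<Sum>\<^sub>I f \<xi>\<^sub>I \<otimes> \<omega>\<^sub>I\<close>.\<close>

definition hom_to_MC :: "nat \<Rightarrow> ('k::field_char_0 tseries \<Rightarrow> 'v::ab_group_add) \<Rightarrow>
    (nat set \<Rightarrow> 'v)" where
  "hom_to_MC n f = (\<lambda>I. if I \<in> faces n then f (xi I) else 0)"

end

theory Submission
 imports Defs
begin

text \<open>
  A morphism of complete graded Lie algebras out of \<open>mc\<^sub>n\<close> is the same as a choice of images
  \<open>x\<^sub>I\<close> of the generators \<open>\<xi>\<^sub>I\<close>; write \<open>F\<^sub>x\<close> for the morphism belonging to the family \<open>x\<close>. It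
  commutes with the differentials if and only if \<open>F\<^sub>x (d \<xi>\<^sub>I) = d x\<^sub>I\<close> for every face \<open>I\<close>. The theorem
  holds because these equations are the components of the Maurer--Cartan equation of
  \<open>\<Sum> x\<^sub>I \<otimes> \<omega>\<^sub>I\<close> (\<open>mc_equation\<close>). Both sides are expressed through the elements
  \<open>J\<^sub>1 = i x\<close>, \<open>J\<^sub>k = - h (1/2 \<Sum> [J\<^sub>r, J\<^sub>k\<^sub>-\<^sub>r])\<close> of \<open>g \<otimes> \<Omega>\<^sub>n\<close>.

  On the side of \<open>mc\<^sub>n\<close>, the coefficients of the words of length \<open>k\<close> in the recursion for the
  \<open>C\<^sub>\<infinity>\<close>-operations form an element \<open>U\<^sub>k\<close> of the free Lie algebra tensored with \<open>\<Omega>\<^sub>n\<close>. It satisfies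
  the recursion for \<open>J\<^sub>k\<close> with the commutator as bracket (\<open>U_quad\<close>), hence is a Lie element
  (\<open>U_lie\<close>) that \<open>F\<^sub>x\<close> sends to \<open>J\<^sub>k\<close> (\<open>JJ_ev\<close>). The part of \<open>d \<xi>\<^sub>I\<close> of length \<open>k \<ge> 2\<close> therefore
  goes to the component \<open>I\<close> of \<open>- p (1/2 \<Sum> [J\<^sub>r, J\<^sub>k\<^sub>-\<^sub>r])\<close> (\<open>dxi_ev\<close>). The morphism \<open>F\<^sub>x\<close> is defined by
  Dynkin's formula, as \<open>1/k\<close> times the right-normed bracket on words of length \<open>k\<close>; in
  characteristic \<open>0\<close> this is compatible with brackets of Lie elements (\<open>ev_brk\<close>).

  On the side of the homotopy transfer, the side conditions \<open>h h = 0\<close>, \<open>h i = 0\<close>, \<open>p h = 0\<close> kill all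
  words but those in which \<open>h\<close> is applied to the bracket just formed, and the symmetrisation in
  \<open>H\<close> only leaves a factor \<open>1/(q+1)\<close>, where \<open>q\<close> counts the other letters in the image of \<open>h\<close>
  (\<open>S_H_word\<close>). Summed over compositions of \<open>N\<close>, these factors telescope, and \<open>1/N!\<close> times the
  operation of arity \<open>N\<close> is \<open>p (1/2 \<Sum> [J\<^sub>r, J\<^sub>N\<^sub>-\<^sub>r])\<close> (\<open>transfer_equal_letters\<close>).

  The side conditions and the simpliciality of the contraction are derived from one formula:
  on forms of weight \<open>w > 0\<close> for the contraction to the vertex \<open>i\<close>, the operator \<open>h\<^sup>i\<close> is \<open>1/w\<close> times
  the contraction with the Euler field of that vertex. Simpliciality makes the recursion natural
  (\<open>C_b_natural\<close>), so the bijections respect the simplicial structures; naturality in \<open>g\<close> is then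
  immediate from the description on generators.
\<close>

abbreviation slist where "slist == sorted_list_of_set"

abbreviation lk where "lk \<equiv> Poly_Mapping.lookup"
abbreviation sng where "sng \<equiv> Poly_Mapping.single"
abbreviation ks where "ks \<equiv> Poly_Mapping.keys"

section \<open>Linear maps on spaces with a basis\<close>

lemma lookup_cscale [simp]: "lk (cscale c al) x = c * lk al x"
 by (simp add: cscale_def Poly_Mapping.map.rep_eq when_def)

interpretation P: vector_space "cscale :: 'k::field_char_0 => ('b \<Rightarrow>\<^sub>0 'k) => _"
 by unfold_locales (auto intro!: poly_mapping_eqI simp: lookup_add algebra_simps)

lemma cscale_single [simp]: "cscale c (sng x d) = sng x (c * d)"
 by (rule poly_mapping_eqI) (simp add: lookup_single when_def)

lemma keys_cscale_subset: "ks (cscale c al) \<subseteq> ks al"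
 by (auto simp: in_keys_iff)

lemma lin_superset:
 fixes al :: "'a \<Rightarrow>\<^sub>0 'k::field_char_0"
 assumes "finite S" "ks al \<subseteq> S"
 shows "lin f al = (\<Sum>x\<in>S. cscale (lk al x) (f x))"
 unfolding lin_def by (rule sum.mono_neutral_left) (use assms in \<open>auto simp: in_keys_iff\<close>)

definition klin :: "(('a \<Rightarrow>\<^sub>0 'k::field_char_0) => ('b \<Rightarrow>\<^sub>0 'k)) => bool" where
 "klin F \<longleftrightarrow> (\<forall>a b. F (a + b) = F a + F b) & (\<forall>c a. F (cscale c a) = cscale c (F a))"

lemma klin_lin [simp]: "klin (lin f)"
proof -
 have "lin f (a + b) = lin f a + lin f b" for a b
  using lin_superset[of "ks a \<union> ks b" "a + b" f] lin_superset[of "ks a \<union> ks b" a f]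
   lin_superset[of "ks a \<union> ks b" b f] Poly_Mapping.keys_add[of a b]
  by (simp add: lookup_add P.scale_left_distrib sum.distrib)
 moreover have "lin f (cscale c a) = cscale c (lin f a)" for c a
  using lin_superset[of "ks a" "cscale c a" f] keys_cscale_subset[of c a]
  by (simp add: lin_def P.scale_sum_right)
 ultimately show ?thesis by (simp add: klin_def)
qed

lemma klin_add: "klin F ==> F (a + b) = F a + F b" by (simp add: klin_def)
lemma klin_scale: "klin F ==> F (cscale c a) = cscale c (F a)" by (simp add: klin_def)
lemma klin_0: "klin F ==> F 0 = 0" by (metis P.scale_zero_left klin_scale)
lemma klin_uminus: "klin F ==> F (- a) = - F a" using klin_scale[of F "- 1" a] by simp
lemma klin_diff: "klin F ==> F (a - b) = F a - F b"
 using klin_add[of F a "- b"] klin_uminus[of F b] by simp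
lemma klin_sum: "klin F ==> F (sum f A) = (\<Sum>x\<in>A. F (f x))"
 by (induction A rule: infinite_finite_induct) (auto simp: klin_0 klin_add)

lemma single_decomp: "al = (\<Sum>x\<in>ks al. cscale (lk al x) (sng x (1::'k::field_char_0)))"
 by (rule poly_mapping_eqI)
  (auto simp: lookup_sum lookup_single when_def if_distrib sum.delta in_keys_iff cong: if_cong)

lemma klin_expand: "klin F ==> F al = (\<Sum>x\<in>ks al. cscale (lk al x) (F (sng x 1)))"
 by (subst single_decomp) (simp only: klin_sum klin_scale)

lemma klin_eqI:
 assumes "klin F" "klin G" "!!x. x : ks al ==> F (sng x 1) = G (sng x 1)"
 shows "F al = G al"
 using klin_expand[OF assms(1), of al] klin_expand[OF assms(2), of al] assms(3) by simp

lemma klin_eq_lin: "klin F ==> lin (%x. F (sng x 1)) al = F al"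
 using klin_expand[of F al] by (simp add: lin_def)

lemma lin_single [simp]: "lin f (sng x (c :: 'k::field_char_0)) = cscale c (f x)"
 using lin_superset[of "{x}" "sng x c" f] by (simp split: if_splits)

lemma klinI: "(!!a b. F (a + b) = F a + F b) ==> (!!c a. F (cscale c a) = cscale c (F a)) ==> klin F"
 by (simp add: klin_def)

lemma klin_comp: "klin F ==> klin G ==> klin (%x. F (G x))" by (simp add: klin_def)
lemma klin_plus: "klin F ==> klin G ==> klin (%x. F x + G x)"
 by (simp add: klin_def P.scale_right_distrib algebra_simps)
lemma klin_uminusI: "klin F ==> klin (%x. - F x)"
 by (simp add: klin_def P.scale_minus_right)
lemma klin_minus: "klin F ==> klin G ==> klin (%x. F x - G x)"
 using klin_plus[OF _ klin_uminusI, of F G] by simp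
lemma klin_cscale: "klin F ==> klin (%x. cscale c (F x))"
 by (simp add: klin_def P.scale_right_distrib mult.commute)
lemma klin_sumI: "(!!i. i : A ==> klin (F i)) ==> klin (%x. \<Sum>i\<in>A. F i x)"
 by (auto simp: klin_def sum.distrib P.scale_sum_right)
lemma klin_id: "klin (%x. x)" by (simp add: klin_def)
lemma klin_zero: "klin (%x. 0)" by (simp add: klin_def)

section \<open>The algebra of polynomial forms\<close>

notation wedge (infixl "\<cdot>" 70)

lemma klin_wedge_right: "klin (%be. al \<cdot> be)"
 unfolding wedge_def lin_def[of "%x. lin (wedge_mono x) _"]
 by (intro klin_sumI klin_cscale klin_lin)

lemma klin_wedge_left: "klin (%al. al \<cdot> be)"
 unfolding wedge_def by simp

lemmas wedge_sum = klin_sum[OF klin_wedge_right] klin_sum[OF klin_wedge_left]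
lemmas wedge_alg = klin_add[OF klin_wedge_right] klin_add[OF klin_wedge_left]
 klin_scale[OF klin_wedge_right] klin_scale[OF klin_wedge_left]
 klin_uminus[OF klin_wedge_right] klin_uminus[OF klin_wedge_left]
 klin_diff[OF klin_wedge_right] klin_diff[OF klin_wedge_left]
lemma wedge_0 [simp]: "al \<cdot> 0 = 0" "0 \<cdot> al = 0"
 using klin_0[OF klin_wedge_right] klin_0[OF klin_wedge_left] by auto

lemma wedge_single [simp]: "sng x c \<cdot> sng y d = cscale (c * d) (wedge_mono x y)"
 by (simp add: wedge_def mult.commute)

lemma wedge_one_left [simp]: "form_one \<cdot> al = al"
proof -
 have "(%al. form_one \<cdot> al) al = (%x. x) al"
  by (rule klin_eqI) (auto simp: form_one_def wedge_mono_def intro: klin_wedge_right klin_id)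
 then show ?thesis .
qed

lemma wedge_one_right [simp]: "al \<cdot> form_one = al"
proof -
 have "(%al. al \<cdot> form_one) al = (%x. x) al"
  by (rule klin_eqI) (auto simp: form_one_def wedge_mono_def intro: klin_wedge_left klin_id)
 then show ?thesis .
qed

definition ffin :: "'k::field_char_0 form => bool" where
 "ffin al \<longleftrightarrow> (\<forall>x\<in>ks al. finite (snd x))"

definition invs :: "nat set => nat set => nat" where
 "invs A B = card {(i, j). i : A & j : B & j < i}"

lemma invs_finite: "finite A ==> finite B ==> finite {(i, j). i : A & j : B & j < (i::nat)}"
 by (rule finite_subset[of _ "A \<times> B"]) auto

lemma invs_union_left:
 assumes "finite A" "finite B" "finite C" "A \<inter> B = {}"
 shows "invs (A \<union> B) C = invs A C + invs B C"
proof -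
 have "{(i, j). i : A \<union> B & j : C & j < i} = {(i, j). i : A & j : C & j < i} \<union> {(i, j). i : B & j : C & j < i}"
  by auto
 then show ?thesis unfolding invs_def using assms
  by (simp add: card_Un_disjoint invs_finite disjoint_iff)
qed

lemma invs_union_right:
 assumes "finite A" "finite B" "finite C" "B \<inter> C = {}"
 shows "invs A (B \<union> C) = invs A B + invs A C"
proof -
 have "{(i, j). i : A & j : B \<union> C & j < i} = {(i, j). i : A & j : B & j < i} \<union> {(i, j). i : A & j : C & j < i}"
  by auto
 then show ?thesis unfolding invs_def using assms
  by (simp add: card_Un_disjoint invs_finite disjoint_iff)
qed

lemma invs_swap:
 assumes "finite A" "finite B" "A \<inter> B = {}"
 shows "invs A B + invs B A = card A * card B"
proof -
 have e: "A \<times> B = {(i, j). i : A & j : B & j < i} \<union> prod.swap ` {(i, j). i : B & j : A & j < i}"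
  using assms(3) by (auto simp: image_iff disjoint_iff) (metis linorder_neqE_nat)
 have "card (A \<times> B) = invs A B + card (prod.swap ` {(i, j). i : B & j : A & j < i})"
  unfolding invs_def by (subst e, rule card_Un_disjoint) (use assms in \<open>auto simp: invs_finite\<close>)
 then show ?thesis unfolding invs_def by (simp add: card_image card_cartesian_product)
qed

lemma wedge_mono_invs: "wedge_mono x y = (if snd x \<inter> snd y = {}
   then sng (fst x + fst y, snd x \<union> snd y) ((- 1) ^ invs (snd x) (snd y)) else 0)"
 by (simp add: wedge_mono_def invs_def)

lemma wedge_assoc_mono:
 assumes "finite (snd x)" "finite (snd y)" "finite (snd z)"
 shows "wedge_mono x y \<cdot> sng z 1 = sng x 1 \<cdot> wedge_mono y (z :: fmono)"
 using assms by (auto simp: wedge_mono_invs Int_Un_distrib Int_Un_distrib2 Un_assoc add.assoc invs_union_left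
   invs_union_right power_add Int_commute mult.left_commute mult.commute)

lemma wedge_assoc:
 assumes "ffin al" "ffin be" "ffin \<gamma>"
 shows "al \<cdot> be \<cdot> \<gamma> = al \<cdot> (be \<cdot> \<gamma>)"
proof -
 have 1: "sng x 1 \<cdot> sng y 1 \<cdot> sng z 1 = sng x 1 \<cdot> (sng y 1 \<cdot> sng z (1::'a))"
  if "x : ks al" "y : ks be" "z : ks \<gamma>" for x y z
  using that assms by (simp add: ffin_def wedge_assoc_mono)
 have 2: "sng x 1 \<cdot> sng y 1 \<cdot> \<gamma> = sng x 1 \<cdot> (sng y 1 \<cdot> \<gamma>)" if "x : ks al" "y : ks be" for x y
  by (rule klin_eqI[where F = "%\<gamma>. sng x 1 \<cdot> sng y 1 \<cdot> \<gamma>"])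
   (intro klin_wedge_right klin_comp[OF klin_wedge_right klin_wedge_right] 1 that | assumption)+
 have 3: "sng x 1 \<cdot> be \<cdot> \<gamma> = sng x 1 \<cdot> (be \<cdot> \<gamma>)" if "x : ks al" for x
  by (rule klin_eqI[where F = "%be. sng x 1 \<cdot> be \<cdot> \<gamma>"])
   (intro klin_comp[OF klin_wedge_left klin_wedge_right] klin_comp[OF klin_wedge_right klin_wedge_left] 2 that | assumption)+
 show ?thesis
  by (rule klin_eqI[where F = "%al. al \<cdot> be \<cdot> \<gamma>"])
   (intro klin_comp[OF klin_wedge_left klin_wedge_left] klin_wedge_left 3 | assumption)+
qed

definition tw :: "'k::field_char_0 form => 'k form" where
 "tw = lin (%x. sng x ((- 1) ^ card (snd x)))"

definition fdeg :: "nat => 'k::field_char_0 form => bool" where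
 "fdeg p al \<longleftrightarrow> (\<forall>x\<in>ks al. finite (snd x) & card (snd x) = p)"

definition Om :: "nat set => 'k::field_char_0 form set" where
 "Om N = {al. \<forall>x\<in>ks al. ks (fst x) \<subseteq> N & snd x \<subseteq> N}"

definition dvar :: "nat => 'k::field_char_0 form" where
 "dvar i = sng (0, {i}) 1"

lemma fdeg_ffin: "fdeg p al ==> ffin al" by (auto simp: fdeg_def ffin_def)
lemma Om_ffin: "al : Om N ==> finite N ==> ffin al"
 by (auto simp: Om_def ffin_def intro: finite_subset)

lemma keys_addD: "x : ks (al + be) ==> x : ks al \<or> x : ks be"
 using Poly_Mapping.keys_add[of al be] by blast
lemma keys_cscaleD: "x : ks (cscale c al) ==> x : ks al"
 using keys_cscale_subset[of c al] by blast

lemma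
 shows ffin_0 [simp]: "ffin 0" and ffin_add [simp]: "ffin al ==> ffin be ==> ffin (al + be)"
  and ffin_cscale [simp]: "ffin al ==> ffin (cscale c al)"
  and fdeg_0 [simp]: "fdeg p 0" and fdeg_add: "fdeg p al ==> fdeg p be ==> fdeg p (al + be)"
  and fdeg_cscale: "fdeg p al ==> fdeg p (cscale c al)"
  and Om_0 [simp]: "0 : Om N" and Om_add [simp]: "al : Om N ==> be : Om N ==> al + be : Om N"
  and Om_cscale [simp]: "al : Om N ==> cscale c al : Om N"
 unfolding ffin_def fdeg_def Om_def mem_Collect_eq
 by (auto dest!: keys_addD keys_cscaleD)

lemma ffin_uminus [simp]: "ffin al ==> ffin (- al)" by (simp add: ffin_def)
lemma fdeg_uminus: "fdeg p al ==> fdeg p (- al)" by (simp add: fdeg_def)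
lemma Om_uminus [simp]: "al : Om N ==> - al : Om N" by (simp add: Om_def)
lemma ffin_diff [simp]: "ffin al ==> ffin be ==> ffin (al - be)"
 using ffin_add[of al "- be"] by simp
lemma fdeg_diff: "fdeg p al ==> fdeg p be ==> fdeg p (al - be)"
 using fdeg_add[of p al "- be"] by (simp add: fdeg_uminus)
lemma Om_diff [simp]: "al : Om N ==> be : Om N ==> al - be : Om N"
 using Om_add[of al N "- be"] by simp
lemma ffin_sum [simp]: "(!!i. i : A ==> ffin (f i)) ==> ffin (sum f A)"
 by (induction A rule: infinite_finite_induct) auto
lemma fdeg_sum: "(!!i. i : A ==> fdeg p (f i)) ==> fdeg p (sum f A)"
 by (induction A rule: infinite_finite_induct) (auto intro: fdeg_add)
lemma Om_sum [simp]: "(!!i. i : A ==> f i : Om N) ==> sum f A : Om N"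
 by (induction A rule: infinite_finite_induct) auto
lemma wedge_expand: "al \<cdot> be = (\<Sum>x\<in>ks al. \<Sum>y\<in>ks be. cscale (lk al x * lk be y) (wedge_mono x y))"
 by (simp add: wedge_def lin_def P.scale_sum_right mult.commute)

lemma ffin_wedge [simp]: assumes "ffin al" "ffin be" shows "ffin (al \<cdot> be)"
 unfolding wedge_expand
 by (intro ffin_sum ffin_cscale) (use assms in \<open>auto simp: ffin_def wedge_mono_def\<close>)

lemma fdeg_wedge: assumes "fdeg p al" "fdeg q be" shows "fdeg (p + q) (al \<cdot> be)"
 unfolding wedge_expand
 by (intro fdeg_sum fdeg_cscale) (use assms in \<open>auto simp: fdeg_def wedge_mono_def card_Un_disjoint\<close>)

lemma Om_wedge [simp]: assumes "al : Om N" "be : Om N" shows "al \<cdot> be : Om N"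
proof -
 have *: "ks (a + b) \<subseteq> N" if "ks a \<subseteq> N" "ks b \<subseteq> N" for a b :: "nat \<Rightarrow>\<^sub>0 nat"
  using that Poly_Mapping.keys_add[of a b] by blast
 show ?thesis unfolding wedge_expand
  by (intro Om_sum Om_cscale) (use assms in \<open>auto simp: Om_def wedge_mono_def dest!: subsetD[OF *, rotated 2]\<close>)
qed

lemma ffin_one [simp]: "ffin form_one" and fdeg_one: "fdeg 0 form_one" and Om_one [simp]: "form_one : Om N"
 by (auto simp: form_one_def ffin_def fdeg_def Om_def)
lemma ffin_var [simp]: "ffin (var i)" and fdeg_var: "fdeg 0 (var i)" and Om_var [simp]: "i : N ==> var i : Om N"
 by (auto simp: var_def ffin_def fdeg_def Om_def)
lemma ffin_dvar [simp]: "ffin (dvar i)" and fdeg_dvar: "fdeg 1 (dvar i)" and Om_dvar [simp]: "i : N ==> dvar i : Om N"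
 by (auto simp: dvar_def ffin_def fdeg_def Om_def)

lemma wedge_commute:
 assumes "fdeg p al" "fdeg q be"
 shows "al \<cdot> be = cscale ((- 1) ^ (p * q)) (be \<cdot> al)"
proof -
 have 0: "wedge_mono x y = cscale ((- 1) ^ (p * q)) (wedge_mono y x :: 'a form)"
  if "x : ks al" "y : ks be" for x y
 proof (cases "snd x \<inter> snd y = {}")
  case True
  have f: "finite (snd x)" "finite (snd y)" "card (snd x) = p" "card (snd y) = q"
   using that assms by (auto simp: fdeg_def)
  have "(- 1 :: 'a) ^ invs (snd x) (snd y) = (- 1) ^ (p * q) * (- 1) ^ invs (snd y) (snd x)"
   using arg_cong[OF invs_swap[OF f(1,2) True], of even] f
   by (simp add: minus_one_power_iff) blast
  then show ?thesis using True by (simp add: wedge_mono_invs Int_commute add.commute Un_commute)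
 qed (simp add: wedge_mono_invs Int_commute)
 show ?thesis
  unfolding wedge_expand P.scale_sum_right
  by (subst sum.swap) (intro sum.cong refl, simp add: 0 mult.commute mult.left_commute)
qed

lemma wedge_commute0:
 assumes "fdeg 0 al" "ffin be" shows "al \<cdot> be = be \<cdot> al"
proof -
 show ?thesis
 proof (rule klin_eqI[where F = "%be. al \<cdot> be" and G = "%be. be \<cdot> al"])
  show "al \<cdot> sng x 1 = sng x 1 \<cdot> al" if "x : ks be" for x
   using wedge_commute[of 0 al "card (snd x)" "sng x 1"] that assms by (auto simp: fdeg_def ffin_def)
 qed (auto intro: klin_wedge_left klin_wedge_right)
qed

lemma wedge_left_commute0:
 assumes "fdeg 0 al" "ffin be" "ffin \<gamma>" shows "al \<cdot> (be \<cdot> \<gamma>) = be \<cdot> (al \<cdot> \<gamma>)"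
proof -
 have "al \<cdot> (be \<cdot> \<gamma>) = (al \<cdot> be) \<cdot> \<gamma>" using assms by (simp add: wedge_assoc fdeg_ffin)
 also have "... = (be \<cdot> al) \<cdot> \<gamma>"
  by (simp only: wedge_commute0[OF assms(1,2)])
 finally show ?thesis using assms by (simp add: wedge_assoc fdeg_ffin)
qed

lemma wedge_anticommute1:
 assumes "fdeg 1 al" "fdeg 1 be" shows "al \<cdot> be = - (be \<cdot> al)"
 using wedge_commute[OF assms] by simp

lemma wedge_square1:
 assumes "fdeg 1 al" shows "al \<cdot> al = 0"
proof (rule poly_mapping_eqI)
 fix x show "lk (al \<cdot> al) x = lk 0 x"
  using arg_cong[OF wedge_anticommute1[OF assms assms], of "%al. lk al x"] by (simp add: eq_neg_iff_add_eq_0)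
qed

lemma wedge_left_anticommute1:
 assumes "fdeg 1 al" "fdeg 1 be" "ffin \<gamma>" shows "al \<cdot> (be \<cdot> \<gamma>) = - (be \<cdot> (al \<cdot> \<gamma>))"
proof -
 have "al \<cdot> (be \<cdot> \<gamma>) = (al \<cdot> be) \<cdot> \<gamma>" using assms by (simp add: wedge_assoc fdeg_ffin)
 also have "... = - ((be \<cdot> al) \<cdot> \<gamma>)"
  unfolding wedge_anticommute1[OF assms(1,2)] by (rule klin_uminus[OF klin_wedge_left])
 finally show ?thesis using assms by (simp add: wedge_assoc fdeg_ffin)
qed

lemma klin_tw: "klin tw" by (simp add: tw_def)

lemma tw_fdeg: assumes "fdeg p al" shows "tw al = cscale ((- 1) ^ p) al"
proof -
 show ?thesis
  by (rule klin_eqI[OF klin_tw klin_cscale[OF klin_id]]) (use assms in \<open>auto simp: tw_def fdeg_def\<close>)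
qed

section \<open>Generators\<close>

lemma var_wedge_single: "var i \<cdot> sng (a, A) c = sng (sng i 1 + a, A) c"
 by (simp add: var_def wedge_mono_def)

lemma dvar_wedge_single: "finite A ==> dvar i \<cdot> sng (a, A) c =
  (if i : A then 0 else sng (a, insert i A) ((- 1) ^ card {j : A. j < i} * c))"
proof -
 have "{(i', j). i' : {i} & j : A & j < i'} = Pair i ` {j : A. j < i}" by auto
 then show ?thesis by (simp add: dvar_def wedge_mono_def card_image inj_on_def mult.commute)
qed

lemma form_induct [consumes 2, case_names zero add scale one var dvar]:
 assumes "al : Om N" "finite N"
  and "P 0"
  and "!!al be. al : Om N ==> be : Om N ==> P al ==> P be ==> P (al + be)"
  and "!!c al. al : Om N ==> P al ==> P (cscale c al)"
  and "P form_one"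
  and var: "!!i al. i : N ==> al : Om N ==> P al ==> P (var i \<cdot> al)"
  and dvar: "!!i al. i : N ==> al : Om N ==> P al ==> P (dvar i \<cdot> al)"
 shows "P (al :: 'k::field_char_0 form)"
proof -
 have 1: "P (sng (0, A) 1)" if "A \<subseteq> N" for A
  using finite_subset[OF that assms(2)] that
 proof (induction A rule: finite_linorder_min_induct)
  case empty then show ?case using assms(6) by (simp add: form_one_def)
 next
  case (insert i A)
  have "{j : A. j < i} = {}" using insert by auto
  then have "sng (0, insert i A) 1 = dvar i \<cdot> sng (0, A) (1::'k)"
   unfolding dvar_wedge_single[OF insert(1)] using insert by (auto simp del: Collect_empty_eq)
  then show ?case using insert dvar[of i "sng (0, A) 1"] by (auto simp: Om_def)
 qed
 have 2: "P (sng (a, A) 1)" if "A \<subseteq> N" "ks a \<subseteq> N" for A a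
  using that(2)
 proof (induction "sum (lk a) N" arbitrary: a)
  case 0
  then have "a = 0" using assms(2) by (intro poly_mapping_eqI) (auto simp: in_keys_iff subset_iff)
  then show ?case using 1 that by simp
 next
  case (Suc m)
  then obtain i where i: "i : N" "lk a i ~= 0" by (metis Zero_not_Suc sum.neutral)
  define b where "b = a - sng i 1"
  have a: "a = sng i 1 + b" using i unfolding b_def
   by (intro poly_mapping_eqI) (auto simp: lookup_add lookup_minus lookup_single when_def)
  have kb: "ks b \<subseteq> ks a" unfolding b_def by (auto simp: in_keys_iff lookup_minus)
  have "sum (lk a) N = 1 + sum (lk b) N" unfolding a using i assms(2)
   by (simp add: lookup_add sum.distrib lookup_single when_def sum.delta')
  then have "P (sng (b, A) 1)" using Suc kb by (intro Suc(1)) auto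
  then have "P (var i \<cdot> sng (b, A) 1)" using i Suc kb that by (intro var) (auto simp: Om_def)
  then show ?case by (simp add: var_wedge_single a)
 qed
 have "P (\<Sum>x\<in>S. cscale (lk al x) (sng x 1))" if "S \<subseteq> ks al" for S
  using finite_subset[OF that finite_keys] that
 proof (induction S)
  case (insert x S)
  obtain a A where x: "x = (a, A)" by (cases x)
  have m: "sng y (1::'k) : Om N" if "y : ks al" for y using that assms(1) by (auto simp: Om_def)
  have "x : ks al" using insert by blast
  then have "P (sng x 1)" unfolding x using assms(1) by (intro 2) (force simp: Om_def)+
  then have "P (cscale (lk al x) (sng x 1))" using insert m by (intro assms(5)) auto
  moreover have "P (\<Sum>x\<in>S. cscale (lk al x) (sng x 1))" using insert by blast
  moreover have "cscale (lk al x) (sng x 1) : Om N" using \<open>x : ks al\<close> by (intro Om_cscale m)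
  moreover have "(\<Sum>x\<in>S. cscale (lk al x) (sng x 1)) : Om N"
   using insert by (intro Om_sum Om_cscale m) blast
  ultimately have "P (cscale (lk al x) (sng x 1) + (\<Sum>x\<in>S. cscale (lk al x) (sng x 1)))"
   by (intro assms(4))
  then show ?case using insert by (simp del: cscale_single)
 qed (use assms in auto)
 from this[of "ks al"] show ?thesis using single_decomp[of al] by simp
qed

section \<open>The de Rham differential\<close>

lemma klin_closed:
 assumes "klin F" "!!x. x : ks al ==> Q (F (sng x 1))" "Q 0" "!!a b. Q a ==> Q b ==> Q (a + b)"
  "!!c a. Q a ==> Q (cscale c a)"
 shows "Q (F al)"
proof -
 have "Q (\<Sum>x\<in>S. cscale (lk al x) (F (sng x 1)))" if "S \<subseteq> ks al" for S
  using finite_subset[OF that finite_keys] that by (induction S) (auto intro: assms)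
 then show ?thesis using klin_expand[OF assms(1), of al] by simp
qed

lemma klin_dform: "klin dform" by (simp add: dform_def)
lemmas dform_rules = klin_add[OF klin_dform] klin_scale[OF klin_dform] klin_0[OF klin_dform]
 klin_uminus[OF klin_dform] klin_diff[OF klin_dform]
lemma dform_0 [simp]: "dform 0 = 0" by (rule klin_0[OF klin_dform])

lemma dform_single:
 assumes "finite K" "ks a \<subseteq> K" "finite A"
 shows "dform (sng (a, A) (1::'k::field_char_0)) =
  (\<Sum>i\<in>K. cscale (of_nat (lk a i)) (dvar i \<cdot> sng (a - sng i 1, A) 1))"
proof -
 have "dform (sng (a, A) (1::'k)) = (\<Sum>i\<in>ks a - A.
   sng (a - sng i 1, insert i A) (of_nat (lk a i) * (- 1) ^ card {j : A. j < i}))"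
  by (simp add: dform_def)
 also have "... = (\<Sum>i\<in>K. cscale (of_nat (lk a i)) (dvar i \<cdot> sng (a - sng i 1, A) 1))"
  by (rule sum.mono_neutral_cong_left)
   (use assms in \<open>auto simp: dvar_wedge_single in_keys_iff\<close>)
 finally show ?thesis .
qed

lemma var_dvar_commute: "ffin al ==> var i \<cdot> (dvar j \<cdot> al) = dvar j \<cdot> (var i \<cdot> al)"
 by (rule wedge_left_commute0) (auto simp: fdeg_var)
lemma dvar_anticommute: "ffin al ==> dvar i \<cdot> (dvar j \<cdot> al) = - (dvar j \<cdot> (dvar i \<cdot> al))"
 by (rule wedge_left_anticommute1) (auto simp: fdeg_dvar[unfolded One_nat_def])
lemma dvar_square: "ffin al ==> dvar i \<cdot> (dvar i \<cdot> al) = 0"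
 by (subst wedge_assoc[symmetric]) (auto simp: wedge_square1 fdeg_dvar[unfolded One_nat_def])

lemma dform_one [simp]: "dform form_one = 0"
 by (simp add: form_one_def dform_def)

lemma dform_var_wedge:
 assumes "ffin (al :: 'k::field_char_0 form)"
 shows "dform (var i \<cdot> al) = dvar i \<cdot> al + var i \<cdot> dform al"
proof (rule klin_eqI[where F = "%al. dform (var i \<cdot> al)" and G = "%al. dvar i \<cdot> al + var i \<cdot> dform al"])
 fix x assume "x : ks al"
 then obtain a A where x: "x = (a, A)" and A: "finite A" using assms by (cases x) (auto simp: ffin_def)
 define K where "K = insert i (ks a)"
 have fK: "finite K" "ks a \<subseteq> K" "i : K" by (auto simp: K_def)
 have kK: "ks (sng i 1 + a) \<subseteq> K" using Poly_Mapping.keys_add[of "sng i 1" a] by (auto simp: K_def)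
 have t: "cscale (of_nat (lk (sng i 1 + a) j)) (dvar j \<cdot> sng (sng i 1 + a - sng j 1, A) 1)
   = (if j = i then dvar i \<cdot> sng (a, A) (1::'k) else 0)
    + var i \<cdot> cscale (of_nat (lk a j)) (dvar j \<cdot> sng (a - sng j 1, A) 1)" for j
 proof (cases "lk a j = 0")
  case True
  then show ?thesis by (auto simp: lookup_add lookup_single when_def)
 next
  case False
  then have "sng i 1 + a - sng j 1 = sng i 1 + (a - sng j 1)"
   by (intro poly_mapping_eqI) (auto simp: lookup_add lookup_minus lookup_single when_def)
  moreover have "j = i ==> sng i 1 + (a - sng j 1) = a" using False
   by (intro poly_mapping_eqI) (auto simp: lookup_add lookup_minus lookup_single when_def)
  moreover have "ffin (sng (a - sng j 1, A) (1::'k))" using A by (simp add: ffin_def)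
  ultimately show ?thesis
   by (auto simp: lookup_add lookup_single when_def wedge_alg var_dvar_commute var_wedge_single
     P.scale_left_distrib simp del: cscale_single)
 qed
 show "dform (var i \<cdot> sng x 1) = dvar i \<cdot> sng x (1::'k) + var i \<cdot> dform (sng x 1)"
  unfolding x var_wedge_single dform_single[OF fK(1) kK A] dform_single[OF fK(1,2) A] t sum.distrib
  using fK by (simp add: wedge_sum del: cscale_single)
qed (intro klin_comp[OF klin_dform] klin_comp[OF klin_wedge_right] klin_plus klin_wedge_right klin_dform)+

lemma dform_dvar_wedge:
 assumes "ffin (al :: 'k::field_char_0 form)"
 shows "dform (dvar i \<cdot> al) = - (dvar i \<cdot> dform al)"
proof (rule klin_eqI[where F = "%al. dform (dvar i \<cdot> al)" and G = "%al. - (dvar i \<cdot> dform al)"])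
 fix x assume "x : ks al"
 then obtain a A where x: "x = (a, A)" and A: "finite A" using assms by (cases x) (auto simp: ffin_def)
 obtain s where s: "dvar i \<cdot> sng (b, A) (1::'k) = cscale s (sng (b, insert i A) 1)" for b
  by (rule that[of "if i : A then 0 else (- 1) ^ card {j : A. j < i}"]) (simp add: dvar_wedge_single A)
 have f: "ffin (sng (b, A) (1::'k))" for b using A by (simp add: ffin_def)
 show "dform (dvar i \<cdot> sng x 1) = - (dvar i \<cdot> dform (sng x (1::'k)))"
  unfolding x s dform_rules dform_single[OF finite_keys subset_refl, OF A]
   dform_single[OF finite_keys subset_refl, OF finite.insertI[OF A]]
  by (simp add: wedge_sum wedge_alg dvar_anticommute[OF f, of i] s P.scale_sum_right sum_negf mult.commute
    del: cscale_single)
qed (intro klin_comp[OF klin_dform] klin_comp[OF klin_wedge_right] klin_uminusI klin_wedge_right klin_dform)+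

lemma dform_var [simp]: "dform (var i) = dvar i"
 using dform_var_wedge[of form_one i] by simp
lemma dform_dvar [simp]: "dform (dvar i) = 0"
 using dform_dvar_wedge[of form_one i] by simp

lemma ffin_dform [simp]: assumes "ffin al" shows "ffin (dform al)"
proof (rule klin_closed[OF klin_dform])
 fix x assume "x : ks al"
 then obtain a A where x: "x = (a, A)" and A: "finite A" using assms by (cases x) (auto simp: ffin_def)
 show "ffin (dform (sng x 1))" unfolding x dform_single[OF finite_keys subset_refl A]
  using A by (intro ffin_sum ffin_cscale ffin_wedge) (auto simp: ffin_def[of "sng _ _"])
qed auto

lemma fdeg_dform: assumes "fdeg p al" shows "fdeg (Suc p) (dform al)"
proof (rule klin_closed[OF klin_dform])
 fix x assume "x : ks al"
 then obtain a A where x: "x = (a, A)" and A: "finite A" "card A = p"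
  using assms by (cases x) (auto simp: fdeg_def)
 have "fdeg p (sng (b, A) (1::'a))" for b using A by (simp add: fdeg_def)
 then show "fdeg (Suc p) (dform (sng x (1::'a)))" unfolding x dform_single[OF finite_keys subset_refl A(1)]
  by (intro fdeg_sum fdeg_cscale fdeg_wedge[OF fdeg_dvar, simplified])
qed (auto intro: fdeg_add fdeg_cscale)

lemma Om_dform [simp]: assumes "al : Om N" "finite N" shows "dform al : Om N"
 using assms by (induction al rule: form_induct)
  (use assms(2) in \<open>simp_all add: dform_rules dform_var_wedge dform_dvar_wedge Om_ffin\<close>)

lemmas tw_rules = klin_add[OF klin_tw] klin_scale[OF klin_tw] klin_0[OF klin_tw]
 klin_uminus[OF klin_tw] klin_diff[OF klin_tw]

lemma tw_wedge:
 assumes "fdeg p al" "ffin be" shows "tw (al \<cdot> be) = cscale ((- 1) ^ p) (al \<cdot> tw be)"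
proof (rule klin_eqI[where F = "%be. tw (al \<cdot> be)" and G = "%be. cscale ((- 1) ^ p) (al \<cdot> tw be)"])
 fix x assume "x : ks be"
 then have f: "fdeg (card (snd x)) (sng x (1::'a))" using assms by (auto simp: fdeg_def ffin_def)
 show "tw (al \<cdot> sng x 1) = cscale ((- 1) ^ p) (al \<cdot> tw (sng x (1::'a)))"
  by (simp add: tw_fdeg[OF f] tw_fdeg[OF fdeg_wedge[OF assms(1) f]] wedge_alg power_add del: cscale_single)
qed (intro klin_comp[OF klin_tw] klin_comp[OF klin_wedge_right] klin_cscale klin_wedge_right klin_tw)+

lemma tw_var_wedge: "ffin be ==> tw (var i \<cdot> be) = var i \<cdot> tw be"
 using tw_wedge[OF fdeg_var] by simp
lemma tw_dvar_wedge: "ffin be ==> tw (dvar i \<cdot> be) = - (dvar i \<cdot> tw be)"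
 using tw_wedge[OF fdeg_dvar] by simp
lemma tw_one [simp]: "tw form_one = form_one" using tw_fdeg[OF fdeg_one] by simp

lemma ffin_tw [simp]: assumes "ffin al" shows "ffin (tw al)"
 by (rule klin_closed[OF klin_tw]) (use assms in \<open>auto simp: tw_def ffin_def[of "sng _ _"]\<close>,
  auto simp: ffin_def)
lemma dform_wedge:
 assumes "al : Om N" "finite N" "ffin be"
 shows "dform (al \<cdot> be) = dform al \<cdot> be + tw al \<cdot> dform be"
 using assms(1,2)
 by (induction al rule: form_induct)
  (use assms(2,3) in \<open>simp_all add: dform_rules tw_rules wedge_alg dform_var_wedge dform_dvar_wedge
   tw_var_wedge tw_dvar_wedge wedge_assoc Om_ffin P.scale_right_distrib\<close>)

lemma dform_dform:
 assumes "al : Om N" "finite N" shows "dform (dform al) = 0"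
 using assms
 by (induction al rule: form_induct)
  (use assms(2) in \<open>simp_all add: dform_rules wedge_alg dform_var_wedge dform_dvar_wedge Om_ffin\<close>)

section \<open>Contraction with a vector field\<close>

definition iota :: "(nat => 'k::field_char_0 form) => 'k form => 'k form" where
 "iota c = lin (%(a, A). \<Sum>j\<in>A. cscale ((- 1) ^ card {l : A. l < j}) (c j \<cdot> sng (a, A - {j}) 1))"

lemma klin_iota: "klin (iota c)" by (simp add: iota_def)
lemmas iota_rules = klin_add[OF klin_iota] klin_scale[OF klin_iota] klin_0[OF klin_iota]
 klin_uminus[OF klin_iota] klin_diff[OF klin_iota]
lemma iota_0 [simp]: "iota c 0 = 0" by (rule klin_0[OF klin_iota])
lemma iota_one [simp]: "iota c form_one = 0"
 by (simp add: form_one_def iota_def)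

context
 fixes c :: "nat => 'k::field_char_0 form"
 assumes c: "!!i. fdeg 0 (c i)"
begin

lemma ffin_c [simp]: "ffin (c i)" using c fdeg_ffin by blast

lemma iota_var_wedge:
 assumes "ffin al"
 shows "iota c (var i \<cdot> al) = var i \<cdot> iota c al"
proof (rule klin_eqI[where F = "%al. iota c (var i \<cdot> al)" and G = "%al. var i \<cdot> iota c al"])
 fix x assume "x : ks al"
 then obtain a A where x: "x = (a, A)" and A: "finite A" using assms by (cases x) (auto simp: ffin_def)
 have f: "ffin (sng (a, A - {j}) (1::'k))" for j using A by (simp add: ffin_def)
 show "iota c (var i \<cdot> sng x 1) = var i \<cdot> iota c (sng x 1)"
  by (simp add: x var_wedge_single iota_def wedge_sum wedge_alg
    wedge_left_commute0[OF fdeg_var ffin_c f])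
qed (intro klin_comp[OF klin_iota] klin_comp[OF klin_wedge_right] klin_wedge_right klin_iota)+

lemma iota_dvar_wedge:
 assumes "ffin al"
 shows "iota c (dvar i \<cdot> al) = c i \<cdot> al - dvar i \<cdot> iota c al"
proof (rule klin_eqI[where F = "%al. iota c (dvar i \<cdot> al)" and G = "%al. c i \<cdot> al - dvar i \<cdot> iota c al"])
 fix x assume "x : ks al"
 then obtain a A where x: "x = (a, A)" and A: "finite A" using assms by (cases x) (auto simp: ffin_def)
 have f: "ffin (sng (a, B) (1::'k))" if "B \<subseteq> insert i A" for B
  using A that finite_subset by (fastforce simp: ffin_def)
 have cm: "dvar i \<cdot> (c j \<cdot> sng (a, A - {j}) 1) = c j \<cdot> (dvar i \<cdot> sng (a, A - {j}) 1)" for j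
  by (rule wedge_left_commute0[symmetric]) (auto intro!: f c)
 have iA: "iota c (sng (a, A) 1) = (\<Sum>j\<in>A. cscale ((- 1) ^ card {l : A. l < j}) (c j \<cdot> sng (a, A - {j}) 1))"
  by (simp add: iota_def)
 have R: "dvar i \<cdot> iota c (sng (a, A) 1)
   = (\<Sum>j\<in>A. cscale ((- 1) ^ card {l : A. l < j}) (c j \<cdot> (dvar i \<cdot> sng (a, A - {j}) 1)))"
  unfolding iA by (simp add: wedge_sum wedge_alg cm)
 show "iota c (dvar i \<cdot> sng x 1) = c i \<cdot> sng x 1 - dvar i \<cdot> iota c (sng x 1)"
 proof (cases "i : A")
  case True
  have "(\<Sum>j\<in>A. cscale ((- 1) ^ card {l : A. l < j}) (c j \<cdot> (dvar i \<cdot> sng (a, A - {j}) 1)))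
    = (\<Sum>j\<in>A. if j = i then c i \<cdot> sng (a, A) 1 else 0)"
  proof (intro sum.cong refl)
   fix j assume j: "j : A"
   have e: "{j : A. j ~= i & j < i} = {j : A. j < i}" by auto
   show "cscale ((- 1) ^ card {l : A. l < j}) (c j \<cdot> (dvar i \<cdot> sng (a, A - {j}) 1))
    = (if j = i then c i \<cdot> sng (a, A) 1 else 0)"
   proof (cases "j = i")
    case True
    have "dvar i \<cdot> sng (a, A - {i}) 1 = cscale ((- 1) ^ card {j : A. j < i}) (sng (a, A) (1::'k))"
     using A \<open>i : A\<close> by (simp add: dvar_wedge_single e insert_absorb)
    then show ?thesis using True
     by (simp add: wedge_alg power_add[symmetric] mult_2[symmetric] del: cscale_single)
   next
    case False then show ?thesis using A \<open>i : A\<close> by (simp add: dvar_wedge_single)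
   qed
  qed
  then have "dvar i \<cdot> iota c (sng (a, A) 1) = c i \<cdot> sng (a, A) 1" using True A by (simp add: R)
  moreover have "dvar i \<cdot> sng (a, A) (1::'k) = 0" using True A by (simp add: dvar_wedge_single)
  ultimately show ?thesis by (simp add: x)
 next
  case False
  define s where "s = (- 1 :: 'k) ^ card {j : A. j < i}"
  have ss: "s * s = 1" by (simp add: s_def power_add[symmetric] mult_2[symmetric])
  have d: "dvar i \<cdot> sng (a, A) (1::'k) = cscale s (sng (a, insert i A) 1)"
   using False A by (simp add: dvar_wedge_single s_def)
  have t: "cscale s (cscale ((- 1) ^ card {l : insert i A. l < j}) (c j \<cdot> sng (a, insert i A - {j}) 1))
    = - cscale ((- 1) ^ card {l : A. l < j}) (c j \<cdot> (dvar i \<cdot> sng (a, A - {j}) 1))" if j: "j : A" for j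
  proof -
   have ij: "i ~= j" using False j by auto
   then have e1: "insert i A - {j} = insert i (A - {j})" by auto
   have e2: "{l : insert i A. l < j} = (if i < j then insert i {l : A. l < j} else {l : A. l < j})" by auto
   have e3: "{l : A. l < i} = (if j < i then insert j {l : A - {j}. l < i} else {l : A - {j}. l < i})"
    using j by auto
   have c1: "(- 1 :: 'k) ^ card {l : insert i A. l < j} = (if i < j then - 1 else 1) * (- 1) ^ card {l : A. l < j}"
    unfolding e2 using A False by simp
   have c2: "s = (if j < i then - 1 else 1) * (- 1) ^ card {l : A - {j}. l < i}"
    unfolding s_def e3 using A by simp
   have "dvar i \<cdot> sng (a, A - {j}) (1::'k) = cscale ((- 1) ^ card {l : A - {j}. l < i}) (sng (a, insert i (A - {j})) 1)"
    using False A by (simp add: dvar_wedge_single)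
   then show ?thesis unfolding e1 c1 c2 using ij
    by (auto simp add: wedge_alg mult.commute simp del: cscale_single)
  qed
  have e4: "{l : insert i A. l < i} = {l : A. l < i}" by auto
  have e5: "insert i A - {i} = A" using False by auto
  have "iota c (dvar i \<cdot> sng (a, A) 1) = cscale s (\<Sum>j\<in>insert i A.
    cscale ((- 1) ^ card {l : insert i A. l < j}) (c j \<cdot> sng (a, insert i A - {j}) 1))"
   unfolding d by (simp add: iota_def)
  also have "... = cscale s (cscale s (c i \<cdot> sng (a, A) 1)) + (\<Sum>j\<in>A. cscale s
    (cscale ((- 1) ^ card {l : insert i A. l < j}) (c j \<cdot> sng (a, insert i A - {j}) 1)))"
   unfolding sum.insert[OF A False] P.scale_right_distrib P.scale_sum_right e4 e5 s_def[symmetric] ..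
  also have "... = cscale s (cscale s (c i \<cdot> sng (a, A) 1)) + (\<Sum>j\<in>A. - cscale ((- 1) ^ card {l : A. l < j})
    (c j \<cdot> (dvar i \<cdot> sng (a, A - {j}) 1)))"
   by (intro arg_cong2[of _ _ _ _ "(+)"] refl sum.cong t)
  finally show ?thesis unfolding x R by (simp add: sum_negf ss)
 qed
qed (intro klin_comp[OF klin_iota] klin_comp[OF klin_wedge_right] klin_minus klin_wedge_right klin_iota)+

end

section \<open>Pullbacks\<close>

lemma wedges_Nil [simp]: "wedges [] = form_one" and wedges_Cons [simp]: "wedges (x # xs) = x \<cdot> wedges xs"
 by (auto simp: wedges_def)

lemma ffin_wedges [simp]: "(!!x. x : set xs ==> ffin x) ==> ffin (wedges xs)"
 by (induction xs) auto
lemma Om_wedges [simp]: "(!!x. x : set xs ==> x : Om N) ==> wedges xs : Om N"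
 by (induction xs) auto
lemma wedges_append: "(!!x. x : set xs \<union> set ys ==> ffin x) ==> wedges (xs @ ys) = wedges xs \<cdot> wedges ys"
 by (induction xs) (auto simp: wedge_assoc)
lemma fdeg_wedges0: "(!!x. x : set xs ==> fdeg 0 x) ==> fdeg 0 (wedges xs)"
 by (induction xs) (use fdeg_wedge[of 0 _ 0] in \<open>auto intro: fdeg_one\<close>)
lemma fdeg_wedges1: "(!!x. x : set xs ==> fdeg 1 x) ==> fdeg (length xs) (wedges xs)"
 by (induction xs) (use fdeg_wedge[of 1] in \<open>auto intro: fdeg_one\<close>)

lemma klin_pullback: "klin (pullback s)" by (simp add: pullback_def)
lemmas pullback_rules = klin_add[OF klin_pullback] klin_scale[OF klin_pullback] klin_0[OF klin_pullback]
 klin_uminus[OF klin_pullback] klin_diff[OF klin_pullback]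
lemmas pullback_sum = klin_sum[OF klin_pullback]
lemma pullback_0 [simp]: "pullback s 0 = 0" by (rule klin_0[OF klin_pullback])
lemma pullback_one [simp]: "pullback s form_one = form_one"
 by (simp add: form_one_def pullback_def)

lemma sorted_list_of_set_filter:
 assumes "A \<subseteq> {..<M}" shows "slist A = filter (%i. i : A) [0..<M]"
proof -
 have "finite A" using assms finite_subset by blast
 then show ?thesis using assms
  by (intro sorted_distinct_set_unique) (auto intro: sorted_wrt_filter)
qed

lemma finite_nat_bounded_ex: "finite A ==> \<exists>M. A \<subseteq> {..<M :: nat}"
 using finite_nat_set_iff_bounded[of A] by auto

lemma concat_map_filter: "(!!i. i : set xs ==> \<not> Q i ==> f i = []) ==> concat (map f (filter Q xs)) = concat (map f xs)"
 by (induction xs) auto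

lemma wedges_insort:
 fixes f :: "nat => 'k::field_char_0 form"
 assumes "!!i. fdeg 1 (f i)" "sorted l" "i \<notin> set l" "distinct l"
 shows "wedges (map f (insort i l)) = cscale ((- 1) ^ card {j : set l. j < i}) (f i \<cdot> wedges (map f l))"
 using assms(2-)
proof (induction l)
 case (Cons x l)
 have ff: "ffin (f j)" for j using assms(1) fdeg_ffin by blast
 show ?case
 proof (cases "i <= x")
  case True
  then have e: "{j. (j = x \<or> j : set l) & j < i} = {}" using Cons by auto
  show ?thesis using True by (auto simp: e)
 next
  case False
  then have e: "{j. (j = x \<or> j : set l) & j < i} = insert x {j : set l. j < i}" by auto
  have "x \<notin> {j : set l. j < i}" using Cons by auto
  moreover have "f x \<cdot> (f i \<cdot> wedges (map f l)) = - (f i \<cdot> (f x \<cdot> wedges (map f l)))"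
   by (rule wedge_left_anticommute1[OF assms(1) assms(1)]) (auto intro!: ffin_wedges simp: ff)
  ultimately show ?thesis using False Cons by (simp add: e wedge_alg)
 qed
qed simp

context
 fixes s :: "nat => 'k::field_char_0 form"
 assumes s: "!!i. fdeg 0 (s i)"
begin

lemma ffin_s [simp]: "ffin (s i)" using s fdeg_ffin by blast
lemma fdeg_ds: "fdeg 1 (dform (s i))" using fdeg_dform[OF s] by simp

lemma pullback_single:
 assumes "ks a \<subseteq> {..<M}" "finite A"
 shows "pullback s (sng (a, A) 1) = wedges (concat (map (%i. replicate (lk a i) (s i)) [0..<M]))
   \<cdot> wedges (map (%i. dform (s i)) (slist A))"
proof -
 have "concat (map (%i. replicate (lk a i) (s i)) (slist (ks a)))
   = concat (map (%i. replicate (lk a i) (s i)) [0..<M])"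
  unfolding sorted_list_of_set_filter[OF assms(1)] by (rule concat_map_filter) (simp add: in_keys_iff)
 then show ?thesis by (simp add: pullback_def, subst wedges_append) auto
qed

lemma powprod_Suc:
 assumes "i < M"
 shows "wedges (concat (map (%j. replicate (lk (sng i 1 + a) j) (s j)) [0..<M]))
  = s i \<cdot> wedges (concat (map (%j. replicate (lk a j) (s j)) [0..<M]))"
 using assms
proof (induction M)
 case (Suc M)
 let ?L = "%a. concat (map (%j. replicate (lk a j) (s j)) [0..<M])"
 have f: "ffin (wedges (?L a))" "ffin (wedges (replicate n (s M)))" for a n
  by (auto intro!: ffin_wedges)
 show ?case
 proof (cases "i = M")
  case True
  have "?L (sng i 1 + a) = ?L a" using True
   by (intro arg_cong[of _ _ concat] map_cong) (auto simp: lookup_add lookup_single when_def)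
  moreover have app: "wedges (?L a @ ys) = wedges (?L a) \<cdot> wedges ys" if "set ys \<subseteq> {s M}" for ys
   by (rule wedges_append) (use that in auto)
  moreover have "wedges (?L a @ replicate n (s M)) = wedges (?L a) \<cdot> wedges (replicate n (s M))"
    "wedges (?L a @ s M # replicate n (s M)) = wedges (?L a) \<cdot> (s M \<cdot> wedges (replicate n (s M)))" for n
   using app[of "s M # replicate n (s M)"] app[of "replicate n (s M)"] by (auto simp: set_replicate_conv_if)
  moreover have "lk (sng i 1 + a) M = Suc (lk a M)" using True by (simp add: lookup_add)
  ultimately show ?thesis using True f
   by (auto simp: wedge_left_commute0[OF s f(1) f(2)] simp del: One_nat_def)
 next
  case False
  then have "lk (sng i 1 + a) M = lk a M" by (simp add: lookup_add lookup_single when_def)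
  moreover have "wedges (?L a @ replicate n (s M)) = wedges (?L a) \<cdot> wedges (replicate n (s M))" for n a
   by (rule wedges_append) auto
  ultimately show ?thesis using False Suc f by (auto simp: wedge_assoc simp del: One_nat_def)
 qed
qed simp

lemma pullback_var_wedge:
 assumes "ffin al"
 shows "pullback s (var i \<cdot> al) = s i \<cdot> pullback s al"
proof (rule klin_eqI[where F = "%al. pullback s (var i \<cdot> al)" and G = "%al. s i \<cdot> pullback s al"])
 fix x assume "x : ks al"
 then obtain a A where x: "x = (a, A)" and A: "finite A" using assms by (cases x) (auto simp: ffin_def)
 obtain M where M: "insert i (ks a) \<subseteq> {..<M}"
  using finite_nat_bounded_ex[of "insert i (ks a)"] by auto
 then have M': "ks a \<subseteq> {..<M}" "ks (sng i 1 + a) \<subseteq> {..<M}" "i < M"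
  using Poly_Mapping.keys_add[of "sng i 1" a] by auto
 show "pullback s (var i \<cdot> sng x 1) = s i \<cdot> pullback s (sng x 1)"
  unfolding x var_wedge_single pullback_single[OF M'(1) A] pullback_single[OF M'(2) A] powprod_Suc[OF M'(3)]
  by (rule wedge_assoc) (auto intro!: ffin_wedges)
qed (intro klin_comp[OF klin_pullback] klin_comp[OF klin_wedge_right] klin_wedge_right klin_pullback)+

lemma pullback_dvar_wedge:
 assumes "ffin al"
 shows "pullback s (dvar i \<cdot> al) = dform (s i) \<cdot> pullback s al"
proof (rule klin_eqI[where F = "%al. pullback s (dvar i \<cdot> al)" and G = "%al. dform (s i) \<cdot> pullback s al"])
 fix x assume "x : ks al"
 then obtain a A where x: "x = (a, A)" and A: "finite A" using assms by (cases x) (auto simp: ffin_def)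
 obtain M where M: "ks a \<subseteq> {..<M}" using finite_nat_bounded_ex[of "ks a"] by auto
 let ?P = "wedges (concat (map (%i. replicate (lk a i) (s i)) [0..<M]))"
 let ?D = "%A. wedges (map (%i. dform (s i)) (slist A))"
 have cm: "?P \<cdot> (dform (s i) \<cdot> ?D B) = dform (s i) \<cdot> (?P \<cdot> ?D B)" for B
  by (rule wedge_left_commute0) (auto intro!: fdeg_wedges0 ffin_wedges s)
 have dd: "dform (s i) \<cdot> ?D (insert i B) = 0" if "finite B" for B
 proof -
  have i1: "insert i B - {i} = B - {i}" "insert i (B - {i}) = insert i B" by auto
  have "?D (insert i B) = cscale ((- 1) ^ card {j : set (slist (B - {i})). j < i})
   (dform (s i) \<cdot> ?D (B - {i}))"
   using that wedges_insort[OF fdeg_ds, of "slist (B - {i})" i]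
    sorted_list_of_set_insert[of "B - {i}" i] by (simp add: i1)
  moreover have "dform (s i) \<cdot> (dform (s i) \<cdot> ?D (B - {i})) = 0"
   by (subst wedge_assoc[symmetric]) (auto intro!: ffin_wedges simp: wedge_square1[OF fdeg_ds])
  ultimately show ?thesis by (simp add: wedge_alg)
 qed
 show "pullback s (dvar i \<cdot> sng x 1) = dform (s i) \<cdot> pullback s (sng x 1)"
 proof (cases "i : A")
  case True
  then have "dform (s i) \<cdot> ?D A = 0" using dd[OF A] by (simp add: insert_absorb)
  then show ?thesis using True A
   by (simp add: x dvar_wedge_single pullback_single[OF M A] cm[symmetric])
 next
  case False
  have "dvar i \<cdot> sng x 1 = cscale ((- 1) ^ card {j : A. j < i}) (sng (a, insert i A) (1 :: 'k))"
   using False A by (simp add: x dvar_wedge_single)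
  moreover have "?D (insert i A) = cscale ((- 1) ^ card {j : A. j < i}) (dform (s i) \<cdot> ?D A)"
   using A False wedges_insort[OF fdeg_ds, of "slist A" i] by simp
  ultimately show ?thesis using A
   by (simp add: x pullback_single[OF M] pullback_rules wedge_alg cm power_add[symmetric] mult_2[symmetric]
     del: cscale_single)
 qed
qed (intro klin_comp[OF klin_pullback] klin_comp[OF klin_wedge_right] klin_wedge_right klin_pullback)+

lemma ffin_pullback [simp]:
 assumes "ffin al" shows "ffin (pullback s al)"
proof (rule klin_closed[OF klin_pullback])
 fix x assume "x : ks al"
 then obtain a A where x: "x = (a, A)" and A: "finite A" using assms by (cases x) (auto simp: ffin_def)
 obtain M where M: "ks a \<subseteq> {..<M}" using finite_nat_bounded_ex[of "ks a"] by auto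
 show "ffin (pullback s (sng x 1))" unfolding x pullback_single[OF M A] by (intro ffin_wedge ffin_wedges) auto
qed auto

lemma fdeg_pullback:
 assumes "fdeg p al" shows "fdeg p (pullback s al)"
proof (rule klin_closed[OF klin_pullback])
 fix x assume "x : ks al"
 then obtain a A where x: "x = (a, A)" and A: "finite A" "card A = p"
  using assms by (cases x) (auto simp: fdeg_def)
 obtain M where M: "ks a \<subseteq> {..<M}" using finite_nat_bounded_ex[of "ks a"] by auto
 have "fdeg (0 + length (map (%i. dform (s i)) (slist A))) (pullback s (sng x 1))"
  unfolding x pullback_single[OF M A(1)]
  by (intro fdeg_wedge fdeg_wedges0 fdeg_wedges1) (auto intro: s fdeg_ds[simplified])
 then show "fdeg p (pullback s (sng x 1))" using A by simp
qed (auto intro: fdeg_add fdeg_cscale)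

lemma Om_pullback:
 assumes "al : Om N" "finite N" "!!i. i : N ==> s i : Om M" "finite M"
 shows "pullback s al : Om M"
 using assms(1,2)
 by (induction al rule: form_induct)
  (use assms in \<open>simp_all add: pullback_rules pullback_var_wedge pullback_dvar_wedge Om_ffin\<close>)

lemma pullback_wedge:
 assumes "al : Om N" "finite N" "ffin be"
 shows "pullback s (al \<cdot> be) = pullback s al \<cdot> pullback s be"
 using assms(1,2)
 by (induction al rule: form_induct)
  (use assms(2,3) in \<open>simp_all add: pullback_rules wedge_alg pullback_var_wedge pullback_dvar_wedge
   wedge_assoc Om_ffin\<close>)

lemma pullback_var [simp]: "pullback s (var i) = s i"
 using pullback_var_wedge[of form_one i] by simp
lemma pullback_dvar [simp]: "pullback s (dvar i) = dform (s i)"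
 using pullback_dvar_wedge[of form_one i] by simp

lemma tw_s: "tw (s i) = s i" using tw_fdeg[OF s] by simp
lemma tw_ds: "tw (dform (s i)) = - dform (s i)" using tw_fdeg[OF fdeg_ds] by simp

lemma dform_pullback:
 assumes "al : Om N" "finite N" "!!i. i : N ==> s i : Om M" "finite M"
 shows "dform (pullback s al) = pullback s (dform al)"
 using assms(1,2)
proof (induction al rule: form_induct)
 case (var i al)
 then show ?case using assms(2)
  by (simp add: pullback_var_wedge pullback_dvar_wedge dform_var_wedge pullback_rules Om_ffin
    dform_wedge[OF assms(3)[OF var(1)] assms(4)] tw_s)
next
 case (dvar i al)
 then show ?case using assms(2)
  by (simp add: pullback_var_wedge pullback_dvar_wedge dform_dvar_wedge pullback_rules Om_ffin wedge_alg
    dform_wedge[OF Om_dform[OF assms(3)[OF dvar(1)] assms(4)] assms(4)]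
    dform_dform[OF assms(3)[OF dvar(1)] assms(4)] tw_ds)
qed (simp_all add: dform_rules pullback_rules)

end

lemma pullback_pullback:
 assumes "al : Om N" "finite N" "!!i. i : N ==> t i : Om M" "finite M"
  "!!i. i : M ==> s i : Om L" "finite L" "!!i. fdeg 0 (s i)" "!!i. fdeg 0 (t i)"
 shows "pullback s (pullback t al) = pullback (%i. pullback s (t i)) al"
 using assms(1,2)
proof (induction al rule: form_induct)
 case (var i al)
 have "fdeg 0 (pullback s (t j))" for j using assms(7,8) by (rule fdeg_pullback)
 then show ?case using assms(2) var
  by (simp add: pullback_var_wedge[OF assms(8)] pullback_var_wedge Om_ffin
    pullback_wedge[OF assms(7) assms(3)[OF var(1)] assms(4)] ffin_pullback[OF assms(8)])
next
 case (dvar i al)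
 have "fdeg 0 (pullback s (t j))" for j using assms(7,8) by (rule fdeg_pullback)
 then show ?case using assms(2) dvar
  by (simp add: pullback_dvar_wedge[OF assms(8)] pullback_dvar_wedge Om_ffin
    pullback_wedge[OF assms(7) Om_dform[OF assms(3)[OF dvar(1)] assms(4)] assms(4)] ffin_pullback[OF assms(8)]
    dform_pullback[OF assms(7) assms(3)[OF dvar(1)] assms(4,5,6)])
qed (simp_all add: pullback_rules)

section \<open>Weights with respect to a vertex\<close>

definition xc :: "nat => nat => 'k::field_char_0 form" where
 "xc i j = var j - (if j = i then form_one else 0)"

abbreviation iot where "iot i \<equiv> iota (xc i)"

lemma fdeg_xc: "fdeg 0 (xc i j)" by (auto simp: xc_def intro!: fdeg_diff fdeg_var fdeg_one)
lemma ffin_xc [simp]: "ffin (xc i j)" using fdeg_xc fdeg_ffin by blast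
lemma Om_xc [simp]: "j : N ==> xc i j : Om N" by (simp add: xc_def)
lemma dform_xc [simp]: "dform (xc i j) = dvar j" by (simp add: xc_def dform_rules)

lemmas iot_var_wedge = iota_var_wedge[of "xc i" for i, OF fdeg_xc]
lemmas iot_dvar_wedge = iota_dvar_wedge[of "xc i" for i, OF fdeg_xc]

lemma iot_xc_wedge: "ffin al ==> iot k (xc i j \<cdot> al) = xc i j \<cdot> iot k al"
 by (simp add: xc_def wedge_alg iota_rules iot_var_wedge)

lemma xc_dvar_commute: "ffin al ==> xc i j \<cdot> (dvar k \<cdot> al) = dvar k \<cdot> (xc i j \<cdot> al)"
 by (rule wedge_left_commute0[OF fdeg_xc]) auto

lemma xc_var_commute: "ffin al ==> xc i j \<cdot> (var k \<cdot> al) = var k \<cdot> (xc i j \<cdot> al)"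
 by (rule wedge_left_commute0[OF fdeg_xc]) auto

lemma Om_iot [simp]: assumes "al : Om N" "finite N" shows "iot i al : Om N"
 using assms by (induction al rule: form_induct)
  (use assms(2) in \<open>simp_all add: iota_rules iot_var_wedge iot_dvar_wedge Om_ffin\<close>)

lemma iot_var [simp]: "iot i (var j) = 0" using iot_var_wedge[of form_one i j] by simp
lemma iot_dvar [simp]: "iot i (dvar j) = xc i j" using iot_dvar_wedge[of form_one i j] by simp

lemma iot_wedge:
 assumes "al : Om N" "finite N" "be : Om M" "finite M"
 shows "iot i (al \<cdot> be) = iot i al \<cdot> be + tw al \<cdot> iot i be"
 using assms(1,2)
proof (induction al rule: form_induct)
 case (dvar j al)
 have "ffin (iot i be)" using assms by (auto intro: Om_ffin[OF Om_iot])
 moreover have "ffin (iot i al)" using assms dvar by (auto intro: Om_ffin[OF Om_iot])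
 ultimately show ?case using assms dvar
  by (simp add: iot_dvar_wedge tw_dvar_wedge wedge_alg wedge_assoc Om_ffin)
next
 case (var j al)
 have "ffin (iot i be)" using assms by (auto intro: Om_ffin[OF Om_iot])
 moreover have "ffin (iot i al)" using assms var by (auto intro: Om_ffin[OF Om_iot])
 ultimately show ?case using assms var
  by (simp add: iot_var_wedge tw_var_wedge wedge_alg wedge_assoc Om_ffin)
qed (use assms in \<open>simp_all add: iota_rules tw_rules wedge_alg P.scale_right_distrib\<close>)

lemma iot_fdeg0: assumes "fdeg 0 al" shows "iot i al = 0"
 by (rule klin_closed[OF klin_iota]) (use assms in \<open>auto simp: iota_def fdeg_def\<close>)

lemma iot_anticommute:
 assumes "al : Om N" "finite N" shows "iot i (iot j al) = - iot j (iot i al)"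
 using assms
proof (induction al rule: form_induct)
 case (var k al)
 then show ?case using assms by (simp add: iot_var_wedge wedge_alg Om_ffin[OF Om_iot] Om_ffin)
next
 case (dvar k al)
 then show ?case using assms
  by (simp add: iot_dvar_wedge iot_xc_wedge iota_rules wedge_alg Om_ffin[OF Om_iot] Om_ffin)
qed (auto simp: iota_rules)

lemma iot_iot: assumes "al : Om N" "finite N" shows "iot i (iot i al) = 0"
proof (rule poly_mapping_eqI)
 fix x show "lk (iot i (iot i al)) x = lk 0 x"
  using arg_cong[OF iot_anticommute[OF assms, of i i], of "%al. lk al x"] by (simp add: eq_neg_iff_add_eq_0)
qed

inductive hw :: "nat set => nat => nat => 'k::field_char_0 form => bool" for N i where
 one: "hw N i 0 form_one"
| zero: "hw N i w 0"
| add: "hw N i w al ==> hw N i w be ==> hw N i w (al + be)"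
| scale: "hw N i w al ==> hw N i w (cscale c al)"
| xc: "j : N ==> hw N i w al ==> hw N i (Suc w) (xc i j \<cdot> al)"
| dvar: "j : N ==> hw N i w al ==> hw N i (Suc w) (dvar j \<cdot> al)"

lemma hw_sum: "(!!x. x : A ==> hw N i w (f x)) ==> hw N i w (sum f A)"
 by (induction A rule: infinite_finite_induct) (auto intro: hw.intros)
lemma hw_uminus: "hw N i w al ==> hw N i w (- al)"
 using hw.scale[of N i w al "- 1"] by simp
lemma hw_diff: "hw N i w al ==> hw N i w be ==> hw N i w (al - be)"
 using hw.add[OF _ hw_uminus, of N i w al be] by simp

lemma hw_Om: "hw N i w al ==> al : Om N"
 by (induction rule: hw.induct) auto

lemma hw_xc1: "j : N ==> hw N i (Suc 0) (xc i j)" and hw_dvar1: "j : N ==> hw N i (Suc 0) (dvar j)"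
 using hw.xc[OF _ hw.one, of j N i] hw.dvar[OF _ hw.one, of j N i] by auto

lemma hw_wedge:
 assumes "finite N" "hw N i w al" "hw N i v be" shows "hw N i (w + v) (al \<cdot> be)"
 using assms(2)
proof (induction)
 case (xc j w al)
 then have "ffin al" "ffin be" using hw_Om assms Om_ffin by blast+
 then show ?case using hw.xc[OF xc(1,3)] by (simp add: wedge_assoc)
next
 case (dvar j w al)
 then have "ffin al" "ffin be" using hw_Om assms Om_ffin by blast+
 then show ?case using hw.dvar[OF dvar(1,3)] by (simp add: wedge_assoc)
qed (use assms in \<open>auto simp: wedge_alg intro: hw.intros\<close>)

lemma hw_iot: assumes "finite N" "hw N i w al" shows "hw N i w (iot i al)"
 using assms(2)
proof (induction)
 case (xc j w al)
 then have "ffin al" using hw_Om assms Om_ffin by blast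
 then show ?case using hw.xc[OF xc(1,3)] by (simp add: iot_xc_wedge)
next
 case (dvar j w al)
 then have "ffin al" using hw_Om assms Om_ffin by blast
 then show ?case using hw.xc[OF dvar(1,2)] hw.dvar[OF dvar(1,3)] by (simp add: iot_dvar_wedge hw_diff)
qed (auto simp: iota_rules intro: hw.intros)

lemma weight_decomp:
 assumes "al : Om N" "finite N"
 shows "\<exists>M f. al = (\<Sum>w<M. f w) & (\<forall>w. hw N i w (f w))"
 using assms
proof (induction al rule: form_induct)
 case zero
 show ?case by (rule exI[of _ 0], rule exI[of _ "%w. 0"]) (auto intro: hw.zero)
next
 case one
 show ?case by (rule exI[of _ 1], rule exI[of _ "%w. if w = 0 then form_one else 0"]) (auto intro: hw.intros)
next
 case (add al be)
 then obtain M f M' f' where *: "al = (\<Sum>w<M. f w)" "\<forall>w. hw N i w (f w)" "be = (\<Sum>w<M'. f' w)" "\<forall>w. hw N i w (f' w)"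
  by blast
 have e: "(\<Sum>w<m. g w) = (\<Sum>w<max M M'. if w < m then g w else 0)" if "m <= max M M'" for m and g :: "nat => 'a form"
  by (rule sum.mono_neutral_cong_left) (use that in auto)
 show ?case
  by (rule exI[of _ "max M M'"], rule exI[of _ "%w. (if w < M then f w else 0) + (if w < M' then f' w else 0)"])
   (use * in \<open>auto simp: sum.distrib e[symmetric] intro!: hw.add intro: hw.zero\<close>)
next
 case (scale c al)
 then obtain M f where *: "al = (\<Sum>w<M. f w)" "\<forall>w. hw N i w (f w)" by blast
 show ?case by (rule exI[of _ M], rule exI[of _ "%w. cscale c (f w)"])
  (use * in \<open>auto simp: P.scale_sum_right intro: hw.intros\<close>)
next
 case (var j al)
 then obtain M f where *: "al = (\<Sum>w<M. f w)" "\<forall>w. hw N i w (f w)" by blast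
 define d where "d = (if j = i then 1 else 0 :: 'a)"
 have v: "var j = xc i j + cscale d form_one" by (auto simp: xc_def d_def)
 show ?case
 proof (rule exI[of _ "Suc M"], rule exI[of _ "%w. (if w = 0 then 0 else xc i j \<cdot> f (w - 1)) + (if w < M then cscale d (f w) else 0)"], intro conjI allI)
  have "(\<Sum>w<Suc M. if w < M then cscale d (f w) else 0) = cscale d al"
   unfolding *(1) P.scale_sum_right by (rule sum.mono_neutral_cong_right) auto
  moreover have "(\<Sum>w<Suc M. if w = 0 then 0 else xc i j \<cdot> f (w - 1)) = xc i j \<cdot> al"
   unfolding *(1) sum.lessThan_Suc_shift by (simp add: wedge_sum)
  ultimately show "var j \<cdot> al = (\<Sum>w<Suc M. (if w = 0 then 0 else xc i j \<cdot> f (w - 1)) + (if w < M then cscale d (f w) else 0))"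
   unfolding sum.distrib v by (simp add: wedge_alg)
  show "hw N i w ((if w = 0 then 0 else xc i j \<cdot> f (w - 1)) + (if w < M then cscale d (f w) else 0))" for w
   using *(2) hw.xc[OF var(1), of i "w - 1" "f (w - 1)"] by (auto intro!: hw.add intro: hw.zero hw.scale)
 qed
next
 case (dvar j al)
 then obtain M f where *: "al = (\<Sum>w<M. f w)" "\<forall>w. hw N i w (f w)" by blast
 show ?case
 proof (rule exI[of _ "Suc M"], rule exI[of _ "%w. if w = 0 then 0 else dvar j \<cdot> f (w - 1)"], intro conjI allI)
  show "dvar j \<cdot> al = (\<Sum>w<Suc M. if w = 0 then 0 else dvar j \<cdot> f (w - 1))"
   unfolding *(1) sum.lessThan_Suc_shift by (simp add: wedge_sum)
  show "hw N i w (if w = 0 then 0 else dvar j \<cdot> f (w - 1))" for w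
   using *(2) hw.dvar[OF dvar(1), of i "w - 1" "f (w - 1)"] by (auto intro: hw.zero)
 qed
qed

lemma weight_induct [consumes 2, case_names zero add hw]:
 assumes "al : Om N" "finite N" "P 0" "!!al be. al : Om N ==> be : Om N ==> P al ==> P be ==> P (al + be)"
  "!!w be. hw N i w be ==> P be"
 shows "P al"
proof -
 obtain M f where f: "al = (\<Sum>w<M. f w)" "\<forall>w. hw N i w (f w)" using weight_decomp[OF assms(1,2), of i] by blast
 have "P (\<Sum>w<m. f w)" for m
  by (induction m) (auto intro!: assms(3,4) Om_sum hw_Om[OF f(2)[rule_format]] assms(5)[OF f(2)[rule_format]])
 then show ?thesis using f(1) by simp
qed

section \<open>The contracting homotopies of the vertices\<close>

definition upow :: "nat => 'k::field_char_0 form" where "upow w = sng (sng 0 w, {}) 1"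

lemma fdeg_upow: "fdeg 0 (upow w)" and ffin_upow [simp]: "ffin (upow w)"
 by (auto simp: upow_def fdeg_def ffin_def)
lemma upow_0 [simp]: "upow 0 = form_one" by (simp add: upow_def form_one_def)
lemma upow_Suc: fixes al :: "'a::field_char_0 form" assumes "ffin al" shows "upow (Suc w) \<cdot> al = var 0 \<cdot> (upow w \<cdot> al)"
proof -
 have "upow (Suc w) = var 0 \<cdot> (upow w :: 'a form)"
  by (simp add: upow_def var_wedge_single single_add[symmetric])
 then show ?thesis using assms by (simp add: wedge_assoc)
qed
lemma upow_commute: "ffin al ==> ffin be ==> be \<cdot> (upow w \<cdot> al) = upow w \<cdot> (be \<cdot> al)"
 by (rule wedge_left_commute0[symmetric, OF fdeg_upow]) auto

definition ucoef :: "(nat => 'k::field_char_0) => 'k form => 'k form" where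
 "ucoef c = lin (%(a, A). if 0 : A then 0 else sng (a - sng 0 (lk a 0), A) (c (lk a 0)))"

lemma klin_ucoef: "klin (ucoef c)" by (simp add: ucoef_def)
lemma klin_fibre: "klin fibre_integral" by (simp add: fibre_integral_def)

lemma ucoef_upow:
 assumes "al : Om N" "finite N" "0 \<notin> N"
 shows "ucoef c (upow w \<cdot> al) = cscale (c w) al" "ucoef c (upow w \<cdot> (dvar 0 \<cdot> al)) = 0"
  "fibre_integral (upow w \<cdot> al) = 0" "fibre_integral (upow w \<cdot> (dvar 0 \<cdot> al)) = cscale (1 / of_nat (w + 1)) al"
proof -
 have 1: "upow w \<cdot> sng x 1 = sng (sng 0 w + fst x, snd x) (1::'a)" for x
  by (simp add: upow_def wedge_mono_def)
 have 2: "upow w \<cdot> (dvar 0 \<cdot> sng x 1) = sng (sng 0 w + fst x, insert 0 (snd x)) (1::'a)"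
   "lk (sng 0 w + fst x) 0 = w" "sng 0 w + fst x - sng 0 w = fst x" "0 \<notin> snd x" if "x : ks al" for x
 proof -
  have x: "snd x \<subseteq> N" "ks (fst x) \<subseteq> N" using that assms by (auto simp: Om_def)
  then show n: "0 \<notin> snd x" using assms by auto
  have "lk (fst x) 0 = 0" using x assms by (auto simp: in_keys_iff)
  then show "lk (sng 0 w + fst x) 0 = w" by (simp add: lookup_add)
  have "finite (snd x)" using x assms finite_subset by blast
  then show "upow w \<cdot> (dvar 0 \<cdot> sng x 1) = sng (sng 0 w + fst x, insert 0 (snd x)) (1::'a)"
   using n dvar_wedge_single[of "snd x" 0 "fst x" "1::'a"] by (simp add: upow_def wedge_mono_def)
 qed simp
 show "ucoef c (upow w \<cdot> al) = cscale (c w) al"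
  by (rule klin_eqI[OF klin_comp[OF klin_ucoef klin_wedge_right] klin_cscale[OF klin_id]])
   (simp add: 1 2 ucoef_def)
 show "ucoef c (upow w \<cdot> (dvar 0 \<cdot> al)) = 0"
  by (rule klin_eqI[OF klin_comp[OF klin_ucoef klin_comp[OF klin_wedge_right klin_wedge_right]] klin_zero])
   (simp add: 2 ucoef_def)
 show "fibre_integral (upow w \<cdot> al) = 0"
  by (rule klin_eqI[OF klin_comp[OF klin_fibre klin_wedge_right] klin_zero])
   (simp add: 1 2 fibre_integral_def)
 show "fibre_integral (upow w \<cdot> (dvar 0 \<cdot> al)) = cscale (1 / of_nat (w + 1)) al"
  by (rule klin_eqI[OF klin_comp[OF klin_fibre klin_comp[OF klin_wedge_right klin_wedge_right]] klin_cscale[OF klin_id]])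
   (simp add: 2 fibre_integral_def)
qed

definition hsub :: "nat => nat => 'k::field_char_0 form" where
 "hsub i j = wedge (var 0) (var j) + (if j = i then form_one - var 0 else 0)"

lemma h_vertex_hsub: "h_vertex i al = fibre_integral (pullback (hsub i) al)"
 by (simp add: h_vertex_def hsub_def[abs_def])

lemma klin_h_vertex: "klin (h_vertex i)"
 unfolding h_vertex_hsub[abs_def] by (rule klin_comp[OF klin_fibre klin_pullback])

lemma fdeg_hsub: "fdeg 0 (hsub i j)"
 using fdeg_wedge[OF fdeg_var fdeg_var, of 0 j]
 by (auto simp: hsub_def intro!: fdeg_add fdeg_diff fdeg_one fdeg_var)

lemma dform_hsub: "dform (hsub i j) = dvar 0 \<cdot> xc i j + var 0 \<cdot> dvar j"
 by (simp add: hsub_def xc_def dform_rules dform_var_wedge wedge_alg)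

lemma pullback_xc: "pullback (hsub i) (xc i j) = var 0 \<cdot> xc i j"
 by (simp add: xc_def pullback_rules pullback_var[OF fdeg_hsub] hsub_def wedge_alg)

lemma pullback_hsub_hw:
 assumes "hw N i w al" "finite N" "0 \<notin> N"
 shows "pullback (hsub i) al = upow w \<cdot> al + upow (w - 1) \<cdot> (dvar 0 \<cdot> iot i al) & (w = 0 --> iot i al = 0)"
 using assms(1)
proof induction
 case (xc j w al)
 have f: "al : Om N" "ffin al" "ffin (iot i al)" using hw_Om[OF xc(2)] assms(2) by (auto simp: Om_ffin[OF Om_iot] Om_ffin)
 have "pullback (hsub i) (xc i j \<cdot> al) = (var 0 \<cdot> xc i j) \<cdot> (upow w \<cdot> al + upow (w - 1) \<cdot> (dvar 0 \<cdot> iot i al))"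
  unfolding pullback_wedge[OF fdeg_hsub Om_xc[OF xc(1)] assms(2) f(2)] using xc by (simp add: pullback_xc)
 also have "... = upow (Suc w) \<cdot> (xc i j \<cdot> al) + upow w \<cdot> (dvar 0 \<cdot> (xc i j \<cdot> iot i al))"
 proof (cases w)
  case 0 then show ?thesis using xc f by (simp add: wedge_assoc upow_Suc)
 next
  case (Suc v) then show ?thesis using f
   by (simp add: wedge_alg wedge_assoc upow_Suc upow_commute xc_dvar_commute xc_var_commute)
 qed
 finally show ?case using f by (simp add: iot_xc_wedge)
next
 case (dvar j w al)
 have f: "al : Om N" "ffin al" "ffin (iot i al)" using hw_Om[OF dvar(2)] assms(2) by (auto simp: Om_ffin[OF Om_iot] Om_ffin)
 have "pullback (hsub i) (dvar j \<cdot> al) = (dvar 0 \<cdot> xc i j + var 0 \<cdot> dvar j) \<cdot> (upow w \<cdot> al + upow (w - 1) \<cdot> (dvar 0 \<cdot> iot i al))"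
  unfolding pullback_dvar_wedge[OF fdeg_hsub f(2)] using dvar by (simp add: dform_hsub)
 also have "... = upow (Suc w) \<cdot> (dvar j \<cdot> al) + upow w \<cdot> (dvar 0 \<cdot> (xc i j \<cdot> al - dvar j \<cdot> iot i al))"
 proof (cases w)
  case 0 then show ?thesis using dvar f by (simp add: wedge_assoc upow_Suc wedge_alg)
 next
  case (Suc v) then show ?thesis using f
   by (simp add: wedge_alg wedge_assoc upow_Suc upow_commute xc_dvar_commute xc_var_commute dvar_square dvar_anticommute[of _ j 0]
    var_dvar_commute[of _ 0, symmetric])
 qed
 finally show ?case using f by (simp add: iot_dvar_wedge)
qed (auto simp: pullback_rules wedge_alg iota_rules P.scale_right_distrib)

text \<open>
  The pullback along the contraction to the vertex scales a form of weight \<open>w\<close> by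
  \<open>u\<^sup>w\<close>, and its part containing \<open>du\<close> is
  \<open>u\<^sup>w\<^sup>-\<^sup>1 du\<close> times the contracted form; integrating over
  \<open>u\<close> gives \<open>1/w\<close>.
\<close>

lemma h_vertex_hw:
 assumes "hw N i w al" "finite N" "0 \<notin> N"
 shows "h_vertex i al = cscale (1 / of_nat w) (iot i al)"
proof -
 have al: "al : Om N" using hw_Om[OF assms(1)] .
 show ?thesis
  using pullback_hsub_hw[OF assms] ucoef_upow(3)[OF al assms(2,3)] ucoef_upow(3)[OF al assms(2,3), of 0]
   ucoef_upow(4)[OF Om_iot[OF al assms(2)] assms(2,3)]
  by (cases w) (auto simp: h_vertex_hsub klin_add[OF klin_fibre])
qed

definition wop :: "nat => (nat => 'k) => 'k form => 'k::field_char_0 form" where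
 "wop i c al = ucoef c (pullback (hsub i) al)"

lemma klin_wop: "klin (wop i c)"
 unfolding wop_def[abs_def] by (rule klin_comp[OF klin_ucoef klin_pullback])
lemmas wop_rules = klin_add[OF klin_wop] klin_scale[OF klin_wop] klin_0[OF klin_wop]
 klin_uminus[OF klin_wop] klin_diff[OF klin_wop]

lemma wop_hw:
 assumes "hw N i w al" "finite N" "0 \<notin> N"
 shows "wop i c al = cscale (c w) al"
proof -
 have al: "al : Om N" using hw_Om[OF assms(1)] .
 show ?thesis
  using pullback_hsub_hw[OF assms] ucoef_upow(1)[OF al assms(2,3)] ucoef_upow(1)[OF al assms(2,3), of _ 0]
   ucoef_upow(2)[OF Om_iot[OF al assms(2)] assms(2,3)]
  by (auto simp: wop_def klin_add[OF klin_ucoef])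
qed

lemmas h_vertex_rules = klin_add[OF klin_h_vertex] klin_scale[OF klin_h_vertex] klin_0[OF klin_h_vertex]
 klin_uminus[OF klin_h_vertex] klin_diff[OF klin_h_vertex]

lemma h_vertex_wop:
 assumes "al : Om N" "finite N" "0 \<notin> N"
 shows "h_vertex i al = wop i (%w. 1 / of_nat w) (iot i al)"
 using assms(1,2)
proof (induction al rule: weight_induct[where i = i])
 case (hw w be)
 show ?case unfolding h_vertex_hw[OF hw assms(2,3)]
  by (rule wop_hw[OF hw_iot[OF assms(2) hw] assms(2,3), symmetric])
qed (auto simp: h_vertex_rules wop_rules iota_rules)

section \<open>Lie derivatives and anticommutation of the vertex homotopies\<close>

definition LieD :: "nat => 'k::field_char_0 form => 'k form" where
 "LieD i al = dform (iot i al) + iot i (dform al)"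

lemma klin_LieD: "klin (LieD i)"
 unfolding LieD_def[abs_def] by (intro klin_plus klin_comp[OF klin_dform klin_iota] klin_comp[OF klin_iota klin_dform])
lemmas LieD_rules = klin_add[OF klin_LieD] klin_scale[OF klin_LieD] klin_0[OF klin_LieD]
 klin_uminus[OF klin_LieD] klin_diff[OF klin_LieD]

lemma dform_xc_wedge: "ffin al ==> dform (xc i j \<cdot> al) = dvar j \<cdot> al + xc i j \<cdot> dform al"
 by (simp add: xc_def wedge_alg dform_rules dform_var_wedge)

lemma ffin_iot: assumes "ffin (al :: 'a::field_char_0 form)" shows "ffin (iot i al)"
proof (rule klin_closed[OF klin_iota])
 fix x assume "x : ks al"
 then obtain a A where x: "x = (a, A)" and A: "finite A"
  using assms by (cases x) (auto simp: ffin_def)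
 have "ffin (sng (a, A - {j}) (1::'a))" for j using A by (simp add: ffin_def)
 then show "ffin (iot i (sng x (1::'a)))"
  by (auto simp: x iota_def intro!: ffin_sum ffin_cscale ffin_wedge)
qed auto
declare ffin_iot [simp]

lemma LieD_var_wedge:
 assumes "ffin al" shows "LieD i (var j \<cdot> al) = xc i j \<cdot> al + var j \<cdot> LieD i al"
 using assms by (simp add: LieD_def dform_rules iota_rules iot_var_wedge iot_dvar_wedge dform_var_wedge
   dform_dvar_wedge wedge_alg)

lemma LieD_dvar_wedge:
 assumes "ffin al" shows "LieD i (dvar j \<cdot> al) = dvar j \<cdot> al + dvar j \<cdot> LieD i al"
 using assms by (simp add: LieD_def dform_rules iota_rules iot_var_wedge iot_dvar_wedge dform_var_wedge
   dform_dvar_wedge wedge_alg dform_xc_wedge)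

lemma LieD_xc_wedge:
 assumes "ffin al" shows "LieD i (xc k j \<cdot> al) = xc i j \<cdot> al + xc k j \<cdot> LieD i al"
 using assms by (simp add: xc_def[of k] wedge_alg LieD_rules LieD_var_wedge)

lemma ffin_LieD [simp]: "ffin al ==> ffin (LieD i al)" by (simp add: LieD_def)
lemma Om_LieD [simp]: "al : Om N ==> finite N ==> LieD i al : Om N" by (simp add: LieD_def)

lemma LieD_one [simp]: "LieD i form_one = 0" by (simp add: LieD_def)

lemma LieD_hw: assumes "hw N i w al" "finite N" shows "LieD i al = cscale (of_nat w) al"
 using assms(1)
proof induction
 case (xc j w al)
 then have "ffin al" using hw_Om assms Om_ffin by blast
 then show ?case using xc by (simp add: LieD_xc_wedge wedge_alg P.scale_left_distrib)
next
 case (dvar j w al)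
 then have "ffin al" using hw_Om assms Om_ffin by blast
 then show ?case using dvar by (simp add: LieD_dvar_wedge wedge_alg P.scale_left_distrib)
qed (simp_all add: LieD_rules P.scale_right_distrib mult.commute)

lemma LieD_iot:
 assumes "al : Om N" "finite N"
 shows "LieD i (iot j al) = iot j (LieD i al) + iot i al - iot j al"
 using assms
proof (induction al rule: form_induct)
 case (var k al)
 then have "ffin al" using assms Om_ffin by blast
 then show ?case using var
  by (simp add: iot_var_wedge iot_xc_wedge LieD_var_wedge iota_rules wedge_alg)
next
 case (dvar k al)
 then have f: "ffin al" using assms Om_ffin by blast
 show ?case using f dvar
  by (simp add: iot_dvar_wedge LieD_dvar_wedge LieD_xc_wedge LieD_rules iota_rules wedge_alg)
qed (simp_all add: LieD_rules iota_rules P.scale_right_distrib P.scale_right_diff_distrib)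

lemma LieD_LieD:
 assumes "al : Om N" "finite N"
 shows "LieD i (LieD j al) = LieD j (LieD i al) + LieD i al - LieD j al"
 using assms
proof (induction al rule: form_induct)
 case (var k al)
 then have "ffin al" using assms Om_ffin by blast
 then show ?case using var
  by (simp add: LieD_var_wedge LieD_xc_wedge LieD_rules wedge_alg)
next
 case (dvar k al)
 then have f: "ffin al" using assms Om_ffin by blast
 show ?case using f dvar
  by (simp add: LieD_dvar_wedge LieD_rules wedge_alg)
qed (simp_all add: LieD_rules P.scale_right_distrib P.scale_right_diff_distrib)

lemma hw_iot0: "hw N i 0 al ==> finite N ==> 0 \<notin> N ==> iot i al = 0"
 using pullback_hsub_hw by blast

context
 fixes N :: "nat set"
 assumes N: "finite N" "0 \<notin> N"
begin

lemma h_hw: "hw N i w al ==> h_vertex i al = cscale (1 / of_nat w) (iot i al)"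
 using h_vertex_hw N by blast

lemma hw_h_vertex: "hw N i w al ==> hw N i w (h_vertex i al)"
 by (simp add: h_hw hw.scale hw_iot N)

lemma Om_h_vertex [simp]: assumes "al : Om N" shows "h_vertex i al : Om N"
 using assms N(1)
proof (induction al rule: weight_induct[where i = i])
 case (hw w be)
 then show ?case using hw_Om[OF hw_h_vertex] by blast
qed (auto simp: h_vertex_rules)

lemma iot_h_vertex: assumes "al : Om N" shows "iot i (h_vertex i al) = 0"
 using assms N(1)
proof (induction al rule: weight_induct[where i = i])
 case (hw w be)
 then show ?case using iot_iot[OF hw_Om[OF hw] N(1), of i] by (simp add: h_hw iota_rules)
qed (auto simp: h_vertex_rules iota_rules)

lemma h_vertex_h_vertex: assumes "al : Om N" shows "h_vertex i (h_vertex i al) = 0"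
 using h_vertex_wop[OF Om_h_vertex[OF assms, of i] N, of i] iot_h_vertex[OF assms, of i] by (simp add: wop_rules)

lemma LieD_h_vertex: assumes "al : Om N" shows "LieD i (h_vertex i al) = iot i al"
 using assms N(1)
proof (induction al rule: weight_induct[where i = i])
 case (hw w be)
 show ?case
  using LieD_hw[OF hw_h_vertex[OF hw] N(1)] h_hw[OF hw] hw_iot0[OF _ N, of i be] hw
  by (cases w) (auto simp del: of_nat_Suc)
qed (auto simp: h_vertex_rules LieD_rules iota_rules)

lemma LieD_plus_one_inj:
 assumes "al : Om N" "al + LieD i al = 0" shows "al = 0"
proof -
 have "wop i (%w. 1 / (1 + of_nat w)) (al + LieD i al) = al"
  using assms(1) N(1)
 proof (induction al rule: weight_induct[where i = i])
  case (hw w be)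
  have "1 + of_nat w ~= (0::'a)" using of_nat_neq_0[of w, where ?'a = 'a] by (simp add: add.commute)
  then show ?case using LieD_hw[OF hw N(1)] wop_hw[OF hw N]
   by (simp add: wop_rules P.scale_left_distrib[symmetric] distrib_left[symmetric] add_divide_distrib[symmetric])
 next
  case (add al be)
  have "al + be + LieD i (al + be) = (al + LieD i al) + (be + LieD i be)" by (simp add: LieD_rules add_ac)
  then show ?case using add by (simp only: wop_rules(1)[of _ _ "al + LieD i al"])
 qed (simp add: wop_rules LieD_rules)
 then show ?thesis using assms(2) by (simp add: wop_rules)
qed

lemma hw_0_const: assumes "hw N i w al" shows "w = 0 ==> \<exists>c. al = cscale c form_one"
 using assms
proof induction
 case one
 then show ?case by (intro exI[of _ 1]) simp
next
 case (zero w)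
 then show ?case by (intro exI[of _ 0]) simp
next
 case (add w al be)
 then show ?case by (metis P.scale_left_distrib)
next
 case (scale w al c)
 then show ?case by (metis P.scale_scale)
qed auto

lemma LieD_ker_const:
 assumes "al : Om N" "LieD i al = 0" shows "\<exists>c. al = cscale c form_one"
proof -
 define D where "D = wop i (%w. if w = 0 then 1 else 0 :: 'a)"
 have "wop i (%w. 1 / of_nat w) (LieD i al) = al - D al & (\<exists>c. D al = cscale c form_one)"
  using assms(1) N(1)
 proof (induction al rule: weight_induct[where i = i])
  case zero
  then show ?case by (auto simp: D_def wop_rules LieD_rules intro!: exI[of _ 0])
 next
  case (add al be)
  then obtain c d where "D al = cscale c form_one" "D be = cscale d form_one" by blast
  then have "D (al + be) = cscale (c + d) form_one" by (simp add: D_def wop_rules P.scale_left_distrib)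
  moreover have "wop i (%w. 1 / of_nat w) (LieD i (al + be)) = al + be - D (al + be)"
   using add(3,4)[THEN conjunct1] by (simp add: D_def wop_rules LieD_rules)
  ultimately show ?case by blast
 next
  case (hw w be)
  have "\<exists>c. D be = cscale c form_one"
  proof (cases w)
   case 0 then show ?thesis using hw_0_const[OF hw] wop_hw[OF hw N] by (simp add: D_def)
  next
   case (Suc v) then show ?thesis using wop_hw[OF hw N] by (auto simp: D_def intro!: exI[of _ 0])
  qed
  then show ?case using LieD_hw[OF hw N(1)] wop_hw[OF hw N] by (cases w) (auto simp: D_def wop_rules simp del: of_nat_Suc)
 qed
 then show ?thesis using assms(2) by (auto simp: wop_rules)
qed

lemma LieD_h_anticomm:
 assumes "al : Om N"
 shows "\<exists>c. h_vertex i (h_vertex j al) + h_vertex j (h_vertex i al) = cscale c form_one"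
proof -
 let ?h = h_vertex
 define A where "A = LieD i (?h i (?h j al))"
 define B where "B = LieD i (?h j (?h i al))"
 have O: "?h i al : Om N" "?h j al : Om N" "?h j (?h i al) : Om N" using assms by auto
 have A: "A + LieD j A = iot i (iot j al)"
  unfolding A_def LieD_h_vertex[OF O(2)] LieD_iot[OF O(2) N(1)] LieD_h_vertex[OF assms]
  using iot_h_vertex[OF assms, of j] by simp
 have "LieD j B = LieD i (iot j (?h i al)) - B + iot j (?h i al)"
  unfolding B_def using LieD_LieD[OF O(3) N(1), of i j] LieD_h_vertex[OF O(1), of j] by simp
 also have "LieD i (iot j (?h i al)) = iot j (iot i al) - iot j (?h i al)"
  unfolding LieD_iot[OF O(1) N(1)] LieD_h_vertex[OF assms] using iot_h_vertex[OF assms, of i] by simp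
 finally have "B + LieD j B = iot j (iot i al)" by simp
 then have "(A + B) + LieD j (A + B) = 0"
 proof -
  assume B: "B + LieD j B = iot j (iot i al)"
  have "(A + B) + LieD j (A + B) = (A + LieD j A) + (B + LieD j B)" by (simp add: LieD_rules add_ac)
  then show ?thesis using iot_anticommute[OF assms N(1), of i j] by (simp add: A B)
 qed
 moreover have "A + B : Om N" unfolding A_def B_def using O N by simp
 ultimately have "A + B = 0" using LieD_plus_one_inj[of "A + B" j] by blast
 then have "LieD i (?h i (?h j al) + ?h j (?h i al)) = 0"
  unfolding A_def B_def LieD_rules .
 then show ?thesis using O by (intro LieD_ker_const) auto
qed

end

lemma hw_pullback:
 fixes s :: "nat => 'k::field_char_0 form"
 assumes s: "!!k. fdeg 0 (s k)" and N: "finite N" and M: "finite M" and sM: "!!k. k : N ==> s k : Om M"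
  and a: "!!k. k : N ==> pullback s (xc i k) = (\<Sum>l\<in>M. cscale (a k l) (xc i' l))"
  and al: "hw N i w al"
 shows "hw M i' w (pullback s al) & iot i' (pullback s al) = pullback s (iot i al)"
 using al
proof induction
 case (xc k w al)
 have f: "ffin al" "ffin (pullback s al)" using hw_Om[OF xc(2)] N by (auto simp: Om_ffin ffin_pullback[OF s])
 have p: "pullback s (xc i k \<cdot> be) = (\<Sum>l\<in>M. cscale (a k l) (xc i' l \<cdot> pullback s be))" if "ffin be" for be
  unfolding pullback_wedge[OF s Om_xc[OF xc(1)] N that] a[OF xc(1)] by (simp add: wedge_sum wedge_alg)
 show ?case using f xc by (auto simp: p iot_xc_wedge klin_sum[OF klin_iota] iota_rules intro!: hw_sum hw.scale hw.xc)
next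
 case (dvar k w al)
 have f: "ffin al" "ffin (pullback s al)" "ffin (iot i al)" using hw_Om[OF dvar(2)] N by (auto simp: Om_ffin ffin_pullback[OF s])
 have "dform (s k) = dform (pullback s (xc i k))"
  by (simp add: xc_def pullback_rules pullback_var[OF s] dform_rules)
 then have ds: "dform (s k) = (\<Sum>l\<in>M. cscale (a k l) (dvar l))"
  by (simp add: a[OF dvar(1)] klin_sum[OF klin_dform] dform_rules)
 have p: "pullback s (dvar k \<cdot> be) = (\<Sum>l\<in>M. cscale (a k l) (dvar l \<cdot> pullback s be))" if "ffin be" for be
  unfolding pullback_dvar_wedge[OF s that] ds by (simp add: wedge_sum wedge_alg)
 have p': "pullback s (xc i k \<cdot> al) = (\<Sum>l\<in>M. cscale (a k l) (xc i' l \<cdot> pullback s al))"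
  unfolding pullback_wedge[OF s Om_xc[OF dvar(1)] N f(1)] a[OF dvar(1)] by (simp add: wedge_sum wedge_alg)
 show ?case using f dvar
  by (auto simp: p p' iot_dvar_wedge klin_sum[OF klin_iota] iota_rules pullback_rules sum_subtractf
    P.scale_right_diff_distrib intro!: hw_sum hw.scale hw.dvar)
qed (auto simp: pullback_rules iota_rules intro: hw.intros)

lemma pullback_h_vertex:
 fixes s :: "nat => 'k::field_char_0 form"
 assumes s: "!!k. fdeg 0 (s k)" and N: "finite N" "0 \<notin> N" and M: "finite M" "0 \<notin> M"
  and sM: "!!k. k : N ==> s k : Om M"
  and a: "!!k. k : N ==> pullback s (xc i k) = (\<Sum>l\<in>M. cscale (a k l) (xc i' l))"
  and al: "al : Om N"
 shows "pullback s (h_vertex i al) = h_vertex i' (pullback s al)"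
 using al N(1)
proof (induction al rule: weight_induct[where i = i])
 case (hw w be)
 have *: "hw M i' w (pullback s be) & iot i' (pullback s be) = pullback s (iot i be)"
  by (rule hw_pullback[OF s N(1) M(1) sM a hw])
 then show ?case using h_hw[OF M, of i' w "pullback s be"] h_hw[OF N hw] by (simp add: pullback_rules)
qed (simp_all add: pullback_rules h_vertex_rules)

lemma fdeg_h_vertex: assumes "fdeg (Suc p) al" shows "fdeg p (h_vertex i (al :: 'a::field_char_0 form))"
 unfolding h_vertex_hsub
proof (rule klin_closed[OF klin_fibre])
 fix x assume "x : ks (pullback (hsub i) al)"
 then have "finite (snd x)" "card (snd x) = Suc p"
  using fdeg_pullback[where s = "hsub i", OF fdeg_hsub assms] by (auto simp: fdeg_def)
 then show "fdeg p (fibre_integral (sng x (1::'a)))"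
  by (auto simp: fibre_integral_def fdeg_def split: prod.splits)
qed (auto intro: fdeg_add fdeg_cscale)

lemma h_vertex_fdeg0: assumes "fdeg 0 (al :: 'a::field_char_0 form)" shows "h_vertex i al = 0"
 unfolding h_vertex_hsub
proof (rule klin_closed[OF klin_fibre])
 fix x assume "x : ks (pullback (hsub i) al)"
 then have "snd x = {}"
  using fdeg_pullback[where s = "hsub i", OF fdeg_hsub assms] by (auto simp: fdeg_def)
 then show "fibre_integral (sng x (1::'a)) = 0"
  by (auto simp: fibre_integral_def split: prod.splits)
qed auto

lemma fold_h_vertex_fdeg: "fdeg p al ==> p < length l ==> fold h_vertex l al = 0"
proof (induction l arbitrary: p al)
 case (Cons i l)
 have z: "fold h_vertex l 0 = (0::'a form)" for l by (induction l) (auto simp: h_vertex_rules)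
 show ?case
 proof (cases p)
  case 0 then show ?thesis using Cons(2) z by (simp add: h_vertex_fdeg0)
 next
  case (Suc q) then show ?thesis using Cons fdeg_h_vertex[of q al i] by simp
 qed
qed simp

lemma klin_fold_h: "klin (fold h_vertex l)"
proof (induction l)
 case (Cons i l)
 then show ?case using klin_comp[OF Cons klin_h_vertex[of i]] by (simp add: o_def)
qed (simp add: klin_id id_def)
lemmas fold_h_rules = klin_add[OF klin_fold_h] klin_scale[OF klin_fold_h] klin_0[OF klin_fold_h]
 klin_uminus[OF klin_fold_h] klin_diff[OF klin_fold_h]

lemma fold_h_too_long:
 assumes "al : Om N" "finite N" "card N < length l" shows "fold h_vertex l (al :: 'a::field_char_0 form) = 0"
proof (rule klin_closed[OF klin_fold_h])
 fix x assume "x : ks al"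
 then have "snd x \<subseteq> N" using assms by (auto simp: Om_def)
 then have "finite (snd x)" "card (snd x) < length l"
  using assms card_mono[of N "snd x"] finite_subset by (auto intro: finite_subset)
 then show "fold h_vertex l (sng x (1::'a)) = 0"
  by (intro fold_h_vertex_fdeg[of "card (snd x)"]) (auto simp: fdeg_def)
qed auto

text \<open>
  This is the source of all the side conditions: it lets the terms of the double sums in \<open>h
  h\<close> and \<open>h i\<close> cancel in pairs.
\<close>

lemma h_vertex_anticommute:
 assumes "al : Om N" "finite N" "0 \<notin> N"
 shows "h_vertex i (h_vertex j al) = - h_vertex j (h_vertex i al)"
proof (cases "i = j")
 case True then show ?thesis using h_vertex_h_vertex[OF assms(2,3,1)] by simp
next
 case False
 obtain c where c: "h_vertex i (h_vertex j al) + h_vertex j (h_vertex i al) = cscale c form_one"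
  using LieD_h_anticomm[OF assms(2,3,1)] by blast
 define s :: "nat => 'a form" where
  "s k = (if k = i then var 1 else if k = j then form_one - var 1 else 0)" for k
 have s: "fdeg 0 (s k)" "s k : Om {1}" for k
  by (auto simp: s_def intro!: fdeg_diff fdeg_var fdeg_one)
 have *: "pullback s (h_vertex i be) = h_vertex 1 (pullback s be)"
  "pullback s (h_vertex j be) = h_vertex 0 (pullback s be)" if "be : Om N" for be
 proof -
  have xs: "pullback s (xc v k) = s k - (if k = v then form_one else 0)" for v k
   by (simp add: xc_def pullback_rules pullback_var[OF s(1)])
  let ?a = "%k (l::nat). if k = i then 1 else if k = j then - 1 else (0::'a)"
  show "pullback s (h_vertex i be) = h_vertex 1 (pullback s be)"
   by (rule pullback_h_vertex[where a = ?a, OF s(1) assms(2,3) _ _ s(2) _ that])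
    (use False in \<open>auto simp: xs, auto simp: xc_def s_def\<close>)
  show "pullback s (h_vertex j be) = h_vertex 0 (pullback s be)"
   by (rule pullback_h_vertex[where a = ?a, OF s(1) assms(2,3) _ _ s(2) _ that])
    (use False in \<open>auto simp: xs, auto simp: xc_def s_def\<close>)
 qed
 have p: "pullback s al : Om {1}" by (rule Om_pullback[OF s(1) assms(1,2) s(2)]) auto
 have "cscale c form_one = pullback s (h_vertex i (h_vertex j al) + h_vertex j (h_vertex i al))"
  unfolding c by (simp add: pullback_rules)
 also have "... = fold h_vertex [0, 1] (pullback s al) + fold h_vertex [1, 0] (pullback s al)"
  using assms by (simp add: pullback_rules *)
 also have "... = 0" using fold_h_too_long[OF p, of "[0, 1]"] fold_h_too_long[OF p, of "[1, 0]"] by simp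
 finally have "c = 0"
  by (simp add: form_one_def single_zero) (metis lookup_single_eq lookup_zero)
 then show ?thesis using c by (simp add: eq_neg_iff_add_eq_0)
qed

section \<open>Whitney forms\<close>

definition ix :: "nat => nat set" where "ix n = {1..n}"

lemma ix_simps [simp]: "finite (ix n)" "0 \<notin> ix n" "card (ix n) = n"
 and in_ix: "i : ix n \<longleftrightarrow> i ~= 0 & i <= n"
 by (auto simp: ix_def)

definition dtl :: "nat => nat list => 'k::field_char_0 form" where
 "dtl n l = wedges (map (%i. dform (bary n i)) l)"

fun Wh :: "nat => nat list => 'k::field_char_0 form" where
 "Wh n [] = 0"
| "Wh n (i # l) = cscale (fact (length l)) (bary n i \<cdot> dtl n l) - cscale (of_nat (length l)) (dform (bary n i) \<cdot> Wh n l)"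

lemma fdeg_bary: "fdeg 0 (bary n i)"
 by (auto simp: bary_def intro!: fdeg_diff fdeg_one fdeg_sum fdeg_var)
lemma ffin_bary [simp]: "ffin (bary n i)" using fdeg_bary fdeg_ffin by blast
lemma fdeg_dbary: "fdeg 1 (dform (bary n i))" using fdeg_dform[OF fdeg_bary] by simp
lemma Om_bary [simp]: "i <= n ==> bary n i : Om (ix n)"
 by (auto simp: bary_def ix_def simp del: One_nat_def intro!: Om_diff Om_sum Om_var)

lemma bary_hw: assumes "i <= n" "j <= n"
 shows "hw (ix n) i (Suc 0) (bary n j - (if j = i then form_one else 0) :: 'a::field_char_0 form)"
  "hw (ix n) i (Suc 0) (dform (bary n j) :: 'a form)"
  "iot i (dform (bary n j)) = bary n j - (if j = i then form_one else (0 :: 'a form))"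
proof -
 have *: "bary n j - (if j = i then form_one else (0 :: 'a form)) = (\<Sum>l\<in>ix n. cscale (if j = 0 then - 1 else if l = j then 1 else 0) (xc i l))
  & dform (bary n j :: 'a form) = (\<Sum>l\<in>ix n. cscale (if j = 0 then - 1 else if l = j then 1 else 0) (dvar l))"
 proof (cases "j = 0")
  case True
  have "(\<Sum>l\<in>ix n. if l = i then form_one else (0 :: 'a form)) = (if i = 0 then 0 else form_one)"
   using assms by (auto simp: sum.delta in_ix)
  then show ?thesis using True assms
   by (auto simp: bary_def xc_def sum_negf sum_subtractf dform_rules klin_sum[OF klin_dform] ix_def[symmetric] in_ix simp del: One_nat_def)
 next
  case False
  then show ?thesis using assms by (auto simp: bary_def xc_def in_ix if_distrib[of "%c. cscale c _"] sum.delta' cong: if_cong)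
 qed
 note E = *[THEN conjunct1] *[THEN conjunct2]
 show "hw (ix n) i (Suc 0) (bary n j - (if j = i then form_one else 0) :: 'a form)"
  unfolding E by (intro hw_sum hw.scale hw_xc1)
 show "hw (ix n) i (Suc 0) (dform (bary n j) :: 'a form)"
  unfolding E by (intro hw_sum hw.scale hw_dvar1)
 show "iot i (dform (bary n j)) = bary n j - (if j = i then form_one else (0 :: 'a form))"
  unfolding E klin_sum[OF klin_iota] iota_rules iot_dvar ..
qed

lemma Om_dtl [simp]: "set l \<subseteq> {0..n} ==> dtl n l : Om (ix n)"
 by (auto simp: dtl_def subset_iff intro!: Om_wedges Om_dform)
lemma Om_Wh [simp]: "set l \<subseteq> {0..n} ==> Wh n l : Om (ix n)"
 by (induction l) auto
lemma ffin_dtl [simp]: "ffin (dtl n l)"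
 by (auto simp: dtl_def intro!: ffin_wedges)
lemma ffin_Wh [simp]: "ffin (Wh n l)"
 by (induction l) auto
lemma fdeg_dtl: "fdeg (length l) (dtl n l)"
 unfolding dtl_def using fdeg_wedges1[of "map (%i. dform (bary n i)) l"] fdeg_dbary by auto
lemma fdeg_Wh: "fdeg (length l - 1) (Wh n l)"
proof (induction l)
 case (Cons i l)
 then show ?case using fdeg_wedge[OF fdeg_bary[of n i] fdeg_dtl[of l n]] fdeg_wedge[OF fdeg_dbary[of n i] Cons]
  by (cases l) (auto intro!: fdeg_diff fdeg_cscale)
qed simp

lemma dtl_Cons: "dtl n (i # l) = dform (bary n i) \<cdot> dtl n l" by (simp add: dtl_def)
lemma dtl_Nil [simp]: "dtl n [] = form_one" by (simp add: dtl_def)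

lemma dbary_bary_commute: "ffin al ==> dform (bary n i) \<cdot> (bary n j \<cdot> al) = bary n j \<cdot> (dform (bary n i) \<cdot> al)"
 by (rule wedge_left_commute0[symmetric, OF fdeg_bary]) auto

lemma iot_bary_wedge: assumes "j <= n" "be : Om (ix n)"
 shows "iot i (bary n j \<cdot> be) = bary n j \<cdot> iot i be"
 using iot_wedge[OF Om_bary[OF assms(1)] _ assms(2), of i] by (simp add: iot_fdeg0[OF fdeg_bary] tw_fdeg[OF fdeg_bary])

lemma iot_dbary_wedge: assumes "j <= n" "i <= n" "be : Om (ix n)"
 shows "iot i (dform (bary n j) \<cdot> be) = bary n j \<cdot> be - (if j = i then be else 0) - dform (bary n j) \<cdot> iot i be"
 using iot_wedge[OF Om_dform[OF Om_bary[OF assms(1)]] _ assms(3), of i]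
 by (simp add: bary_hw(3)[OF assms(2,1)] tw_fdeg[OF fdeg_dbary] wedge_alg)

definition ps :: "nat => nat list => nat" where "ps i l = length (takeWhile (%x. x ~= i) l)"

lemma iot_dtl:
 assumes "distinct l" "set l \<subseteq> {0..n}" "i <= n"
 shows "cscale (fact (length l - 1)) (iot i (dtl n l)) = (Wh n l :: 'k::field_char_0 form) -
  (if i : set l then cscale (fact (length l - 1) * (- 1) ^ ps i l) (dtl n (remove1 i l)) else 0)"
 using assms(1,2)
proof (induction l)
 case (Cons x l)
 then have x: "x <= n" "set l \<subseteq> {0..n}" "x \<notin> set l" "distinct l" by auto
 show ?case
 proof (cases "l = []")
  case True
  then show ?thesis using x assms
   by (auto simp: dtl_Cons iot_dbary_wedge ps_def bary_hw)
 next
  case False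
  then have f: "fact (length l) = (of_nat (length l) * fact (length l - 1) :: 'k)"
   by (simp add: fact_reduce)
  have IH: "cscale (fact (length l - 1)) (iot i (dtl n l)) = (Wh n l :: 'k form) -
   (if i : set l then cscale (fact (length l - 1) * (- 1) ^ ps i l) (dtl n (remove1 i l)) else 0)"
   using Cons x by blast
  have "cscale (fact (length l)) (iot i (dtl n (x # l)))
   = cscale (fact (length l)) (bary n x \<cdot> dtl n l) - cscale (fact (length l)) (if x = i then dtl n l else (0 :: 'k form))
    - cscale (of_nat (length l)) (dform (bary n x) \<cdot> cscale (fact (length l - 1)) (iot i (dtl n l)))"
   unfolding dtl_Cons iot_dbary_wedge[OF x(1) assms(3) Om_dtl[OF x(2)]]
   by (simp only: P.scale_right_diff_distrib klin_scale[OF klin_wedge_right] P.scale_scale f)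
  also have "... = Wh n (x # l) - cscale (fact (length l)) (if x = i then dtl n l else 0) +
   (if i : set l then cscale (fact (length l) * (- 1) ^ ps i l) (dform (bary n x) \<cdot> dtl n (remove1 i l)) else 0)"
   unfolding IH by (auto simp: wedge_alg P.scale_right_diff_distrib f mult.assoc)
  finally show ?thesis using x by (auto simp: ps_def dtl_Cons)
 qed
qed simp

lemma iot_Wh:
 assumes "distinct l" "set l \<subseteq> {0..n}" "i <= n"
 shows "iot i (Wh n l) = (if i : set l
  then cscale (of_nat (length l - 1) * (- 1) ^ ps i l) (Wh n (remove1 i l)) else (0 :: 'k::field_char_0 form))"
 using assms(1,2)
proof (induction l)
 case (Cons x l)
 then have x: "x <= n" "set l \<subseteq> {0..n}" "x \<notin> set l" "distinct l" by auto
 show ?case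
 proof (cases "l = []")
  case True
  then show ?thesis by (auto simp: iot_fdeg0[OF fdeg_bary])
 next
  case False
  then have f: "fact (length l) = (of_nat (length l) * fact (length l - 1) :: 'k)"
   by (simp add: fact_reduce)
  have IH: "iot i (Wh n l) = (if i : set l
   then cscale (of_nat (length l - 1) * (- 1) ^ ps i l) (Wh n (remove1 i l)) else (0 :: 'k form))"
   using Cons x by blast
  note D = iot_dtl[OF x(4,2) assms(3), where ?'k = 'k]
  have "iot i (Wh n (x # l) :: 'k form) = cscale (of_nat (length l)) (bary n x \<cdot> cscale (fact (length l - 1)) (iot i (dtl n l)))
   - cscale (of_nat (length l)) (bary n x \<cdot> Wh n l - (if x = i then Wh n l else 0) - dform (bary n x) \<cdot> iot i (Wh n l))"
   unfolding Wh.simps iota_rules iot_bary_wedge[OF x(1) Om_dtl[OF x(2)]] iot_dbary_wedge[OF x(1) assms(3) Om_Wh[OF x(2)]]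
   by (simp only: klin_scale[OF klin_wedge_right] P.scale_scale f)
  also have "... = cscale (of_nat (length l)) ((if x = i then Wh n l else 0) + dform (bary n x) \<cdot> iot i (Wh n l)
    - (if i : set l then bary n x \<cdot> cscale (fact (length l - 1) * (- 1) ^ ps i l) (dtl n (remove1 i l)) else 0))"
   unfolding D by (simp add: wedge_alg P.scale_right_diff_distrib P.scale_right_distrib)
  also have "... = (if i : set (x # l)
   then cscale (of_nat (length l) * (- 1) ^ ps i (x # l)) (Wh n (remove1 i (x # l))) else 0)"
  proof (cases "x = i")
   case True then show ?thesis using x IH by (simp add: ps_def)
  next
   case xi: False
   show ?thesis
   proof (cases "i : set l")
    case True
    have l: "length (remove1 i l) = length l - 1" using True by (simp add: length_remove1)
    show ?thesis unfolding IH using True xi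
     by (simp add: l ps_def wedge_alg P.scale_right_diff_distrib mult.assoc mult.commute mult.left_commute)
   next
    case False then show ?thesis using xi IH by simp
   qed
  qed
  finally show ?thesis by simp
 qed
qed simp

lemma hw_dtl:
 assumes "set l \<subseteq> {0..n}" "i <= n" shows "hw (ix n) i (length l) (dtl n l)"
 using assms(1)
proof (induction l)
 case (Cons x l)
 then show ?case using hw_wedge[OF _ bary_hw(2)[OF assms(2), of x] Cons(1)] by (simp add: dtl_Cons)
qed (simp add: hw.one)

lemma hw_Wh:
 assumes "set l \<subseteq> {0..n}" "i <= n" "i \<notin> set l" shows "hw (ix n) i (length l) (Wh n l)"
 using assms(1,3)
proof (induction l)
 case (Cons x l)
 then have "hw (ix n) i (Suc 0) (bary n x)" using bary_hw(1)[OF assms(2), of x] by auto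
 then show ?case using Cons hw_wedge[OF _ bary_hw(2)[OF assms(2), of x] Cons(1)]
   hw_wedge[OF _ _ hw_dtl[OF _ assms(2), of l], of "Suc 0" "bary n x"]
  by (auto intro!: hw_diff hw.scale)
qed (simp add: hw.zero)

lemma omega_Wh: "omega n I = Wh n (slist I)"
proof -
 have "(\<Sum>j<length l. cscale (fact (length l - 1) * (- 1) ^ j)
    (wedges (bary n (l ! j) # map (%i. dform (bary n i)) (take j l @ drop (Suc j) l)))) = (Wh n l :: 'a form)" for l
 proof (induction l)
  case (Cons x l)
  have t: "(cscale (fact (length l) * (- 1) ^ Suc j) (wedges (bary n (l ! j) # map (%i. dform (bary n i)) (x # take j l @ drop (Suc j) l))) :: 'a form)
   = - cscale (of_nat (length l)) (dform (bary n x) \<cdot> cscale (fact (length l - 1) * (- 1) ^ j)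
    (wedges (bary n (l ! j) # map (%i. dform (bary n i)) (take j l @ drop (Suc j) l))))" if "j < length l" for j
  proof -
   have "fact (length l) = (of_nat (length l) * fact (length l - 1) :: 'a)" using that
    by (cases "length l") (simp_all add: fact_reduce)
   then have key: "cscale (fact (length l) * (- 1) ^ Suc j) (bary n (l ! j) \<cdot> (dform (bary n x) \<cdot> W))
     = - cscale (of_nat (length l)) (dform (bary n x) \<cdot> cscale (fact (length l - 1) * (- 1) ^ j) (bary n (l ! j) \<cdot> W))"
    if "ffin W" for W :: "'a form" using that by (simp add: wedge_alg dbary_bary_commute mult.assoc)
   have "ffin (wedges (map (%i. dform (bary n i)) (take j l @ drop (Suc j) l)))"
    by (auto intro!: ffin_wedges)
   from key[OF this] show ?thesis by simp
  qed
  have "(\<Sum>j<length (x # l). cscale (fact (length (x # l) - 1) * (- 1) ^ j)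
    (wedges (bary n ((x # l) ! j) # map (%i. dform (bary n i)) (take j (x # l) @ drop (Suc j) (x # l)))) :: 'a form)
   = cscale (fact (length l)) (bary n x \<cdot> dtl n l) + (\<Sum>j<length l. - cscale (of_nat (length l)) (dform (bary n x) \<cdot>
     cscale (fact (length l - 1) * (- 1) ^ j) (wedges (bary n (l ! j) # map (%i. dform (bary n i)) (take j l @ drop (Suc j) l)))))"
   unfolding length_Cons sum.lessThan_Suc_shift
   by (intro arg_cong2[of _ _ _ _ "(+)"] sum.cong) (use t in \<open>auto simp: dtl_def\<close>)
  also have "... = Wh n (x # l)"
   unfolding sum_negf P.scale_sum_right[symmetric] wedge_sum[symmetric] Cons by simp
  finally show ?case .
 qed simp
 then show ?thesis by (simp only: omega_def Let_def)
qed

lemma ps_sorted: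
 assumes "finite I" "i : I" shows "ps i (slist I) = card {j : I. j < i}"
proof -
 have "takeWhile (%x. x ~= i) l = filter (%x. x < i) l" if "sorted l" "distinct l" "i : set l" for l
  using that by (induction l) (auto simp: order_less_le filter_empty_conv intro!: filter_False[symmetric])
 then have "ps i (slist I) = length (filter (%x. x < i) (slist I))"
  using assms by (simp add: ps_def)
 also have "... = card (set (filter (%x. x < i) (slist I)))"
  by (rule distinct_card[symmetric]) simp
 finally show ?thesis using assms by (simp add: Int_def conj_commute)
qed

lemma omega_empty [simp]: "omega n {} = 0" by (simp add: omega_Wh)

context
 fixes n :: nat and I :: "nat set"
 assumes I: "I \<subseteq> {0..n}"
begin

lemma finI: "finite I" using I finite_subset by blast

lemma Om_omega [simp]: "omega n I : Om (ix n)"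
 using I finI by (simp add: omega_Wh)
lemma fdeg_omega: "fdeg (card I - 1) (omega n I)"
 using fdeg_Wh[of "slist I" n] finI by (simp add: omega_Wh)

lemma iot_omega:
 assumes "i <= n"
 shows "iot i (omega n I) = (if i : I
  then cscale (of_nat (card I - 1) * (- 1) ^ card {j : I. j < i}) (omega n (I - {i})) else 0)"
 using I finI assms
 by (simp add: omega_Wh iot_Wh ps_sorted sorted_list_of_set_remove)

lemma hw_omega: "i <= n ==> i \<notin> I ==> hw (ix n) i (card I) (omega n I)"
 using hw_Wh[of "slist I" n i] I finI by (simp add: omega_Wh)

end

section \<open>Iterated vertex homotopies\<close>

lemma Om_fold_h [simp]: "al : Om N ==> finite N ==> 0 \<notin> N ==> fold h_vertex l al : Om N"
 by (induction l arbitrary: al) auto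

lemma fold_h_h:
 assumes "al : Om (ix n)"
 shows "fold h_vertex l (h_vertex i al) = cscale ((- 1) ^ length l) (h_vertex i (fold h_vertex l al))"
 using assms
proof (induction l arbitrary: al)
 case (Cons x l)
 have "fold h_vertex (x # l) (h_vertex i al) = - fold h_vertex l (h_vertex i (h_vertex x al))"
  using h_vertex_anticommute[OF Cons(2), of x i] by (simp add: fold_h_rules)
 then show ?case using Cons by simp
qed simp

lemma fold_h_fold:
 assumes "al : Om (ix n)"
 shows "fold h_vertex l (fold h_vertex l' al) = cscale ((- 1) ^ (length l * length l')) (fold h_vertex l' (fold h_vertex l al))"
 using assms
proof (induction l' arbitrary: al)
 case (Cons x l')
 then have "fold h_vertex l (fold h_vertex (x # l') al)
   = cscale ((- 1) ^ (length l * length l')) (fold h_vertex l' (fold h_vertex l (h_vertex x al)))" by simp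
 then show ?case using Cons(2) by (simp add: fold_h_h fold_h_rules power_add mult.commute)
qed simp

lemma fold_h_nondistinct:
 assumes "al : Om (ix n)" "\<not> distinct l" shows "fold h_vertex l al = 0"
proof -
 obtain xs ys zs i where l: "l = xs @ [i] @ ys @ [i] @ zs" using assms(2) not_distinct_decomp by blast
 show ?thesis using assms(1)
  by (simp add: l fold_h_h[where n = n] h_vertex_rules h_vertex_h_vertex[where N = "ix n"] fold_h_rules)
qed

lemma fold_h_insort:
 assumes "al : Om (ix n)" "sorted l" "distinct l" "i \<notin> set l"
 shows "fold h_vertex (insort i l) al = cscale ((- 1) ^ card {j : set l. i < j}) (h_vertex i (fold h_vertex l al))"
 using assms
proof (induction l arbitrary: al)
 case (Cons x l)
 show ?case
 proof (cases "i <= x")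
  case True
  then have "{j. (j = x \<or> j : set l) & i < j} = insert x (set l)" using Cons by auto
  moreover have "card (insert x (set l)) = Suc (length l)" using Cons by (simp add: distinct_card)
  ultimately show ?thesis using fold_h_h[OF Cons(2), of "x # l" i] True by simp
 next
  case False
  then have "{j. (j = x \<or> j : set l) & i < j} = {j : set l. i < j}" by auto
  then show ?thesis using False Cons by simp
 qed
qed simp

definition hK :: "nat set => 'k::field_char_0 form => 'k form" where
 "hK I al = fold h_vertex (slist I) al"

lemma Om_hK [simp]: "al : Om (ix n) ==> hK I al : Om (ix n)" by (simp add: hK_def)
lemma hK_empty [simp]: "hK {} al = al" by (simp add: hK_def)

lemma hK_insert:
 assumes "al : Om (ix n)" "finite L" "i \<notin> L"
 shows "hK (insert i L) al = cscale ((- 1) ^ card {j : L. i < j}) (h_vertex i (hK L al))"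
 using fold_h_insort[OF assms(1), of "slist L" i] assms by (simp add: hK_def)

lemma hK_h: assumes "al : Om (ix n)"
 shows "hK L (h_vertex i al) = cscale ((- 1) ^ card L) (h_vertex i (hK L al))"
 using fold_h_h[OF assms, of "slist L" i] by (simp add: hK_def)

lemma hK_hK: assumes "al : Om (ix n)"
 shows "hK K (hK L al) = cscale ((- 1) ^ (card K * card L)) (hK L (hK K al))"
 using fold_h_fold[OF assms, of "slist K" "slist L"] by (simp add: hK_def)

section \<open>The Dupont homotopy: side conditions\<close>

definition HX :: "nat => nat set => 'k::field_char_0 form => 'k form" where
 "HX n X al = (\<Sum>L\<in>Pow ({0..n} - X) - {{}}. cscale ((- 1) ^ (card L - 1)) (omega n L \<cdot> hK L al))"

lemma klin_dupont_h: "klin (dupont_h n)"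
 unfolding dupont_h_def[abs_def] by (intro klin_sumI klin_cscale klin_comp[OF klin_wedge_right klin_fold_h])
lemma Om_HX [simp]: "al : Om (ix n) ==> HX n X al : Om (ix n)"
 by (auto simp: HX_def intro!: Om_sum Om_cscale Om_wedge Om_omega)

lemma dupont_h_HX: assumes "al : Om (ix n)" shows "dupont_h n al = HX n {} al"
 unfolding dupont_h_def HX_def hK_def[symmetric]
proof (rule sum.mono_neutral_left)
 show "\<forall>I\<in>Pow ({0..n} - {}) - {{}} - {I. I \<subseteq> {0..n} & 1 <= card I & card I <= n}.
   cscale ((- 1) ^ (card I - 1)) (omega n I \<cdot> hK I al) = 0"
 proof
  fix I assume I: "I : Pow ({0..n} - {}) - {{}} - {I. I \<subseteq> {0..n} & 1 <= card I & card I <= n}"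
  then have f: "finite I" using finite_subset by blast
  then have "card I > n" using I by (auto simp: Suc_le_eq card_gt_0_iff)
  then have "hK I al = 0" using f fold_h_too_long[OF assms, of "slist I"] by (simp add: hK_def)
  then show "cscale ((- 1) ^ (card I - 1)) (omega n I \<cdot> hK I al) = 0" by simp
 qed
qed (auto simp: card_gt_0_iff)

lemma h_omega_pair:
 fixes be :: "'k::field_char_0 form"
 assumes L: "L \<subseteq> {0..n}" "L ~= {}" "i \<notin> L" "i <= n" and be: "be : Om (ix n)"
 shows "cscale ((- 1) ^ (card L - 1)) (h_vertex i (omega n L \<cdot> be))
  + cscale ((- 1) ^ (card L + card {j : L. i < j})) (h_vertex i (omega n (insert i L) \<cdot> h_vertex i be))
  = omega n L \<cdot> h_vertex i be"
 using be ix_simps(1)[of n]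
proof (induction be rule: weight_induct[where i = i])
 case (add al be)
 have "!!x y x' y' z z' :: 'k form. x + y = z ==> x' + y' = z' ==> x + x' + (y + y') = z + z'"
  by (metis (no_types, lifting) add.assoc add.left_commute)
 from this[OF add(3,4)] show ?case by (simp only: wedge_alg h_vertex_rules P.scale_right_distrib)
next
 case (hw w be)
 note N = ix_simps(1,2)[of n]
 define l where "l = card L"
 define r where "r = card {j : L. i < j}"
 define m where "m = card {j : insert i L. j < i}"
 have fL: "finite L" using L(1) finite_subset by blast
 have l: "l > 0" using L(2) fL by (simp add: l_def card_gt_0_iff)
 have be: "be : Om (ix n)" using hw_Om[OF hw] .
 have I: "insert i L \<subseteq> {0..n}" using L by auto
 have mr: "m + r = l"
 proof -
  have "card L = card ({j : insert i L. j < i} \<union> {j : L. i < j})"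
  proof (rule arg_cong[of _ _ card])
   show "L = {j : insert i L. j < i} \<union> {j : L. i < j}"
    using L(3) by auto (metis linorder_neqE_nat)
  qed
  also have "... = m + r" unfolding m_def r_def by (rule card_Un_disjoint) (use fL in auto)
  finally show ?thesis by (simp add: l_def)
 qed
 have hwL: "hw (ix n) i l (omega n L)" using hw_omega[OF L(1,4,3)] by (simp add: l_def)
 have iL: "iot i (omega n L) = (0 :: 'k form)" using iot_omega[OF L(1,4)] L(3) by simp
 have iI: "iot i (omega n (insert i L)) = cscale (of_nat l * (- 1) ^ m) (omega n L :: 'k form)"
  using iot_omega[OF I L(4)] L(3) fL by (simp add: l_def m_def)
 have 1: "h_vertex i (omega n L \<cdot> be) = cscale ((- 1) ^ (l - 1) / of_nat (l + w)) (omega n L \<cdot> iot i be)"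
  using h_hw[OF N hw_wedge[OF N(1) hwL hw]] iot_wedge[OF Om_omega[OF L(1)] N(1) be N(1), of i]
  by (simp add: iL tw_fdeg[OF fdeg_omega[OF L(1)]] wedge_alg l_def)
 have h: "h_vertex i be = cscale (1 / of_nat w) (iot i be)" by (rule h_hw[OF N hw])
 have 2: "iot i (omega n (insert i L) \<cdot> h_vertex i be) = cscale (of_nat l * (- 1) ^ m / of_nat w) (omega n L \<cdot> iot i be)"
  unfolding iot_wedge[OF Om_omega[OF I] N(1) Om_h_vertex[OF N be] N(1)] iot_h_vertex[OF N be] iI
  by (simp add: wedge_alg h)
 have 3: "h_vertex i (omega n (insert i L) \<cdot> h_vertex i be)
   = cscale (of_nat l * (- 1) ^ m / (of_nat w * of_nat (l + w))) (omega n L \<cdot> iot i be)"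
  using h_vertex_wop[OF Om_wedge[OF Om_omega[OF I] Om_h_vertex[OF N be]] N, of i i]
   wop_hw[OF hw_wedge[OF N(1) hwL hw_iot[OF N(1) hw]] N]
  by (simp add: 2 wop_rules)
 have s: "(- 1 :: 'k) ^ (l - 1) * (- 1) ^ (l - 1) = 1" "(- 1 :: 'k) ^ (l + r) * (- 1) ^ m = 1"
 proof -
  have "l - 1 + (l - 1) = 2 * (l - 1)" "l + r + m = 2 * l" using mr by auto
  then show "(- 1 :: 'k) ^ (l - 1) * (- 1) ^ (l - 1) = 1" "(- 1 :: 'k) ^ (l + r) * (- 1) ^ m = 1"
   by (simp_all only: power_add[symmetric] power_minus1_even)
 qed
 show ?case
 proof (cases "w = 0")
  case True
  then have "iot i be = 0" using hw_iot0[OF _ N] hw by blast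
  then show ?thesis using True by (simp add: 1 3 h h_vertex_rules)
 next
  case False
  have nz: "of_nat w ~= (0 :: 'k)" "of_nat (l + w) ~= (0 :: 'k)" using False by (simp_all del: of_nat_add)
  have "(- 1) ^ (l - 1) * ((- 1) ^ (l - 1) / of_nat (l + w)) +
    (- 1) ^ (l + r) * (of_nat l * (- 1) ^ m / (of_nat w * of_nat (l + w))) =
    ((- 1) ^ (l - 1) * (- 1) ^ (l - 1)) / of_nat (l + w) +
    ((- 1) ^ (l + r) * (- 1) ^ m) * of_nat l / (of_nat w * (of_nat (l + w) :: 'k))"
   by (simp add: mult_ac)
  also have "... = 1 / of_nat w"
  proof -
   have "1 / (a + b) + 1 * a / (b * (a + b)) = 1 / b" if "b ~= 0" "a + b ~= 0" for a b :: 'k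
   proof -
    have "1 / (a + b) + 1 * a / (b * (a + b)) = (b + a) / (b * (a + b))"
     using that by (simp add: add_divide_distrib)
    then show ?thesis using that by (simp add: add.commute)
   qed
   from this[OF nz[unfolded of_nat_add]] show ?thesis unfolding s of_nat_add .
  qed
  finally have E: "(- 1) ^ (l - 1) * ((- 1) ^ (l - 1) / of_nat (l + w)) +
    (- 1) ^ (l + r) * (of_nat l * (- 1) ^ m / (of_nat w * of_nat (l + w))) = 1 / (of_nat w :: 'k)" .
  show ?thesis unfolding l_def[symmetric] r_def[symmetric] 1 3
   unfolding h wedge_alg P.scale_scale P.scale_left_distrib[symmetric] E ..
 qed
qed (simp add: h_vertex_rules)

lemma h_HX:
 fixes al :: "'k::field_char_0 form"
 assumes al: "al : Om (ix n)" and i: "i <= n" "i \<notin> X"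
 shows "h_vertex i (HX n X al) = - HX n (insert i X) (h_vertex i al)"
proof -
 note N = ix_simps(1,2)[of n]
 let ?P = "Pow ({0..n} - insert i X)"
 let ?t = "%L. cscale ((- 1) ^ (card L - 1)) (omega n L \<cdot> hK L al)"
 have split: "Pow ({0..n} - X) - {{}} = (?P - {{}}) \<union> insert i ` ?P"
 proof -
  have "{0..n} - X = insert i ({0..n} - insert i X)" using i by auto
  then have "Pow ({0..n} - X) = ?P \<union> insert i ` ?P" using Pow_insert by metis
  then show ?thesis by auto
 qed
 have inj: "inj_on (insert i) ?P" by (auto simp: inj_on_def)
 have "HX n X al = (\<Sum>L\<in>?P - {{}}. ?t L) + (\<Sum>L\<in>insert i ` ?P. ?t L)"
  unfolding HX_def split by (rule sum.union_disjoint) auto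
 also have "(\<Sum>L\<in>insert i ` ?P. ?t L) = (\<Sum>L\<in>?P. ?t (insert i L))"
  by (simp add: sum.reindex[OF inj])
 also have "... = ?t {i} + (\<Sum>L\<in>?P - {{}}. ?t (insert i L))"
  by (subst sum.remove[of _ "{}"]) auto
 finally have "h_vertex i (HX n X al) = h_vertex i (?t {i}) + (\<Sum>L\<in>?P - {{}}. h_vertex i (?t L) + h_vertex i (?t (insert i L)))"
  by (simp add: h_vertex_rules klin_sum[OF klin_h_vertex] sum.distrib)
 also have "h_vertex i (?t {i}) = 0"
 proof -
  have I: "{i} \<subseteq> {0..n}" using i by auto
  have "iot i (omega n {i} \<cdot> h_vertex i al) = 0"
   using iot_wedge[OF Om_omega[OF I] N(1) Om_h_vertex[OF N al] N(1), of i] iot_h_vertex[OF N al, of i]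
    iot_omega[OF I i(1), where ?'a = 'k] by simp
  then have "h_vertex i (omega n {i} \<cdot> h_vertex i al) = 0"
   using h_vertex_wop[OF Om_wedge[OF Om_omega[OF I] Om_h_vertex[OF N al]] N, of i i] by (simp add: wop_rules)
  then show ?thesis by (simp add: hK_def h_vertex_rules)
 qed
 also have "(\<Sum>L\<in>?P - {{}}. h_vertex i (?t L) + h_vertex i (?t (insert i L)))
   = (\<Sum>L\<in>?P - {{}}. - cscale ((- 1) ^ (card L - 1)) (omega n L \<cdot> hK L (h_vertex i al)))"
 proof (intro sum.cong refl)
  fix L assume "L : ?P - {{}}"
  then have L: "L \<subseteq> {0..n}" "L ~= {}" "i \<notin> L" "finite L" using finite_subset by auto
  have "h_vertex i (?t L) + h_vertex i (?t (insert i L)) = omega n L \<cdot> h_vertex i (hK L al)"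
   using h_omega_pair[OF L(1,2,3) i(1) Om_hK[OF al, of L]] L
   by (simp add: hK_insert[OF al] h_vertex_rules wedge_alg power_add)
  also have "... = - cscale ((- 1) ^ (card L - 1)) (omega n L \<cdot> hK L (h_vertex i al))"
  proof -
   have "card L = Suc (card L - 1)" using L by (simp add: card_gt_0_iff)
   then have "(- 1 :: 'k) ^ card L = - ((- 1) ^ (card L - 1))" by (metis power_Suc mult_minus1)
   then show ?thesis by (simp add: hK_h[OF al] wedge_alg power_add[symmetric] mult_2[symmetric])
  qed
  finally show "h_vertex i (?t L) + h_vertex i (?t (insert i L)) = - cscale ((- 1) ^ (card L - 1)) (omega n L \<cdot> hK L (h_vertex i al))" .
 qed
 finally show ?thesis by (simp add: HX_def sum_negf)
qed

lemma fold_h_HX: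
 assumes "al : Om (ix n)" "set l \<subseteq> {0..n}" "distinct l" "set l \<inter> X = {}"
 shows "fold h_vertex l (HX n X al) = cscale ((- 1) ^ length l) (HX n (X \<union> set l) (fold h_vertex l al))"
 using assms
proof (induction l arbitrary: X al)
 case (Cons i l)
 have "fold h_vertex (i # l) (HX n X al) = - fold h_vertex l (HX n (insert i X) (h_vertex i al))"
  using h_HX[OF Cons(2), of i X] Cons by (simp add: fold_h_rules)
 also have "... = - cscale ((- 1) ^ length l) (HX n (insert i X \<union> set l) (fold h_vertex l (h_vertex i al)))"
  using Cons by (subst Cons(1)) auto
 finally show ?case by (simp add: Un_commute insert_commute)
qed simp

lemma omega_commute:
 assumes "K \<subseteq> {0..n}" "L \<subseteq> {0..n}" "ffin \<gamma>"
 shows "omega n K \<cdot> (omega n L \<cdot> \<gamma>) = cscale ((- 1) ^ ((card K - 1) * (card L - 1))) (omega n L \<cdot> (omega n K \<cdot> \<gamma>))"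
proof -
 have f: "ffin (omega n K :: 'a form)" "ffin (omega n L :: 'a form)"
  using fdeg_omega[OF assms(1)] fdeg_omega[OF assms(2)] fdeg_ffin by blast+
 show ?thesis
  using wedge_commute[OF fdeg_omega[OF assms(1)] fdeg_omega[OF assms(2)], where ?'a = 'a] f assms
  by (simp add: wedge_assoc[symmetric] wedge_alg)
qed

lemma sum_neg_self_zero: "(s :: 'b \<Rightarrow>\<^sub>0 'k::field_char_0) = - s ==> s = 0"
proof (rule poly_mapping_eqI)
 fix x assume "s = - s"
 then have "lk s x = - lk s x" by (metis lookup_uminus)
 then show "lk s x = lk 0 x" by (simp add: eq_neg_iff_add_eq_0)
qed

lemma odd_sign_swap:
 "k > 0 ==> l > 0 ==> (- 1) ^ k * ((- 1) ^ ((k - 1) * (l - 1)) * (- 1) ^ (k * l)) = - ((- 1) ^ l :: 'k::field_char_0)"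
 by (cases k; cases l) (auto simp: minus_one_power_iff)

text \<open>
  In the double sum over pairs of disjoint sets of vertices, the terms for \<open>(K, L)\<close>
  and \<open>(L, K)\<close> cancel.
\<close>

lemma dupont_h_dupont_h:
 assumes al: "al : Om (ix n)" shows "dupont_h n (dupont_h n (al :: 'k::field_char_0 form)) = 0"
proof -
 let ?S = "Pow {0..n} - {{}}"
 define Q where "Q = {(K, L). K : ?S & L : ?S & K \<inter> L = {}}"
 define T where "T = (%(K, L). cscale ((- 1) ^ card L) (omega n K \<cdot> (omega n L \<cdot> hK L (hK K al))) :: 'k form)"
 have fin: "finite Q" unfolding Q_def by (rule finite_subset[of _ "?S \<times> ?S"]) auto
 have "dupont_h n (dupont_h n al) = (\<Sum>K\<in>?S. cscale ((- 1) ^ (card K - 1)) (omega n K \<cdot> hK K (HX n {} al)))"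
  using al by (simp add: dupont_h_HX) (simp add: HX_def)
 also have "... = (\<Sum>K\<in>?S. \<Sum>L\<in>Pow ({0..n} - K) - {{}}. T (K, L))"
 proof (intro sum.cong refl)
  fix K assume K: "K : ?S"
  then have fK: "finite K" "card K > 0" using finite_subset by (auto simp: card_gt_0_iff)
  have 1: "hK K (HX n {} al) = cscale ((- 1) ^ card K) (HX n K (hK K al))"
   using fold_h_HX[OF al, of "slist K" "{}"] K fK by (auto simp: hK_def)
  have s: "(- 1 :: 'k) ^ (card K - 1) * (- 1) ^ card K = - 1" using fK
   by (cases "card K") (auto simp: power_add[symmetric] mult_2[symmetric])
  have s': "(- 1 :: 'k) ^ card L = - ((- 1) ^ (card L - 1))" if "L : Pow ({0..n} - K) - {{}}" for L
  proof -
   have "finite L" using that finite_subset by auto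
   then have "card L > 0" using that by (auto simp: card_gt_0_iff)
   then show ?thesis by (cases "card L") auto
  qed
  have "cscale ((- 1) ^ (card K - 1)) (omega n K \<cdot> hK K (HX n {} al)) = - (omega n K \<cdot> HX n K (hK K al))"
   unfolding 1 wedge_alg P.scale_scale s by simp
  also have "... = (\<Sum>L\<in>Pow ({0..n} - K) - {{}}. T (K, L))"
   unfolding HX_def T_def by (simp add: wedge_sum wedge_alg sum_negf[symmetric] s')
  finally show "cscale ((- 1) ^ (card K - 1)) (omega n K \<cdot> hK K (HX n {} al)) = (\<Sum>L\<in>Pow ({0..n} - K) - {{}}. T (K, L))" .
 qed
 also have "... = sum T Q"
  by (subst sum.Sigma) (auto simp: Q_def intro!: sum.cong)
 finally have e: "dupont_h n (dupont_h n al) = sum T Q" .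
 have "sum T Q = (\<Sum>x\<in>Q. - T x)"
 proof (rule sum.reindex_bij_witness[of _ prod.swap prod.swap])
  fix x assume "x : Q"
  then obtain K L where x: "x = (K, L)" and KL: "K \<subseteq> {0..n}" "L \<subseteq> {0..n}" "K ~= {}" "L ~= {}" by (auto simp: Q_def)
  then have f: "card K > 0" "card L > 0" using finite_subset by (auto simp: card_gt_0_iff)
  have ff: "ffin (hK K (hK L al))" using Om_ffin[OF Om_hK[OF Om_hK[OF al]]] by simp
  have "T (K, L) = cscale ((- 1) ^ card L * ((- 1) ^ ((card L - 1) * (card K - 1)) * (- 1) ^ (card L * card K)))
   (omega n L \<cdot> (omega n K \<cdot> hK K (hK L al)))"
   unfolding T_def prod.case hK_hK[OF al, of L K] wedge_alg P.scale_scale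
    omega_commute[OF KL(1,2) ff] by (simp add: mult_ac)
  then show "- T (prod.swap x) = T x" unfolding odd_sign_swap[OF f(2,1)] by (simp add: x T_def)
 qed (auto simp: Q_def)
 then show ?thesis unfolding e sum_negf by (rule sum_neg_self_zero)
qed

lemma h_vertex_omega:
 fixes n :: nat assumes "I \<subseteq> {0..n}" "i <= n"
 shows "h_vertex i (omega n I) = (if i : I then cscale ((- 1) ^ card {j : I. j < i}) (omega n (I - {i})) else (0 :: 'k::field_char_0 form))"
proof -
 note N = ix_simps(1,2)[of n]
 have e: "h_vertex i (omega n I) = wop i (%w. 1 / of_nat w) (iot i (omega n I :: 'k form))"
  by (rule h_vertex_wop[OF Om_omega[OF assms(1)] N])
 show ?thesis
 proof (cases "i : I")
  case False then show ?thesis unfolding e iot_omega[OF assms] by (simp add: wop_rules)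
 next
  case True
  have I': "I - {i} \<subseteq> {0..n}" "finite I" using assms finite_subset by auto
  show ?thesis
  proof (cases "card I - 1 = 0")
   case True
   then have "I - {i} = {}" using \<open>i : I\<close> I' by (metis card_Diff_singleton card_eq_0_iff finite_Diff)
   then show ?thesis unfolding e iot_omega[OF assms] True by (simp only:) (simp add: wop_rules)
  next
   case False
   have w: "wop i (%w. 1 / of_nat w) (omega n (I - {i})) = cscale (1 / of_nat (card I - 1)) (omega n (I - {i}) :: 'k form)"
    using wop_hw[OF hw_omega[OF I'(1) assms(2)] N, of "%w. 1 / of_nat w"] True I' by simp
   show ?thesis using True False unfolding e iot_omega[OF assms] by (simp add: wop_rules w)
  qed
 qed
qed

lemma hK_omega:
 assumes "I \<subseteq> {0..n}" "K \<subseteq> {0..n}"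
 shows "hK K (omega n I) = (if K \<subseteq> I then cscale ((- 1) ^ invs K (I - K)) (omega n (I - K)) else (0 :: 'k::field_char_0 form))"
proof -
 have "finite K" "finite I" using assms finite_subset by blast+
 then show ?thesis using assms(2)
 proof (induction K rule: finite_linorder_max_induct)
  case empty
  then show ?case by (simp add: invs_def)
 next
  case (insert i K)
  have "{j : K. i < j} = {}" using insert by auto
  then have c0: "card {j : K. i < j} = 0" by (simp only: card.empty)
  have iK: "i \<notin> K" using insert by auto
  have e: "hK (insert i K) (omega n I) = h_vertex i (hK K (omega n I :: 'k form))"
   unfolding hK_insert[OF Om_omega[OF assms(1)] insert(1) iK] c0 by simp
  show ?case
  proof (cases "K \<subseteq> I & i : I")
   case True
   have 1: "I - K = (I - insert i K) \<union> {i}" using True iK by auto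
   have "{(i', j). i' : K & j : {i} & j < i'} = {}" using insert.hyps by force
   then have 2: "invs K {i} = 0" by (simp only: invs_def card.empty)
   have fi: "finite (I - insert i K)" using insert.prems by auto
   have "invs K (I - K) = invs K (I - insert i K)"
    by (subst 1, subst invs_union_right) (use insert fi 2 in auto)
   moreover have "invs (insert i K) (I - insert i K) = invs {i} (I - insert i K) + invs K (I - insert i K)"
    using invs_union_left[of "{i}" K "I - insert i K"] insert iK fi by simp
   moreover have "invs {i} (I - insert i K) = card {j : I - K. j < i}"
   proof -
    have "{(i', j). i' : {i} & j : I - insert i K & j < i'} = Pair i ` {j : I - K. j < i}" by auto
    then show ?thesis by (simp add: invs_def card_image inj_on_def)
   qed
   moreover have "I - K - {i} = I - insert i K" by auto
   moreover have "I - K \<subseteq> {0..n}" "i <= n" using assms insert by auto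
   ultimately show ?thesis using True insert iK
    by (simp add: e h_vertex_rules h_vertex_omega power_add mult.commute)
  next
   case False
   have "h_vertex i (omega n (I - K)) = (0 :: 'k form)" if "i \<notin> I"
    using h_vertex_omega[of "I - K" n i] assms insert that by auto
   then show ?thesis using False insert by (auto simp: e h_vertex_rules)
  qed
 qed
qed

text \<open>
  The vertex operators turn \<open>\<omega>\<^sub>I\<close> into a multiple of
  \<open>\<omega>\<^sub>I\<^sub>-\<^sub>K\<close>; the products \<open>\<omega>\<^sub>K
  \<omega>\<^sub>I\<^sub>-\<^sub>K\<close> for \<open>K\<close> and its complement cancel.
\<close>

lemma dupont_h_omega:
 assumes I: "I \<subseteq> {0..n}" shows "dupont_h n (omega n I :: 'k::field_char_0 form) = 0"
proof -
 let ?P = "{K. K \<subseteq> I & K ~= {} & K ~= I}"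
 define T where "T = (%K. cscale ((- 1) ^ (card K - 1) * (- 1) ^ invs K (I - K)) (omega n K \<cdot> omega n (I - K)) :: 'k form)"
 have fI: "finite I" using I finite_subset by blast
 have "dupont_h n (omega n I) = (\<Sum>K\<in>Pow {0..n} - {{}}. cscale ((- 1) ^ (card K - 1)) (omega n K \<cdot> hK K (omega n I :: 'k form)))"
  by (simp add: dupont_h_HX[OF Om_omega[OF I]] HX_def)
 also have "... = sum T ?P"
 proof (rule sum.mono_neutral_cong_right)
  show "?P \<subseteq> Pow {0..n} - {{}}" using I by auto
  show "\<forall>K\<in>Pow {0..n} - {{}} - ?P. cscale ((- 1) ^ (card K - 1)) (omega n K \<cdot> hK K (omega n I :: 'k form)) = 0"
   using I by (auto simp: hK_omega)
  show "!!K. K : ?P ==> cscale ((- 1) ^ (card K - 1)) (omega n K \<cdot> hK K (omega n I)) = T K"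
   using I by (auto simp: hK_omega T_def wedge_alg subset_trans)
 qed auto
 finally have e: "dupont_h n (omega n I) = sum T ?P" .
 have "sum T ?P = (\<Sum>K\<in>?P. - T K)"
 proof (rule sum.reindex_bij_witness[of _ "%K. I - K" "%K. I - K"])
  fix K assume "K : ?P"
  then have K: "K \<subseteq> I" "K ~= {}" "K ~= I" "finite K" using fI finite_subset by auto
  then have IK: "I - (I - K) = K" "I - K ~= {}" by auto
  have k: "card K > 0" "card (I - K) > 0" using K fI IK by (auto simp: card_gt_0_iff)
  have sub: "K \<subseteq> {0..n}" "I - K \<subseteq> {0..n}" using K I by auto
  have "even (invs K (I - K) + invs (I - K) K) = even (card K * card (I - K))"
   using invs_swap[of K "I - K"] K fI by auto
  then have "(- 1) ^ (card (I - K) - 1) * (- 1) ^ invs (I - K) K * (- 1) ^ ((card (I - K) - 1) * (card K - 1))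
   = - ((- 1) ^ (card K - 1) * (- 1 :: 'k) ^ invs K (I - K))"
   using k by (cases "card K"; cases "card (I - K)") (auto simp: minus_one_power_iff)
  then show "- T (I - K) = T K"
   using wedge_commute[OF fdeg_omega[OF sub(2)] fdeg_omega[OF sub(1)], where ?'a = 'k]
   by (simp add: T_def IK mult.assoc[symmetric])
 qed auto
 then show ?thesis unfolding e sum_negf by (rule sum_neg_self_zero)
qed

section \<open>Simpliciality of forms\<close>

definition fsub :: "nat => (nat => nat) => nat => 'k::field_char_0 form" where
 "fsub m ph i = (\<Sum>j | j <= m & ph j = i. bary m j)"

lemma form_map_pullback: "form_map m ph = pullback (fsub m ph)"
 by (simp add: form_map_def fsub_def[abs_def])

lemma fdeg_fsub: "fdeg 0 (fsub m ph i)"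
 by (auto simp: fsub_def intro!: fdeg_sum fdeg_bary)
lemma Om_fsub [simp]: "fsub m ph i : Om (ix m)"
 by (auto simp: fsub_def intro!: Om_sum Om_bary)

lemma klin_form_map: "klin (form_map m ph)" by (simp add: form_map_pullback klin_pullback)
lemmas form_map_rules = klin_add[OF klin_form_map] klin_scale[OF klin_form_map] klin_0[OF klin_form_map]
 klin_uminus[OF klin_form_map] klin_diff[OF klin_form_map] klin_sum[OF klin_form_map]

lemma Om_form_map [simp]: "al : Om (ix n) ==> form_map m ph al : Om (ix m)"
 unfolding form_map_pullback by (rule Om_pullback[OF fdeg_fsub, where N = "ix n"]) auto

lemma form_map_wedge: "al : Om (ix n) ==> be : Om (ix n) ==> form_map m ph (al \<cdot> be) = form_map m ph al \<cdot> form_map m ph be"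
 unfolding form_map_pullback by (rule pullback_wedge[OF fdeg_fsub, where N = "ix n"]) (auto intro: Om_ffin[where N = "ix n"])

lemma form_map_dform: "al : Om (ix n) ==> form_map m ph (dform al) = dform (form_map m ph al)"
 unfolding form_map_pullback by (rule dform_pullback[OF fdeg_fsub, where N = "ix n" and M = "ix m", symmetric]) auto

lemma form_map_fdeg: "fdeg p al ==> fdeg p (form_map m ph al)"
 unfolding form_map_pullback by (rule fdeg_pullback[OF fdeg_fsub])

lemma form_map_one [simp]: "form_map m ph form_one = form_one" by (simp add: form_map_pullback)

lemma sum_bary: "(\<Sum>j\<in>{0..m}. bary m j) = (form_one :: 'k::field_char_0 form)"
proof -
 have "(\<Sum>j\<in>{0..m}. bary m j) = bary m 0 + (\<Sum>j\<in>{1..m}. bary m j :: 'k form)"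
  by (simp add: sum.atLeast_Suc_atMost)
 also have "(\<Sum>j\<in>{1..m}. bary m j) = (\<Sum>j\<in>{1..m}. var j :: 'k form)"
  by (rule sum.cong) (auto simp: bary_def)
 finally show ?thesis by (simp add: bary_def)
qed

lemma form_map_bary:
 assumes "ph : {0..m} \<rightarrow> {0..n}" "i <= n" shows "form_map m ph (bary n i) = fsub m ph i"
proof (cases "i = 0")
 case True
 have "(\<Sum>i\<in>{0..n}. fsub m ph i) = (\<Sum>j\<in>{0..m}. bary m j :: 'a form)"
  unfolding fsub_def using sum.group[of "{0..m}" "{0..n}" ph "bary m :: nat => 'a form"] assms
  by (simp add: Pi_iff image_subset_iff)
 then have "fsub m ph 0 + (\<Sum>i\<in>{1..n}. fsub m ph i) = (form_one :: 'a form)"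
  unfolding sum_bary by (simp add: sum.atLeast_Suc_atMost)
 then have "fsub m ph 0 = form_one - (\<Sum>i\<in>{1..n}. fsub m ph i :: 'a form)" by (simp add: algebra_simps)
 then show ?thesis using True
  by (simp add: form_map_pullback bary_def pullback_rules pullback_sum pullback_var[OF fdeg_fsub])
next
 case False then show ?thesis by (simp add: form_map_pullback bary_def pullback_var[OF fdeg_fsub])
qed

lemma form_map_comp:
 assumes "ph : {0..m} \<rightarrow> {0..n}" "pz : {0..l} \<rightarrow> {0..m}" "al : Om (ix n)"
 shows "form_map l pz (form_map m ph al) = form_map l (ph \<circ> pz) (al :: 'k::field_char_0 form)"
proof -
 have "form_map l pz (form_map m ph al) = pullback (%i. pullback (fsub l pz) (fsub m ph i)) al"
  unfolding form_map_pullback by (rule pullback_pullback[OF assms(3), where M = "ix m" and L = "ix l"]) (auto intro: fdeg_fsub)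
 also have "(%i. pullback (fsub l pz) (fsub m ph i)) = (fsub l (ph \<circ> pz) :: nat => 'k form)"
 proof
  fix i
  have "pullback (fsub l pz) (fsub m ph i) = (\<Sum>j | j <= m & ph j = i. fsub l pz j :: 'k form)"
   unfolding fsub_def[of m] pullback_sum
   by (intro sum.cong refl) (use form_map_bary[OF assms(2), unfolded form_map_pullback] in auto)
  also have "... = (\<Sum>j | j <= m & ph j = i. \<Sum>k | k : {k. k <= l & ph (pz k) = i} & pz k = j. bary l k)"
   by (intro sum.cong refl) (auto simp: fsub_def intro!: sum.cong)
  also have "... = (\<Sum>k\<in>{k. k <= l & ph (pz k) = i}. bary l k)"
   by (rule sum.group) (use assms(2) in auto)
  finally show "pullback (fsub l pz) (fsub m ph i) = (fsub l (ph \<circ> pz) i :: 'k form)" by (simp add: fsub_def)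
 qed
 finally show ?thesis by (simp add: form_map_pullback)
qed

lemma form_map_cong:
 assumes "!!j. j <= m ==> ph j = pz j" shows "form_map m ph = form_map m pz"
proof -
 have "{j. j <= m & ph j = i} = {j. j <= m & pz j = i}" for i using assms by auto
 then show ?thesis by (simp add: form_map_def)
qed

lemma form_map_h_vertex:
 assumes "ph : {0..m} \<rightarrow> {0..n}" "j <= m" "al : Om (ix n)"
 shows "form_map m ph (h_vertex (ph j) al) = h_vertex j (form_map m ph (al :: 'k::field_char_0 form))"
proof -
 define b where "b k l = (if k = 0 then - 1 else if l = k then 1 else (0 :: 'k))" for k l :: nat
 have b: "bary m k = (if k = j then form_one else 0) + (\<Sum>l\<in>ix m. cscale (b k l) (xc j l))" if "k <= m" for k
 proof (cases "k = 0")
  case True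
  have "(\<Sum>l\<in>ix m. if l = j then form_one else (0 :: 'k form)) = (if j = 0 then 0 else form_one)"
   using assms by (auto simp: sum.delta in_ix)
  then show ?thesis using True assms
   by (auto simp: b_def bary_def xc_def sum_negf sum_subtractf ix_def[symmetric] in_ix simp del: One_nat_def)
 next
  case False
  then show ?thesis using assms that
   by (auto simp: b_def bary_def xc_def in_ix if_distrib[of "%c. cscale c _"] sum.delta' cong: if_cong)
 qed
 show ?thesis unfolding form_map_pullback
 proof (rule pullback_h_vertex[where a = "%k l. \<Sum>q | q <= m & ph q = k. b q l" and N = "ix n" and M = "ix m", OF fdeg_fsub])
  fix k assume "k : ix n"
  have "fsub m ph k = (\<Sum>q | q <= m & ph q = k. (if q = j then form_one else 0) + (\<Sum>l\<in>ix m. cscale (b q l) (xc j l)))"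
   unfolding fsub_def by (intro sum.cong refl b) auto
  also have "... = (if k = ph j then form_one else 0) + (\<Sum>l\<in>ix m. \<Sum>q | q <= m & ph q = k. cscale (b q l) (xc j l))"
   unfolding sum.distrib using assms(2) by (subst sum.swap[of _ "ix m"]) (auto simp: sum.delta)
  finally show "pullback (fsub m ph) (xc (ph j) k) = (\<Sum>l\<in>ix m. cscale (\<Sum>q | q <= m & ph q = k. b q l) (xc j l))"
   by (simp add: xc_def[of "ph j"] pullback_rules pullback_var[OF fdeg_fsub] P.scale_sum_left)
 qed (use assms in auto)
qed

lemma form_map_fold_h:
 assumes "ph : {0..m} \<rightarrow> {0..n}" "set l \<subseteq> {0..m}" "al : Om (ix n)"
 shows "form_map m ph (fold h_vertex (map ph l) al) = fold h_vertex l (form_map m ph (al :: 'k::field_char_0 form))"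
 using assms(2,3)
proof (induction l arbitrary: al)
 case (Cons j l)
 then show ?case using form_map_h_vertex[OF assms(1), of j al] by simp
qed simp

definition lifts :: "nat => (nat => nat) => nat list => nat list set" where
 "lifts m ph l = {l'. set l' \<subseteq> {0..m} & map ph l' = l}"

lemma lifts_Cons: "lifts m ph (i # l) = (%(j, l'). j # l') ` ({j. j <= m & ph j = i} \<times> lifts m ph l)"
 by (auto simp: lifts_def image_iff Cons_eq_map_conv map_eq_Cons_conv)

lemma lifts_Nil [simp]: "lifts m ph [] = {[]}" by (auto simp: lifts_def)

lemma sum_lifts_Cons: "(\<Sum>l'\<in>lifts m ph (i # l). F l') = (\<Sum>j | j <= m & ph j = i. \<Sum>l'\<in>lifts m ph l. F (j # l'))"
 unfolding lifts_Cons by (subst sum.reindex) (auto simp: inj_on_def sum.cartesian_product intro!: sum.cong)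

lemma form_map_dtl_Wh:
 assumes "ph : {0..m} \<rightarrow> {0..n}" "set l \<subseteq> {0..n}"
 shows "form_map m ph (dtl n l) = (\<Sum>l'\<in>lifts m ph l. dtl m l' :: 'k::field_char_0 form) \<and>
  form_map m ph (Wh n l) = (\<Sum>l'\<in>lifts m ph l. Wh m l' :: 'k::field_char_0 form)"
 using assms(2)
proof (induction l)
 case (Cons i l)
 then have i: "i <= n" "set l \<subseteq> {0..n}" by auto
 have b: "form_map m ph (bary n i) = (\<Sum>j | j <= m & ph j = i. bary m j :: 'k form)"
  using form_map_bary[OF assms(1) i(1)] by (simp add: fsub_def)
 have db: "form_map m ph (dform (bary n i)) = (\<Sum>j | j <= m & ph j = i. dform (bary m j) :: 'k form)"
  unfolding form_map_dform[OF Om_bary[OF i(1)]] b by (simp add: klin_sum[OF klin_dform])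
 have len: "length l' = length l" if "l' : lifts m ph l" for l' using that by (auto simp: lifts_def)
 have 1: "form_map m ph (dtl n (i # l)) = (\<Sum>l'\<in>lifts m ph (i # l). dtl m l' :: 'k form)"
  unfolding dtl_Cons form_map_wedge[OF Om_dform[OF Om_bary[OF i(1)] ix_simps(1)] Om_dtl[OF i(2)]] db
   Cons.IH[OF i(2), THEN conjunct1] sum_lifts_Cons
  by (simp add: wedge_sum) (rule sum.swap)
 have 2: "form_map m ph (Wh n (i # l)) = (\<Sum>l'\<in>lifts m ph (i # l). Wh m l' :: 'k form)"
  unfolding Wh.simps form_map_rules form_map_wedge[OF Om_bary[OF i(1)] Om_dtl[OF i(2)]]
   form_map_wedge[OF Om_dform[OF Om_bary[OF i(1)] ix_simps(1)] Om_Wh[OF i(2)]] b db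
   Cons.IH[OF i(2), THEN conjunct1] Cons.IH[OF i(2), THEN conjunct2] sum_lifts_Cons
  by (simp add: wedge_sum len P.scale_sum_right sum_subtractf)
   (subst (1 2) sum.swap[of _ "lifts m ph l"], rule refl)
 show ?case using 1 2 by blast
qed (simp add: form_map_rules)

text \<open>
  The faces that the vertex map sends bijectively onto \<open>I\<close>.
\<close>

definition fib :: "nat => (nat => nat) => nat set => nat set set" where
 "fib m ph I = {J. J \<subseteq> {0..m} & inj_on ph J & ph ` J = I}"

lemma strict_sorted_eq: "sorted_wrt (<) (l :: nat list) ==> set l = A ==> slist A = l"
 by (metis sorted_list_of_set.idem_if_sorted_distinct strict_sorted_iff)

lemma fib_map_sorted:
 fixes ph :: "nat => nat"
 assumes "mono_on {0..m} ph" "J \<subseteq> {0..m}" "inj_on ph J"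
 shows "map ph (slist J) = slist (ph ` J)"
proof -
 have f: "finite J" using assms(2) by (rule finite_subset) simp
 have "sorted_wrt (%x y. ph x < ph y) (slist J)"
 proof (rule sorted_wrt_mono_rel[of _ "(<)"])
  fix x y assume "x : set (slist J)" "y : set (slist J)" "x < y"
  then have xy: "x : J" "y : J" "x < y" using f by auto
  then have "ph x <= ph y" using assms(2) by (intro mono_onD[OF assms(1)]) auto
  moreover have "ph x ~= ph y" using xy assms(3) by (auto dest: inj_onD)
  ultimately show "ph x < ph y" by simp
 qed simp
 then have "sorted_wrt (<) (map ph (slist J))" by (simp add: sorted_wrt_map)
 then show ?thesis using f by (intro strict_sorted_eq[symmetric]) auto
qed

lemma fib_card: "J : fib m ph I ==> card J = card I"
 by (auto simp: fib_def card_image)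
lemma finite_fib [simp]: "finite (fib m ph I)"
 by (rule finite_subset[of _ "Pow {0..m}"]) (auto simp: fib_def)

text \<open>
  Substituting the sums of barycentric coordinates into a Whitney form and expanding by
  multilinearity, the terms with two vertices over the same vertex vanish.
\<close>

lemma form_map_omega:
 assumes "simplex_map m n ph" "I \<subseteq> {0..n}"
 shows "form_map m ph (omega n I) = (\<Sum>J\<in>fib m ph I. omega m J :: 'k::field_char_0 form)"
proof -
 have ph: "ph : {0..m} \<rightarrow> {0..n}" "mono_on {0..m} ph" using assms by (auto simp: simplex_map_def)
 have fI: "finite I" using assms finite_subset by blast
 have "form_map m ph (omega n I) = (\<Sum>l'\<in>lifts m ph (slist I). Wh m l' :: 'k form)"
  unfolding omega_Wh using form_map_dtl_Wh[OF ph(1), of "slist I", where ?'k = 'k] assms(2) fI by simp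
 also have "... = (\<Sum>J\<in>fib m ph I. omega m J)"
 proof (rule sum.reindex_bij_witness[of _ slist set])
  fix l' assume l': "l' : lifts m ph (slist I)"
  then have m: "map ph l' = slist I" "set l' \<subseteq> {0..m}" by (auto simp: lifts_def)
  have "sorted_wrt (<) (map ph l')" unfolding m(1) by simp
  then have "sorted_wrt (%x y. ph x < ph y) l'" by (simp add: sorted_wrt_map)
  then have "sorted_wrt (<) l'"
  proof (rule sorted_wrt_mono_rel[rotated])
   fix x y assume "x : set l'" "y : set l'" "ph x < ph y"
   then show "x < y" using m(2) mono_onD[OF ph(2), of y x] by (metis leD leI subsetD)
  qed
  then show s: "slist (set l') = l'" by (rule strict_sorted_eq) simp
  have "distinct (map ph l')" unfolding m(1) by simp
  then have "inj_on ph (set l')" by (simp add: distinct_map)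
  moreover have "ph ` set l' = I" using m(1) fI by (metis list.set_map set_sorted_list_of_set)
  ultimately show "set l' : fib m ph I" using m by (simp add: fib_def)
  show "omega m (set l') = Wh m l'" by (simp add: omega_Wh s)
 next
  fix J assume J: "J : fib m ph I"
  then have fJ: "finite J" "J \<subseteq> {0..m}" using finite_subset by (auto simp: fib_def)
  then show "set (slist J) = J" by simp
  show "slist J : lifts m ph (slist I)"
   using fib_map_sorted[OF ph(2), of J] J fJ by (auto simp: lifts_def fib_def)
 qed
 finally show ?thesis .
qed

lemma form_map_dupont_h:
 assumes "simplex_map m n ph" "al : Om (ix n)"
 shows "form_map m ph (dupont_h n al) = dupont_h m (form_map m ph (al :: 'k::field_char_0 form))"
proof -
 have ph: "ph : {0..m} \<rightarrow> {0..n}" "mono_on {0..m} ph" using assms by (auto simp: simplex_map_def)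
 let ?t = "%J. cscale ((- 1) ^ (card J - 1)) (omega m J \<cdot> hK J (form_map m ph al))"
 let ?S = "Pow {0..n} - {{}}"
 have "form_map m ph (dupont_h n al) = (\<Sum>I\<in>?S. \<Sum>J\<in>fib m ph I. ?t J)"
  unfolding dupont_h_HX[OF assms(2)] HX_def form_map_rules Diff_empty
 proof (intro sum.cong refl)
  fix I assume I: "I : ?S"
  have "form_map m ph (hK I al) = hK J (form_map m ph al)" if J: "J : fib m ph I" for J
  proof -
   have fJ: "finite J" "J \<subseteq> {0..m}" "inj_on ph J" "ph ` J = I" using finite_subset J by (auto simp: fib_def)
   show ?thesis unfolding hK_def fJ(4)[symmetric] fib_map_sorted[OF ph(2) fJ(2,3), symmetric]
    by (rule form_map_fold_h[OF ph(1) _ assms(2)]) (use fJ in auto)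
  qed
  then show "cscale ((- 1) ^ (card I - 1)) (form_map m ph (omega n I \<cdot> hK I al)) = (\<Sum>J\<in>fib m ph I. ?t J)"
   using I assms by (simp add: form_map_wedge[where n = n] form_map_omega wedge_sum P.scale_sum_right fib_card)
 qed
 also have "... = (\<Sum>J\<in>(\<Union>I\<in>?S. fib m ph I). ?t J)"
  by (rule sum.UNION_disjoint[symmetric]) (auto simp: fib_def)
 also have "... = (\<Sum>J\<in>Pow ({0..m} - {}) - {{}}. ?t J)"
 proof (rule sum.mono_neutral_left)
  show "(\<Union>I\<in>?S. fib m ph I) \<subseteq> Pow ({0..m} - {}) - {{}}" by (auto simp: fib_def)
  show "\<forall>J\<in>Pow ({0..m} - {}) - {{}} - (\<Union>I\<in>?S. fib m ph I). ?t J = 0"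
  proof
   fix J assume J: "J : Pow ({0..m} - {}) - {{}} - (\<Union>I\<in>?S. fib m ph I)"
   then have fJ: "finite J" using finite_subset by auto
   have "ph ` J : ?S" using J ph(1) by auto
   then have "\<not> inj_on ph J" using J by (auto simp: fib_def)
   then have "\<not> distinct (map ph (slist J))" using fJ by (simp add: distinct_map)
   then have "form_map m ph (fold h_vertex (map ph (slist J)) al) = 0"
    using fold_h_nondistinct[OF assms(2)] by (simp add: form_map_rules)
   then have "hK J (form_map m ph al) = 0"
    using form_map_fold_h[OF ph(1) _ assms(2), of "slist J"] J fJ by (simp add: hK_def)
   then show "?t J = 0" by simp
  qed
 qed auto
 also have "... = dupont_h m (form_map m ph al)"
  using assms(2) by (simp add: dupont_h_HX HX_def)
 finally show ?thesis .
qed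

section \<open>Integration over the faces\<close>

definition siw :: "nat => fmono => 'k::field_char_0" where
 "siw k x = (if snd x = {1..k} then (\<Prod>i=1..k. fact (lk (fst x) i)) / fact ((\<Sum>i=1..k. lk (fst x) i) + k) else 0)"

lemma si_superset:
 assumes "finite S" "ks al \<subseteq> S"
 shows "simplex_integral k al = (\<Sum>x\<in>S. lk al x * siw k x)"
 unfolding simplex_integral_def
 by (rule sum.mono_neutral_cong_left) (use assms in \<open>auto simp: siw_def in_keys_iff\<close>)

lemma si_add: "simplex_integral k (al + be) = simplex_integral k al + simplex_integral k be"
 using si_superset[of "ks al \<union> ks be" "al + be" k] si_superset[of "ks al \<union> ks be" al k]
  si_superset[of "ks al \<union> ks be" be k] Poly_Mapping.keys_add[of al be]
 by (simp add: lookup_add sum.distrib distrib_right)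

lemma si_scale: "simplex_integral k (cscale c al) = c * simplex_integral k al"
 using si_superset[of "ks al" "cscale c al" k] si_superset[of "ks al" al k] keys_cscale_subset[of c al]
 by (simp add: sum_distrib_left mult.assoc)

lemma si_0 [simp]: "simplex_integral k 0 = 0" by (simp add: simplex_integral_def)
lemma si_sum: "simplex_integral k (sum f A) = (\<Sum>x\<in>A. simplex_integral k (f x))"
 by (induction A rule: infinite_finite_induct) (auto simp: si_add)

lemma si_fdeg: assumes "fdeg p al" "p ~= k" shows "simplex_integral k al = 0"
proof -
 have "siw k x = (0::'a)" if "x : ks al" for x using that assms by (auto simp: siw_def fdeg_def)
 then show ?thesis by (subst si_superset[of "ks al"]) auto
qed

lemma si_klin_0:
 assumes "klin F" "!!x. x : ks al ==> simplex_integral k (F (sng x 1)) = 0"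
 shows "simplex_integral k (F al) = 0"
 unfolding klin_expand[OF assms(1), of al] by (simp add: si_sum si_scale assms(2) del: cscale_single)

lemma mono_fdeg: fixes al :: "'k::field_char_0 form" assumes "al : Om (ix n)" "x : ks al"
 shows "fdeg (card (snd x)) (sng x (1::'k))" "card (snd x) <= n" "sng x (1::'k) : Om (ix n)"
proof -
 have "snd x \<subseteq> ix n" using assms by (auto simp: Om_def)
 then show "fdeg (card (snd x)) (sng x (1::'k))" "card (snd x) <= n"
  using card_mono[of "ix n" "snd x"] finite_subset[of "snd x" "ix n"] by (auto simp: fdeg_def)
 show "sng x (1::'k) : Om (ix n)" using assms by (auto simp: Om_def)
qed

lemma klin_dupont_p: "klin (dupont_p n)"
proof (rule klinI)
 show "dupont_p n (a + b) = dupont_p n a + dupont_p n b" for a b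
  by (simp add: dupont_p_def form_map_rules si_add single_add sum.distrib)
 show "dupont_p n (cscale c a) = cscale c (dupont_p n a)" for c a
  by (simp add: dupont_p_def form_map_rules si_scale P.scale_sum_right)
qed
lemma finite_faces [simp]: "finite (faces n)"
 by (rule finite_subset[of _ "Pow {0..n}"]) (auto simp: faces_def)

lemma facesD: assumes "I : faces n" shows "I \<subseteq> {0..n}" "finite I" "card I > 0" "I ~= {}"
proof -
 show "I \<subseteq> {0..n}" "I ~= {}" using assms by (auto simp: faces_def)
 then show "finite I" by (auto intro: finite_subset)
 then show "card I > 0" using \<open>I ~= {}\<close> by (simp add: card_gt_0_iff)
qed

lemma lk_dupont_p: "lk (dupont_p n al) J = (if J : faces n
  then simplex_integral (card J - 1) (form_map (card J - 1) (%j. slist J ! j) al) else 0)"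
 by (simp add: dupont_p_def lookup_sum lookup_single when_def sum.delta)

lemma face_map:
 assumes "J : faces m"
 shows "simplex_map (card J - 1) m (%j. slist J ! j)"
  "(%j. slist J ! j) ` {0..card J - 1} = J"
  "inj_on (%j. slist J ! j) {0..card J - 1}"
proof -
 note J = facesD[OF assms]
 have l: "{0..card J - 1} = {..<length (slist J)}" using J by auto
 show im: "(%j. slist J ! j) ` {0..card J - 1} = J"
  unfolding l using J by (auto simp: image_iff in_set_conv_nth[symmetric] Bex_def)
   (metis in_set_conv_nth set_sorted_list_of_set length_sorted_list_of_set)+
 show "inj_on (%j. slist J ! j) {0..card J - 1}"
  unfolding l by (rule inj_onI) (simp add: nth_eq_iff_index_eq)
 have "mono_on {0..card J - 1} (%j. slist J ! j)"
  by (rule mono_onI) (use J in \<open>auto intro!: sorted_nth_mono\<close>)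
 moreover have "(%j. slist J ! j) : {0..card J - 1} \<rightarrow> {0..m}"
  using im J(1) by blast
 ultimately show "simplex_map (card J - 1) m (%j. slist J ! j)"
  by (simp add: simplex_map_def)
qed

lemma simplex_mapD: "simplex_map m n ph ==> ph : {0..m} \<rightarrow> {0..n}" "simplex_map m n ph ==> mono_on {0..m} ph"
 by (auto simp: simplex_map_def)

lemma si_noninj:
 assumes "\<chi> : {0..k} \<rightarrow> {0..n}" "\<not> inj_on \<chi> {0..k}" "al : Om (ix n)"
 shows "simplex_integral k (form_map k \<chi> (al :: 'k::field_char_0 form)) = 0"
proof -
 define S where "S = \<chi> ` {0..k}"
 define r where "r = card S - 1"
 have SF: "S : faces n" using assms(1) by (auto simp: S_def faces_def)
 have "card S < card {0..k}" using assms(2) card_image_le[of "{0..k}" \<chi>] eq_card_imp_inj_on[of "{0..k}" \<chi>]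
  unfolding S_def by (metis finite_atLeastAtMost le_neq_implies_less)
 then have rk: "r < k" using facesD[OF SF] by (simp add: r_def)
 note fm = face_map[OF SF, folded r_def]
 define si where "si j = (SOME i. i <= r & slist S ! i = \<chi> j)" for j
 have si: "si j <= r & slist S ! (si j) = \<chi> j" if "j <= k" for j
 proof -
  have "\<chi> j : (%i. slist S ! i) ` {0..r}" unfolding fm(2) using that by (auto simp: S_def)
  then have "\<exists>i. i <= r & slist S ! i = \<chi> j" by auto
  then show ?thesis unfolding si_def by (rule someI_ex)
 qed
 define be where "be = form_map r (%i. slist S ! i) al"
 have be: "be : Om (ix r)" using assms(3) by (simp add: be_def)
 have "form_map k \<chi> al = form_map k ((%i. slist S ! i) \<circ> si) al"
  by (rule fun_cong[OF form_map_cong]) (use si in auto)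
 also have "... = form_map k si be" unfolding be_def
  by (rule form_map_comp[OF simplex_mapD(1)[OF fm(1)] _ assms(3), symmetric]) (use si in auto)
 also have "simplex_integral k ... = 0"
 proof (rule si_klin_0[OF klin_form_map])
  fix x assume "x : ks be"
  then show "simplex_integral k (form_map k si (sng x (1::'k))) = 0"
   using mono_fdeg[OF be, of x] rk by (intro si_fdeg[OF form_map_fdeg]) auto
 qed
 finally show ?thesis .
qed

lemma dupont_p_form_map:
 assumes "simplex_map m n ph" "al : Om (ix n)" "J : faces m"
 shows "lk (dupont_p m (form_map m ph al)) J
  = (if inj_on ph J then lk (dupont_p n al) (ph ` J) else (0 :: 'k::field_char_0))"
proof -
 note ph = simplex_mapD[OF assms(1)]
 note J = facesD[OF assms(3)]
 note fm = face_map[OF assms(3)]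
 let ?k = "card J - 1"
 let ?s = "%j. slist J ! j"
 have e: "lk (dupont_p m (form_map m ph al)) J = simplex_integral ?k (form_map ?k (ph \<circ> ?s) al)"
  using assms(3) form_map_comp[OF ph(1) simplex_mapD(1)[OF fm(1)] assms(2)] by (simp add: lk_dupont_p)
 show ?thesis
 proof (cases "inj_on ph J")
  case True
  have "form_map ?k (ph \<circ> ?s) = (form_map ?k (%j. slist (ph ` J) ! j) :: 'k form => 'k form)"
  proof (rule form_map_cong)
   fix j assume "j <= ?k"
   then have "j < length (slist J)" using J by simp
   then show "(ph \<circ> ?s) j = slist (ph ` J) ! j"
    using fib_map_sorted[OF ph(2) J(1) True] by (metis comp_apply nth_map)
  qed
  moreover have "ph ` J : faces n" using ph(1) J by (auto simp: faces_def)
  moreover have "card (ph ` J) = card J" using True by (rule card_image)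
  ultimately show ?thesis unfolding e using True by (simp add: lk_dupont_p)
 next
  case False
  have "\<not> inj_on (ph \<circ> ?s) {0..?k}" using False fm(2) inj_on_imageI[of ph ?s "{0..?k}"] by auto
  moreover have "ph \<circ> ?s : {0..?k} \<rightarrow> {0..n}" using ph(1) simplex_mapD(1)[OF fm(1)] by auto
  ultimately show ?thesis unfolding e using False si_noninj[OF _ _ assms(2)] by simp
 qed
qed

lemma dvar_Wh:
 assumes "set l \<subseteq> {1..k}" "distinct l" "j : set l"
 shows "dvar j \<cdot> Wh k l = cscale (fact (length l - 1)) (var j \<cdot> (dtl k l :: 'k::field_char_0 form))"
proof -
 have l: "set l \<subseteq> {0..k}" "0 \<notin> set l" "j <= k" "j ~= 0" using assms by auto
 have bj: "bary k j = (var j :: 'k form)" using l by (simp add: bary_def)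
 have "dvar j \<cdot> dtl k l = (0 :: 'k form)"
  using assms(3) l(1)
 proof (induction l)
  case (Cons x l)
  show ?case
  proof (cases "x = j")
   case True then show ?thesis using bj l by (simp add: dtl_Cons dvar_square)
  next
   case False
   have "dvar j \<cdot> (dform (bary k x) \<cdot> dtl k l) = - (dform (bary k x) \<cdot> (dvar j \<cdot> dtl k l :: 'k form))"
    by (rule wedge_left_anticommute1[OF fdeg_dvar fdeg_dbary]) simp
   then show ?thesis using False Cons by (simp add: dtl_Cons)
  qed
 qed simp
 moreover have "dvar j = dform (bary k j :: 'k form)" by (simp add: bj)
 ultimately have "iot 0 (dform (bary k j) \<cdot> dtl k l) = (0 :: 'k form)" by simp
 moreover have "iot 0 (dform (bary k j) \<cdot> dtl k l) = var j \<cdot> dtl k l - dvar j \<cdot> iot 0 (dtl k l :: 'k form)"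
  unfolding iot_dbary_wedge[OF l(3) le0 Om_dtl[OF l(1)]] using l(4) bj by simp
 ultimately have "dvar j \<cdot> iot 0 (dtl k l) = var j \<cdot> (dtl k l :: 'k form)" by simp
 moreover have "Wh k l = cscale (fact (length l - 1)) (iot 0 (dtl k l) :: 'k form)"
  using iot_dtl[OF assms(2) l(1), of 0, where ?'k = 'k] l(2) by simp
 ultimately show ?thesis by (simp add: wedge_alg)
qed

lemma wedges_dvar: "wedges (map dvar [1..<Suc k]) = sng (0, {1..k}) (1 :: 'k::field_char_0)"
proof -
 have "wedges (map dvar [m..<Suc k]) = sng (0, {m..k}) (1 :: 'k)" if "m <= Suc k" for m
  using that
 proof (induction "Suc k - m" arbitrary: m)
  case 0
  then show ?case by (simp add: form_one_def)
 next
  case (Suc d)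
  then have m: "m <= k" by simp
  have "{j. Suc m <= j & j <= k & j < m} = {}" by auto
  then have c: "card {j. Suc m <= j & j <= k & j < m} = 0" by (simp only: card.empty)
  have "insert m {Suc m..k} = {m..k}" using m by auto
  moreover have "[m..<Suc k] = m # [Suc m..<Suc k]" using m by (simp add: upt_rec)
  moreover have "wedges (map dvar [Suc m..<Suc k]) = sng (0, {Suc m..k}) (1 :: 'k)" using Suc by simp
  ultimately show ?case using dvar_wedge_single[of "{Suc m..k}" m 0 "1 :: 'k"] by (simp add: c del: upt_Suc)
 qed
 from this[of 1] show ?thesis by simp
qed

lemma omega_top: "omega k {0..k} = sng (0, {1..k}) (fact k :: 'k::field_char_0)"
proof -
 define l where "l = [1..<Suc k]"
 have len: "length l = k" by (simp add: l_def)
 have s: "slist {0..k} = 0 # l"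
 proof -
  have "{0..k} = {0..<Suc k}" by auto
  then have "slist {0..k} = [0..<Suc k]" by (simp only: sorted_list_of_set_range)
  then show ?thesis unfolding l_def by (simp add: upt_conv_Cons del: upt_Suc)
 qed
 have sl: "set l = {1..k}" by (auto simp: l_def)
 have d: "dtl k l = sng (0, {1..k}) (1 :: 'k)"
 proof -
  have "map (%i. dform (bary k i :: 'k form)) l = map dvar l" by (auto simp: l_def bary_def)
  then show ?thesis unfolding dtl_def by (simp only: l_def wedges_dvar)
 qed
 have b: "bary k 0 = form_one - (\<Sum>j\<in>{1..k}. var j :: 'k form)" by (simp add: bary_def)
 have db: "dform (bary k 0) = - (\<Sum>j\<in>{1..k}. dvar j :: 'k form)"
  unfolding b by (simp add: dform_rules klin_sum[OF klin_dform])
 have "omega k {0..k} = cscale (fact k) (bary k 0 \<cdot> dtl k l) + cscale (of_nat k) (\<Sum>j\<in>{1..k}. dvar j \<cdot> (Wh k l :: 'k form))"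
  unfolding omega_Wh s Wh.simps len db by (simp add: wedge_alg wedge_sum)
 also have "(\<Sum>j\<in>{1..k}. dvar j \<cdot> (Wh k l :: 'k form)) = cscale (fact (k - 1)) (\<Sum>j\<in>{1..k}. var j \<cdot> dtl k l)"
  unfolding P.scale_sum_right
 proof (rule sum.cong[OF refl])
  fix j assume "j : {1..k}"
  then show "dvar j \<cdot> Wh k l = cscale (fact (k - 1)) (var j \<cdot> (dtl k l :: 'k form))"
   using dvar_Wh[of l k j, where ?'k = 'k] by (simp only: sl len) (simp add: l_def)
 qed
 also have "cscale (of_nat k) ... = cscale (fact k) (\<Sum>j\<in>{1..k}. var j \<cdot> (dtl k l :: 'k form))"
  by (cases k) (simp_all del: of_nat_Suc)
 also have "cscale (fact k) (bary k 0 \<cdot> dtl k l) + ... = cscale (fact k) (dtl k l)"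
  unfolding b by (simp add: P.scale_right_distrib[symmetric] wedge_alg wedge_sum)
 finally show ?thesis by (simp add: d)
qed

lemma si_omega_top: "simplex_integral k (omega k {0..k}) = (1 :: 'k::field_char_0)"
 by (subst si_superset[of "{(0, {1..k})}"]) (simp_all add: omega_top siw_def)

lemma dupont_p_omega:
 assumes "I : faces n" shows "dupont_p n (omega n I) = sng I (1 :: 'k::field_char_0)"
proof (rule poly_mapping_eqI)
 fix J
 show "lk (dupont_p n (omega n I)) J = lk (sng I (1::'k)) J"
 proof (cases "J : faces n")
  case True
  note fm = face_map[OF True]
  note I = facesD[OF assms]
  let ?k = "card J - 1"
  let ?s = "%j. slist J ! j"
  have e: "lk (dupont_p n (omega n I)) J = (\<Sum>J'\<in>fib ?k ?s I. simplex_integral ?k (omega ?k J' :: 'k form))"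
   unfolding lk_dupont_p form_map_omega[OF fm(1) I(1)] si_sum using True by simp
  have kJ: "Suc ?k = card J" using facesD[OF True] by simp
  show ?thesis
  proof (cases "I = J")
   case IJ: True
   have "fib ?k ?s I = {{0..?k}}"
   proof -
    have "J' = {0..?k}" if "J' : fib ?k ?s I" for J'
     using that fib_card[OF that] IJ kJ card_subset_eq[of "{0..?k}" J'] by (auto simp: fib_def)
    moreover have "{0..?k} : fib ?k ?s I" using fm IJ by (simp add: fib_def)
    ultimately show ?thesis by blast
   qed
   then show ?thesis unfolding e by (simp add: si_omega_top IJ)
  next
   case False
   have "simplex_integral ?k (omega ?k J' :: 'k form) = 0" if J': "J' : fib ?k ?s I" for J'
   proof (rule si_fdeg)
    show "fdeg (card J' - 1) (omega ?k J' :: 'k form)" using J' by (intro fdeg_omega) (auto simp: fib_def)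
    show "card J' - 1 ~= ?k"
    proof
     assume "card J' - 1 = ?k"
     then have "card J' = Suc ?k" using fib_card[OF J'] I(3) by simp
     then have "J' = {0..?k}" using J' card_subset_eq[of "{0..?k}" J'] by (auto simp: fib_def)
     then show False using J' fm(2) False by (auto simp: fib_def)
    qed
   qed
   then show ?thesis unfolding e using False by (simp add: lookup_single)
  qed
 next
  case False
  then show ?thesis using assms by (auto simp: lk_dupont_p lookup_single when_def)
 qed
qed

lemma C_map_lookup:
 assumes "simplex_map m n ph" "I : faces n"
 shows "lk (C_map m n ph I) J = (if J : faces m & inj_on ph J & ph ` J = I then 1 else (0 :: 'k::field_char_0))"
proof (cases "J : faces m")
 case True
 have "lk (C_map m n ph I) J = (if inj_on ph J then lk (sng I (1::'k)) (ph ` J) else 0)"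
  unfolding C_map_def dupont_p_form_map[OF assms(1) Om_omega[OF facesD(1)[OF assms(2)]] True]
   dupont_p_omega[OF assms(2)] ..
 then show ?thesis using True by (auto simp: lookup_single when_def)
qed (simp add: C_map_def lk_dupont_p)

lemma fdeg_fold_h: "fdeg p al ==> length l <= p ==> fdeg (p - length l) (fold h_vertex l al)"
proof (induction l arbitrary: p al)
 case (Cons i l)
 then obtain q where "p = Suc q" by (cases p) auto
 then show ?case using Cons fdeg_h_vertex[of q al i] by simp
qed simp

lemma fdeg_dupont_h:
 assumes "fdeg p al" shows "fdeg (p - 1) (dupont_h n al)" "p = 0 ==> dupont_h n al = 0"
proof -
 have t: "fdeg (p - 1) (cscale ((- 1) ^ (card I - 1)) (omega n I \<cdot> fold h_vertex (slist I) al))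
   & (p = 0 --> fold h_vertex (slist I) al = 0)"
  if "I \<subseteq> {0..n}" "1 <= card I" for I
 proof (cases "card I <= p")
  case True
  then have "fdeg (card I - 1 + (p - length (slist I))) (omega n I \<cdot> fold h_vertex (slist I) al)"
   using fdeg_wedge[OF fdeg_omega[OF that(1)] fdeg_fold_h[OF assms, of "slist I"]] by simp
  moreover have "card I - 1 + (p - length (slist I)) = p - 1" using True that by simp
  ultimately show ?thesis using True that by (auto intro: fdeg_cscale)
 next
  case False
  then show ?thesis using fold_h_vertex_fdeg[OF assms, of "slist I"] that by simp
 qed
 show "fdeg (p - 1) (dupont_h n al)"
  unfolding dupont_h_def by (rule fdeg_sum) (use t in blast)
 show "p = 0 ==> dupont_h n al = 0" unfolding dupont_h_def using t by (intro sum.neutral) auto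
qed

text \<open>
  By naturality with respect to faces it suffices to look at the top face, where \<open>h\<close>
  only yields forms of too low a degree.
\<close>

lemma dupont_p_dupont_h:
 assumes "al : Om (ix n)" shows "dupont_p n (dupont_h n al) = (0 :: nat set \<Rightarrow>\<^sub>0 'k::field_char_0)"
proof (rule poly_mapping_eqI)
 fix J
 show "lk (dupont_p n (dupont_h n al)) J = lk (0 :: nat set \<Rightarrow>\<^sub>0 'k) J"
 proof (cases "J : faces n")
  case True
  let ?k = "card J - 1"
  define be where "be = form_map ?k (%j. slist J ! j) al"
  have be: "be : Om (ix ?k)" using assms by (simp add: be_def)
  have "lk (dupont_p n (dupont_h n al)) J = simplex_integral ?k (dupont_h ?k be)"
   unfolding lk_dupont_p form_map_dupont_h[OF face_map(1)[OF True] assms] be_def using True by simp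
  also have "... = 0"
  proof (rule si_klin_0[OF klin_dupont_h])
   fix x assume x: "x : ks be"
   note m = mono_fdeg[OF be x]
   show "simplex_integral ?k (dupont_h ?k (sng x (1::'k))) = 0"
   proof (cases "card (snd x) = 0")
    case True then show ?thesis using fdeg_dupont_h(2)[OF m(1)] by simp
   next
    case False then show ?thesis using m(2) by (intro si_fdeg[OF fdeg_dupont_h(1)[OF m(1)]]) auto
   qed
  qed
  finally show ?thesis by simp
 qed (simp add: lk_dupont_p)
qed

section \<open>Degrees of the structure maps on basis elements\<close>

lemma form_basis_Om: "form_basis n = {x. ks (fst x) \<subseteq> ix n & snd x \<subseteq> ix n}"
 by (auto simp: form_basis_def ix_def)

lemma Om_keys: "al : Om (ix n) \<longleftrightarrow> ks al \<subseteq> form_basis n"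
 by (auto simp: Om_def form_basis_Om)

lemma single_form_basis: assumes "x : form_basis n"
 shows "sng x (1::'k::field_char_0) : Om (ix n)" "fdeg (card (snd x)) (sng x (1::'k))"
 using assms finite_subset[of "snd x" "ix n"] by (auto simp: Om_keys fdeg_def form_basis_Om)

lemma dupont_p_degree:
 assumes "x : form_basis n" "lk (dupont_p n (sng x (1::'k::field_char_0))) J ~= 0"
 shows "J : faces n" "cdeg J = mdeg x"
proof -
 show J: "J : faces n" using assms(2) by (auto simp: lk_dupont_p split: if_splits)
 have "card (snd x) = card J - 1"
 proof (rule ccontr)
  assume "card (snd x) ~= card J - 1"
  then have "lk (dupont_p n (sng x (1::'k))) J = 0"
   using si_fdeg[OF form_map_fdeg[OF single_form_basis(2)[OF assms(1), where ?'k = 'k]]] by (simp add: lk_dupont_p)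
  then show False using assms(2) by simp
 qed
 then show "cdeg J = mdeg x" using facesD[OF J] by (simp add: cdeg_def mdeg_def)
qed

lemma dupont_h_degree:
 assumes "x : form_basis n" "lk (dupont_h n (sng x (1::'k::field_char_0))) y ~= 0"
 shows "y : form_basis n" "mdeg y = mdeg x - 1"
proof -
 note s = single_form_basis[OF assms(1), where ?'k = 'k]
 have y: "y : ks (dupont_h n (sng x (1::'k)))" using assms(2) by (simp add: in_keys_iff)
 have "dupont_h n (sng x (1::'k)) : Om (ix n)" using s by (simp add: dupont_h_HX)
 then show "y : form_basis n" using y by (auto simp: Om_keys)
 have "card (snd x) ~= 0" using fdeg_dupont_h(2)[OF s(2)] assms(2) by (metis lookup_zero)
 moreover have "card (snd y) = card (snd x) - 1"
  using fdeg_dupont_h(1)[OF s(2)] y by (auto simp: fdeg_def)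
 ultimately show "mdeg y = mdeg x - 1" by (simp add: mdeg_def)
qed

lemma omega_degree:
 assumes "I : faces n" "lk (omega n I) y ~= (0::'k::field_char_0)"
 shows "y : form_basis n" "mdeg y = cdeg I"
proof -
 note I = facesD[OF assms(1)]
 have y: "y : ks (omega n I :: 'k form)" using assms(2) by (simp add: in_keys_iff)
 have "(omega n I :: 'k form) : Om (ix n)" using I by simp
 then show "y : form_basis n" using y by (auto simp: Om_keys)
 show "mdeg y = cdeg I" using fdeg_omega[OF I(1), where ?'a = 'k] y I(3) by (auto simp: fdeg_def mdeg_def cdeg_def)
qed

lemma form_map_degree:
 assumes "x : form_basis n" "lk (form_map m ph (sng x (1::'k::field_char_0))) y ~= 0"
 shows "y : form_basis m" "mdeg y = mdeg x"
proof -
 note s = single_form_basis[OF assms(1), where ?'k = 'k]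
 have y: "y : ks (form_map m ph (sng x (1::'k)))" using assms(2) by (simp add: in_keys_iff)
 show "y : form_basis m" using y Om_form_map[OF s(1), of m ph] by (auto simp: Om_keys)
 show "mdeg y = mdeg x" using form_map_fdeg[OF s(2), of m ph] y by (auto simp: fdeg_def mdeg_def)
qed

lemma C_d_degree:
 assumes "I : faces n" "lk (C_d n I) J ~= (0::'k::field_char_0)"
 shows "J : faces n" "cdeg J = cdeg I + 1"
proof -
 note I = facesD[OF assms(1)]
 show J: "J : faces n" using assms(2) by (auto simp: C_d_def lk_dupont_p split: if_splits)
 have "Suc (card I - 1) = card J - 1"
 proof (rule ccontr)
  assume "Suc (card I - 1) ~= card J - 1"
  then have "lk (C_d n I) J = (0::'k)"
   using si_fdeg[OF form_map_fdeg[OF fdeg_dform[OF fdeg_omega[OF I(1), where ?'a = 'k]]]] by (simp add: C_d_def lk_dupont_p)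
  then show False using assms(2) by simp
 qed
 then show "cdeg J = cdeg I + 1" using facesD[OF J] I by (simp add: cdeg_def)
qed

lemma wedge_mono_degree:
 assumes "x : form_basis n" "y : form_basis n" "lk (wedge_mono x y) z ~= (0::'k::field_char_0)"
 shows "z : form_basis n" "mdeg z = mdeg x + mdeg y"
proof -
 have z: "z : ks (sng x (1::'k) \<cdot> sng y 1)" using assms(3) by (simp add: in_keys_iff)
 show "z : form_basis n" using z Om_wedge[OF single_form_basis(1)[OF assms(1), where ?'k = 'k] single_form_basis(1)[OF assms(2), where ?'k = 'k]]
  unfolding Om_keys by blast
 show "mdeg z = mdeg x + mdeg y"
  using z fdeg_wedge[OF single_form_basis(2)[OF assms(1), where ?'k = 'k] single_form_basis(2)[OF assms(2), where ?'k = 'k]]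
  by (auto simp: fdeg_def mdeg_def simp del: wedge_single)
qed

section \<open>Signs\<close>

lemma sg_cong: "even a = even b ==> sg a = sg b" by (simp add: sg_def)
lemma sg_add: "sg (a + b) = sg a * (sg b :: 'k::comm_ring_1)" by (auto simp: sg_def)
lemma sg_0 [simp]: "sg 0 = 1" by (simp add: sg_def)
lemma sg_minus [simp]: "sg (- a) = sg a" by (simp add: sg_def)
lemma sg_sq [simp]: "sg a * sg a = (1 :: 'k::comm_ring_1)" by (simp add: sg_def)
lemma sg_sq_left [simp]: "sg a * (sg a * b) = (b :: 'k::comm_ring_1)" by (simp add: sg_def)

section \<open>Words and the free Lie algebra\<close>

definition words :: "nat => nat => nat set list set" where
 "words n k = {w. set w \<subseteq> faces n & length w = k}"

lemma finite_words [simp]: "finite (words n k)"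
 unfolding words_def using finite_lists_length_eq[OF finite_faces] by simp

lemma wdeg_append [simp]: "wdeg (u @ v) = wdeg u + wdeg v" by (simp add: wdeg_def)
lemma wdeg_Cons [simp]: "wdeg (I # v) = xdeg I + wdeg v" by (simp add: wdeg_def)
lemma wdeg_Nil [simp]: "wdeg [] = 0" by (simp add: wdeg_def)

lemma words_append: "u : words n k ==> v : words n l ==> u @ v : words n (k + l)"
 by (auto simp: words_def)

lemma sum_words_append:
 "(\<Sum>w\<in>words n (k + l). f (take k w) (drop k w)) = (\<Sum>u\<in>words n k. \<Sum>v\<in>words n l. f u v)"
 unfolding sum.cartesian_product
 by (rule sum.reindex_bij_witness[of _ "%(u, v). u @ v" "%w. (take k w, drop k w)"])
  (auto simp: words_def dest: in_set_takeD in_set_dropD)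

lemma sum_fun_app: "sum f A w = (\<Sum>i\<in>A. f i w)"
 by (induction A rule: infinite_finite_induct) auto

definition comp :: "nat => 'k::field_char_0 tseries => 'k tseries" where
 "comp k s = (%w. if length w = k then s w else 0)"

lemma mc_gr_comp: "mc_gr n d = {s. s [] = 0 & (\<forall>k\<ge>1. lie_part n k d (comp k s))}"
 by (simp add: mc_gr_def comp_def)

lemma tbrk_zero [simp]: "tbrk 0 t = 0" "tbrk s 0 = 0" by (auto simp: tbrk_def fun_eq_iff)
lemma tscl_zero [simp]: "tscl c 0 = 0" by (auto simp: tscl_def fun_eq_iff)

lemma lie_part_Nil: "lie_part n k d s ==> s [] = 0"
 by (induction rule: lie_part.induct) (auto simp: xi_def tscl_def tbrk_def)

lemma lie_part_support: "lie_part n k d s ==> s w ~= 0 ==> w : words n k & wdeg w = d"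
proof (induction arbitrary: w rule: lie_part.induct)
 case (brk k d s l e t)
 then have "(\<Sum>i\<le>length w. s (take i w) * t (drop i w)
   - sg (wdeg (take i w) * wdeg (drop i w)) * t (take i w) * s (drop i w)) ~= 0" by (simp add: tbrk_def)
 then obtain i where i: "s (take i w) * t (drop i w)
   - sg (wdeg (take i w) * wdeg (drop i w)) * t (take i w) * s (drop i w) ~= 0"
  by (metis (no_types, lifting) sum.neutral)
 then have "(s (take i w) ~= 0 & t (drop i w) ~= 0) \<or> (t (take i w) ~= 0 & s (drop i w) ~= 0)" by auto
 then show ?case
 proof
  assume "s (take i w) ~= 0 & t (drop i w) ~= 0"
  then have "take i w : words n k & wdeg (take i w) = d" "drop i w : words n l & wdeg (drop i w) = e"
   using brk.IH by auto
  then show ?thesis using words_append[of "take i w" n k "drop i w" l] wdeg_append[of "take i w" "drop i w"] by simp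
 next
  assume "t (take i w) ~= 0 & s (drop i w) ~= 0"
  then have "take i w : words n l & wdeg (take i w) = e" "drop i w : words n k & wdeg (drop i w) = d"
   using brk.IH by auto
  then show ?thesis using words_append[of "take i w" n l "drop i w" k] wdeg_append[of "take i w" "drop i w"]
   by (simp add: add.commute)
 qed
next
 case (add k d s t)
 then have "s w ~= 0 \<or> t w ~= 0" by (auto simp: plus_fun_def)
 then show ?case using add by blast
qed (auto simp: xi_def words_def tscl_def split: if_splits)

lemma lie_part_0: "lie_part n 0 d s ==> s = 0"
 using lie_part_support[of n 0 d s] lie_part_Nil[of n 0 d s] by (fastforce simp: words_def fun_eq_iff)

lemma lie_part_sum: "(!!i. i : A ==> lie_part n k d (f i)) ==> lie_part n k d (sum f A)"
 by (induction A rule: infinite_finite_induct) (auto intro: lie_part.intros)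

lemma lie_part_comp: assumes "lie_part n k d s" shows "comp j s = (if j = k then s else 0)"
 using lie_part_support[OF assms] by (fastforce simp: comp_def words_def fun_eq_iff)

lemma lie_part_mc_gr: "lie_part n k d s ==> s : mc_gr n d"
 using lie_part_Nil lie_part_comp by (fastforce simp: mc_gr_comp intro: lie_part.zero)

lemma mc_gr_support: assumes "s : mc_gr n d" "s w ~= 0" shows "set w \<subseteq> faces n" "wdeg w = d" "w ~= []"
proof -
 show w: "w ~= []" using assms by (auto simp: mc_gr_def)
 then have "length w \<ge> 1" by (cases w) auto
 then have "lie_part n (length w) d (comp (length w) s)" using assms by (simp add: mc_gr_comp)
 from lie_part_support[OF this, of w] assms(2) show "set w \<subseteq> faces n" "wdeg w = d"
  by (auto simp: comp_def words_def)
qed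

lemma comp_add: "comp k (s + t) = comp k s + comp k t" by (auto simp: comp_def fun_eq_iff)
lemma comp_tscl: "comp k (tscl c s) = tscl c (comp k s)" by (auto simp: comp_def tscl_def fun_eq_iff)
lemma comp_0 [simp]: "comp k 0 = 0" by (auto simp: comp_def fun_eq_iff)

lemma mc_gr_0 [simp]: "0 : mc_gr n d" by (simp add: mc_gr_comp lie_part.zero)
lemma mc_gr_add: "s : mc_gr n d ==> t : mc_gr n d ==> s + t : mc_gr n d"
 by (simp add: mc_gr_comp comp_add lie_part.add)
lemma mc_gr_tscl: "s : mc_gr n d ==> tscl c s : mc_gr n d"
 by (simp add: mc_gr_comp comp_tscl lie_part.scl) (simp add: tscl_def)
lemma mc_gr_sum: "(!!i. i : A ==> f i : mc_gr n d) ==> sum f A : mc_gr n d"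
 by (induction A rule: infinite_finite_induct) (auto intro: mc_gr_add)
lemma mc_gr_xi: "I : faces n ==> xi I : mc_gr n (xdeg I)"
 using lie_part_mc_gr[OF lie_part.gen] by blast

lemma tbrk_homog:
 assumes s: "!!w. s w ~= 0 ==> length w = k & wdeg w = d" and t: "!!w. t w ~= 0 ==> length w = l & wdeg w = e"
  and w: "length w = k + l"
 shows "tbrk s t w = s (take k w) * t (drop k w) - sg (d * e) * t (take l w) * s (drop l w)"
proof -
 have 1: "s (take i w) * t (drop i w) = (if i = k then s (take k w) * t (drop k w) else 0)" if "i <= length w" for i
 proof (cases "s (take i w) = 0")
  case False
  then have "i = k" using s[of "take i w"] that by simp
  then show ?thesis by simp
 next
  case True
  then show ?thesis by (cases "i = k") simp_all
 qed
 have 2: "sg (wdeg (take i w) * wdeg (drop i w)) * t (take i w) * s (drop i w)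
   = (if i = l then sg (d * e) * t (take l w) * s (drop l w) else 0)" if "i <= length w" for i
 proof (cases "t (take i w) * s (drop i w) = 0")
  case True
  then show ?thesis by (cases "i = l") auto
 next
  case False
  then have "i = l" using t[of "take i w"] that by simp
  moreover have "wdeg (take i w) = e" "wdeg (drop i w) = d"
   using False s[of "drop i w"] t[of "take i w"] by simp_all
  ultimately show ?thesis by (simp add: mult.commute)
 qed
 have "(\<Sum>i\<le>length w. s (take i w) * t (drop i w)) = s (take k w) * t (drop k w)"
  by (subst sum.cong[OF refl 1]) (use w in auto)
 moreover have "(\<Sum>i\<le>length w. sg (wdeg (take i w) * wdeg (drop i w)) * t (take i w) * s (drop i w))
   = sg (d * e) * t (take l w) * s (drop l w)"
  by (subst sum.cong[OF refl 2]) (use w in auto)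
 ultimately show ?thesis unfolding tbrk_def sum_subtractf by simp
qed

lemma comp_tbrk:
 assumes "s [] = 0" "t [] = 0"
 shows "comp m (tbrk s t) = (\<Sum>i\<in>{1..<m}. tbrk (comp i s) (comp (m - i) t))"
proof
 fix w
 let ?A = "%i. s (take i w) * t (drop i w)"
 let ?B = "%i. sg (wdeg (take i w) * wdeg (drop i w)) * t (take i w) * s (drop i w)"
 show "comp m (tbrk s t) w = (\<Sum>i\<in>{1..<m}. tbrk (comp i s) (comp (m - i) t)) w"
 proof (cases "length w = m")
  case False
  have "tbrk (comp i s) (comp (m - i) t) w = 0" if "i : {1..<m}" for i
   unfolding tbrk_def using that False by (intro sum.neutral ballI) (auto simp: comp_def min_def)
  then show ?thesis using False by (simp add: comp_def sum_fun_app)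
 next
  case True
  have "tbrk (comp i s) (comp (m - i) t) w = ?A i - ?B (m - i)" if i: "i : {1..<m}" for i
  proof -
   have a: "comp i s (take j w) * comp (m - i) t (drop j w) = (if j = i then ?A i else 0)" if "j <= m" for j
    using that True i by (auto simp: comp_def)
   have b: "sg (wdeg (take j w) * wdeg (drop j w)) * comp (m - i) t (take j w) * comp i s (drop j w)
     = (if j = m - i then ?B (m - i) else 0)" if "j <= m" for j
    using that True i by (auto simp: comp_def)
   have "(\<Sum>j\<le>m. comp i s (take j w) * comp (m - i) t (drop j w)) = ?A i"
    by (subst sum.cong[OF refl a]) (use i in auto)
   moreover have "(\<Sum>j\<le>m. sg (wdeg (take j w) * wdeg (drop j w)) * comp (m - i) t (take j w) * comp i s (drop j w)) = ?B (m - i)"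
    by (subst sum.cong[OF refl b]) (use i in auto)
   ultimately show ?thesis unfolding tbrk_def sum_subtractf using True by simp
  qed
  then have "(\<Sum>i\<in>{1..<m}. tbrk (comp i s) (comp (m - i) t) w) = (\<Sum>i\<in>{1..<m}. ?A i) - (\<Sum>i\<in>{1..<m}. ?B (m - i))"
   by (simp add: sum_subtractf)
  also have "(\<Sum>i\<in>{1..<m}. ?B (m - i)) = (\<Sum>i\<in>{1..<m}. ?B i)"
   by (rule sum.reindex_bij_witness[of _ "%i. m - i" "%i. m - i"]) auto
  also have "(\<Sum>i\<in>{1..<m}. ?A i) = (\<Sum>i\<le>m. ?A i)"
   by (rule sum.mono_neutral_left) (use assms True in \<open>auto simp: not_less Suc_le_eq\<close>)
  also have "(\<Sum>i\<in>{1..<m}. ?B i) = (\<Sum>i\<le>m. ?B i)"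
   by (rule sum.mono_neutral_left) (use assms True in \<open>auto simp: not_less Suc_le_eq\<close>)
  finally show ?thesis using True by (simp add: comp_def tbrk_def sum_fun_app sum_subtractf)
 qed
qed

lemma mc_gr_tbrk: assumes "s : mc_gr n d" "t : mc_gr n e" shows "tbrk s t : mc_gr n (d + e)"
proof -
 have z: "s [] = 0" "t [] = 0" using assms by (auto simp: mc_gr_def)
 have "lie_part n m (d + e) (comp m (tbrk s t))" for m
  unfolding comp_tbrk[where s = s and t = t, OF z]
 proof (rule lie_part_sum)
  fix i assume i: "i : {1..<m}"
  then have "lie_part n (i + (m - i)) (d + e) (tbrk (comp i s) (comp (m - i) t))"
   using assms by (intro lie_part.brk) (auto simp: mc_gr_comp)
  then show "lie_part n m (d + e) (tbrk (comp i s) (comp (m - i) t))" using i by simp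
 qed
 then show ?thesis using z by (simp add: mc_gr_comp) (simp add: tbrk_def)
qed

section \<open>Evaluation of Lie series\<close>

context complete_dg_lie begin

sublocale V: vector_space "scl g" by (rule vs)

lemma gr_0 [simp]: "0 : gr g d" using gr_subspace V.subspace_0 by blast
lemma gr_add: "x : gr g d ==> y : gr g d ==> x + y : gr g d" using gr_subspace V.subspace_add by blast
lemma gr_scl: "x : gr g d ==> scl g c x : gr g d" using gr_subspace V.subspace_scale by blast
lemma gr_diff: "x : gr g d ==> y : gr g d ==> x - y : gr g d" using gr_subspace V.subspace_diff by blast
lemma gr_sum: "(!!i. i : A ==> f i : gr g d) ==> sum f A : gr g d" using gr_subspace V.subspace_sum by blast

lemma fil_0 [simp]: "1 <= n ==> 0 : fil g n d" using fil_subspace V.subspace_0 by blast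
lemma fil_add: "1 <= n ==> x : fil g n d ==> y : fil g n d ==> x + y : fil g n d" using fil_subspace V.subspace_add by blast
lemma fil_scl: "1 <= n ==> x : fil g n d ==> scl g c x : fil g n d" using fil_subspace V.subspace_scale by blast
lemma fil_uminus: "1 <= n ==> x : fil g n d ==> - x : fil g n d" using fil_subspace V.subspace_neg by blast
lemma fil_diff: "1 <= n ==> x : fil g n d ==> y : fil g n d ==> x - y : fil g n d" using fil_subspace V.subspace_diff by blast
lemma fil_sum: "1 <= n ==> (!!i. i : A ==> f i : fil g n d) ==> sum f A : fil g n d" using fil_subspace V.subspace_sum by blast

lemma fil_mono: "m <= n ==> 1 <= m ==> x : fil g n d ==> x : fil g m d"
proof (induction n rule: dec_induct)
 case (step k)
 then show ?case using fil_descending[of k d] by auto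
qed
lemma fil_gr: "1 <= n ==> x : fil g n d ==> x : gr g d"
 using fil_mono[of 1 n x d] fil_one[of d] by simp

lemma dif_0 [simp]: "dif g 0 = 0" using dif_scl[OF gr_0, of 0] by simp
lemma brk_add_right:
 assumes "x : gr g d" "y : gr g e" "z : gr g e" shows "brk g x (y + z) = brk g x y + brk g x z"
 using brk_antisym[OF assms(1) gr_add[OF assms(2,3)]] brk_antisym[OF assms(1,2)] brk_antisym[OF assms(1,3)]
  brk_add[OF assms(2,3,1)] by (simp add: V.scale_right_distrib)
lemma brk_scl_right:
 assumes "x : gr g d" "y : gr g e" shows "brk g x (scl g c y) = scl g c (brk g x y)"
 using brk_antisym[OF assms(1) gr_scl[OF assms(2)], of c] brk_antisym[OF assms]
  brk_scl[OF assms(2,1), of c] by (simp add: mult.commute)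
lemma brk_zero_left: "x : gr g d ==> brk g 0 x = 0" using brk_scl[OF gr_0, where c = 0 and y = x] by simp
lemma brk_zero_right: "x : gr g d ==> brk g x 0 = 0" using brk_scl_right[OF _ gr_0, where c = 0 and x = x] by simp
lemma brk_sum_right:
 "(!!i. i : A ==> f i : gr g d) ==> y : gr g e ==> brk g y (sum f A) = (\<Sum>i\<in>A. brk g y (f i))"
 by (induction A rule: infinite_finite_induct) (auto simp: brk_add_right[where d = e and e = d] gr_sum brk_zero_right)

fun Ad :: "(nat set => 'v) => nat set list => 'v => 'v" where
 "Ad x [] y = y"
| "Ad x (I # w) y = brk g (x I) (Ad x w y)"

definition Rn :: "(nat set => 'v) => nat set list => 'v" where
 "Rn x w = Ad x (butlast w) (x (last w))"

text \<open>
  Dynkin's projection: the right-normed brackets of the letters, divided by the length.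
\<close>

definition ev :: "nat => (nat set => 'v) => nat => 'k tseries => 'v" where
 "ev n x k s = scl g (1 / of_nat k) (\<Sum>w\<in>words n k. scl g (s w) (Rn x w))"

lemma Ad_append: "Ad x (u @ v) y = Ad x u (Ad x v y)" by (induction u) auto
lemma Rn_append: "v ~= [] ==> Rn x (u @ v) = Ad x u (Rn x v)"
 by (simp add: Rn_def butlast_append Ad_append)

context
 fixes n :: nat and x :: "nat set => 'v"
 assumes x: "!!I. I : faces n ==> x I : gr g (xdeg I)"
begin

lemma Ad_fil: "set w \<subseteq> faces n ==> 1 <= m ==> y : fil g m e ==> Ad x w y : fil g (length w + m) (wdeg w + e)"
proof (induction w)
 case (Cons I w)
 then have "brk g (x I) (Ad x w y) : fil g (1 + (length w + m)) (xdeg I + (wdeg w + e))"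
  using x by (intro brk_fil) (auto simp: fil_one[simplified])
 then show ?case by (simp add: add.assoc)
qed simp

lemma Ad_gr: "set w \<subseteq> faces n ==> y : gr g e ==> Ad x w y : gr g (wdeg w + e)"
 using Ad_fil[of w 1 y e] fil_gr[of "length w + 1"] by (simp add: fil_one[simplified])

lemma Ad_gr_words: "w : words n k ==> wdeg w = d ==> y : gr g f ==> Ad x w y : gr g (d + f)"
 using Ad_gr[of w y f] by (auto simp: words_def)

lemma Rn_fil: assumes "set w \<subseteq> faces n" "w ~= []" shows "Rn x w : fil g (length w) (wdeg w)"
proof -
 obtain v I where w: "w = v @ [I]" using assms(2) by (metis append_butlast_last_id)
 then show ?thesis using Ad_fil[of v 1 "x I" "xdeg I"] assms x[of I] by (simp add: Rn_def fil_one[simplified])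
qed

lemma Ad_sum:
 assumes "set u \<subseteq> faces n" "!!v. v : A ==> c v ~= 0 ==> z v : gr g e"
 shows "Ad x u (\<Sum>v\<in>A. scl g (c v) (z v)) = (\<Sum>v\<in>A. scl g (c v) (Ad x u (z v)))"
 using assms(1)
proof (induction u)
 case (Cons I u)
 have t: "scl g (c v) (Ad x u (z v)) : gr g (wdeg u + e)" if "v : A" for v
  by (cases "c v = 0") (use that Cons assms(2) in \<open>auto intro: gr_scl Ad_gr\<close>)
 have "brk g (x I) (scl g (c v) (Ad x u (z v))) = scl g (c v) (brk g (x I) (Ad x u (z v)))" if "v : A" for v
 proof (cases "c v = 0")
  case True then show ?thesis using x[of I] Cons by (auto simp: brk_zero_right)
 next
  case False
  then show ?thesis using that Cons assms(2) x[of I] by (intro brk_scl_right) (auto intro: Ad_gr)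
 qed
 then show ?case using Cons x[of I] t by (simp add: brk_sum_right[where d = "wdeg u + e" and e = "xdeg I"])
qed simp

lemma ev_add: "ev n x k (s + t) = ev n x k s + ev n x k t"
 by (simp add: ev_def V.scale_left_distrib sum.distrib V.scale_right_distrib)
lemma ev_tscl: "ev n x k (tscl c s) = scl g c (ev n x k s)"
 by (simp add: ev_def tscl_def V.scale_sum_right mult.left_commute)
lemma ev_0 [simp]: "ev n x k 0 = 0" by (simp add: ev_def)
lemma ev_sum: "ev n x k (sum f A) = (\<Sum>i\<in>A. ev n x k (f i))"
 by (induction A rule: infinite_finite_induct) (simp_all only: ev_add ev_0 sum.infinite sum.empty sum.insert simp_thms)
lemma ev_comp: "ev n x k (comp k s) = ev n x k s"
 by (auto simp: ev_def comp_def words_def intro!: sum.cong arg_cong[where f = "scl g _"])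

lemma ev_xi: "I : faces n ==> ev n x 1 (xi I) = x I"
proof -
 assume I: "I : faces n"
 have "(\<Sum>w\<in>words n 1. scl g (xi I w) (Rn x w)) = (\<Sum>w\<in>words n 1. if w = [I] then x I else 0)"
  by (rule sum.cong) (auto simp: xi_def Rn_def)
 also have "... = x I"
 proof -
  have "[I] : words n 1" using I by (simp add: words_def)
  then show ?thesis by (subst sum.delta) simp_all
 qed
 finally show ?thesis by (simp add: ev_def)
qed

lemma sum_tbrk:
 assumes s: "lie_part n k d s" and t: "lie_part n l e t"
 shows "(\<Sum>w\<in>words n (k + l). scl g (tbrk s t w) (G w))
  = (\<Sum>u\<in>words n k. scl g (s u) (\<Sum>v\<in>words n l. scl g (t v) (G (u @ v))))
   - scl g (sg (d * e)) (\<Sum>v\<in>words n l. scl g (t v) (\<Sum>u\<in>words n k. scl g (s u) (G (v @ u))))"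
proof -
 have "tbrk s t w = s (take k w) * t (drop k w) - sg (d * e) * t (take l w) * s (drop l w)" if "w : words n (k + l)" for w
  by (rule tbrk_homog) (use lie_part_support[OF s] lie_part_support[OF t] that in \<open>auto simp: words_def\<close>)
 then have "(\<Sum>w\<in>words n (k + l). scl g (tbrk s t w) (G w))
  = (\<Sum>w\<in>words n (k + l). scl g (s (take k w) * t (drop k w)) (G w))
  - (\<Sum>w\<in>words n (l + k). scl g (sg (d * e) * (t (take l w) * s (drop l w))) (G w))"
  by (simp add: V.scale_left_diff_distrib sum_subtractf add.commute mult.assoc)
 also have "(\<Sum>w\<in>words n (k + l). scl g (s (take k w) * t (drop k w)) (G w))
  = (\<Sum>u\<in>words n k. \<Sum>v\<in>words n l. scl g (s u * t v) (G (u @ v)))"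
  using sum_words_append[of "%u v. scl g (s u * t v) (G (u @ v))" k n l] by simp
 also have "(\<Sum>w\<in>words n (l + k). scl g (sg (d * e) * (t (take l w) * s (drop l w))) (G w))
  = (\<Sum>v\<in>words n l. \<Sum>u\<in>words n k. scl g (sg (d * e) * (t v * s u)) (G (v @ u)))"
  using sum_words_append[of "%v u. scl g (sg (d * e) * (t v * s u)) (G (v @ u))" l n k] by simp
 finally show ?thesis by (simp add: V.scale_sum_right)
qed

lemma Rn_gr: assumes "w : words n k" "1 <= k" "wdeg w = d" shows "Rn x w : gr g d"
proof -
 have "w ~= []" "set w \<subseteq> faces n" "1 <= length w" using assms by (auto simp: words_def)
 then show ?thesis using fil_gr[OF _ Rn_fil, of w] assms(3) by simp
qed

lemma ev_fil:
 assumes "lie_part n k d s" "1 <= k" shows "ev n x k s : fil g k d"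
proof -
 have "scl g (s w) (Rn x w) : fil g k d" if "w : words n k" for w
 proof (cases "s w = 0")
  case True then show ?thesis using assms(2) by simp
 next
  case False
  then have "w : words n k" "wdeg w = d" using lie_part_support[OF assms(1)] by auto
  moreover from this have "w ~= []" using assms(2) by (auto simp: words_def)
  ultimately show ?thesis using Rn_fil[of w] assms(2) by (auto simp: words_def intro: fil_scl)
 qed
 then show ?thesis unfolding ev_def by (rule fil_scl[OF assms(2) fil_sum[OF assms(2)]])
qed

lemma ev_gr: "lie_part n k d s ==> ev n x k s : gr g d"
 by (cases "k = 0") (auto simp: ev_def intro: fil_gr[OF _ ev_fil[unfolded ev_def]])

lemma ev_Rn: "1 <= k ==> (\<Sum>w\<in>words n k. scl g (s w) (Rn x w)) = scl g (of_nat k) (ev n x k s)"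
 by (simp add: ev_def)

lemma ev_brk_aux:
 assumes s: "lie_part n k d s" and t: "lie_part n l e t"
  and Ts: "!!y f. y : gr g f ==> (\<Sum>w\<in>words n k. scl g (s w) (Ad x w y)) = brk g (ev n x k s) y"
  and Tt: "!!y f. y : gr g f ==> (\<Sum>w\<in>words n l. scl g (t w) (Ad x w y)) = brk g (ev n x l t) y"
 shows "ev n x (k + l) (tbrk s t) = brk g (ev n x k s) (ev n x l t)"
proof -
 let ?T = "%k s y. \<Sum>w\<in>words n k. scl g (s w) (Ad x w y)"
 note S = ev_gr[OF s] and T = ev_gr[OF t]
 show ?thesis
 proof (cases "k = 0 \<or> l = 0")
  case True
  then have "s = 0 \<or> t = 0" using s t lie_part_0 by blast
  then show ?thesis using S T by (auto simp: brk_zero_left brk_zero_right)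
 next
  case False
  let ?D = "%k s. \<Sum>w\<in>words n k. scl g (s w) (Rn x w)"
  have D: "?D k s = scl g (of_nat k) (ev n x k s)" "?D l t = scl g (of_nat l) (ev n x l t)" using False ev_Rn by auto
  have 3: "(\<Sum>u\<in>words n k. scl g (s u) (\<Sum>v\<in>words n l. scl g (t v) (Rn x (u @ v)))) = ?T k s (?D l t)"
  proof (intro sum.cong refl arg_cong[where f = "scl g _"])
   fix u assume "u : words n k"
   then have "Ad x u (?D l t) = (\<Sum>v\<in>words n l. scl g (t v) (Ad x u (Rn x v)))"
    using lie_part_support[OF t] False
    by (intro Ad_sum[where e = e] Rn_gr[where k = l]) (auto simp: words_def)
   then show "(\<Sum>v\<in>words n l. scl g (t v) (Rn x (u @ v))) = Ad x u (?D l t)"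
    using False by (intro sum.cong[THEN trans, OF refl _ sym]) (auto simp: words_def intro!: Rn_append arg_cong[where f = "scl g _"])
  qed
  have 4: "(\<Sum>v\<in>words n l. scl g (t v) (\<Sum>u\<in>words n k. scl g (s u) (Rn x (v @ u)))) = ?T l t (?D k s)"
  proof (intro sum.cong refl arg_cong[where f = "scl g _"])
   fix u assume "u : words n l"
   then have "Ad x u (?D k s) = (\<Sum>v\<in>words n k. scl g (s v) (Ad x u (Rn x v)))"
    using lie_part_support[OF s] False
    by (intro Ad_sum[where e = d] Rn_gr[where k = k]) (auto simp: words_def)
   then show "(\<Sum>v\<in>words n k. scl g (s v) (Rn x (u @ v))) = Ad x u (?D k s)"
    using False by (intro sum.cong[THEN trans, OF refl _ sym]) (auto simp: words_def intro!: Rn_append arg_cong[where f = "scl g _"])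
  qed
  have "?D (k + l) (tbrk s t) = brk g (ev n x k s) (?D l t) - scl g (sg (d * e)) (brk g (ev n x l t) (?D k s))"
   unfolding sum_tbrk[OF s t] 3 4
   using Ts[of "?D l t" e] Tt[of "?D k s" d] S T by (simp add: D gr_scl)
  also have "... = scl g (of_nat l) (brk g (ev n x k s) (ev n x l t)) + scl g (of_nat k) (brk g (ev n x k s) (ev n x l t))"
   unfolding D brk_scl_right[OF S T] brk_scl_right[OF T S] using brk_antisym[OF S T] by (simp add: mult.commute)
  also have "... = scl g (of_nat (k + l)) (brk g (ev n x k s) (ev n x l t))"
   by (simp add: V.scale_left_distrib add.commute)
  finally have "scl g (of_nat (k + l)) (ev n x (k + l) (tbrk s t)) = scl g (of_nat (k + l)) (brk g (ev n x k s) (ev n x l t))"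
   using ev_Rn[of "k + l" "tbrk s t"] False by (simp del: of_nat_add V.scale_cancel_left)
  then show ?thesis using False by (simp del: of_nat_add)
 qed
qed

lemma ev_brk_Ad:
 assumes "lie_part n k d s"
 shows "y : gr g f ==> (\<Sum>w\<in>words n k. scl g (s w) (Ad x w y)) = brk g (ev n x k s) y"
 using assms
proof (induction arbitrary: y f rule: lie_part.induct)
 case (gen I)
 have "(\<Sum>w\<in>words n 1. scl g (xi I w) (Ad x w y)) = (\<Sum>w\<in>words n 1. if w = [I] then brk g (x I) y else 0)"
  by (rule sum.cong) (auto simp: xi_def)
 also have "... = brk g (x I) y"
 proof -
  have "[I] : words n 1" using gen by (simp add: words_def)
  then show ?thesis by (subst sum.delta) simp_all
 qed
 finally show ?case using ev_xi[OF gen(1)] by simp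
next
 case (zero k d)
 have "(\<Sum>w\<in>words n k. scl g ((0 :: 'k tseries) w) (Ad x w y)) = 0" by simp
 then show ?case using brk_zero_left[OF zero(1)] by (simp only: ev_0)
next
 case (add k d s t)
 have "(\<Sum>w\<in>words n k. scl g ((s + t) w) (Ad x w y))
   = (\<Sum>w\<in>words n k. scl g (s w) (Ad x w y)) + (\<Sum>w\<in>words n k. scl g (t w) (Ad x w y))"
  by (simp add: V.scale_left_distrib sum.distrib)
 then show ?case using brk_add[OF ev_gr[OF add(1)] ev_gr[OF add(2)] add(5)] add(3,4)[OF add(5)]
  by (simp only: ev_add)
next
 case (scl k d s c)
 have "(\<Sum>w\<in>words n k. scl g (tscl c s w) (Ad x w y)) = scl g c (\<Sum>w\<in>words n k. scl g (s w) (Ad x w y))"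
  by (simp add: tscl_def V.scale_sum_right)
 then show ?case using scl brk_scl[OF ev_gr[OF scl(1)] scl(3)] by (simp add: ev_tscl)
next
 case (brk k d s l e t)
 let ?T = "%k s y. \<Sum>w\<in>words n k. scl g (s w) (Ad x w y)"
 note S = ev_gr[OF brk(1)] and T = ev_gr[OF brk(2)]
 have 1: "(\<Sum>u\<in>words n k. scl g (s u) (\<Sum>v\<in>words n l. scl g (t v) (Ad x (u @ v) y))) = ?T k s (?T l t y)"
 proof (intro sum.cong refl arg_cong[where f = "scl g _"])
  fix u assume "u : words n k"
  then have "Ad x u (?T l t y) = (\<Sum>v\<in>words n l. scl g (t v) (Ad x u (Ad x v y)))"
   using lie_part_support[OF brk(2)]
   by (intro Ad_sum[where e = "e + f"] Ad_gr_words[OF _ _ brk.prems]) (auto simp: words_def)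
  then show "(\<Sum>v\<in>words n l. scl g (t v) (Ad x (u @ v) y)) = Ad x u (?T l t y)" by (simp add: Ad_append)
 qed
 have 2: "(\<Sum>v\<in>words n l. scl g (t v) (\<Sum>u\<in>words n k. scl g (s u) (Ad x (v @ u) y))) = ?T l t (?T k s y)"
 proof (intro sum.cong refl arg_cong[where f = "scl g _"])
  fix v assume "v : words n l"
  then have "Ad x v (?T k s y) = (\<Sum>u\<in>words n k. scl g (s u) (Ad x v (Ad x u y)))"
   using lie_part_support[OF brk(1)]
   by (intro Ad_sum[where e = "d + f"] Ad_gr_words[OF _ _ brk.prems]) (auto simp: words_def)
  then show "(\<Sum>u\<in>words n k. scl g (s u) (Ad x (v @ u) y)) = Ad x v (?T k s y)" by (simp add: Ad_append)
 qed
 have "?T (k + l) (tbrk s t) y = brk g (ev n x k s) (brk g (ev n x l t) y) - scl g (sg (d * e)) (brk g (ev n x l t) (brk g (ev n x k s) y))"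
  unfolding sum_tbrk[OF brk(1,2)] 1 2
  using brk.IH(1)[OF brk_degree[OF T brk.prems]] brk.IH(2)[OF brk_degree[OF S brk.prems]]
   brk.IH(1)[OF brk.prems] brk.IH(2)[OF brk.prems] by simp
 also have "... = brk g (brk g (ev n x k s) (ev n x l t)) y" using brk_jacobi[OF S T brk.prems] by simp
 also have "brk g (ev n x k s) (ev n x l t) = ev n x (k + l) (tbrk s t)"
  using ev_brk_aux[OF brk(1,2) brk.IH] by simp
 finally show ?case .
qed

text \<open>
  Dynkin's argument: by induction a Lie element acts through its nested brackets as the adjoint
  action of its evaluation, so the right-normed bracket of \<open>[s, t]\<close> is \<open>k +
  l\<close> times the bracket of the evaluations.
\<close>

lemma ev_brk:
 assumes "lie_part n k d s" "lie_part n l e t"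
 shows "ev n x (k + l) (tbrk s t) = brk g (ev n x k s) (ev n x l t)"
 by (rule ev_brk_aux[OF assms ev_brk_Ad[OF assms(1)] ev_brk_Ad[OF assms(2)]])

end

end

section \<open>Splitting words and the derivation\<close>

definition sp2 :: "'a list => ('a list \<times> 'a list) set" where "sp2 w = {(u, v). u @ v = w}"
definition sp3 :: "'a list => ('a list \<times> 'a list \<times> 'a list) set" where "sp3 w = {(u, v, z). u @ v @ z = w}"

lemma sp2_image: "sp2 w = (%i. (take i w, drop i w)) ` {..length w}"
proof (rule set_eqI)
 fix p :: "'a list \<times> 'a list"
 obtain u v where p: "p = (u, v)" by (cases p)
 have "(u, v) : (%i. (take i w, drop i w)) ` {..length w}" if "u @ v = w"
  by (rule image_eqI[where x = "length u"]) (use that in auto)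
 then show "p : sp2 w \<longleftrightarrow> p : (%i. (take i w, drop i w)) ` {..length w}"
  by (auto simp: p sp2_def)
qed

lemma finite_sp2 [simp]: "finite (sp2 w)" by (simp add: sp2_image)

lemma sum_sp2: "(\<Sum>(u, v)\<in>sp2 w. f u v) = (\<Sum>i\<le>length w. f (take i w) (drop i w))"
 by (rule sum.reindex_bij_witness[of _ "%i. (take i w, drop i w)" "%(u, v). length u"])
  (auto simp: sp2_def)

lemma finite_sp3 [simp]: "finite (sp3 w)"
proof (rule finite_subset)
 show "sp3 w \<subseteq> (\<Union>p\<in>sp2 w. Pair (fst p) ` sp2 (snd p))"
 proof
  fix q assume "q : sp3 w"
  then obtain u v z where q: "q = (u, v, z)" "u @ v @ z = w" by (auto simp: sp3_def)
  show "q : (\<Union>p\<in>sp2 w. Pair (fst p) ` sp2 (snd p))"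
   by (rule UN_I[of "(u, v @ z)"]) (use q in \<open>auto simp: sp2_def\<close>)
 qed
qed simp

lemma sum_sp2_Cons: "(\<Sum>(a, b)\<in>sp2 (x # w). f a b) = f [] (x # w) + (\<Sum>(a, b)\<in>sp2 w. f (x # a) b)"
 unfolding sum_sp2 by (simp add: sum.atMost_Suc_shift del: sum.atMost_Suc)

lemma sp2_Nil [simp]: "sp2 [] = {([], [])}" by (auto simp: sp2_def)

lemma sum_sp2_insert:
 "(\<Sum>(a, b)\<in>sp2 (u @ I # z). f a b :: 'b::comm_monoid_add)
  = (\<Sum>(u1, u2)\<in>sp2 u. f u1 (u2 @ I # z)) + (\<Sum>(z1, z2)\<in>sp2 z. f (u @ I # z1) z2)"
proof (induction u arbitrary: f)
 case Nil
 show ?case using sum_sp2_Cons[of f I z] by simp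
next
 case (Cons x u)
 show ?case using Cons[of "%a b. f (x # a) b"] sum_sp2_Cons[of f x "u @ I # z"]
   sum_sp2_Cons[of "%u1 u2. f u1 (u2 @ I # z)" x u] by (simp add: add.assoc)
qed

lemma sum_sp3_left:
 "(\<Sum>(u, v, z)\<in>sp3 w. \<Sum>(u1, u2)\<in>sp2 u. G u1 u2 v z)
  = (\<Sum>(a, b)\<in>sp2 w. \<Sum>(u2, v, z)\<in>sp3 b. G a u2 v (z :: 'a list) :: 'b::comm_monoid_add)"
proof -
 have "(\<Sum>(u, v, z)\<in>sp3 w. \<Sum>(u1, u2)\<in>sp2 u. G u1 u2 v z)
  = (\<Sum>((u, v, z), (u1, u2))\<in>(SIGMA p:sp3 w. sp2 (fst p)). G u1 u2 v z)"
  by (subst sum.Sigma[symmetric]) (auto intro!: sum.cong)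
 also have "... = (\<Sum>((a, b), (u2, v, z))\<in>(SIGMA p:sp2 w. sp3 (snd p)). G a u2 v z)"
  by (rule sum.reindex_bij_witness[of _ "%((a, b), (u2, v, z)). ((a @ u2, v, z), (a, u2))"
     "%((u, v, z), (u1, u2)). ((u1, u2 @ v @ z), (u2, v, z))"])
   (auto simp: sp2_def sp3_def)
 also have "... = (\<Sum>(a, b)\<in>sp2 w. \<Sum>(u2, v, z)\<in>sp3 b. G a u2 v z)"
  by (subst sum.Sigma[symmetric]) (auto intro!: sum.cong)
 finally show ?thesis .
qed

lemma sum_sp3_right:
 "(\<Sum>(u, v, z)\<in>sp3 w. \<Sum>(z1, z2)\<in>sp2 z. G u v z1 z2)
  = (\<Sum>(a, b)\<in>sp2 w. \<Sum>(u, v, z)\<in>sp3 a. G u v z (b :: 'a list) :: 'b::comm_monoid_add)"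
proof -
 have "(\<Sum>(u, v, z)\<in>sp3 w. \<Sum>(z1, z2)\<in>sp2 z. G u v z1 z2)
  = (\<Sum>((u, v, z), (z1, z2))\<in>(SIGMA p:sp3 w. sp2 (snd (snd p))). G u v z1 z2)"
  by (subst sum.Sigma[symmetric]) (auto intro!: sum.cong)
 also have "... = (\<Sum>((a, b), (u, v, z))\<in>(SIGMA p:sp2 w. sp3 (fst p)). G u v z b)"
  by (rule sum.reindex_bij_witness[of _ "%((a, b), (u, v, z)). ((u, v, z @ b), (z, b))"
     "%((u, v, z), (z1, z2)). ((u @ v @ z1, z2), (u, v, z1))"])
   (auto simp: sp2_def sp3_def)
 also have "... = (\<Sum>(a, b)\<in>sp2 w. \<Sum>(u, v, z)\<in>sp3 a. G u v z b)"
  by (subst sum.Sigma[symmetric]) (auto intro!: sum.cong)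
 finally show ?thesis .
qed

definition cc :: "'k::field_char_0 tseries => 'k tseries => 'k tseries" where
 "cc s t = (%w. \<Sum>(u, v)\<in>sp2 w. s u * t v)"

definition sgt :: "'k::field_char_0 tseries => 'k tseries" where "sgt s = (%w. sg (wdeg w) * s w)"

definition homog :: "int => 'k::field_char_0 tseries => bool" where
 "homog d s \<longleftrightarrow> (\<forall>w. s w ~= 0 --> wdeg w = d)"

lemma tbrk_cc: assumes "homog d s" "homog e t"
 shows "tbrk s t = cc s t - tscl (sg (d * e)) (cc t s)"
proof
 fix w
 have E: "sg (wdeg (take i w) * wdeg (drop i w)) * t (take i w) * s (drop i w)
   = sg (d * e) * (t (take i w) * s (drop i w))" for i
 proof (cases "t (take i w) * s (drop i w) = 0")
  case False
  then have "wdeg (take i w) = e" "wdeg (drop i w) = d" using assms by (auto simp: homog_def)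
  then show ?thesis by (simp add: mult.commute)
 qed auto
 show "tbrk s t w = (cc s t - tscl (sg (d * e)) (cc t s)) w"
  unfolding tbrk_def sum_subtractf E
  by (simp add: cc_def sum_sp2 tscl_def sum_distrib_left fun_diff_def)
qed

lemma homog_sgt: "homog d s ==> sgt s = tscl (sg d) s"
 by (auto simp: homog_def sgt_def tscl_def fun_eq_iff)

lemma cc_tscl_left: "cc (tscl c s) t = tscl c (cc s t)"
 by (auto simp: cc_def tscl_def sum_distrib_left mult.assoc fun_eq_iff intro!: sum.cong)

lemma dxi_Nil [simp]: "dxi n I [] = 0" by (simp add: dxi_def)

lemma mc_dif_sp3: "mc_dif n s w = (\<Sum>(u, v, z)\<in>sp3 w. \<Sum>I\<in>faces n. sg (wdeg u) * s (u @ I # z) * dxi n I v)"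
proof -
 let ?f = "%u v z. \<Sum>I\<in>faces n. sg (wdeg u) * s (u @ I # z) * dxi n I v"
 have tdd: "take i w @ drop i (take j w) @ drop j w = w" if "i <= j" for i j
 proof -
  have "take i w = take i (take j w)" using that by (simp add: min_def)
  then show ?thesis by (metis append_assoc append_take_drop_id)
 qed
 have "mc_dif n s w = (\<Sum>(j, i)\<in>(SIGMA j:{..length w}. {..<j}). ?f (take i w) (drop i (take j w)) (drop j w))"
  unfolding mc_dif_def by (subst sum.Sigma[symmetric]) auto
 also have "... = (\<Sum>(u, v, z)\<in>{(u, v, z). u @ v @ z = w & v ~= []}. ?f u v z)"
  by (rule sum.reindex_bij_witness[of _ "%(u, v, z). (length u + length v, length u)"
     "%(j, i). (take i w, drop i (take j w), drop j w)"])
   (auto simp: min_def tdd split: if_splits)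
 also have "... = (\<Sum>(u, v, z)\<in>sp3 w. ?f u v z)"
  by (rule sum.mono_neutral_left[OF finite_sp3]) (auto simp: sp3_def)
 finally show ?thesis .
qed

lemma mc_dif_cc: "mc_dif n (cc s t) = cc (mc_dif n s) t + cc (sgt s) (mc_dif n t)"
proof
 fix w
 have "mc_dif n (cc s t) w = (\<Sum>(u, v, z)\<in>sp3 w. \<Sum>(u1, u2)\<in>sp2 u. \<Sum>I\<in>faces n. sg (wdeg u1) * s u1 * (sg (wdeg u2) * t (u2 @ I # z) * dxi n I v))
  + (\<Sum>(u, v, z)\<in>sp3 w. \<Sum>(z1, z2)\<in>sp2 z. \<Sum>I\<in>faces n. sg (wdeg u) * s (u @ I # z1) * dxi n I v * t z2)"
  unfolding mc_dif_sp3 sum.distrib[symmetric]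
 proof (intro sum.cong refl, clarify)
  fix u v z assume "(u, v, z) : sp3 w"
  have "(\<Sum>I\<in>faces n. sg (wdeg u) * cc s t (u @ I # z) * dxi n I v)
   = (\<Sum>I\<in>faces n. (\<Sum>(u1, u2)\<in>sp2 u. sg (wdeg u1) * s u1 * (sg (wdeg u2) * t (u2 @ I # z) * dxi n I v))
    + (\<Sum>(z1, z2)\<in>sp2 z. sg (wdeg u) * s (u @ I # z1) * dxi n I v * t z2))"
  proof (intro sum.cong refl)
   fix I
   have "(\<Sum>(u1, u2)\<in>sp2 u. sg (wdeg u) * s u1 * t (u2 @ I # z) * dxi n I v)
    = (\<Sum>(u1, u2)\<in>sp2 u. sg (wdeg u1) * s u1 * (sg (wdeg u2) * t (u2 @ I # z) * dxi n I v))"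
    by (rule sum.cong) (auto simp: sp2_def sg_add mult_ac)
   then show "sg (wdeg u) * cc s t (u @ I # z) * dxi n I v
    = (\<Sum>(u1, u2)\<in>sp2 u. sg (wdeg u1) * s u1 * (sg (wdeg u2) * t (u2 @ I # z) * dxi n I v))
    + (\<Sum>(z1, z2)\<in>sp2 z. sg (wdeg u) * s (u @ I # z1) * dxi n I v * t z2)"
    unfolding cc_def sum_sp2_insert
    by (simp add: distrib_left distrib_right sum_distrib_left sum_distrib_right case_prod_unfold mult_ac)
  qed
  then show "(\<Sum>I\<in>faces n. sg (wdeg u) * cc s t (u @ I # z) * dxi n I v)
   = (\<Sum>(u1, u2)\<in>sp2 u. \<Sum>I\<in>faces n. sg (wdeg u1) * s u1 * (sg (wdeg u2) * t (u2 @ I # z) * dxi n I v))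
   + (\<Sum>(z1, z2)\<in>sp2 z. \<Sum>I\<in>faces n. sg (wdeg u) * s (u @ I # z1) * dxi n I v * t z2)"
   unfolding sum.distrib case_prod_unfold by (simp only: sum.swap[where A = "faces n"])
 qed
 also have "... = (cc (mc_dif n s) t + cc (sgt s) (mc_dif n t)) w"
  unfolding sum_sp3_left sum_sp3_right
  by (simp add: cc_def mc_dif_sp3 sgt_def sum_distrib_left sum_distrib_right case_prod_unfold add.commute)
 finally show "mc_dif n (cc s t) w = (cc (mc_dif n s) t + cc (sgt s) (mc_dif n t)) w" .
qed

lemma mc_dif_add: "mc_dif n (s + t) = mc_dif n s + mc_dif n t"
 by (simp add: mc_dif_def fun_eq_iff distrib_left distrib_right sum.distrib)
lemma mc_dif_tscl: "mc_dif n (tscl c s) = tscl c (mc_dif n s)"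
 by (simp add: mc_dif_def fun_eq_iff tscl_def sum_distrib_left mult_ac)
lemma mc_dif_zero: "mc_dif n 0 = 0"
 by (simp add: mc_dif_def fun_eq_iff)

lemma tscl_minus: "tscl (- 1) s = - s" by (auto simp: tscl_def fun_eq_iff)
lemma mc_dif_diff: "mc_dif n (s - t) = mc_dif n s - mc_dif n t"
 using mc_dif_add[of n s "- t"] mc_dif_tscl[of n "- 1" t] by (simp add: tscl_minus)

lemma mc_dif_homog:
 assumes "homog d s" "!!I. I : faces n ==> homog (xdeg I + 1) (dxi n I :: 'k::field_char_0 tseries)"
 shows "homog (d + 1) (mc_dif n s :: 'k tseries)"
 unfolding homog_def
proof (intro allI impI)
 fix w assume "mc_dif n s w ~= 0"
 then obtain p where p: "p : sp3 w" "(case p of (u, v, z) => \<Sum>I\<in>faces n. sg (wdeg u) * s (u @ I # z) * dxi n I v) ~= 0"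
  unfolding mc_dif_sp3 by (meson sum.not_neutral_contains_not_neutral)
 obtain u v z where uvz: "p = (u, v, z)" by (metis prod_cases3)
 then have "(\<Sum>I\<in>faces n. sg (wdeg u) * s (u @ I # z) * dxi n I v) ~= 0" using p by simp
 then obtain I where I: "I : faces n" "sg (wdeg u) * s (u @ I # z) * dxi n I v ~= 0"
  by (meson sum.not_neutral_contains_not_neutral)
 then have "wdeg (u @ I # z) = d" "wdeg v = xdeg I + 1" using assms by (auto simp: homog_def)
 then show "wdeg w = d + 1" using p uvz by (auto simp: sp3_def)
qed

lemma mc_dif_tbrk:
 assumes s: "homog d s" and t: "homog e t" and D: "!!I. I : faces n ==> homog (xdeg I + 1) (dxi n I :: 'k::field_char_0 tseries)"
 shows "mc_dif n (tbrk s t) = tbrk (mc_dif n s) t + tscl (sg d) (tbrk s (mc_dif n t :: 'k tseries))"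
proof -
 have 1: "sg ((d + 1) * e) = sg (d * e) * (sg e :: 'k)" by (simp add: sg_def algebra_simps)
 have 2: "sg d * sg (d * (e + 1)) = (sg (d * e) :: 'k)" by (simp add: sg_def algebra_simps)
 have e1: "tbrk (mc_dif n s) t = cc (mc_dif n s) t - tscl (sg ((d + 1) * e)) (cc t (mc_dif n s))"
  by (rule tbrk_cc[OF mc_dif_homog[OF s D] t])
 have e2: "tbrk s (mc_dif n t) = cc s (mc_dif n t) - tscl (sg (d * (e + 1))) (cc (mc_dif n t) s)"
  by (rule tbrk_cc[OF s mc_dif_homog[OF t D]])
 have "mc_dif n (tbrk s t) = cc (mc_dif n s) t + tscl (sg d) (cc s (mc_dif n t))
  - tscl (sg (d * e)) (cc (mc_dif n t) s + tscl (sg e) (cc t (mc_dif n s)))"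
  unfolding tbrk_cc[OF s t] mc_dif_diff mc_dif_tscl mc_dif_cc homog_sgt[OF s] homog_sgt[OF t] cc_tscl_left ..
 also have "... = tbrk (mc_dif n s) t + tscl (sg d) (tbrk s (mc_dif n t))"
  unfolding e1 e2 1 2[symmetric] by (simp add: fun_eq_iff tscl_def distrib_left right_diff_distrib mult.assoc)
 finally show ?thesis .
qed

lemma mc_dif_xi: assumes "I : faces n" shows "mc_dif n (xi I) = dxi n I"
proof
 fix w
 have "mc_dif n (xi I) w = (\<Sum>p\<in>sp3 w. if p = ([], w, []) then dxi n I w else 0)"
  unfolding mc_dif_sp3
 proof (intro sum.cong refl, clarify)
  fix u v z assume "(u, v, z) : sp3 w"
  have "(\<Sum>J\<in>faces n. sg (wdeg u) * xi I (u @ J # z) * dxi n J v) = (\<Sum>J\<in>faces n. if J = I then (if u = [] & z = [] then dxi n I v else 0) else 0)"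
   by (rule sum.cong) (auto simp: xi_def append_eq_Cons_conv)
  then show "(\<Sum>J\<in>faces n. sg (wdeg u) * xi I (u @ J # z) * dxi n J v) = (if (u, v, z) = ([], w, []) then dxi n I w else 0)"
   using assms \<open>(u, v, z) : sp3 w\<close> by (auto simp: sp3_def)
 qed
 also have "... = dxi n I w"
 proof -
  have "([], w, []) : sp3 w" by (simp add: sp3_def)
  then show ?thesis by (subst sum.delta) simp_all
 qed
 finally show "mc_dif n (xi I) w = dxi n I w" .
qed

lemma mc_gr_homog: "s : mc_gr n d ==> homog d s"
 using mc_gr_support(2) by (auto simp: homog_def)

lemma mc_gr_split:
 assumes "s : mc_gr n d"
 obtains b where "s = (\<Sum>k\<in>{1..<N}. comp k s) + b" "(\<Sum>k\<in>{1..<N}. comp k s) : mc_gr n d" "b : mc_gr n d"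
  "!!w. length w < N ==> b w = 0"
proof
 let ?a = "\<Sum>k\<in>{1..<N}. comp k s"
 let ?b = "s + tscl (- 1) ?a"
 show a: "?a : mc_gr n d" by (rule mc_gr_sum, rule lie_part_mc_gr) (use assms in \<open>auto simp: mc_gr_comp\<close>)
 show "?b : mc_gr n d" using assms a by (intro mc_gr_add mc_gr_tscl)
 show "s = ?a + ?b" by (simp add: tscl_minus)
 fix w :: "nat set list" assume "length w < N"
 have "?a w = (\<Sum>k\<in>{1..<N}. if k = length w then s w else 0)"
  unfolding sum_fun_app by (rule sum.cong) (auto simp: comp_def)
 also have "... = s w" using \<open>length w < N\<close> assms by (cases "w = []") (auto simp: mc_gr_def Suc_le_eq)
 finally show "?b w = 0" by (simp add: tscl_minus)
qed

lemma mc_dif_mc_gr: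
 assumes D: "!!I. I : faces n ==> (dxi n I :: 'k::field_char_0 tseries) : mc_gr n (xdeg I + 1)"
  and s: "s : mc_gr n d"
 shows "(mc_dif n s :: 'k tseries) : mc_gr n (d + 1)"
proof -
 have D': "homog (xdeg I + 1) (dxi n I :: 'k tseries)" if "I : faces n" for I
  using D[OF that] mc_gr_homog by blast
 have L: "mc_dif n s : mc_gr n (d + 1)" if "lie_part n k d s" for k d and s :: "'k tseries"
  using that
 proof (induction rule: lie_part.induct)
  case (gen I) show ?case unfolding mc_dif_xi[OF gen] by (rule D[OF gen])
 next
  case (zero k d)
  show ?case unfolding mc_dif_zero by (rule mc_gr_0)
 next
  case (add k d s t)
  then show ?case unfolding mc_dif_add by (intro mc_gr_add)
 next
  case (scl k d s c)
  then show ?case unfolding mc_dif_tscl by (intro mc_gr_tscl)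
 next
  case (brk k d s l e t)
  note S = lie_part_mc_gr[OF brk(1)] and T = lie_part_mc_gr[OF brk(2)]
  have "tbrk (mc_dif n s) t : mc_gr n (d + 1 + e)" "tbrk s (mc_dif n t) : mc_gr n (d + (e + 1))"
   using brk S T by (auto intro: mc_gr_tbrk)
  then have m: "tbrk (mc_dif n s) t : mc_gr n (d + e + 1)" "tbrk s (mc_dif n t) : mc_gr n (d + e + 1)"
   by (simp_all add: algebra_simps)
  have "mc_dif n (tbrk s t) = tbrk (mc_dif n s) t + tscl (sg d) (tbrk s (mc_dif n t))"
   by (rule mc_dif_tbrk[OF mc_gr_homog[OF S] mc_gr_homog[OF T] D'])
  then show ?case using mc_gr_add[OF m(1) mc_gr_tscl[OF m(2)]] by (simp only:)
 qed
 have "lie_part n m (d + 1) (comp m (mc_dif n s))" if "m \<ge> 1" for m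
 proof -
  obtain b where b: "s = (\<Sum>k\<in>{1..<Suc m}. comp k s) + b" "!!w. length w < Suc m ==> b w = 0"
   using mc_gr_split[OF s, of "Suc m"] by metis
  have "mc_dif n (\<Sum>k\<in>K. comp k s) : mc_gr n (d + 1)" if "K \<subseteq> {1..}" "finite K" for K
   using that(2,1)
  proof (induction K)
   case empty
   show ?case unfolding sum.empty mc_dif_zero by (rule mc_gr_0)
  next
   case (insert k K)
   have "lie_part n k d (comp k s)" using insert s by (simp add: mc_gr_comp)
   then have "mc_dif n (comp k s) : mc_gr n (d + 1)" by (rule L)
   then show ?case unfolding sum.insert[OF insert(1,2)] mc_dif_add using insert by (intro mc_gr_add) auto
  qed
  note K = this
  have "mc_dif n (\<Sum>k\<in>{1..<Suc m}. comp k s) : mc_gr n (d + 1)" by (rule K) auto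
  then have "lie_part n m (d + 1) (comp m (mc_dif n (\<Sum>k\<in>{1..<Suc m}. comp k s)))"
   using that by (auto simp: mc_gr_comp)
  moreover have "comp m (mc_dif n b) = 0"
  proof
   fix w
   show "comp m (mc_dif n b) w = 0 w"
    unfolding comp_def mc_dif_sp3
   proof (cases "length w = m")
    case True
    have "sg (wdeg u) * b (u @ I # z) * dxi n I v = 0" if "(u, v, z) : sp3 w" for u v z I
    proof (cases "v = []")
     case False
     then have "length (u @ I # z) < Suc m" using that True by (cases v) (auto simp: sp3_def)
     then show ?thesis using b(2) by simp
    qed simp
    then show "(if length w = m then \<Sum>(u, v, z)\<in>sp3 w. \<Sum>I\<in>faces n. sg (wdeg u) * b (u @ I # z) * dxi n I v else 0) = 0 w"
     by (auto intro!: sum.neutral)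
   qed simp
  qed
  moreover have "comp m (mc_dif n s) = comp m (mc_dif n (\<Sum>k\<in>{1..<Suc m}. comp k s)) + comp m (mc_dif n b)"
   by (subst b(1)) (simp only: mc_dif_add comp_add)
  ultimately show ?thesis by simp
 qed
 then show ?thesis by (simp add: mc_gr_comp) (simp add: mc_dif_def)
qed

lemma mc_dif_low:
 assumes "!!w. length w < N ==> s w = 0" "length w < N" shows "mc_dif n s w = 0"
 unfolding mc_dif_sp3
proof (intro sum.neutral ballI, clarify)
 fix u v z assume uvz: "(u, v, z) : sp3 w"
 show "(\<Sum>I\<in>faces n. sg (wdeg u) * s (u @ I # z) * dxi n I v) = 0"
 proof (cases "v = []")
  case False
  then have "length (u @ I # z) < N" for I using uvz assms(2) by (cases v) (auto simp: sp3_def)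
  then show ?thesis using assms(1) by simp
 qed simp
qed

lemma tbrk_low:
 assumes "!!w. length w < N ==> s w = 0 \<or> t w = 0" "!!w. length w < N ==> s w = 0" "length w < N"
 shows "tbrk s t w = 0" "tbrk t s w = 0"
 unfolding tbrk_def using assms(2,3) by (auto intro!: sum.neutral)

section \<open>Limits and the universal property\<close>

lemma mc_simps [simp]: "gr (mc n) = mc_gr n" "scl (mc n) = tscl" "dif (mc n) = mc_dif n" "brk (mc n) = tbrk"
 "fil (mc n) k d = {s : mc_gr n d. \<forall>w. length w < k --> s w = 0}"
 by (simp_all add: mc_def)

context complete_dg_lie begin

definition limto :: "int => (nat => 'v) => 'v => bool" where
 "limto d u y \<longleftrightarrow> y : gr g d & (\<forall>N\<ge>1. y - (\<Sum>k\<in>{1..<N}. u k) : fil g N d)"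

lemma limto_ex: assumes "!!k. 1 <= k ==> u k : fil g k d" shows "\<exists>y. limto d u y"
proof -
 have "\<exists>y\<in>gr g d. \<forall>n\<ge>1. y - (\<Sum>k\<in>{1..<n}. u k) : fil g n d"
 proof (rule complete_surj)
  show "(\<Sum>k\<in>{1..<n}. u k) : gr g d" for n using assms fil_gr by (intro gr_sum) auto
  show "(\<Sum>k\<in>{1..<Suc n}. u k) - (\<Sum>k\<in>{1..<n}. u k) : fil g n d" if "1 <= n" for n
   using that assms[of n] by simp
 qed
 then show ?thesis by (auto simp: limto_def)
qed

lemma fil_all_eq: assumes "y : gr g d" "z : gr g d" "!!n. 1 <= n ==> y - z : fil g n d" shows "y = z"
 using complete_inj[of "y - z" d] assms gr_diff by simp

lemma limto_unique: assumes "limto d u y" "limto d u z" shows "y = z"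
proof (rule fil_all_eq)
 show "y - z : fil g n d" if "1 <= n" for n
  using fil_diff[OF that, of "y - sum u {1..<n}" d "z - sum u {1..<n}"] assms that by (simp add: limto_def)
qed (use assms in \<open>auto simp: limto_def\<close>)

lemma limto_add: "limto d u y ==> limto d v z ==> limto d (%k. u k + v k) (y + z)"
 using fil_add[of _ "y - _" d "z - _"] by (auto simp: limto_def gr_add sum.distrib algebra_simps)
lemma limto_scl: "limto d u y ==> limto d (%k. scl g c (u k)) (scl g c y)"
 using fil_scl[of _ "y - _" d c] by (auto simp: limto_def gr_scl V.scale_sum_right[symmetric] V.scale_right_diff_distrib[symmetric])
lemma limto_zero: "limto d (%k. 0) 0" by (simp add: limto_def)

lemma limto_fil: assumes "limto d u y" "1 <= N" "!!k. 1 <= k ==> k < N ==> u k = 0" shows "y : fil g N d"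
proof -
 have "(\<Sum>k\<in>{1..<N}. u k) = 0" using assms(3) by (intro sum.neutral) auto
 then show ?thesis using assms by (auto simp: limto_def)
qed

lemma limto_single:
 assumes "1 <= k" "y : fil g k d" shows "limto d (%j. if j = k then y else 0) y"
 unfolding limto_def
proof (intro conjI allI impI)
 fix N :: nat assume N: "1 <= N"
 show "y - (\<Sum>j\<in>{1..<N}. if j = k then y else 0) : fil g N d"
 proof (cases "k < N")
  case True
  then have "(\<Sum>j\<in>{1..<N}. if j = k then y else 0) = y" using assms by (subst sum.delta) auto
  then show ?thesis using N by simp
 next
  case False
  then have "(\<Sum>j\<in>{1..<N}. if j = k then y else 0) = 0" by (subst sum.delta) auto
  then show ?thesis using fil_mono[of N k y d] assms False N by simp
 qed
qed (use assms fil_gr in blast)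

text \<open>
  When the \<open>k\<close>-th term lies in the \<open>k\<close>-th step of the filtration,
  unordered summation is the same as convergence of the partial sums.
\<close>

lemma has_csum_limto:
 assumes "!!k. 1 <= k ==> u k : fil g k d"
 shows "has_csum g d u {1..} y \<longleftrightarrow> limto d u y"
proof
 assume L: "limto d u y"
 show "has_csum g d u {1..} y" unfolding has_csum_def
 proof (intro conjI allI impI)
  fix n :: nat assume n: "1 <= n"
  have "sum u S - y : fil g n d" if S: "finite S" "{1..<n} \<subseteq> S" "S \<subseteq> {1..}" for S
  proof -
   have 1: "sum u S - y = (\<Sum>k\<in>S - {1..<n}. u k) - (y - sum u {1..<n})"
    using sum.subset_diff[OF S(2,1), of u] by (simp add: algebra_simps)
   have 2: "(\<Sum>k\<in>S - {1..<n}. u k) : fil g n d"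
   proof (rule fil_sum[OF n])
    fix k assume "k : S - {1..<n}"
    then have "n <= k" "1 <= k" using S(3) by auto
    then show "u k : fil g n d" using fil_mono[OF _ n assms] by blast
   qed
   have 3: "y - sum u {1..<n} : fil g n d" using L n by (simp only: limto_def)
   show ?thesis unfolding 1 by (rule fil_diff[OF n 2 3])
  qed
  note K = this
  show "\<exists>S0. finite S0 & S0 \<subseteq> {1..} & (\<forall>S. finite S & S0 \<subseteq> S & S \<subseteq> {1..} --> sum u S - y : fil g n d)"
  proof (rule exI[of _ "{1..<n}"], intro conjI allI impI)
   fix S assume "finite S & {1..<n} \<subseteq> S & S \<subseteq> {1..}"
   then show "sum u S - y : fil g n d" by (elim conjE) (rule K)
  qed auto
 qed (use L in \<open>simp add: limto_def\<close>)
next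
 assume H: "has_csum g d u {1..} y"
 show "limto d u y" unfolding limto_def
 proof (intro conjI allI impI)
  fix n :: nat assume n: "1 <= n"
  from H[unfolded has_csum_def, THEN conjunct2, THEN spec, THEN mp, OF n]
  obtain S0 where S0: "finite S0" "S0 \<subseteq> {1..}"
   and S0': "\<forall>S. finite S & S0 \<subseteq> S & S \<subseteq> {1..} --> sum u S - y : fil g n d"
   by (elim exE conjE)
  define S where "S = S0 \<union> {1..<n}"
  have S: "finite S" "{1..<n} \<subseteq> S" "S \<subseteq> {1..}" using S0 by (auto simp: S_def)
  have 1: "sum u S - y : fil g n d" by (rule S0'[THEN spec, THEN mp]) (use S in \<open>simp add: S_def\<close>)
  have 2: "(\<Sum>k\<in>S - {1..<n}. u k) : fil g n d"
  proof (rule fil_sum[OF n])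
   fix k assume "k : S - {1..<n}"
   then have "n <= k" "1 <= k" using S(3) by auto
   then show "u k : fil g n d" using fil_mono[OF _ n assms] by blast
  qed
  have "y - sum u {1..<n} = (\<Sum>k\<in>S - {1..<n}. u k) - (sum u S - y)"
   using sum.subset_diff[OF S(2,1), of u] by (simp add: algebra_simps)
  then show "y - sum u {1..<n} : fil g n d" using fil_diff[OF n 2 1] by (simp only:)
 qed (use H in \<open>simp add: has_csum_def\<close>)
qed

text \<open>
  Continuous maps that agree on Lie elements of each fixed length agree on all Lie series.
\<close>

lemma agree:
 fixes P Q :: "'k tseries => 'v"
 assumes P: "!!s. s : mc_gr n d ==> P s : gr g e" and Q: "!!s. s : mc_gr n d ==> Q s : gr g e"
  and Pa: "!!s t. s : mc_gr n d ==> t : mc_gr n d ==> P (s + t) = P s + P t"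
  and Qa: "!!s t. s : mc_gr n d ==> t : mc_gr n d ==> Q (s + t) = Q s + Q t"
  and Pf: "!!s N. 1 <= N ==> s : mc_gr n d ==> (!!w. length w < N ==> s w = 0) ==> P s : fil g N e"
  and Qf: "!!s N. 1 <= N ==> s : mc_gr n d ==> (!!w. length w < N ==> s w = 0) ==> Q s : fil g N e"
  and PQ: "!!k s. lie_part n k d s ==> P s = Q s"
  and s: "s : mc_gr n d"
 shows "P s = Q s"
proof (rule fil_all_eq[OF P[OF s] Q[OF s]])
 fix N :: nat assume N: "1 <= N"
 obtain b where b: "s = (\<Sum>k\<in>{1..<N}. comp k s) + b" "(\<Sum>k\<in>{1..<N}. comp k s) : mc_gr n d" "b : mc_gr n d"
  "!!w. length w < N ==> b w = 0" using mc_gr_split[OF s, of N] by metis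
 have "P (\<Sum>k\<in>K. comp k s) = Q (\<Sum>k\<in>K. comp k s) & (\<Sum>k\<in>K. comp k s) : mc_gr n d" if "K \<subseteq> {1..}" "finite K" for K
  using that(2,1)
 proof (induction K)
  case empty
  show ?case unfolding sum.empty using PQ[OF lie_part.zero] mc_gr_0 by blast
 next
  case (insert k K)
  have k: "lie_part n k d (comp k s)" using insert s by (simp add: mc_gr_comp)
  have c: "comp k s : mc_gr n d" "(\<Sum>k\<in>K. comp k s) : mc_gr n d" "P (\<Sum>k\<in>K. comp k s) = Q (\<Sum>k\<in>K. comp k s)"
   using lie_part_mc_gr[OF k] insert by auto
  show ?case unfolding sum.insert[OF insert(1,2)] Pa[OF c(1,2)] Qa[OF c(1,2)] PQ[OF k] c(3)
   using mc_gr_add[OF c(1,2)] by blast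
 qed
 note K = this
 have "P (\<Sum>k\<in>{1..<N}. comp k s) = Q (\<Sum>k\<in>{1..<N}. comp k s)" by (rule K[THEN conjunct1]) auto
 then have "P s - Q s = P b - Q b" using Pa[OF b(2,3)] Qa[OF b(2,3)] by (subst (1 2) b(1)) simp
 then show "P s - Q s : fil g N e" using fil_diff[OF N Pf[OF N b(3,4)] Qf[OF N b(3,4)]] by simp
qed

text \<open>
  The choice operator picks the limit of the partial evaluations; outside the graded pieces the
  value is \<open>undefined\<close>, to make the function extensional.
\<close>

definition Fx :: "nat => (nat set => 'v) => 'k tseries => 'v" where
 "Fx n x s = (if s : elts (mc n) then SOME y. \<exists>d. s : mc_gr n d & limto d (%k. ev n x k s) y else undefined)"

context
 fixes n :: nat and x :: "nat set => 'v"
 assumes x: "!!I. I : faces n ==> x I : gr g (xdeg I)"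
begin

lemma ev_mc_gr_fil: assumes "s : mc_gr n d" "1 <= k" shows "ev n x k s : fil g k d"
proof -
 have "lie_part n k d (comp k s)" using assms by (simp add: mc_gr_comp)
 from ev_fil[OF x this assms(2)] show ?thesis by (simp add: ev_comp[OF x])
qed

lemma Fx_limto: assumes s: "s : mc_gr n d" shows "limto d (%k. ev n x k s) (Fx n x s)"
proof -
 have "\<exists>y. limto d (%k. ev n x k s) y" using ev_mc_gr_fil[OF s] by (rule limto_ex)
 then have "\<exists>y. \<exists>d. s : mc_gr n d & limto d (%k. ev n x k s) y" using s by blast
 then have "\<exists>d. s : mc_gr n d & limto d (%k. ev n x k s) (SOME y. \<exists>d. s : mc_gr n d & limto d (%k. ev n x k s) y)"
  by (rule someI_ex)
 moreover have "s : elts (mc n)" using s by (auto simp: elts_def)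
 ultimately obtain d' where d': "s : mc_gr n d'" "limto d' (%k. ev n x k s) (Fx n x s)"
  unfolding Fx_def by auto
 show ?thesis
 proof (cases "s = 0")
  case True
  then have z: "(%k. ev n x k s) = (%k. 0)" using ev_0[OF x] by simp
  then have "Fx n x s = 0" using limto_unique[OF d'(2)[unfolded z] limto_zero] by simp
  then show ?thesis using limto_zero z by simp
 next
  case False
  then obtain w where "s w ~= 0" by (auto simp: fun_eq_iff)
  then have "d' = d" using mc_gr_support(2)[OF s] mc_gr_support(2)[OF d'(1)] by blast
  then show ?thesis using d' by simp
 qed
qed

lemma Fx_gr: "s : mc_gr n d ==> Fx n x s : gr g d"
 using Fx_limto by (simp add: limto_def)

lemma Fx_add: assumes "s : mc_gr n d" "t : mc_gr n d" shows "Fx n x (s + t) = Fx n x s + Fx n x t"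
proof (rule limto_unique)
 show "limto d (%k. ev n x k (s + t)) (Fx n x (s + t))" by (rule Fx_limto[OF mc_gr_add[OF assms]])
 have e: "(%k. ev n x k (s + t)) = (%k. ev n x k s + ev n x k t)" by (rule ext, rule ev_add[OF x])
 show "limto d (%k. ev n x k (s + t)) (Fx n x s + Fx n x t)"
  unfolding e by (rule limto_add[OF Fx_limto[OF assms(1)] Fx_limto[OF assms(2)]])
qed

lemma Fx_tscl: assumes "s : mc_gr n d" shows "Fx n x (tscl c s) = scl g c (Fx n x s)"
proof (rule limto_unique)
 show "limto d (%k. ev n x k (tscl c s)) (Fx n x (tscl c s))" by (rule Fx_limto[OF mc_gr_tscl[OF assms]])
 have e: "(%k. ev n x k (tscl c s)) = (%k. scl g c (ev n x k s))" by (rule ext, rule ev_tscl[OF x])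
 show "limto d (%k. ev n x k (tscl c s)) (scl g c (Fx n x s))"
  unfolding e by (rule limto_scl[OF Fx_limto[OF assms]])
qed

lemma Fx_lie_part: assumes "lie_part n k d s" shows "Fx n x s = ev n x k s"
proof (cases "k = 0")
 case True
 then have s: "s = 0" using assms lie_part_0 by blast
 have "Fx n x (0 + 0) = Fx n x 0 + Fx n x 0" by (rule Fx_add[of _ 0]) auto
 then have "Fx n x 0 = 0" by simp
 then show ?thesis using s ev_0[OF x] by simp
next
 case False
 have e: "ev n x j s = (if j = k then ev n x k s else 0)" for j
  using ev_comp[OF x, where k = j and s = s] lie_part_comp[OF assms, of j] ev_0[OF x] by (auto split: if_splits)
 have "limto d (%j. ev n x j s) (ev n x k s)"
  using limto_single[where k = k and y = "ev n x k s" and d = d] ev_fil[OF x assms] False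
  by (subst e[abs_def]) simp
 then show ?thesis using limto_unique[OF Fx_limto[OF lie_part_mc_gr[OF assms]]] by blast
qed

lemma Fx_xi: "I : faces n ==> Fx n x (xi I) = x I"
 using Fx_lie_part[OF lie_part.gen] ev_xi[OF x] by simp

lemma Fx_fil: assumes "1 <= N" "s : mc_gr n d" "!!w. length w < N ==> s w = 0" shows "Fx n x s : fil g N d"
proof (rule limto_fil[OF Fx_limto[OF assms(2)] assms(1)])
 fix k assume "k < N"
 then have "comp k s = 0" using assms(3) by (auto simp: comp_def fun_eq_iff)
 then show "ev n x k s = 0" using ev_comp[OF x, where k = k and s = s] ev_0[OF x] by simp
qed

lemma Fx_tbrk: assumes s: "s : mc_gr n d" and t: "t : mc_gr n e"
 shows "Fx n x (tbrk s t) = brk g (Fx n x s) (Fx n x t)"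
proof -
 have tbrk_add1: "tbrk (a + b) c = tbrk a c + tbrk b c" for a b c :: "'k tseries"
  by (simp add: tbrk_def fun_eq_iff sum.distrib[symmetric] algebra_simps)
 have tbrk_add2: "tbrk c (a + b) = tbrk c a + tbrk c b" for a b c :: "'k tseries"
  by (simp add: tbrk_def fun_eq_iff sum.distrib[symmetric] algebra_simps)
 have low: "brk g a b : fil g N (d' + e')" "brk g b a : fil g N (e' + d')"
  if "1 <= N" "a : fil g N d'" "b : gr g e'" for a b N d' e'
 proof -
  have b: "b : fil g 1 e'" unfolding fil_one by (rule that(3))
  have "brk g a b : fil g (N + 1) (d' + e')" "brk g b a : fil g (1 + N) (e' + d')"
   using brk_fil[OF that(1) order_refl that(2) b] brk_fil[OF order_refl that(1) b that(2)] .
  then show "brk g a b : fil g N (d' + e')" "brk g b a : fil g N (e' + d')"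
   using fil_mono[of N "N + 1"] that(1) by auto
 qed
 have 1: "Fx n x (tbrk a b) = brk g (Fx n x a) (Fx n x b)" if b: "lie_part n l e b" and a: "a : mc_gr n d" for a b l
 proof (rule agree[where n = n and d = d and e = "d + e" and P = "%a. Fx n x (tbrk a b)" and Q = "%a. brk g (Fx n x a) (Fx n x b)"])
  note B = lie_part_mc_gr[OF b]
  show "Fx n x (tbrk a b) : gr g (d + e)" "brk g (Fx n x a) (Fx n x b) : gr g (d + e)" if "a : mc_gr n d" for a
   using that B by (auto intro!: Fx_gr mc_gr_tbrk brk_degree)
  show "Fx n x (tbrk (a + a') b) = Fx n x (tbrk a b) + Fx n x (tbrk a' b)"
   "brk g (Fx n x (a + a')) (Fx n x b) = brk g (Fx n x a) (Fx n x b) + brk g (Fx n x a') (Fx n x b)"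
   if "a : mc_gr n d" "a' : mc_gr n d" for a a'
   using that B Fx_add[OF mc_gr_tbrk[OF that(1) B] mc_gr_tbrk[OF that(2) B]] Fx_add[OF that]
    brk_add[OF Fx_gr[OF that(1)] Fx_gr[OF that(2)] Fx_gr[OF B]] by (simp_all only: tbrk_add1)
  show "Fx n x (tbrk a b) : fil g N (d + e)" "brk g (Fx n x a) (Fx n x b) : fil g N (d + e)"
   if "1 <= N" "a : mc_gr n d" "!!w. length w < N ==> a w = 0" for a N
   using that B low(1)[OF that(1) Fx_fil[OF that] Fx_gr[OF B]]
   by (auto intro!: Fx_fil mc_gr_tbrk tbrk_low(1)[of N])
  show "Fx n x (tbrk a b) = brk g (Fx n x a) (Fx n x b)" if a: "lie_part n k d a" for k a
   using Fx_lie_part[OF lie_part.brk[OF a b]] Fx_lie_part[OF a] Fx_lie_part[OF b] ev_brk[OF x a b] by simp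
 qed (rule a)
 show ?thesis
 proof (rule agree[where n = n and d = e and e = "d + e" and P = "%b. Fx n x (tbrk s b)" and Q = "%b. brk g (Fx n x s) (Fx n x b)"])
  show "Fx n x (tbrk s b) : gr g (d + e)" "brk g (Fx n x s) (Fx n x b) : gr g (d + e)" if "b : mc_gr n e" for b
   using that s by (auto intro!: Fx_gr mc_gr_tbrk brk_degree)
  show "Fx n x (tbrk s (a + a')) = Fx n x (tbrk s a) + Fx n x (tbrk s a')"
   "brk g (Fx n x s) (Fx n x (a + a')) = brk g (Fx n x s) (Fx n x a) + brk g (Fx n x s) (Fx n x a')"
   if "a : mc_gr n e" "a' : mc_gr n e" for a a'
   using that s Fx_add[OF mc_gr_tbrk[OF s that(1)] mc_gr_tbrk[OF s that(2)]] Fx_add[OF that]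
    brk_add_right[OF Fx_gr[OF s] Fx_gr[OF that(1)] Fx_gr[OF that(2)]] by (simp_all only: tbrk_add2)
  show "Fx n x (tbrk s a) : fil g N (d + e)" "brk g (Fx n x s) (Fx n x a) : fil g N (d + e)"
   if "1 <= N" "a : mc_gr n e" "!!w. length w < N ==> a w = 0" for a N
   using that s low(2)[OF that(1) Fx_fil[OF that] Fx_gr[OF s]]
   by (auto intro!: Fx_fil mc_gr_tbrk tbrk_low(2)[of N])
  show "Fx n x (tbrk s b) = brk g (Fx n x s) (Fx n x b)" if "lie_part n k e b" for k b
   using 1[OF that s] .
 qed (rule t)
qed

lemma Fx_unique:
 assumes f: "!!d s. s : mc_gr n d ==> f s : gr g d"
  and fa: "!!d s t. s : mc_gr n d ==> t : mc_gr n d ==> f (s + t) = f s + f t"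
  and fs: "!!d c s. s : mc_gr n d ==> f (tscl c s) = scl g c (f s)"
  and fb: "!!d e s t. s : mc_gr n d ==> t : mc_gr n e ==> f (tbrk s t) = brk g (f s) (f t)"
  and ff: "!!N d s. 1 <= N ==> s : mc_gr n d ==> (!!w. length w < N ==> s w = 0) ==> f s : fil g N d"
  and fx: "!!I. I : faces n ==> f (xi I) = x I"
  and s: "s : mc_gr n d"
 shows "f s = Fx n x s"
proof (rule agree[where n = n and d = d and e = d])
 have f0: "f 0 = 0" using fa[of 0 0 0] by simp
 show "f s = Fx n x s" if "lie_part n k d s" for k d s
  using that
 proof (induction rule: lie_part.induct)
  case (gen I) then show ?case by (simp add: fx Fx_xi)
 next
  case (zero k d)
  have "Fx n x 0 = 0" using Fx_lie_part[OF lie_part.zero[of n 1 0]] ev_0[OF x] by simp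
  then show ?case using f0 by (simp only:)
 next
  case (add k d s t)
  then show ?case using fa Fx_add lie_part_mc_gr by metis
 next
  case (scl k d s c)
  then show ?case using fs Fx_tscl lie_part_mc_gr by metis
 next
  case (brk k d s l e t)
  then show ?case using fb Fx_tbrk lie_part_mc_gr by metis
 qed
qed (use f fa ff s Fx_gr Fx_add Fx_fil in blast)+

lemma Fx_mc_dif:
 assumes D: "!!I. I : faces n ==> (dxi n I :: 'k tseries) : mc_gr n (xdeg I + 1)"
  and G: "!!I. I : faces n ==> Fx n x (dxi n I) = dif g (x I)"
  and s: "s : mc_gr n d"
 shows "Fx n x (mc_dif n s) = dif g (Fx n x s)"
proof (rule agree[where n = n and d = d and e = "d + 1" and P = "%s. Fx n x (mc_dif n s)" and Q = "%s. dif g (Fx n x s)"])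
 have M: "mc_dif n s : mc_gr n (d + 1)" if "s : mc_gr n d" for s :: "'k tseries" and d
  using mc_dif_mc_gr[OF D that] .
 have D': "homog (xdeg I + 1) (dxi n I :: 'k tseries)" if "I : faces n" for I using D[OF that] mc_gr_homog by blast
 show "Fx n x (mc_dif n s) : gr g (d + 1)" "dif g (Fx n x s) : gr g (d + 1)" if "s : mc_gr n d" for s
  using that by (auto intro!: Fx_gr M dif_degree)
 show "Fx n x (mc_dif n (s + t)) = Fx n x (mc_dif n s) + Fx n x (mc_dif n t)"
  "dif g (Fx n x (s + t)) = dif g (Fx n x s) + dif g (Fx n x t)" if "s : mc_gr n d" "t : mc_gr n d" for s t
  using Fx_add[OF M[OF that(1)] M[OF that(2)]] Fx_add[OF that] dif_add[OF Fx_gr[OF that(1)] Fx_gr[OF that(2)]]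
  by (simp_all only: mc_dif_add)
 show "Fx n x (mc_dif n s) : fil g N (d + 1)" "dif g (Fx n x s) : fil g N (d + 1)"
  if "1 <= N" "s : mc_gr n d" "!!w. length w < N ==> s w = 0" for s N
  using that dif_fil[OF that(1) Fx_fil[OF that]] mc_dif_low[of N s] by (auto intro!: Fx_fil M)
 show "Fx n x (mc_dif n s) = dif g (Fx n x s)" if "lie_part n k d s" for k d s
  using that
 proof (induction rule: lie_part.induct)
  case (gen I)
  then show ?case using G by (simp add: mc_dif_xi Fx_xi)
 next
  case (zero k d)
  have "Fx n x 0 = 0" using Fx_lie_part[OF lie_part.zero[of n 1 0]] ev_0[OF x] by simp
  then show ?case unfolding mc_dif_zero by (simp only: dif_0)
 next
  case (add k d s t)
  note S = lie_part_mc_gr[OF add(1)] and T = lie_part_mc_gr[OF add(2)]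
  show ?case unfolding mc_dif_add Fx_add[OF M[OF S] M[OF T]] Fx_add[OF S T]
    dif_add[OF Fx_gr[OF S] Fx_gr[OF T]] add.IH ..
 next
  case (scl k d s c)
  note S = lie_part_mc_gr[OF scl(1)]
  show ?case unfolding mc_dif_tscl Fx_tscl[OF M[OF S]] Fx_tscl[OF S] dif_scl[OF Fx_gr[OF S]] scl.IH ..
 next
  case (brk k d s l e t)
  note S = lie_part_mc_gr[OF brk(1)] and T = lie_part_mc_gr[OF brk(2)]
  have a: "tbrk (mc_dif n s) t : mc_gr n (d + e + 1)" "tbrk s (mc_dif n t) : mc_gr n (d + e + 1)"
   using mc_gr_tbrk[OF M[OF S] T] mc_gr_tbrk[OF S M[OF T]] by (simp_all add: algebra_simps)
  have m: "mc_dif n (tbrk s t) = tbrk (mc_dif n s) t + tscl (sg d) (tbrk s (mc_dif n t))"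
   by (rule mc_dif_tbrk[OF mc_gr_homog[OF S] mc_gr_homog[OF T] D'])
  show ?case unfolding m Fx_add[OF a(1) mc_gr_tscl[OF a(2)]]
   Fx_tscl[OF a(2)] Fx_tbrk[OF M[OF S] T] Fx_tbrk[OF S M[OF T]] Fx_tbrk[OF S T] brk.IH
   dif_brk[OF Fx_gr[OF S] Fx_gr[OF T]] ..
 qed
qed (rule s)

end

end

section \<open>Sums over compositions\<close>

definition dsum :: "('a => 'a => 'a multiset => 'v::comm_monoid_add) => 'a multiset => 'v" where
 "dsum F M = (\<Sum>x\<in>#M. \<Sum>y\<in>#M - {#x#}. F x y (M - {#x#} - {#y#}))"

lemma sum_mset_cong: "(!!x. x \<in># M ==> f x = g x) ==> (\<Sum>x\<in>#M. f x) = (\<Sum>x\<in>#M. g x)"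
 by (metis (mono_tags, lifting) image_mset_cong)

lemma sum_mset_add: "(\<Sum>x\<in>#M. f x + g x) = (\<Sum>x\<in>#M. f x) + (\<Sum>x\<in>#M. g x :: 'v::comm_monoid_add)"
 by (rule sum_mset.distrib)

lemma dsum_cong:
 assumes "!!x y R. M = add_mset x (add_mset y R) ==> F x y R = G x y R" shows "dsum F M = dsum G M"
 unfolding dsum_def
proof (intro sum_mset_cong)
 fix x y assume "x \<in># M" "y \<in># M - {#x#}"
 then have "M = add_mset x (add_mset y (M - {#x#} - {#y#}))" by (simp del: diff_diff_add_mset)
 from assms[OF this] show "F x y (M - {#x#} - {#y#}) = G x y (M - {#x#} - {#y#})" .
qed

lemma dsum_add: "dsum (%x y R. F x y R + G x y R) M = dsum F M + (dsum G M :: 'v::comm_monoid_add)"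
 by (simp add: dsum_def sum_mset_add)

lemma dsum_add_mset:
 "dsum F (add_mset a M) = (\<Sum>y\<in>#M. F a y (M - {#y#})) + (\<Sum>x\<in>#M. F x a (M - {#x#}))
   + dsum (%x y R. F x y (add_mset a R)) M"
proof -
 have "(\<Sum>y\<in>#add_mset a M - {#x#}. F x y (add_mset a M - {#x#} - {#y#}))
   = F x a (M - {#x#}) + (\<Sum>y\<in>#M - {#x#}. F x y (add_mset a (M - {#x#} - {#y#})))" if "x \<in># M" for x
 proof -
  have e: "add_mset a M - {#x#} = add_mset a (M - {#x#})" using that by simp
  have "(\<Sum>y\<in>#M - {#x#}. F x y (add_mset a (M - {#x#}) - {#y#}))
   = (\<Sum>y\<in>#M - {#x#}. F x y (add_mset a (M - {#x#} - {#y#})))"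
   by (rule sum_mset_cong) (simp del: diff_diff_add_mset)
  then show ?thesis unfolding e by (simp del: diff_diff_add_mset)
 qed
 then have "(\<Sum>x\<in>#M. \<Sum>y\<in>#add_mset a M - {#x#}. F x y (add_mset a M - {#x#} - {#y#}))
   = (\<Sum>x\<in>#M. F x a (M - {#x#}) + (\<Sum>y\<in>#M - {#x#}. F x y (add_mset a (M - {#x#} - {#y#}))))"
  by (rule sum_mset_cong)
 then show ?thesis by (simp add: dsum_def sum_mset_add add.assoc)
qed

lemma sum_index_mset: "(\<Sum>i<length w. F (w ! i)) = (\<Sum>x\<in>#mset w. F x)"
proof -
 have "(\<Sum>x\<in>#mset w. F x) = sum_list (map F w)" by (induction w) auto
 then show ?thesis by (simp add: sum_list_sum_nth atLeast0LessThan)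
qed

text \<open>
  A symmetric sum over ordered pairs of letters counts every pair of positions \<open>i <
  j\<close> twice.
\<close>

lemma dsum_index:
 fixes F :: "'a => 'a => 'a multiset => 'v::comm_monoid_add"
 assumes "!!x y R. F x y R = F y x R"
 shows "dsum F (mset w) = (\<Sum>j<length w. \<Sum>i<j. F (w ! i) (w ! j) (mset (nths w (- {i, j}))))
   + (\<Sum>j<length w. \<Sum>i<j. F (w ! i) (w ! j) (mset (nths w (- {i, j}))))"
 using assms
proof (induction w arbitrary: F)
 case Nil
 show ?case by (simp add: dsum_def)
next
 case (Cons a w)
 let ?S = "%F w. \<Sum>j<length w. \<Sum>i<j. F (w ! i) (w ! j) (mset (nths w (- {i, j})))"
 have nn: "nths (a # w) (- {Suc i, Suc j}) = a # nths w (- {i, j})" for i j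
  by (simp add: nths_Cons) (rule arg_cong[where f = "nths w"], auto)
 have n0: "nths (a # w) (- {0, Suc j}) = nths w (- {j})" for j
  by (simp add: nths_Cons) (rule arg_cong[where f = "nths w"], auto)
 have m1: "mset (nths v (- {j})) = mset v - {#v ! j#}" if "j < length v" for v :: "'a list" and j
  using that
 proof (induction v arbitrary: j)
  case (Cons b v)
  show ?case
  proof (cases j)
   case 0
   then show ?thesis by (simp add: nths_Cons nths_all)
  next
   case (Suc i)
   have "nths (b # v) (- {Suc i}) = b # nths v (- {i})"
    by (simp add: nths_Cons) (rule arg_cong[where f = "nths v"], auto)
   moreover have "v ! i \<in># mset v" using Suc Cons by simp
   ultimately show ?thesis using Cons Suc by simp
  qed
 qed simp
 have "?S F (a # w) = (\<Sum>j<length w. \<Sum>i<Suc j. F ((a # w) ! i) (w ! j) (mset (nths (a # w) (- {i, Suc j}))))"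
  by (simp add: sum.lessThan_Suc_shift del: sum.lessThan_Suc)
 also have "... = (\<Sum>j<length w. F a (w ! j) (mset w - {#w ! j#})) + ?S (%x y R. F x y (add_mset a R)) w"
  by (simp add: sum.lessThan_Suc_shift nn n0 m1 sum.distrib del: sum.lessThan_Suc)
 also have "(\<Sum>j<length w. F a (w ! j) (mset w - {#w ! j#})) = (\<Sum>y\<in>#mset w. F a y (mset w - {#y#}))"
  by (rule sum_index_mset)
 finally have S: "?S F (a # w) = (\<Sum>y\<in>#mset w. F a y (mset w - {#y#})) + ?S (%x y R. F x y (add_mset a R)) w" .
 have sy: "F x a R = F a x R" for x R by (rule Cons.prems)
 have IH: "dsum (%x y R. F x y (add_mset a R)) (mset w)
   = ?S (%x y R. F x y (add_mset a R)) w + ?S (%x y R. F x y (add_mset a R)) w"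
  by (rule Cons.IH) (rule Cons.prems)
 show ?case unfolding S mset.simps dsum_add_mset IH sy by (simp add: add_ac)
qed

text \<open>
  The sum of \<open>F\<close> over the compositions of \<open>N\<close> into \<open>m\<close>
  positive parts; \<open>F\<close> only sees the multiset of the parts.
\<close>

primrec CS :: "nat => nat => (nat multiset => 'v::comm_monoid_add) => 'v" where
 "CS 0 N F = (if N = 0 then F {#} else 0)"
| "CS (Suc m) N F = (\<Sum>x\<in>{1..N}. CS m (N - x) (%M. F (add_mset x M)))"

lemma CS_cong:
 "(!!M. size M = m ==> sum_mset M = N ==> 0 \<notin># M ==> F M = G M) ==> CS m N F = CS m N G"
proof (induction m arbitrary: N F G)
 case (Suc m)
 have "CS m (N - x) (%M. F (add_mset x M)) = CS m (N - x) (%M. G (add_mset x M))" if "x : {1..N}" for x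
  by (rule Suc.IH) (use that in \<open>auto intro!: Suc.prems\<close>)
 then show ?case by simp
qed simp

lemma CS_add: "CS m N (%M. F M + G M) = CS m N F + CS m N G"
 by (induction m arbitrary: N F G) (auto simp: sum.distrib)

lemma CS_zero: "CS m N (%M. 0) = 0"
 by (induction m arbitrary: N) auto

lemma CS_sum: "CS m N (%M. \<Sum>i\<in>A. F i M) = (\<Sum>i\<in>A. CS m N (F i))"
 by (induction A rule: infinite_finite_induct) (simp_all add: CS_add CS_zero)

lemma CS_less: "N < m ==> CS m N F = 0"
 by (induction m arbitrary: N F) (auto intro!: sum.neutral)

lemma CS_diag: "CS N N F = F (replicate_mset N 1)"
proof (induction N arbitrary: F)
 case (Suc N)
 have "CS (Suc N) (Suc N) F = (\<Sum>x\<in>{1..Suc N}. if x = 1 then CS N N (%M. F (add_mset 1 M)) else 0)"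
  unfolding CS.simps by (intro sum.cong) (auto intro!: CS_less)
 then show ?case using Suc[of "%M. F (add_mset 1 M)"] by simp
qed simp

lemma sum_triangle:
 "(\<Sum>x\<in>{1..N}. \<Sum>y\<in>{1..N - x}. G x y) = (\<Sum>s\<in>{2..N}. \<Sum>x\<in>{1..<s}. G x (s - x) :: 'v::comm_monoid_add)"
 for N :: nat
 unfolding sum.Sigma[OF finite_atLeastAtMost ballI[OF finite_atLeastAtMost]]
  sum.Sigma[OF finite_atLeastAtMost ballI[OF finite_atLeastLessThan]]
 by (rule sum.reindex_bij_witness[of _ "%(s, x). (x, s - x)" "%(x, y). (x + y, x)"]) auto

lemma sum_triangle_swap:
 "(\<Sum>x\<in>{1..N}. \<Sum>y\<in>{1..N - x}. G x y) = (\<Sum>y\<in>{1..N}. \<Sum>x\<in>{1..N - y}. G x y :: 'v::comm_monoid_add)"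
 for N :: nat
 unfolding sum.Sigma[OF finite_atLeastAtMost ballI[OF finite_atLeastAtMost]]
 by (rule sum.reindex_bij_witness[of _ "%(s, x). (x, s)" "%(s, x). (x, s)"]) auto

lemma dsum_image: "dsum F (image_mset f M) = dsum (%x y R. F (f x) (f y) (image_mset f R)) M"
proof -
 have "(\<Sum>y\<in>#image_mset f M - {#f x#}. F (f x) y (image_mset f M - {#f x#} - {#y#}))
  = (\<Sum>y\<in>#M - {#x#}. F (f x) (f y) (image_mset f (M - {#x#} - {#y#})))" if x: "x \<in># M" for x
 proof -
  have e: "image_mset f M - {#f x#} = image_mset f (M - {#x#})" using x by (simp add: image_mset_Diff)
  show ?thesis unfolding e image_mset.compositionality o_def
  proof (rule sum_mset_cong)
   fix y assume "y \<in># M - {#x#}"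
   then have "image_mset f (M - {#x#} - {#y#}) = image_mset f (M - {#x#}) - {#f y#}"
    by (subst image_mset_Diff) simp_all
   then show "F (f x) (f y) (image_mset f (M - {#x#}) - {#f y#}) = F (f x) (f y) (image_mset f (M - {#x#} - {#y#}))"
    by simp
  qed
 qed
 then show ?thesis unfolding dsum_def image_mset.compositionality o_def by (intro sum_mset_cong)
qed

context vector_space begin

lemma CS_scale: "CS m N (%M. scale c (F M)) = scale c (CS m N F)"
 by (induction m arbitrary: N F) (auto simp: scale_sum_right)

text \<open>
  Choosing an entry of a composition and removing it: each composition with a marked entry is
  obtained from \<open>m + 1\<close> positions of the mark.
\<close>

lemma CS_pick:
 "CS (Suc m) N (%M. \<Sum>x\<in>#M. F x (M - {#x#})) = scale (of_nat (Suc m)) (\<Sum>x\<in>{1..N}. CS m (N - x) (F x))"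
proof (induction m arbitrary: N F)
 case 0
 have "CS (Suc 0) N (%M. \<Sum>x\<in>#M. F x (M - {#x#})) = (\<Sum>x\<in>{1..N}. CS 0 (N - x) (F x))"
  unfolding CS.simps by (rule sum.cong) auto
 then show ?case by (simp del: CS.simps)
next
 case (Suc m)
 let ?G = "%x y M. F y (add_mset x M)"
 have add_diff: "(\<Sum>y\<in>#M. F y (add_mset x M - {#y#})) = (\<Sum>y\<in>#M. F y (add_mset x (M - {#y#})))" for x M
  by (rule sum_mset_cong) simp
 have "CS (Suc (Suc m)) N (%M. \<Sum>x\<in>#M. F x (M - {#x#}))
   = (\<Sum>x\<in>{1..N}. CS (Suc m) (N - x) (%M. F x M + (\<Sum>y\<in>#M. ?G x y (M - {#y#}))))"
  unfolding CS.simps(2)[of "Suc m" N]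
  by (intro sum.cong refl arg_cong[where f = "CS (Suc m) _"] ext) (simp add: add_diff)
 also have "... = (\<Sum>x\<in>{1..N}. CS (Suc m) (N - x) (F x))
   + (\<Sum>x\<in>{1..N}. scale (of_nat (Suc m)) (\<Sum>y\<in>{1..N - x}. CS m (N - x - y) (?G x y)))"
 proof -
  have "CS (Suc m) (N - x) (%M. F x M + (\<Sum>y\<in>#M. ?G x y (M - {#y#})))
   = CS (Suc m) (N - x) (F x) + scale (of_nat (Suc m)) (\<Sum>y\<in>{1..N - x}. CS m (N - x - y) (?G x y))" for x
   unfolding Suc.IH[symmetric] by (rule CS_add)
  then have "(\<Sum>x\<in>{1..N}. CS (Suc m) (N - x) (%M. F x M + (\<Sum>y\<in>#M. ?G x y (M - {#y#}))))
   = (\<Sum>x\<in>{1..N}. CS (Suc m) (N - x) (F x) + scale (of_nat (Suc m)) (\<Sum>y\<in>{1..N - x}. CS m (N - x - y) (?G x y)))"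
   by (intro sum.cong refl)
  then show ?thesis by (rule trans[OF _ sum.distrib])
 qed
 also have "(\<Sum>x\<in>{1..N}. scale (of_nat (Suc m)) (\<Sum>y\<in>{1..N - x}. CS m (N - x - y) (?G x y)))
   = scale (of_nat (Suc m)) (\<Sum>y\<in>{1..N}. \<Sum>x\<in>{1..N - y}. CS m (N - x - y) (?G x y))"
  unfolding scale_sum_right[symmetric] by (subst sum_triangle_swap) (rule refl)
 also have "(\<Sum>y\<in>{1..N}. \<Sum>x\<in>{1..N - y}. CS m (N - x - y) (?G x y)) = (\<Sum>y\<in>{1..N}. CS (Suc m) (N - y) (F y))"
  unfolding CS.simps(2)[of m] by (intro sum.cong refl) (simp add: add.commute)
 finally show ?case unfolding of_nat_Suc[of "Suc m"] scale_left_distrib scale_one .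
qed

end

section \<open>The transfer formula on a sum of equal letters\<close>

text \<open>
  The data that survive of a contraction when only elements of degree one are considered:
  \<open>hl\<close> is \<open>h\<close> after the bracket, \<open>pl\<close> a component of
  \<open>p\<close> after the bracket, \<open>Y\<close> is contained in the kernels of
  \<open>h\<close> and \<open>p\<close>, and \<open>a\<close> is the image of \<open>i\<close>.
\<close>

locale quadratic_transfer = A: vector_space s1 + B: vector_space s2
 for s1 :: "'k::field_char_0 => 'b::ab_group_add => 'b" and s2 :: "'k => 'v::ab_group_add => 'v" +
 fixes V Y :: "'b set" and hl :: "'b => 'b => 'b" and pl :: "'b => 'b => 'v" and a :: 'b
 assumes Y: "A.subspace Y" and Y_V: "Y \<subseteq> V" and a_V: "a : V"
  and hl_Y: "!!x y. x : V ==> y : V ==> hl x y : Y"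
  and hl_sym: "!!x y. x : V ==> y : V ==> hl x y = hl y x"
  and pl_sym: "!!x y. x : V ==> y : V ==> pl x y = pl y x"
  and hl_lin: "!!c x y z. x : V ==> y : V ==> z : V ==> hl (s1 c x + y) z = s1 c (hl x z) + hl y z"
  and pl_lin: "!!c x y z. x : V ==> y : V ==> z : V ==> pl (s1 c x + y) z = s2 c (pl x z) + pl y z"
begin

text \<open>
  A letter is marked \<open>None\<close> if it is the given element \<open>a\<close> and
  \<open>Some y\<close> if it was created by \<open>hl\<close>. Marks are needed because the value
  of a letter alone does not tell which kind it is.
\<close>

primrec val :: "'b option => 'b" where "val None = a" | "val (Some y) = y"

definition marks :: "'b option multiset => bool" where "marks M \<longleftrightarrow> (\<forall>y. Some y \<in># M --> y : Y)"

definition qn :: "'b option multiset => nat" where "qn M = size (filter_mset (%z. z ~= None) M)"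

primrec hv :: "nat => 'b option multiset => 'v" where
 "hv 0 M = s2 (1 / 2) (dsum (%x y R. pl (val x) (val y)) M)"
| "hv (Suc k) M = s2 (- (1 / 2)) (dsum (%x y R. s2 (1 / of_nat (qn R + 1))
   (hv k (add_mset (Some (hl (val x) (val y))) R))) M)"

lemma marks_add: "marks (add_mset z M) \<longleftrightarrow> (\<forall>y. z = Some y --> y : Y) & marks M"
 by (auto simp: marks_def)
lemma val_V: "marks (add_mset z M) ==> val z : V"
 using a_V Y_V by (cases z) (auto simp: marks_add)
lemma Y_lin: "x : Y ==> y : Y ==> s1 c x + y : Y"
 using Y by (simp add: A.subspace_add A.subspace_scale)
lemma qn_Some: "qn (add_mset (Some y) M) = Suc (qn M)" by (simp add: qn_def)

lemma mset_scale: "(\<Sum>x\<in>#M. s2 c (f x)) = s2 c (\<Sum>x\<in>#M. f x)"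
 by (induction M) (auto simp: B.scale_right_distrib)

lemma dsum_scale: "dsum (%x y R. s2 c (F x y R)) M = s2 c (dsum F M)"
 by (simp only: dsum_def mset_scale)

lemma dsum_lin:
 "dsum (%x y R. s2 c (F x y R) + G x y R) M = s2 c (dsum F M) + dsum G M"
 by (simp add: dsum_add dsum_scale)
lemma mset_lin: "(\<Sum>x\<in>#M. s2 c (f x) + h x) = s2 c (\<Sum>x\<in>#M. f x) + (\<Sum>x\<in>#M. h x)"
 by (induction M) (auto simp: B.scale_right_distrib add_ac)

text \<open>
  The slot of a newly created letter stays linear through the whole recursion, because the weights
  \<open>1/(q+1)\<close> depend only on the number of such letters.
\<close>

lemma hv_lin:
 assumes "x : Y" "y : Y" "marks M" "size M = Suc k"
 shows "hv k (add_mset (Some (s1 c x + y)) M) = s2 c (hv k (add_mset (Some x) M)) + hv k (add_mset (Some y) M)"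
 using assms
proof (induction k arbitrary: x y M)
 case 0
 let ?z = "s1 c x + y"
 have V: "x : V" "y : V" "?z : V" using 0 Y_V Y_lin by auto
 obtain m where M: "M = {#m#}" using 0(4) size_1_singleton_mset[of M] by auto
 have m: "val m : V" using 0(3) val_V M by blast
 have h: "hv 0 (add_mset (Some u) M) = pl u (val m)" if "u : V" for u
  using pl_sym[OF that m] B.scale_left_distrib[of "1 / 2" "1 / 2" "pl u (val m)"] by (simp add: M dsum_def B.scale_right_distrib)
 show ?case unfolding h[OF V(1)] h[OF V(2)] h[OF V(3)] by (rule pl_lin[OF V(1,2) m])
next
 case (Suc k)
 let ?z = "s1 c x + y"
 have V: "x : V" "y : V" "?z : V" using Suc Y_V Y_lin by auto
 define K where "K u = s2 (1 / of_nat (qn u + 1)) \<circ> hv k" for u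
 have vV: "val z : V" "marks (M - {#z#})" "size (M - {#z#}) = Suc k" if "z \<in># M" for z
  using that Suc.prems(3,4) val_V[of z "M - {#z#}"] marks_add[of z "M - {#z#}"] by (simp_all add: size_Diff_singleton)
 let ?A = "%u z. s2 (1 / of_nat (qn (M - {#z#}) + 1)) (hv k (add_mset (Some (hl u (val z))) (M - {#z#})))"
 have 1: "(\<Sum>z\<in>#M. ?A ?z z) = (\<Sum>z\<in>#M. s2 c (?A x z) + ?A y z)"
 proof (rule sum_mset_cong)
  fix z assume "z \<in># M"
  note z = vV[OF this]
  show "?A ?z z = s2 c (?A x z) + ?A y z"
   unfolding hl_lin[OF V(1,2) z(1)] Suc.IH[OF hl_Y[OF V(1) z(1)] hl_Y[OF V(2) z(1)] z(2,3)]
   by (simp add: B.scale_right_distrib mult.commute)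
 qed
 let ?B = "%u z. s2 (1 / of_nat (qn (M - {#z#}) + 1)) (hv k (add_mset (Some (hl (val z) u)) (M - {#z#})))"
 have 2: "(\<Sum>z\<in>#M. ?B u z) = (\<Sum>z\<in>#M. ?A u z)" if "u : V" for u
  by (rule sum_mset_cong) (simp add: hl_sym[OF that vV(1)])
 let ?C = "%u s t R. s2 (1 / of_nat (qn (add_mset (Some u) R) + 1)) (hv k (add_mset (Some (hl (val s) (val t))) (add_mset (Some u) R)))"
 have 3: "dsum (?C ?z) M = dsum (%s t R. s2 c (?C x s t R) + ?C y s t R) M"
 proof (rule dsum_cong)
  fix s t R assume M: "M = add_mset s (add_mset t R)"
  have st: "val s : V" "val t : V" "marks R" "size R = k"
   using Suc.prems(3,4) val_V[of s "add_mset t R"] val_V[of t R] by (auto simp: M marks_add)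
  have m: "marks (add_mset (Some (hl (val s) (val t))) R)" "size (add_mset (Some (hl (val s) (val t))) R) = Suc k"
   using st hl_Y by (simp_all add: marks_add)
  show "?C ?z s t R = s2 c (?C x s t R) + ?C y s t R"
   unfolding add_mset_commute[of "Some (hl _ _)"] Suc.IH[OF Suc.prems(1,2) m]
   by (simp add: B.scale_right_distrib mult.commute qn_Some)
 qed
 have h: "hv (Suc k) (add_mset (Some u) M) = s2 (- (1 / 2)) ((\<Sum>z\<in>#M. ?A u z) + (\<Sum>z\<in>#M. ?A u z) + dsum (?C u) M)"
  if "u : V" for u unfolding hv.simps dsum_add_mset val.simps 2[OF that] ..
 show ?case unfolding h[OF V(1)] h[OF V(2)] h[OF V(3)] 1 3 dsum_lin mset_lin
  by (simp only: B.scale_right_distrib B.scale_scale mult.commute add_ac)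
qed

lemma hv_zero:
 assumes "marks M" "size M = Suc k" shows "hv k (add_mset (Some 0) M) = 0"
 using hv_lin[of 0 0 M k 1] assms Y by (simp add: A.subspace_0)

lemma hv_sum:
 assumes "marks M" "size M = Suc k" "!!i. i : S ==> f i : Y"
 shows "hv k (add_mset (Some (s1 c (sum f S))) M) = s2 c (\<Sum>i\<in>S. hv k (add_mset (Some (f i)) M))"
proof -
 have Y0: "0 : Y" using Y by (rule A.subspace_0)
 have "sum f S : Y & hv k (add_mset (Some (sum f S)) M) = (\<Sum>i\<in>S. hv k (add_mset (Some (f i)) M))"
  using assms(3)
 proof (induction S rule: infinite_finite_induct)
  case (insert i S)
  then show ?case using hv_lin[of "f i" "sum f S" M k 1] assms(1,2) Y by (simp add: A.subspace_add)
 qed (simp_all add: hv_zero[OF assms(1,2)] Y0)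
 then show ?thesis using hv_lin[of "sum f S" 0 M k c] Y0 assms(1,2) by (simp add: hv_zero)
qed

lemma sum_mset_if: "(\<Sum>x\<in>#M. if P x then c else 0) = s2 (of_nat (size (filter_mset P M))) c"
 by (induction M) (auto simp: B.scale_left_distrib)

lemma CS_dsum:
 "CS (Suc (Suc m)) N (dsum G) = s2 (of_nat (Suc (Suc m) * Suc m))
   (\<Sum>s\<in>{2..N}. CS m (N - s) (%R. \<Sum>x\<in>{1..<s}. G x (s - x) R))"
proof -
 have "CS (Suc (Suc m)) N (dsum G) = CS (Suc (Suc m)) N (%M. \<Sum>x\<in>#M. \<Sum>y\<in>#M - {#x#}. G x y (M - {#x#} - {#y#}))"
  by (intro arg_cong[where f = "CS _ _"] ext dsum_def)
 also have "... = s2 (of_nat (Suc (Suc m))) (\<Sum>x\<in>{1..N}. CS (Suc m) (N - x) (%M. \<Sum>y\<in>#M. G x y (M - {#y#})))"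
  by (rule B.CS_pick)
 also have "(\<Sum>x\<in>{1..N}. CS (Suc m) (N - x) (%M. \<Sum>y\<in>#M. G x y (M - {#y#})))
   = s2 (of_nat (Suc m)) (\<Sum>x\<in>{1..N}. \<Sum>y\<in>{1..N - x}. CS m (N - x - y) (G x y))"
  unfolding B.CS_pick B.scale_sum_right ..
 also have "(\<Sum>x\<in>{1..N}. \<Sum>y\<in>{1..N - x}. CS m (N - x - y) (G x y))
   = (\<Sum>s\<in>{2..N}. CS m (N - s) (%R. \<Sum>x\<in>{1..<s}. G x (s - x) R))"
  unfolding sum_triangle CS_sum by (intro sum.cong refl) simp
 finally show ?thesis by (simp only: B.scale_scale of_nat_mult)
qed

context
 fixes J :: "nat => 'b"
 assumes J1: "J 1 = a"
  and J: "!!s. 2 <= s ==> J s = s1 (- (1 / 2)) (\<Sum>x\<in>{1..<s}. hl (J x) (J (s - x)))"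
begin

lemma J_V_Y: "(1 <= s --> J s : V) & (2 <= s --> J s : Y)"
proof (induction s rule: less_induct)
 case (less s)
 have "J s : Y" if s: "2 <= s"
 proof -
  have "hl (J x) (J (s - x)) : Y" if "x : {1..<s}" for x using that less[of x] less[of "s - x"] by (intro hl_Y) auto
  then show ?thesis unfolding J[OF s] using Y by (intro A.subspace_scale A.subspace_sum) auto
 qed
 moreover have "J s : V" if "s = 1" using that J1 a_V by simp
 ultimately show ?case using Y_V by (cases "s = 1") auto
qed

definition mk :: "nat => 'b option" where "mk r = (if r = 1 then None else Some (J r))"

lemma val_mk [simp]: "val (mk r) = J r" using J1 by (simp add: mk_def)

lemma marks_mk: "0 \<notin># M ==> marks (image_mset mk M)"
proof (induction M)
 case (add r M)
 have "mk r = Some y ==> y : Y" for y using J_V_Y[of r] add(2) by (auto simp: mk_def split: if_splits)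
 then show ?case using add by (simp add: marks_add)
qed (simp add: marks_def)

lemma qn_mk: "qn (image_mset mk M) = size (filter_mset (%r. r ~= 1) M)"
 by (simp add: qn_def filter_mset_image_mset mk_def[abs_def] comp_def if_distrib cong: if_cong)

text \<open>
  Joining two of the \<open>m + 1\<close> entries of a composition gives an entry \<open>s \<ge>
  2\<close>, and the sum over its decompositions is \<open>J\<^sub>s\<close>. Every composition
  into \<open>m\<close> parts arises once for each of its \<open>q\<close> entries greater than
  \<open>1\<close>, which compensates the weight \<open>1/q\<close>.
\<close>

lemma transfer_step:
 assumes "Suc (Suc k) < N"
 shows "CS (Suc (Suc (Suc k))) N (%M. hv (Suc k) (image_mset mk M))
  = s2 (of_nat (Suc (Suc (Suc k)))) (CS (Suc (Suc k)) N (%M. hv k (image_mset mk M)))"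
proof -
 define F where "F s R = s2 (1 / of_nat (qn (image_mset mk R) + 1)) (hv k (add_mset (Some (J s)) (image_mset mk R)))" for s R
 define G where "G x y R = s2 (1 / of_nat (qn (image_mset mk R) + 1)) (hv k (add_mset (Some (hl (J x) (J y))) (image_mset mk R)))" for x y R
 define F' where "F' s R = (if s = 1 then 0 else F s R)" for s R
 have GF: "s2 (- (1 / 2)) (CS (Suc k) M (%R. \<Sum>x\<in>{1..<s}. G x (s - x) R)) = CS (Suc k) M (F s)" if s: "2 <= s" for s M
  unfolding B.CS_scale[symmetric]
 proof (rule CS_cong)
  fix R :: "nat multiset" assume R: "size R = Suc k" "0 \<notin># R"
  have hl: "hl (J x) (J (s - x)) : Y" if "x : {1..<s}" for x
   using that J_V_Y[of x] J_V_Y[of "s - x"] by (intro hl_Y) auto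
  have "hv k (add_mset (Some (J s)) (image_mset mk R))
   = s2 (- (1 / 2)) (\<Sum>x\<in>{1..<s}. hv k (add_mset (Some (hl (J x) (J (s - x)))) (image_mset mk R)))"
   unfolding J[OF s] by (rule hv_sum[OF marks_mk[OF R(2)] _ hl]) (use R in simp_all)
  then show "s2 (- (1 / 2)) (\<Sum>x\<in>{1..<s}. G x (s - x) R) = F s R"
   by (simp add: F_def G_def B.scale_sum_right mult.commute)
 qed
 have "CS (Suc (Suc (Suc k))) N (%M. hv (Suc k) (image_mset mk M)) = s2 (- (1 / 2)) (CS (Suc (Suc (Suc k))) N (dsum G))"
  unfolding hv.simps B.CS_scale dsum_image val_mk G_def[abs_def] ..
 also have "... = s2 (of_nat (Suc (Suc (Suc k)))) (s2 (of_nat (Suc (Suc k)))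
   (\<Sum>s\<in>{2..N}. s2 (- (1 / 2)) (CS (Suc k) (N - s) (%R. \<Sum>x\<in>{1..<s}. G x (s - x) R))))"
  unfolding CS_dsum B.scale_sum_right[symmetric] B.scale_scale by (rule arg_cong[where f = "%c. s2 c _"]) (simp add: algebra_simps)
 also have "(\<Sum>s\<in>{2..N}. s2 (- (1 / 2)) (CS (Suc k) (N - s) (%R. \<Sum>x\<in>{1..<s}. G x (s - x) R))) = (\<Sum>s\<in>{2..N}. CS (Suc k) (N - s) (F s))"
  by (rule sum.cong[OF refl GF]) simp
 also have "... = (\<Sum>s\<in>{1..N}. CS (Suc k) (N - s) (F' s))"
  by (rule sum.mono_neutral_cong_left) (auto simp: F'_def[abs_def] CS_zero simp del: CS.simps)
 also have "s2 (of_nat (Suc (Suc k))) ... = CS (Suc (Suc k)) N (%M. \<Sum>x\<in>#M. F' x (M - {#x#}))"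
  by (rule B.CS_pick[symmetric])
 also have "... = CS (Suc (Suc k)) N (%M. hv k (image_mset mk M))"
 proof (rule CS_cong)
  fix M :: "nat multiset" assume M: "size M = Suc (Suc k)" "sum_mset M = N" "0 \<notin># M"
  let ?q = "size (filter_mset (%r. r ~= 1) M)"
  have q: "?q ~= 0"
  proof
   assume "?q = 0"
   then have "\<forall>r\<in>#M. r = 1" by simp
   moreover have "sum_mset M = size M" if "\<forall>r\<in>#M. r = 1" for M :: "nat multiset"
    using that by (induction M) auto
   ultimately have "sum_mset M = size M" by blast
   then show False using M assms by simp
  qed
  have "F' x (M - {#x#}) = (if x ~= 1 then s2 (1 / of_nat ?q) (hv k (image_mset mk M)) else 0)" if x: "x \<in># M" for x
  proof (cases "x = 1")
   case False
   have e: "image_mset mk M = add_mset (Some (J x)) (image_mset mk (M - {#x#}))"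
    using insert_DiffM[OF x] False by (metis image_mset_add_mset mk_def)
   have q: "?q = Suc (qn (image_mset mk (M - {#x#})))" unfolding qn_mk[symmetric] e by (rule qn_Some)
   show ?thesis unfolding q F'_def F_def e using False by (simp add: add.commute)
  qed (simp add: F'_def)
  then have e: "(\<Sum>x\<in>#M. F' x (M - {#x#})) = (\<Sum>x\<in>#M. if x ~= 1 then s2 (1 / of_nat ?q) (hv k (image_mset mk M)) else 0)"
   by (rule sum_mset_cong)
  have "of_nat j * (1 / of_nat j) = (1 :: 'k)" if "j ~= 0" for j :: nat using that by simp
  note q1 = this[OF q]
  show "(\<Sum>x\<in>#M. F' x (M - {#x#})) = hv k (image_mset mk M)"
   unfolding e sum_mset_if B.scale_scale q1 by (rule B.scale_one)
 qed
 finally show ?thesis .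
qed

lemma transfer_two: "2 <= N ==> CS 2 N (%M. hv 0 (image_mset mk M)) = (\<Sum>x\<in>{1..<N}. pl (J x) (J (N - x)))"
proof -
 assume N: "2 <= N"
 have "CS (Suc (Suc 0)) N (%M. hv 0 (image_mset mk M)) = s2 (1 / 2) (CS (Suc (Suc 0)) N (dsum (%x y R. pl (J x) (J y))))"
  unfolding hv.simps B.CS_scale dsum_image val_mk ..
 also have "... = (\<Sum>s\<in>{2..N}. CS 0 (N - s) (%R. \<Sum>x\<in>{1..<s}. pl (J x) (J (s - x))))"
  unfolding CS_dsum B.scale_scale by simp
 also have "... = (\<Sum>s\<in>{2..N}. if s = N then \<Sum>x\<in>{1..<N}. pl (J x) (J (N - x)) else 0)"
  by (rule sum.cong) auto
 also have "... = (\<Sum>x\<in>{1..<N}. pl (J x) (J (N - x)))" using N by simp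
 finally show ?thesis by (simp add: numeral_2_eq_2)
qed

lemma transfer_iterate:
 "Suc (Suc k) <= N ==> CS (Suc (Suc k)) N (%M. hv k (image_mset mk M))
   = s2 (fact (Suc (Suc k)) / 2) (CS 2 N (%M. hv 0 (image_mset mk M)))"
proof (induction k)
 case 0
 show ?case by (simp add: numeral_2_eq_2 del: CS.simps hv.simps)
next
 case (Suc k)
 have IH: "CS (Suc (Suc k)) N (%M. hv k (image_mset mk M))
   = s2 (fact (Suc (Suc k)) / 2) (CS 2 N (%M. hv 0 (image_mset mk M)))" by (rule Suc.IH) (use Suc.prems in simp)
 have "CS (Suc (Suc (Suc k))) N (%M. hv (Suc k) (image_mset mk M))
  = s2 (of_nat (Suc (Suc (Suc k)))) (CS (Suc (Suc k)) N (%M. hv k (image_mset mk M)))"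
  by (rule transfer_step) (use Suc.prems in simp)
 then show ?case unfolding IH B.scale_scale fact_Suc[of "Suc (Suc k)"] by (simp only: times_divide_eq_right)
qed

text \<open>
  The sums over compositions of \<open>N\<close> into \<open>m\<close> parts, divided by
  \<open>m!\<close>, do not depend on \<open>m\<close>: for \<open>m = N\<close> there is only the
  word of equal letters, and \<open>m = 2\<close> is the right-hand side.
\<close>

theorem transfer_equal_letters:
 assumes "2 <= N"
 shows "s2 (1 / fact N) (hv (N - 2) (replicate_mset N None)) = s2 (1 / 2) (\<Sum>x\<in>{1..<N}. pl (J x) (J (N - x)))"
proof -
 obtain k where N: "N = Suc (Suc k)" using assms by (metis add_2_eq_Suc less_eqE)
 have "hv k (replicate_mset N None) = CS N N (%M. hv k (image_mset mk M))"
  unfolding CS_diag by (simp add: mk_def)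
 also have "... = s2 (fact N / 2) (\<Sum>x\<in>{1..<N}. pl (J x) (J (N - x)))"
  using transfer_iterate[of k N] transfer_two[OF assms] N by simp
 finally show ?thesis using N by (simp del: fact_Suc)
qed

end

end

section \<open>Tensors of finite support\<close>

definition homT :: "'b set => ('b => int) => 'c set => ('c => int) => int => ('b => ('c \<Rightarrow>\<^sub>0 'k::field_char_0)) => bool" where
 "homT B degB C degC t T \<longleftrightarrow> (\<forall>b\<in>B. \<forall>c. lk (T b) c ~= 0 --> c : C & degC c = degB b + t)"

lemma homT_h: "homT (form_basis n) mdeg (form_basis n) mdeg (- 1) (%m. dupont_h n (sng m 1))"
 using dupont_h_degree by (fastforce simp: homT_def)
lemma homT_p: "homT (form_basis n) mdeg (faces n) cdeg 0 (%m. dupont_p n (sng m 1))"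
 using dupont_p_degree by (fastforce simp: homT_def)
lemma homT_i: "homT (faces n) cdeg (form_basis n) mdeg 0 (omega n)"
 using omega_degree by (fastforce simp: homT_def)
lemma homT_Cd: "homT (faces n) cdeg (faces n) cdeg 1 (C_d n)"
 using C_d_degree by (fastforce simp: homT_def)

context complete_dg_lie begin

definition FT :: "'b set => ('b => int) => int => ('b => 'v) set" where
 "FT B deg D = {z. finite {b. z b ~= 0} & (\<forall>b\<in>B. z b : gr g (D - deg b)) & (\<forall>b. b \<notin> B --> z b = 0)}"

definition supp :: "('b => 'v) => 'b set" where "supp z = {b. z b ~= 0}"

lemma FTD: assumes "z : FT B deg D"
 shows "finite (supp z)" "supp z \<subseteq> B" "z b : gr g (D - deg b)"
proof -
 show "finite (supp z)" "supp z \<subseteq> B" using assms by (auto simp: FT_def supp_def)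
 show "z b : gr g (D - deg b)" by (cases "b : B") (use assms in \<open>auto simp: FT_def\<close>)
qed

lemma FTI: assumes "finite S" "!!b. z b ~= 0 ==> b : S" "!!b. z b : gr g (D - deg b)" "!!b. z b ~= 0 ==> b : B"
 shows "z : FT B deg D"
proof -
 have "finite {b. z b ~= 0}" by (rule finite_subset[OF _ assms(1)]) (use assms(2) in auto)
 then show ?thesis using assms by (auto simp: FT_def)
qed

lemma FT_zero: "0 : FT B deg D" by (auto simp: FT_def)
lemma FT_lin: assumes "y : FT B deg D" "z : FT B deg D" shows "(%b. scl g c (y b)) + z : FT B deg D"
proof (rule FTI[of "supp y \<union> supp z"])
 show "finite (supp y \<union> supp z)" using FTD(1) assms by blast
 fix b
 show "((%b. scl g c (y b)) + z) b : gr g (D - deg b)" using FTD(3)[OF assms(1)] FTD(3)[OF assms(2)] by (simp add: gr_add gr_scl)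
 assume "((%b. scl g c (y b)) + z) b ~= 0"
 then show b: "b : supp y \<union> supp z" by (auto simp: supp_def)
 then show "b : B" using FTD(2) assms by blast
qed

text \<open>
  The value of a sum is unique because the filtration is separated.
\<close>

lemma csum_finite:
 assumes S: "finite S" "S \<subseteq> A" and z: "!!i. i : A ==> i \<notin> S ==> f i = 0" and f: "!!i. i : S ==> f i : gr g e"
 shows "csum g e f A = sum f S"
 unfolding csum_def
proof (rule the_equality)
 have eq: "sum f S' = sum f S" if "finite S'" "S \<subseteq> S'" "S' \<subseteq> A" for S'
  by (rule sum.mono_neutral_right) (use that z in auto)
 have gr: "sum f S : gr g e" using f by (rule gr_sum)
 show "has_csum g e f A (sum f S)" unfolding has_csum_def
 proof (intro conjI allI impI gr exI[of _ S] S)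
  fix n :: nat and S' assume "1 <= n" "finite S' & S \<subseteq> S' & S' \<subseteq> A"
  then show "sum f S' - sum f S : fil g n e" using eq[of S'] by simp
 qed
 fix y assume y: "has_csum g e f A y"
 show "y = sum f S"
 proof (rule fil_all_eq[OF _ gr])
  show "y : gr g e" using y by (simp add: has_csum_def)
  fix n :: nat assume n: "1 <= n"
  then obtain S0 where S0: "finite S0" "S0 \<subseteq> A" "!!S. finite S ==> S0 \<subseteq> S ==> S \<subseteq> A ==> sum f S - y : fil g n e"
   using y unfolding has_csum_def by meson
  have "sum f (S0 \<union> S) - y : fil g n e" by (rule S0(3)) (use S0 S in auto)
  then show "y - sum f S : fil g n e" using eq[of "S0 \<union> S"] S0 S fil_uminus[OF n, of "sum f S - y" e] by simp
 qed
qed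

lemma tensor_op_sum:
 assumes z: "z : FT B degB D" and T: "homT B degB C degC t T" and S: "finite S" "supp z \<subseteq> S"
 shows "tensor_op g B degB degC t T D z c = (\<Sum>b\<in>S. scl g (sg (t * (D - degB b)) * lk (T b) c) (z b))"
proof -
 have "tensor_op g B degB degC t T D z c = (\<Sum>b\<in>supp z. scl g (sg (t * (D - degB b)) * lk (T b) c) (z b))"
  unfolding tensor_op_def
 proof (rule csum_finite[OF FTD(1,2)[OF z]])
  fix b assume "b : supp z"
  then have b: "b : B" using FTD(2)[OF z] by blast
  show "scl g (sg (t * (D - degB b)) * lk (T b) c) (z b) : gr g (D + t - degC c)"
  proof (cases "lk (T b) c = 0")
   case False
   then have e: "D + t - degC c = D - degB b" using T b by (simp add: homT_def)
   show ?thesis unfolding e by (intro gr_scl FTD(3)[OF z])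
  qed simp
 qed (auto simp: supp_def)
 also have "... = (\<Sum>b\<in>S. scl g (sg (t * (D - degB b)) * lk (T b) c) (z b))"
  by (rule sum.mono_neutral_left) (use S in \<open>auto simp: supp_def\<close>)
 finally show ?thesis .
qed

lemma tensor_op_FT:
 assumes z: "z : FT B degB D" and T: "homT B degB C degC t T"
 shows "tensor_op g B degB degC t T D z : FT C degC (D + t)"
proof (rule FTI[of "\<Union>b\<in>supp z. ks (T b)"])
 note eq = tensor_op_sum[OF z T FTD(1)[OF z] order_refl]
 show "finite (\<Union>b\<in>supp z. ks (T b))" using FTD(1)[OF z] by auto
 fix c
 show "tensor_op g B degB degC t T D z c : gr g (D + t - degC c)" unfolding eq
 proof (rule gr_sum)
  fix b assume "b : supp z"
  then have b: "b : B" using FTD(2)[OF z] by blast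
  show "scl g (sg (t * (D - degB b)) * lk (T b) c) (z b) : gr g (D + t - degC c)"
  proof (cases "lk (T b) c = 0")
   case False
   then have e: "D + t - degC c = D - degB b" using T b by (simp add: homT_def)
   show ?thesis unfolding e by (intro gr_scl FTD(3)[OF z])
  qed simp
 qed
 assume "tensor_op g B degB degC t T D z c ~= 0"
 then obtain b where b: "b : supp z" "lk (T b) c ~= 0"
  unfolding eq using sum.not_neutral_contains_not_neutral[of "%b. scl g (sg (t * (D - degB b)) * lk (T b) c) (z b)" "supp z"]
  by auto
 then show "c : (\<Union>b\<in>supp z. ks (T b))" by (auto simp: in_keys_iff)
 show "c : C" using b FTD(2)[OF z] T by (auto simp: homT_def)
qed

lemma tensor_op_lin:
 assumes y: "y : FT B degB D" and z: "z : FT B degB D" and T: "homT B degB C degC t T"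
 shows "tensor_op g B degB degC t T D ((%b. scl g a (y b)) + z)
  = (%c. scl g a (tensor_op g B degB degC t T D y c)) + tensor_op g B degB degC t T D z"
proof
 fix c
 let ?S = "supp y \<union> supp z"
 have S: "finite ?S" "supp y \<subseteq> ?S" "supp z \<subseteq> ?S" "supp ((%b. scl g a (y b)) + z) \<subseteq> ?S"
  using FTD(1)[OF y] FTD(1)[OF z] by (auto simp: supp_def)
 show "tensor_op g B degB degC t T D ((%b. scl g a (y b)) + z) c
  = ((%c. scl g a (tensor_op g B degB degC t T D y c)) + tensor_op g B degB degC t T D z) c"
  unfolding plus_fun_apply tensor_op_sum[OF y T S(1,2)] tensor_op_sum[OF z T S(1,3)]
   tensor_op_sum[OF FT_lin[OF y z] T S(1,4)]
  by (simp add: V.scale_right_distrib sum.distrib V.scale_sum_right mult.commute)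
qed

lemma tensor_op_zero: assumes "homT B degB C degC t T" shows "tensor_op g B degB degC t T D 0 = 0"
proof
 fix c show "tensor_op g B degB degC t T D 0 c = 0 c"
  using tensor_op_sum[OF FT_zero assms, of "{}" D c] by (simp add: supp_def)
qed

text \<open>
  The Koszul signs of the two factors combine since the first operator is homogeneous.
\<close>

lemma tensor_op_comp:
 assumes z: "z : FT B degB D" and T: "homT B degB C degC t T" and T': "homT C degC E degE t' T'"
  and S: "finite S" "supp z \<subseteq> S"
 shows "tensor_op g C degC degE t' T' (D + t) (tensor_op g B degB degC t T D z) e
  = (\<Sum>b\<in>S. scl g (sg ((t + t') * (D - degB b)) * lk (lin T' (T b)) e) (z b))"
proof -
 let ?K = "\<Union>b\<in>supp z. ks (T b)"
 let ?c = "%b c. sg (t * (D - degB b)) * lk (T b) c * (sg (t' * (D + t - degC c)) * lk (T' c) e)"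
 have K: "finite ?K" using FTD(1)[OF z] by auto
 have sK: "supp (tensor_op g B degB degC t T D z) \<subseteq> ?K"
 proof
  fix c assume "c : supp (tensor_op g B degB degC t T D z)"
  then have "(\<Sum>b\<in>supp z. scl g (sg (t * (D - degB b)) * lk (T b) c) (z b)) ~= 0"
   by (simp add: supp_def tensor_op_sum[OF z T FTD(1)[OF z] order_refl, unfolded supp_def])
  then obtain b where "b : supp z" "lk (T b) c ~= 0"
   using sum.not_neutral_contains_not_neutral[of "%b. scl g (sg (t * (D - degB b)) * lk (T b) c) (z b)" "supp z"] by auto
  then show "c : ?K" by (auto simp: in_keys_iff)
 qed
 have "tensor_op g C degC degE t' T' (D + t) (tensor_op g B degB degC t T D z) e
  = (\<Sum>c\<in>?K. \<Sum>b\<in>supp z. scl g (?c b c) (z b))"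
  unfolding tensor_op_sum[OF tensor_op_FT[OF z T] T' K sK] tensor_op_sum[OF z T FTD(1)[OF z] order_refl]
  by (simp add: V.scale_sum_right mult.commute)
 also have "... = (\<Sum>b\<in>supp z. scl g (\<Sum>c\<in>?K. ?c b c) (z b))"
  by (subst sum.swap) (simp add: V.scale_sum_left)
 also have "... = (\<Sum>b\<in>supp z. scl g (sg ((t + t') * (D - degB b)) * lk (lin T' (T b)) e) (z b))"
 proof (rule sum.cong[OF refl])
  fix b assume b: "b : supp z"
  then have bB: "b : B" using FTD(2)[OF z] by blast
  have "?c b c = sg ((t + t') * (D - degB b)) * (lk (T b) c * lk (T' c) e)" for c
  proof (cases "lk (T b) c = 0")
   case False
   then have "degC c = degB b + t" using T bB by (simp add: homT_def)
   then have e: "D + t - degC c = D - degB b" by simp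
   show ?thesis unfolding e by (simp add: ring_distribs(2) sg_add mult_ac)
  qed simp
  note C = this
  have "ks (T b) \<subseteq> ?K" using b by blast
  then have "(\<Sum>c\<in>?K. ?c b c) = sg ((t + t') * (D - degB b)) * lk (lin T' (T b)) e"
   unfolding C lin_superset[OF K, of "T b" T', OF \<open>ks (T b) \<subseteq> ?K\<close>] by (simp add: lookup_sum sum_distrib_left)
  then show "scl g (\<Sum>c\<in>?K. ?c b c) (z b) = scl g (sg ((t + t') * (D - degB b)) * lk (lin T' (T b)) e) (z b)"
   by simp
 qed
 also have "... = (\<Sum>b\<in>S. scl g (sg ((t + t') * (D - degB b)) * lk (lin T' (T b)) e) (z b))"
  by (rule sum.mono_neutral_left) (use S in \<open>auto simp: supp_def\<close>)
 finally show ?thesis .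
qed

lemma tensor_brk_sum:
 assumes y: "y : FT (form_basis n) mdeg D" and z: "z : FT (form_basis n) mdeg E"
  and S: "finite S" "S \<subseteq> form_basis n" "supp y \<subseteq> S" "supp z \<subseteq> S"
 shows "tensor_brk g n D E y z m
  = (\<Sum>b\<in>S. \<Sum>c\<in>S. scl g (sg (mdeg b * (E - mdeg c)) * lk (wedge_mono b c) m) (brk g (y b) (z c)))"
proof -
 have "tensor_brk g n D E y z m = (\<Sum>(b, c)\<in>S \<times> S. scl g (sg (mdeg b * (E - mdeg c)) * lk (wedge_mono b c) m) (brk g (y b) (z c)))"
  unfolding tensor_brk_def
 proof (rule csum_finite)
  show "finite (S \<times> S)" "S \<times> S \<subseteq> form_basis n \<times> form_basis n" using S by auto
  show "(case bc of (b, c) => scl g (sg (mdeg b * (E - mdeg c)) * lk (wedge_mono b c) m) (brk g (y b) (z c))) = 0"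
   if "bc : form_basis n \<times> form_basis n" "bc \<notin> S \<times> S" for bc
  proof -
   obtain b c where bc: "bc = (b, c)" by (cases bc)
   then have "y b = 0 \<or> z c = 0" using that S by (auto simp: supp_def)
   then have "brk g (y b) (z c) = 0" using brk_zero_left[OF FTD(3)[OF z, of c]] brk_zero_right[OF FTD(3)[OF y, of b]] by auto
   then show ?thesis by (simp add: bc)
  qed
  show "(case bc of (b, c) => scl g (sg (mdeg b * (E - mdeg c)) * lk (wedge_mono b c) m) (brk g (y b) (z c))) : gr g (D + E - mdeg m)"
   if "bc : S \<times> S" for bc
  proof -
   obtain b c where b: "bc = (b, c)" by (cases bc)
   then have bc: "bc = (b, c)" "b : form_basis n" "c : form_basis n" using that S(2) by blast+
   show ?thesis
   proof (cases "lk (wedge_mono b c) m = (0::'k)")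
    case False
    have e: "D + E - mdeg m = (D - mdeg b) + (E - mdeg c)" using wedge_mono_degree(2)[OF bc(2,3) False] by simp
    show ?thesis unfolding e bc(1) prod.case by (intro gr_scl brk_degree FTD(3)[OF y] FTD(3)[OF z])
   qed (simp add: bc)
  qed
 qed
 then show ?thesis by (simp add: sum.cartesian_product)
qed

lemma tensor_brk_FT:
 assumes y: "y : FT (form_basis n) mdeg D" and z: "z : FT (form_basis n) mdeg E"
 shows "tensor_brk g n D E y z : FT (form_basis n) mdeg (D + E)"
  and "supp (tensor_brk g n D E y z) \<subseteq> (\<Union>b\<in>supp y \<union> supp z. \<Union>c\<in>supp y \<union> supp z. ks (wedge_mono b c :: 'k form))"
proof -
 let ?S = "supp y \<union> supp z"
 have S: "finite ?S" "?S \<subseteq> form_basis n" "supp y \<subseteq> ?S" "supp z \<subseteq> ?S" using FTD(1,2)[OF y] FTD(1,2)[OF z] by auto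
 note eq = tensor_brk_sum[OF y z S]
 have wit: "\<exists>b\<in>?S. \<exists>c\<in>?S. lk (wedge_mono b c) m ~= (0::'k)" if "tensor_brk g n D E y z m ~= 0" for m
 proof (rule ccontr)
  assume "\<not> ?thesis"
  then have 0: "lk (wedge_mono b c) m = (0::'k)" if "b : ?S" "c : ?S" for b c using that by blast
  have "tensor_brk g n D E y z m = 0" unfolding eq
   by (intro sum.neutral ballI) (simp only: 0 mult_zero_right V.scale_zero_left)
  then show False using that by simp
 qed
 show sub: "supp (tensor_brk g n D E y z) \<subseteq> (\<Union>b\<in>?S. \<Union>c\<in>?S. ks (wedge_mono b c :: 'k form))"
 proof
  fix m assume "m : supp (tensor_brk g n D E y z)"
  then have "tensor_brk g n D E y z m ~= 0" by (simp only: supp_def mem_Collect_eq not_False_eq_True)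
  then obtain b c where "b : ?S" "c : ?S" "lk (wedge_mono b c) m ~= (0::'k)" using wit[of m] by blast
  then show "m : (\<Union>b\<in>?S. \<Union>c\<in>?S. ks (wedge_mono b c :: 'k form))" by (intro UN_I) (simp_all only: in_keys_iff not_False_eq_True)
 qed
 show "tensor_brk g n D E y z : FT (form_basis n) mdeg (D + E)"
 proof (rule FTI)
  show "finite (\<Union>b\<in>?S. \<Union>c\<in>?S. ks (wedge_mono b c :: 'k form))" by (intro finite_UN_I S(1) finite_keys)
  fix m
  show "m : (\<Union>b\<in>?S. \<Union>c\<in>?S. ks (wedge_mono b c :: 'k form))" "m : form_basis n"
   if m: "tensor_brk g n D E y z m ~= 0"
  proof -
   show "m : (\<Union>b\<in>?S. \<Union>c\<in>?S. ks (wedge_mono b c :: 'k form))" by (rule subsetD[OF sub]) (simp only: supp_def mem_Collect_eq m not_False_eq_True)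
   obtain b c where "b : ?S" "c : ?S" "lk (wedge_mono b c) m ~= (0::'k)" using wit[OF m] by blast
   then show "m : form_basis n" using wedge_mono_degree(1)[of b n c m, where ?'k = 'k] S(2) by blast
  qed
  show "tensor_brk g n D E y z m : gr g (D + E - mdeg m)" unfolding eq
  proof (intro gr_sum)
   fix b c assume bc: "b : ?S" "c : ?S"
   show "scl g (sg (mdeg b * (E - mdeg c)) * lk (wedge_mono b c) m) (brk g (y b) (z c)) : gr g (D + E - mdeg m)"
   proof (cases "lk (wedge_mono b c) m = (0::'k)")
    case False
    have "b : form_basis n" "c : form_basis n" using bc S(2) by blast+
    then have e: "D + E - mdeg m = (D - mdeg b) + (E - mdeg c)" using wedge_mono_degree(2)[OF _ _ False] by simp
    show ?thesis unfolding e by (intro gr_scl brk_degree FTD(3)[OF y] FTD(3)[OF z])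
   qed simp
  qed
 qed
qed

lemma tensor_op_brk:
 fixes F :: "'k form => ('c \<Rightarrow>\<^sub>0 'k)"
 assumes F: "klin F" and T: "homT (form_basis n) mdeg C degC t (%m. F (sng m 1))"
  and y: "y : FT (form_basis n) mdeg 1" and z: "z : FT (form_basis n) mdeg 1"
  and S: "finite S" "S \<subseteq> form_basis n" "supp y \<subseteq> S" "supp z \<subseteq> S"
 shows "tensor_op g (form_basis n) mdeg degC t (%m. F (sng m 1)) 2 (tensor_brk g n 1 1 y z) e
  = (\<Sum>b\<in>S. \<Sum>c\<in>S. scl g (sg (t * (mdeg b + mdeg c) + mdeg b * (1 - mdeg c)) * lk (F (wedge_mono b c)) e)
    (brk g (y b) (z c)))"
proof -
 let ?K = "\<Union>b\<in>S. \<Union>c\<in>S. ks (wedge_mono b c :: 'k form)"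
 have K: "finite ?K" by (intro finite_UN_I S(1) finite_keys)
 have sK: "supp (tensor_brk g n 1 1 y z) \<subseteq> ?K"
  by (rule order_trans[OF tensor_brk_FT(2)[OF y z]]) (intro UN_mono order_refl Un_least S(3,4))
 have tb: "tensor_brk g n 1 1 y z : FT (form_basis n) mdeg 2" using tensor_brk_FT(1)[OF y z] by simp
 let ?c = "%m b c. sg (t * (2 - mdeg m)) * lk (F (sng m 1)) e * (sg (mdeg b * (1 - mdeg c)) * lk (wedge_mono b c) m)"
 have "tensor_op g (form_basis n) mdeg degC t (%m. F (sng m 1)) 2 (tensor_brk g n 1 1 y z) e
  = (\<Sum>m\<in>?K. \<Sum>b\<in>S. \<Sum>c\<in>S. scl g (?c m b c) (brk g (y b) (z c)))"
  unfolding tensor_op_sum[OF tb T K sK] tensor_brk_sum[OF y z S] by (simp add: V.scale_sum_right)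
 also have "... = (\<Sum>b\<in>S. \<Sum>m\<in>?K. \<Sum>c\<in>S. scl g (?c m b c) (brk g (y b) (z c)))"
  by (rule sum.swap)
 also have "... = (\<Sum>b\<in>S. \<Sum>c\<in>S. \<Sum>m\<in>?K. scl g (?c m b c) (brk g (y b) (z c)))"
  by (rule sum.cong[OF refl sum.swap])
 also have "... = (\<Sum>b\<in>S. \<Sum>c\<in>S. scl g (sg (t * (mdeg b + mdeg c) + mdeg b * (1 - mdeg c)) * lk (F (wedge_mono b c)) e)
    (brk g (y b) (z c)))"
 proof (intro sum.cong refl)
  fix b c assume bc: "b : S" "c : S"
  have "?c m b c = sg (t * (mdeg b + mdeg c) + mdeg b * (1 - mdeg c)) * (lk (wedge_mono b c) m * lk (F (sng m 1)) e)" for m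
  proof (cases "lk (wedge_mono b c) m = (0::'k)")
   case False
   have "b : form_basis n" "c : form_basis n" using bc S(2) by blast+
   then have m: "mdeg m = mdeg b + mdeg c" using wedge_mono_degree(2)[OF _ _ False] by blast
   have "sg (t * (2 - mdeg m)) = (sg (t * (mdeg b + mdeg c)) :: 'k)" unfolding m by (rule sg_cong) simp
   then show ?thesis by (simp add: sg_add mult_ac)
  qed simp
  note C = this
  have "ks (wedge_mono b c :: 'k form) \<subseteq> ?K" using bc by blast
  moreover have "F (wedge_mono b c) = lin (%m. F (sng m 1)) (wedge_mono b c)" using klin_eq_lin[OF F] by metis
  ultimately have "(\<Sum>m\<in>?K. ?c m b c) = sg (t * (mdeg b + mdeg c) + mdeg b * (1 - mdeg c)) * lk (F (wedge_mono b c)) e"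
   unfolding C using lin_superset[OF K, of "wedge_mono b c :: 'k form" "%m. F (sng m 1)"] by (simp add: lookup_sum sum_distrib_left)
  then show "(\<Sum>m\<in>?K. scl g (?c m b c) (brk g (y b) (z c)))
   = scl g (sg (t * (mdeg b + mdeg c) + mdeg b * (1 - mdeg c)) * lk (F (wedge_mono b c)) e) (brk g (y b) (z c))"
   by (simp add: V.scale_sum_left[symmetric])
 qed
 finally show ?thesis .
qed

end

lemma wedge_mono_sym:
 assumes "b : form_basis n" "c : form_basis n"
 shows "wedge_mono b c = cscale (sg (mdeg b * mdeg c)) (wedge_mono c b :: 'k::field_char_0 form)"
proof -
 have "(- 1) ^ k = (sg (int k) :: 'k)" for k by (simp add: sg_def)
 then show ?thesis
  using wedge_commute[OF single_form_basis(2)[OF assms(1), where ?'k = 'k] single_form_basis(2)[OF assms(2), where ?'k = 'k]]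
  by (simp add: mdeg_def)
qed

definition coef :: "int => ('k form => ('c \<Rightarrow>\<^sub>0 'k::field_char_0)) => 'c => fmono => fmono => 'k" where
 "coef t F e b c = sg (t * (mdeg b + mdeg c) + mdeg b * (1 - mdeg c)) * lk (F (wedge_mono b c)) e"

text \<open>
  The sign from exchanging the two forms cancels the one from the antisymmetry of the bracket, so
  the two halves of every commutator contribute equally.
\<close>

lemma coef_sym:
 assumes "klin F" "b : form_basis n" "c : form_basis n"
 shows "coef t F e b c = - (sg ((1 - mdeg b) * (1 - mdeg c)) * coef t F e c b)"
proof -
 have e1: "lk (F (wedge_mono b c)) e = sg (mdeg b * mdeg c) * lk (F (wedge_mono c b)) e"
  unfolding wedge_mono_sym[OF assms(2,3)] klin_scale[OF assms(1)] by simp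
 have e2: "sg (t * (mdeg b + mdeg c) + mdeg b * (1 - mdeg c)) * sg (mdeg b * mdeg c)
  = - (sg ((1 - mdeg b) * (1 - mdeg c)) * sg (t * (mdeg c + mdeg b) + mdeg c * (1 - mdeg b)) :: 'a)"
  by (cases "even (mdeg b)"; cases "even (mdeg c)"; cases "even t") (simp_all add: sg_def)
 show ?thesis unfolding coef_def e1 mult.assoc[symmetric] e2 by (simp add: mult.assoc)
qed

lemma coef_degree:
 fixes F :: "'k::field_char_0 form => ('c \<Rightarrow>\<^sub>0 'k)"
 assumes F: "klin F" "homT (form_basis n) mdeg C degC t (%m. F (sng m 1))"
  and bc: "b : form_basis n" "c : form_basis n" and nz: "coef t F e b c ~= 0"
 shows "e : C" "degC e = mdeg b + mdeg c + t"
proof -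
 have "lk (\<Sum>m\<in>ks (wedge_mono b c :: 'k form). cscale (lk (wedge_mono b c) m) (F (sng m 1))) e ~= 0"
  using nz unfolding coef_def klin_expand[OF F(1), symmetric] by auto
 then have "(\<Sum>m\<in>ks (wedge_mono b c :: 'k form). lk (wedge_mono b c) m * lk (F (sng m 1)) e) ~= 0"
  by (simp add: lookup_sum)
 then obtain m where "lk (wedge_mono b c) m * lk (F (sng m 1)) e ~= 0"
  by (meson sum.not_neutral_contains_not_neutral)
 then have m: "lk (wedge_mono b c) m ~= (0::'k)" "lk (F (sng m 1)) e ~= 0" by auto
 have mm: "m : form_basis n" "mdeg m = mdeg b + mdeg c" using wedge_mono_degree[OF bc m(1)] by auto
 show "e : C" "degC e = mdeg b + mdeg c + t" using F(2) m(2) mm by (simp_all add: homT_def)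
qed

section \<open>The universal solution\<close>

definition eps :: "nat set list => 'k::field_char_0" where
 "eps w = sg (\<Sum>j<length w. \<Sum>i<j. (cdeg (w ! i) - 1) * xdeg (w ! j))"

definition U :: "nat => nat => fmono => 'k::field_char_0 tseries" where
 "U n k b = (%w. if w : words n k then eps w * lk (C_J n w) b else 0)"

text \<open>
  The sign of a word splits because moving the forms of the first part past the generators of the
  second part costs the product of their degrees.
\<close>

lemma eps_append: "eps (u @ v) = eps u * eps v * (sg (wdeg u * wdeg v) :: 'k::field_char_0)"
proof -
 let ?p = "%w. \<Sum>j<length w. \<Sum>i<j. (cdeg (w ! i) - 1) * xdeg (w ! j)"
 have w: "(\<Sum>i<length w. cdeg (w ! i) - 1) = - wdeg w" for w
  by (induction w) (simp_all add: sum.lessThan_Suc_shift xdeg_def del: sum.lessThan_Suc)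
 have s: "?p (w @ [a]) = ?p w - wdeg w * xdeg a" for w a
 proof -
  have "?p (w @ [a]) = ?p w + (\<Sum>i<length w. (cdeg (w ! i) - 1) * xdeg a)"
   by (simp add: nth_append)
  then show ?thesis unfolding sum_distrib_right[symmetric] w by simp
 qed
 have "?p (u @ v) = ?p u + ?p v - wdeg u * wdeg v"
 proof (induction v rule: rev_induct)
  case (snoc a v)
  have "?p ((u @ v) @ [a]) = ?p (u @ v) - wdeg (u @ v) * xdeg a" by (rule s)
  then show ?case unfolding append_assoc[symmetric] s snoc by (simp add: algebra_simps)
 qed simp
 then show ?thesis unfolding eps_def by (simp only:) (simp add: sg_def)
qed

lemma eps_single [simp]: "eps [I] = 1" by (simp add: eps_def)
lemma eps_nz: "eps w ~= 0" by (simp add: eps_def sg_def)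

lemma Om_C_J: "w : words n k ==> (C_J n w :: 'k::field_char_0 form) : Om (ix n)"
proof (induction "length w" arbitrary: w k rule: less_induct)
 case less
 consider "length w = 0" | "length w = 1" | "2 <= length w" by linarith
 then show ?case
 proof cases
  case 1
  then have "C_J n w = (0 :: 'k form)" by (subst C_J.simps) simp
  then show ?thesis by (simp add: Om_keys)
 next
  case 2
  then have "hd w : faces n" using less(2) by (cases w) (auto simp: words_def)
  then show ?thesis using 2 facesD(1,2)[of "hd w" n] by (simp add: C_J.simps[of n w])
 next
  case 3
  have t: "lin (%m. sng m (sg (mdeg m - 1))) al : Om (ix n)" if "al : Om (ix n)" for al :: "'k form"
   unfolding lin_def by (rule Om_sum) (use that in \<open>auto simp: Om_def split: if_splits\<close>)
  have "(\<Sum>r\<in>{1..<length w}. sbeta (C_J n (take r w)) (C_J n (drop r w)) :: 'k form) : Om (ix n)"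
  proof (rule Om_sum)
   fix r assume r: "r : {1..<length w}"
   have a: "take r w : words n r" "drop r w : words n (length w - r)"
    using r less(2) by (auto simp: words_def dest: in_set_takeD in_set_dropD)
   have "(C_J n (take r w) :: 'k form) : Om (ix n)" "(C_J n (drop r w) :: 'k form) : Om (ix n)"
    using less(1)[OF _ a(1)] less(1)[OF _ a(2)] r by auto
   then show "sbeta (C_J n (take r w)) (C_J n (drop r w)) : (Om (ix n) :: 'k form set)"
    unfolding sbeta_def by (intro Om_wedge t)
  qed
  then have "dupont_h n (\<Sum>r\<in>{1..<length w}. sbeta (C_J n (take r w)) (C_J n (drop r w)) :: 'k form) : Om (ix n)"
   by (simp add: dupont_h_HX)
  then show ?thesis using 3 by (simp add: C_J.simps[of n w] Om_keys)
 qed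
qed

definition SU :: "'k::field_char_0 itself => nat => nat => fmono set" where
 "SU T n k = (\<Union>r\<in>{1..k}. \<Union>w\<in>words n r. ks (C_J n w :: 'k form))"

lemma SU: "finite (SU TYPE('k::field_char_0) n k)" "SU TYPE('k) n k \<subseteq> form_basis n"
 "1 <= r ==> r <= k ==> b \<notin> SU TYPE('k) n k ==> (U n r b :: 'k tseries) = 0"
proof -
 show "finite (SU TYPE('k) n k)" unfolding SU_def by (intro finite_UN_I finite_keys finite_words finite_atLeastAtMost)
 show "SU TYPE('k) n k \<subseteq> form_basis n" unfolding SU_def using Om_C_J[where ?'k = 'k] by (fastforce simp: Om_keys)
 show "(U n r b :: 'k tseries) = 0" if "1 <= r" "r <= k" "b \<notin> SU TYPE('k) n k"
 proof
  fix w
  have "lk (C_J n w :: 'k form) b = 0" if "w : words n r"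
  proof (rule ccontr)
   assume "lk (C_J n w :: 'k form) b ~= 0"
   then have "b : ks (C_J n w :: 'k form)" by (simp add: in_keys_iff)
   then have "b : SU TYPE('k) n k" unfolding SU_def by (intro UN_I[of r] UN_I[OF \<open>w : words n r\<close>]) (use \<open>1 <= r\<close> \<open>r <= k\<close> in auto)
   then show False using \<open>b \<notin> SU TYPE('k) n k\<close> by simp
  qed
  then show "(U n r b :: 'k tseries) w = 0 w" by (simp add: U_def)
 qed
qed

lemma sbeta_expand:
 fixes al \<gamma> :: "'k::field_char_0 form"
 assumes S: "finite S" "ks al \<subseteq> S" "ks \<gamma> \<subseteq> S"
 shows "sbeta al \<gamma> = (\<Sum>b\<in>S. \<Sum>c\<in>S. cscale (sg (mdeg b - 1) * lk al b * lk \<gamma> c) (wedge_mono b c))"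
proof -
 have g: "sng b s \<cdot> \<gamma> = (\<Sum>c\<in>S. cscale (s * lk \<gamma> c) (wedge_mono b c))" for b s
  by (simp add: wedge_def lin_superset[OF S(1,3)] P.scale_sum_right)
 show ?thesis unfolding sbeta_def lin_superset[OF S(1,2)] wedge_sum cscale_single g
  by (simp add: mult_ac)
qed

text \<open>
  The quadratic expression \<open>F (1/2 \<Sum> [U\<^sub>r, U\<^sub>k\<^sub>-\<^sub>r])\<close>;
  \<open>F\<close> will be \<open>h\<close> or \<open>p\<close>, of degree \<open>t\<close>.
\<close>

definition quad :: "nat => nat => int => ('k form => ('c \<Rightarrow>\<^sub>0 'k::field_char_0)) => 'c => 'k tseries" where
 "quad n k t F e = tscl (1 / 2) (\<Sum>r\<in>{1..<k}. \<Sum>b\<in>SU TYPE('k) n k. \<Sum>c\<in>SU TYPE('k) n k.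
   tscl (coef t F e b c) (tbrk (U n r b) (U n (k - r) c)))"

lemma quad_lie:
 fixes F :: "'k::field_char_0 form => ('c \<Rightarrow>\<^sub>0 'k)"
 assumes F: "klin F" "homT (form_basis n) mdeg C degC t (%m. F (sng m 1))"
  and L: "!!r b. 1 <= r ==> r < k ==> lie_part n r (1 - mdeg b) (U n r b :: 'k tseries)"
 shows "lie_part n k (2 + t - degC e) (quad n k t F e)"
 unfolding quad_def
proof (intro lie_part.scl[of n k _ _ "1 / 2"] lie_part_sum)
 fix r b c assume r: "r : {1..<k}" and bc: "b : SU TYPE('k) n k" "c : SU TYPE('k) n k"
 then have B: "b : form_basis n" "c : form_basis n" using SU(2) by blast+
 have t: "lie_part n (r + (k - r)) ((1 - mdeg b) + (1 - mdeg c)) (tbrk (U n r b) (U n (k - r) c) :: 'k tseries)"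
  using r by (intro lie_part.brk L) auto
 show "lie_part n k (2 + t - degC e) (tscl (coef t F e b c) (tbrk (U n r b) (U n (k - r) c)))"
 proof (cases "coef t F e b c = 0")
  case True
  have "tscl 0 s = (0 :: 'k tseries)" for s by (auto simp: tscl_def)
  then show ?thesis unfolding True by (simp only: lie_part.zero)
 next
  case False
  have e: "(1 - mdeg b) + (1 - mdeg c) = 2 + t - degC e" "r + (k - r) = k" using coef_degree(2)[OF F B False] r by simp_all
  show ?thesis using t unfolding e by (rule lie_part.scl)
 qed
qed

text \<open>
  The two terms of the commutator give the same contribution, which removes the factor
  \<open>1/2\<close>; on words, what is left is the product in the recursion for
  \<open>C_J\<close>, up to a sign in the degree of the word.
\<close>

lemma quad_word:
 fixes F :: "'k::field_char_0 form => ('c \<Rightarrow>\<^sub>0 'k)"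
 assumes F: "klin F" and L: "!!r b. 1 <= r ==> r < k ==> lie_part n r (1 - mdeg b) (U n r b :: 'k tseries)"
 shows "quad n k t F e = (%w. if w : words n k then sg ((t + 1) * wdeg w) * eps w *
   lk (F (\<Sum>r\<in>{1..<length w}. sbeta (C_J n (take r w)) (C_J n (drop r w)))) e else 0)"
proof
 fix w
 let ?S = "SU TYPE('k) n k"
 let ?C = "coef t F e"
 note S = SU(1)[where ?'k = 'k, of n k] and SB = SU(2)[where ?'k = 'k, of n k]
 have q: "quad n k t F e w = 1 / 2 * (\<Sum>r\<in>{1..<k}. \<Sum>b\<in>?S. \<Sum>c\<in>?S. ?C b c * tbrk (U n r b) (U n (k - r) c) w)"
  unfolding quad_def tscl_def sum_fun_app ..
 show "quad n k t F e w = (if w : words n k then sg ((t + 1) * wdeg w) * eps w *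
   lk (F (\<Sum>r\<in>{1..<length w}. sbeta (C_J n (take r w)) (C_J n (drop r w)))) e else 0)"
 proof (cases "w : words n k")
  case False
  have "tbrk (U n r b) (U n (k - r) c) w = (0::'k)" if "r : {1..<k}" for r b c
  proof (rule ccontr)
   assume a: "tbrk (U n r b) (U n (k - r) c) w ~= (0::'k)"
   have "lie_part n (r + (k - r)) ((1 - mdeg b) + (1 - mdeg c)) (tbrk (U n r b) (U n (k - r) c) :: 'k tseries)"
    using that by (intro lie_part.brk L) auto
   from lie_part_support[OF this a] show False using that False by simp
  qed
  then show ?thesis unfolding q using False by (simp cong: sum.cong_simp)
 next
  case w: True
  then have lw: "length w = k" by (simp add: words_def)
  let ?A = "%r b c. U n r b (take r w) * U n (k - r) c (drop r w) :: 'k"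
  let ?B = "%r b c. sg ((1 - mdeg b) * (1 - mdeg c)) * U n (k - r) c (take (k - r) w) * U n r b (drop (k - r) w) :: 'k"
  have tb: "tbrk (U n r b) (U n (k - r) c) w = ?A r b c - ?B r b c" if r: "r : {1..<k}" for r b c
  proof (rule tbrk_homog)
   have "length v = s & wdeg v = 1 - mdeg b" if "U n s b v ~= (0::'k)" "1 <= s" "s < k" for v s b
    using lie_part_support[OF L[OF that(2,3)] that(1)] by (simp add: words_def)
   note h = this
   show "U n r b v ~= (0::'k) ==> length v = r & wdeg v = 1 - mdeg b" for v
    by (rule h) (use r in auto)
   show "U n (k - r) c v ~= (0::'k) ==> length v = k - r & wdeg v = 1 - mdeg c" for v
    by (rule h) (use r in auto)
   show "length w = r + (k - r)" using r lw by simp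
  qed
  have "(\<Sum>r\<in>{1..<k}. \<Sum>b\<in>?S. \<Sum>c\<in>?S. ?C b c * ?B r b c) = (\<Sum>r\<in>{1..<k}. \<Sum>b\<in>?S. \<Sum>c\<in>?S. ?C b c * ?B (k - r) b c)"
   by (rule sum.reindex_bij_witness[of _ "%r. k - r" "%r. k - r"]) auto
  also have "... = (\<Sum>r\<in>{1..<k}. \<Sum>c\<in>?S. \<Sum>b\<in>?S. ?C b c * ?B (k - r) b c)"
   by (intro sum.cong refl sum.swap)
  also have "... = (\<Sum>r\<in>{1..<k}. \<Sum>c\<in>?S. \<Sum>b\<in>?S. - (?C c b * ?A r c b))"
  proof (intro sum.cong refl)
   fix r b c assume r: "r : {1..<k}" and bc: "c : ?S" "b : ?S"
   then have B: "c : form_basis n" "b : form_basis n" using SB by blast+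
   have kr: "k - (k - r) = r" using r by simp
   show "?C b c * ?B (k - r) b c = - (?C c b * ?A r c b)"
    unfolding coef_sym[OF F B, of t e] kr by (simp add: mult_ac)
  qed
  finally have "(\<Sum>r\<in>{1..<k}. \<Sum>b\<in>?S. \<Sum>c\<in>?S. ?C b c * ?B r b c) = - (\<Sum>r\<in>{1..<k}. \<Sum>b\<in>?S. \<Sum>c\<in>?S. ?C b c * ?A r b c)"
   by (simp add: sum_negf)
  moreover have "(\<Sum>r\<in>{1..<k}. \<Sum>b\<in>?S. \<Sum>c\<in>?S. ?C b c * tbrk (U n r b) (U n (k - r) c) w)
   = (\<Sum>r\<in>{1..<k}. \<Sum>b\<in>?S. \<Sum>c\<in>?S. ?C b c * ?A r b c - ?C b c * ?B r b c)"
   by (intro sum.cong refl) (simp only: tb right_diff_distrib)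
  ultimately have "quad n k t F e w = (\<Sum>r\<in>{1..<k}. \<Sum>b\<in>?S. \<Sum>c\<in>?S. ?C b c * ?A r b c)"
   unfolding q sum_subtractf by simp
  also have "... = (\<Sum>r\<in>{1..<k}. sg ((t + 1) * wdeg w) * eps w * lk (F (sbeta (C_J n (take r w)) (C_J n (drop r w)))) e)"
  proof (rule sum.cong[OF refl])
   fix r assume r: "r : {1..<k}"
   define u v where "u = take r w" and "v = drop r w"
   have uv: "u : words n r" "v : words n (k - r)" "w = u @ v"
    using w r by (auto simp: u_def v_def words_def dest: in_set_takeD in_set_dropD)
   have sub: "ks (C_J n v' :: 'k form) \<subseteq> ?S" if "v' : words n r'" "r' : {1..k}" for v' r'
    unfolding SU_def by (rule subsetI, rule UN_I[OF that(2)], rule UN_I[OF that(1)])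
   have kS: "ks (C_J n u :: 'k form) \<subseteq> ?S" "ks (C_J n v :: 'k form) \<subseteq> ?S"
    by (rule sub[OF uv(1)], use r in simp) (rule sub[OF uv(2)], use r in auto)
   have "?C b c * ?A r b c = sg ((t + 1) * wdeg w) * eps w * (sg (mdeg b - 1) * lk (C_J n u) b * lk (C_J n v) c * lk (F (wedge_mono b c)) e)" for b c
   proof (cases "lk (C_J n u) b = (0::'k) \<or> lk (C_J n v) c = (0::'k)")
    case True
    then show ?thesis unfolding u_def[symmetric] v_def[symmetric] using uv by (auto simp: U_def)
   next
    case False
    then have nz: "U n r b u ~= (0::'k)" "U n (k - r) c v ~= (0::'k)" using uv by (simp_all add: U_def eps_nz)
    have d: "wdeg u = 1 - mdeg b" "wdeg v = 1 - mdeg c"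
     using lie_part_support[OF L nz(1)] lie_part_support[OF L nz(2)] r by auto
    have "sg (t * (mdeg b + mdeg c) + mdeg b * (1 - mdeg c))
     = (sg ((t + 1) * wdeg w) * sg (wdeg u * wdeg v) * sg (mdeg b - 1) :: 'k)"
     unfolding uv(3) wdeg_append d
     by (cases "even (mdeg b)"; cases "even (mdeg c)"; cases "even t") (simp_all add: sg_def)
    moreover have "eps w = eps u * eps v * (sg (wdeg u * wdeg v) :: 'k)" unfolding uv(3) by (rule eps_append)
    ultimately show ?thesis unfolding u_def[symmetric] v_def[symmetric] coef_def U_def using uv(1,2) by (simp add: mult_ac)
   qed
   note tm = this
   have "lk (F (sbeta (C_J n u) (C_J n v))) e
    = (\<Sum>b\<in>?S. \<Sum>c\<in>?S. sg (mdeg b - 1) * lk (C_J n u) b * lk (C_J n v) c * lk (F (wedge_mono b c)) e)"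
    unfolding sbeta_expand[OF S kS] klin_sum[OF F] klin_scale[OF F] lookup_sum lookup_cscale ..
   then show "(\<Sum>b\<in>?S. \<Sum>c\<in>?S. ?C b c * ?A r b c)
    = sg ((t + 1) * wdeg w) * eps w * lk (F (sbeta (C_J n (take r w)) (C_J n (drop r w)))) e"
    unfolding tm unfolding u_def[symmetric] v_def[symmetric] by (simp only: sum_distrib_left)
  qed
  also have "... = sg ((t + 1) * wdeg w) * eps w * lk (F (\<Sum>r\<in>{1..<length w}. sbeta (C_J n (take r w)) (C_J n (drop r w)))) e"
   unfolding lw klin_sum[OF F] lookup_sum sum_distrib_left ..
  finally show ?thesis using w by simp
 qed
qed

lemma U_1: "U n 1 b = (\<Sum>I\<in>faces n. tscl (lk (omega n I) b) (xi I :: 'k::field_char_0 tseries))"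
proof
 fix w
 have "(\<Sum>I\<in>faces n. tscl (lk (omega n I) b) (xi I :: 'k tseries)) w
  = (\<Sum>I\<in>faces n. if w = [I] then lk (omega n I) b else 0)"
  unfolding sum_fun_app tscl_def xi_def by (rule sum.cong) auto
 also have "... = U n 1 b w"
 proof (cases "w : words n 1")
  case True
  then obtain I where w: "w = [I]" "I : faces n" by (auto simp: words_def length_Suc_conv)
  then show ?thesis using True by (simp add: U_def C_J.simps[of n "[I]"] sum.delta eq_commute[of I])
 next
  case False
  then have "w ~= [I]" if "I : faces n" for I using that by (auto simp: words_def)
  then show ?thesis using False by (auto simp: U_def intro!: sum.neutral)
 qed
 finally show "U n 1 b w = (\<Sum>I\<in>faces n. tscl (lk (omega n I) b) (xi I :: 'k tseries)) w" ..
qed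

lemma U_quad:
 assumes "2 <= k" "!!r b. 1 <= r ==> r < k ==> lie_part n r (1 - mdeg b) (U n r b :: 'k::field_char_0 tseries)"
 shows "U n k b = tscl (- 1) (quad n k (- 1) (dupont_h n) b :: 'k tseries)"
proof
 fix w
 have "w : words n k ==> C_J n w = - dupont_h n (\<Sum>r\<in>{1..<length w}. sbeta (C_J n (take r w)) (C_J n (drop r w)) :: 'k form)"
  using assms(1) by (simp add: C_J.simps[of n w] words_def)
 moreover have q: "quad n k (- 1) (dupont_h n) b = (%w. if w : words n k then sg ((- 1 + 1) * wdeg w) * eps w *
   lk (dupont_h n (\<Sum>r\<in>{1..<length w}. sbeta (C_J n (take r w)) (C_J n (drop r w)) :: 'k form)) b else 0)"
  by (rule quad_word[OF klin_dupont_h assms(2)])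
 ultimately show "U n k b w = tscl (- 1) (quad n k (- 1) (dupont_h n) b :: 'k tseries) w"
  unfolding q U_def tscl_def by simp
qed

text \<open>
  Although \<open>C_J\<close> is defined by associative products, its coefficients form Lie
  elements, since the same recursion can be written with commutators.
\<close>

lemma U_lie: "1 <= k ==> lie_part n k (1 - mdeg b) (U n k b :: 'k::field_char_0 tseries)"
proof (induction k arbitrary: b rule: less_induct)
 case (less k)
 show ?case
 proof (cases "k = 1")
  case True
  show ?thesis unfolding True U_1
  proof (rule lie_part_sum)
   fix I assume I: "I : faces n"
   show "lie_part n 1 (1 - mdeg b) (tscl (lk (omega n I) b) (xi I :: 'k tseries))"
   proof (cases "lk (omega n I) b = (0::'k)")
    case True
    have "tscl 0 s = (0 :: 'k tseries)" for s by (auto simp: tscl_def)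
    then show ?thesis unfolding True by (simp only: lie_part.zero)
   next
    case False
    have "1 - mdeg b = xdeg I" using omega_degree(2)[OF I False] by (simp add: xdeg_def)
    then show ?thesis using lie_part.scl[OF lie_part.gen[OF I]] by simp
   qed
  qed
 next
  case False
  then have k: "2 <= k" using less by simp
  have L: "lie_part n r (1 - mdeg b) (U n r b :: 'k tseries)" if "1 <= r" "r < k" for r b using less.IH that by blast
  have q: "lie_part n k (2 + - 1 - mdeg b) (quad n k (- 1) (dupont_h n) b :: 'k tseries)"
   by (rule quad_lie[OF klin_dupont_h homT_h L])
  have e: "U n k b = tscl (- 1) (quad n k (- 1) (dupont_h n) b :: 'k tseries)" by (rule U_quad[OF k L])
  have d: "1 - mdeg b = 2 + - 1 - mdeg b" by simp
  show ?thesis unfolding e d by (rule lie_part.scl[OF q])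
 qed
qed

lemma dxi_1: "comp 1 (dxi n I) = (\<Sum>J\<in>faces n. tscl (- (sg (xdeg J) * lk (C_d n J) I)) (xi J :: 'k::field_char_0 tseries))"
proof
 fix w
 have "(\<Sum>J\<in>faces n. tscl (- (sg (xdeg J) * lk (C_d n J) I)) (xi J :: 'k tseries)) w
  = (\<Sum>J\<in>faces n. if w = [J] then - (sg (xdeg J) * lk (C_d n J) I) else 0)"
  unfolding sum_fun_app tscl_def xi_def by (rule sum.cong) auto
 also have "... = comp 1 (dxi n I) w"
 proof (cases "w : words n 1")
  case True
  then obtain J where w: "w = [J]" "J : faces n" by (auto simp: words_def length_Suc_conv)
  then show ?thesis using True by (simp add: comp_def dxi_def C_b_def sum.delta eq_commute[of J])
 next
  case False
  then have "w ~= [J]" if "J : faces n" for J using that by (auto simp: words_def)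
  then show ?thesis using False by (auto simp: comp_def dxi_def words_def intro!: sum.neutral)
 qed
 finally show "comp 1 (dxi n I) w = (\<Sum>J\<in>faces n. tscl (- (sg (xdeg J) * lk (C_d n J) I)) (xi J :: 'k tseries)) w" ..
qed

lemma dxi_quad: assumes "2 <= k" shows "comp k (dxi n I) = tscl (- 1) (quad n k 0 (dupont_p n) I :: 'k::field_char_0 tseries)"
proof
 fix w
 have q: "quad n k 0 (dupont_p n) I = (%w. if w : words n k then sg ((0 + 1) * wdeg w) * eps w *
   lk (dupont_p n (\<Sum>r\<in>{1..<length w}. sbeta (C_J n (take r w)) (C_J n (drop r w)) :: 'k form)) I else 0)"
  by (rule quad_word[OF klin_dupont_p U_lie])
 have wd: "(\<Sum>j<length w. xdeg (w ! j)) = wdeg w" by (simp add: wdeg_def sum_list_sum_nth atLeast0LessThan)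
 show "comp k (dxi n I) w = tscl (- 1) (quad n k 0 (dupont_p n) I :: 'k tseries) w"
  unfolding q tscl_def comp_def dxi_def wd using assms
  by (auto simp: words_def C_b_def sg_add eps_def)
qed

text \<open>
  The transferred operations vanish on shuffles; here this appears as \<open>d
  \<xi>\<^sub>I\<close> being a Lie series.
\<close>

lemma dxi_lie: assumes "1 <= k" shows "lie_part n k (xdeg I + 1) (comp k (dxi n I) :: 'k::field_char_0 tseries)"
proof (cases "k = 1")
 case True
 show ?thesis unfolding True dxi_1
 proof (rule lie_part_sum)
  fix J assume J: "J : faces n"
  show "lie_part n 1 (xdeg I + 1) (tscl (- (sg (xdeg J) * lk (C_d n J) I)) (xi J :: 'k tseries))"
  proof (cases "lk (C_d n J) I = (0::'k)")
   case True
   have "tscl 0 s = (0 :: 'k tseries)" for s by (auto simp: tscl_def)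
   then show ?thesis unfolding True mult_zero_right minus_zero by (simp only: lie_part.zero)
  next
   case False
   have "xdeg I + 1 = xdeg J" using C_d_degree(2)[OF J False] by (simp add: xdeg_def)
   then show ?thesis using lie_part.scl[OF lie_part.gen[OF J]] by simp
  qed
 qed
next
 case False
 then have k: "2 <= k" using assms by simp
 have q: "lie_part n k (2 + 0 - cdeg I) (quad n k 0 (dupont_p n) I :: 'k tseries)"
  by (rule quad_lie[OF klin_dupont_p homT_p U_lie])
 have e: "comp k (dxi n I) = tscl (- 1) (quad n k 0 (dupont_p n) I :: 'k tseries)" by (rule dxi_quad[OF k])
 have d: "xdeg I + 1 = 2 + 0 - cdeg I" by (simp add: xdeg_def)
 show ?thesis unfolding e d by (rule lie_part.scl[OF q])
qed

lemma dxi_mc_gr: "(dxi n I :: 'k::field_char_0 tseries) : mc_gr n (xdeg I + 1)"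
 by (simp add: mc_gr_comp dxi_lie)

section \<open>The universal solution evaluated in a complete dg Lie algebra\<close>

context complete_dg_lie begin

definition fs :: "'k => ('b => 'v) => ('b => 'v)" where "fs c y = (%b. scl g c (y b))"

lemma vector_space_fs: "vector_space fs"
 by unfold_locales (auto simp: fs_def fun_eq_iff V.scale_right_distrib V.scale_left_distrib)

definition hop :: "nat => int => (fmono => 'v) => (fmono => 'v)" where
 "hop n = tensor_op g (form_basis n) mdeg mdeg (- 1) (%m. dupont_h n (sng m 1))"
definition pop :: "nat => int => (fmono => 'v) => (nat set => 'v)" where
 "pop n = tensor_op g (form_basis n) mdeg cdeg 0 (%m. dupont_p n (sng m 1))"
definition iop :: "nat => int => (nat set => 'v) => (fmono => 'v)" where
 "iop n = tensor_op g (faces n) cdeg mdeg 0 (omega n)"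

abbreviation VV :: "nat => int => (fmono => 'v) set" where "VV n \<equiv> FT (form_basis n) mdeg"
abbreviation WW :: "nat => (nat set => 'v) set" where "WW n \<equiv> FT (faces n) cdeg 1"

definition YY :: "nat => (fmono => 'v) set" where "YY n = {y : VV n 1. hop n 1 y = 0 & pop n 1 y = 0}"

lemma hop_VV: "y : VV n D ==> hop n D y : VV n (D - 1)"
 using tensor_op_FT[OF _ homT_h] by (simp add: hop_def)
lemma iop_VV: "x : WW n ==> iop n 1 x : VV n 1"
 using tensor_op_FT[OF _ homT_i] by (fastforce simp: iop_def)
lemma lop_VV: "y : VV n 1 ==> z : VV n 1 ==> tensor_brk g n 1 1 y z : VV n 2"
 using tensor_brk_FT(1)[of y n 1 z 1] by simp

lemma hop_hop: assumes "y : VV n D" shows "hop n (D - 1) (hop n D y) = 0"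
proof
 fix e
 have "hop n (D + - 1) (hop n D y) e = (\<Sum>b\<in>supp y. scl g (sg ((- 1 + - 1) * (D - mdeg b)) *
   lk (lin (%m. dupont_h n (sng m 1)) (dupont_h n (sng b 1))) e) (y b))"
  unfolding hop_def by (rule tensor_op_comp[OF assms homT_h homT_h FTD(1)[OF assms] order_refl])
 also have "... = 0"
 proof (intro sum.neutral ballI)
  fix b assume "b : supp y"
  then have "b : form_basis n" using FTD(2)[OF assms] by blast
  then have "dupont_h n (dupont_h n (sng b 1)) = (0 :: 'k form)" by (intro dupont_h_dupont_h single_form_basis)
  then show "scl g (sg ((- 1 + - 1) * (D - mdeg b)) * lk (lin (%m. dupont_h n (sng m 1)) (dupont_h n (sng b 1))) e) (y b) = 0"
   unfolding klin_eq_lin[OF klin_dupont_h] by simp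
 qed
 finally show "hop n (D - 1) (hop n D y) e = 0 e" by simp
qed

lemma pop_hop: assumes "y : VV n D" shows "pop n (D - 1) (hop n D y) = 0"
proof
 fix e
 have "pop n (D + - 1) (hop n D y) e = (\<Sum>b\<in>supp y. scl g (sg ((- 1 + 0) * (D - mdeg b)) *
   lk (lin (%m. dupont_p n (sng m 1)) (dupont_h n (sng b 1))) e) (y b))"
  unfolding hop_def pop_def by (rule tensor_op_comp[OF assms homT_h homT_p FTD(1)[OF assms] order_refl])
 also have "... = 0"
 proof (intro sum.neutral ballI)
  fix b assume "b : supp y"
  then have "b : form_basis n" using FTD(2)[OF assms] by blast
  then have "dupont_p n (dupont_h n (sng b 1)) = (0 :: nat set \<Rightarrow>\<^sub>0 'k)" by (intro dupont_p_dupont_h single_form_basis)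
  then show "scl g (sg ((- 1 + 0) * (D - mdeg b)) * lk (lin (%m. dupont_p n (sng m 1)) (dupont_h n (sng b 1))) e) (y b) = 0"
   unfolding klin_eq_lin[OF klin_dupont_p] by simp
 qed
 finally show "pop n (D - 1) (hop n D y) e = 0 e" by simp
qed

lemma hop_iop: assumes "x : WW n" shows "hop n 1 (iop n 1 x) = 0"
proof
 fix e
 have "hop n (1 + 0) (iop n 1 x) e = (\<Sum>I\<in>supp x. scl g (sg ((0 + - 1) * (1 - cdeg I)) *
   lk (lin (%m. dupont_h n (sng m 1)) (omega n I)) e) (x I))"
  unfolding hop_def iop_def by (rule tensor_op_comp[OF assms homT_i homT_h FTD(1)[OF assms] order_refl])
 also have "... = 0"
 proof (intro sum.neutral ballI)
  fix I assume "I : supp x"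
  then have "I : faces n" using FTD(2)[OF assms] by blast
  then have "dupont_h n (omega n I) = (0 :: 'k form)" by (intro dupont_h_omega facesD(1))
  then show "scl g (sg ((0 + - 1) * (1 - cdeg I)) * lk (lin (%m. dupont_h n (sng m 1)) (omega n I)) e) (x I) = 0"
   unfolding klin_eq_lin[OF klin_dupont_h] by simp
 qed
 finally show "hop n 1 (iop n 1 x) e = 0 e" by simp
qed

lemma pop_iop: assumes "x : WW n" shows "pop n 1 (iop n 1 x) = x"
proof
 fix e
 have "pop n (1 + 0) (iop n 1 x) e = (\<Sum>I\<in>faces n. scl g (sg ((0 + 0) * (1 - cdeg I)) *
   lk (lin (%m. dupont_p n (sng m 1)) (omega n I)) e) (x I))"
  unfolding pop_def iop_def by (rule tensor_op_comp[OF assms homT_i homT_p finite_faces FTD(2)[OF assms]])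
 also have "... = (\<Sum>I\<in>faces n. if e = I then x I else 0)"
 proof (intro sum.cong refl)
  fix I assume "I : faces n"
  note po = dupont_p_omega[OF this, where ?'k = 'k]
  show "scl g (sg ((0 + 0) * (1 - cdeg I)) * lk (lin (%m. dupont_p n (sng m 1)) (omega n I)) e) (x I) = (if e = I then x I else 0)"
   unfolding klin_eq_lin[OF klin_dupont_p] po by (simp add: lookup_single when_def)
 qed
 also have "... = x e" using FTD(2)[OF assms] by (auto simp: supp_def)
 finally show "pop n 1 (iop n 1 x) e = x e" by simp
qed

definition qsum where
 "qsum t F S y z e = (\<Sum>b\<in>S. \<Sum>c\<in>S. scl g (coef t F e b c) (brk g (y b) (z c)))"

lemma qsum_sym:
 assumes F: "klin F" and S: "S \<subseteq> form_basis n" and y: "y : VV n 1" and z: "z : VV n 1"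
 shows "qsum t F S y z e = qsum t F S z y e"
proof -
 have "qsum t F S z y e = (\<Sum>b\<in>S. \<Sum>c\<in>S. scl g (coef t F e c b) (brk g (z c) (y b)))"
  unfolding qsum_def by (rule sum.swap)
 also have "... = qsum t F S y z e" unfolding qsum_def
 proof (intro sum.cong refl)
  fix b c assume "b : S" "c : S"
  then have B: "b : form_basis n" "c : form_basis n" using S by blast+
  have c: "coef t F e c b = - (sg ((1 - mdeg c) * (1 - mdeg b)) * coef t F e b c)" by (rule coef_sym[OF F B(2,1)])
  have b: "brk g (z c) (y b) = - scl g (sg ((1 - mdeg c) * (1 - mdeg b))) (brk g (y b) (z c))"
   by (rule brk_antisym[OF FTD(3)[OF z] FTD(3)[OF y]])
  show "scl g (coef t F e c b) (brk g (z c) (y b)) = scl g (coef t F e b c) (brk g (y b) (z c))"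
   unfolding c b by (simp add: mult.assoc[symmetric])
 qed
 finally show ?thesis ..
qed

lemma qsum_lin:
 assumes x: "x : VV n 1" and y: "y : VV n 1" and z: "z : VV n 1"
 shows "qsum t F S (fs a x + y) z e = scl g a (qsum t F S x z e) + qsum t F S y z e"
proof -
 have "brk g ((fs a x + y) b) (z c) = scl g a (brk g (x b) (z c)) + brk g (y b) (z c)" for b c
  unfolding plus_fun_apply fs_def
  using brk_add[OF gr_scl[OF FTD(3)[OF x]] FTD(3)[OF y] FTD(3)[OF z]] brk_scl[OF FTD(3)[OF x] FTD(3)[OF z]] by simp
 then show ?thesis unfolding qsum_def
  by (simp add: V.scale_right_distrib sum.distrib V.scale_sum_right mult.commute)
qed

lemma hop_qsum:
 assumes "y : VV n 1" "z : VV n 1" "finite S" "S \<subseteq> form_basis n" "supp y \<subseteq> S" "supp z \<subseteq> S"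
 shows "hop n 2 (tensor_brk g n 1 1 y z) e = qsum (- 1) (dupont_h n) S y z e"
 unfolding hop_def qsum_def coef_def by (rule tensor_op_brk[OF klin_dupont_h homT_h assms])
lemma pop_qsum:
 assumes "y : VV n 1" "z : VV n 1" "finite S" "S \<subseteq> form_basis n" "supp y \<subseteq> S" "supp z \<subseteq> S"
 shows "pop n 2 (tensor_brk g n 1 1 y z) e = qsum 0 (dupont_p n) S y z e"
 unfolding pop_def qsum_def coef_def by (rule tensor_op_brk[OF klin_dupont_p homT_p assms])

lemma transfer_data:
 assumes x: "x : WW n"
 shows "quadratic_transfer fs (scl g) (VV n 1) (YY n) (%y z. hop n 2 (tensor_brk g n 1 1 y z))
  (%y z. pop n 2 (tensor_brk g n 1 1 y z) I) (iop n 1 x)"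
proof -
 interpret A: vector_space fs by (rule vector_space_fs)
 have S: "finite (supp y \<union> supp z \<union> supp w)" "supp y \<union> supp z \<union> supp w \<subseteq> form_basis n"
  if "y : VV n 1" "z : VV n 1" "w : VV n 1" for y z w
  using FTD(1,2)[OF that(1)] FTD(1,2)[OF that(2)] FTD(1,2)[OF that(3)] by auto
 have lin: "fs a y + z : VV n 1" if "y : VV n 1" "z : VV n 1" for a y z
  unfolding fs_def by (rule FT_lin[OF that])
 show ?thesis
 proof unfold_locales
  have hl: "hop n 1 (fs a y + z) = fs a (hop n 1 y) + hop n 1 z" "pop n 1 (fs a y + z) = fs a (pop n 1 y) + pop n 1 z"
   if "y : VV n 1" "z : VV n 1" for a y z
   unfolding hop_def pop_def fs_def by (rule tensor_op_lin[OF that homT_h]) (rule tensor_op_lin[OF that homT_p])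
  have Yl: "fs a y + z : YY n" if "y : YY n" "z : YY n" for a y z
   using that lin[of y z a] hl[of y z a] by (auto simp: YY_def fs_def fun_eq_iff)
  have Y0: "0 : YY n" unfolding YY_def hop_def pop_def
   by (simp only: mem_Collect_eq tensor_op_zero[OF homT_h] tensor_op_zero[OF homT_p] FT_zero simp_thms)
  show "A.subspace (YY n)"
  proof (rule A.subspaceI[OF Y0])
   show "y + z : YY n" if "y : YY n" "z : YY n" for y z using Yl[OF that, of 1] by (simp only: A.scale_one)
   show "fs c y : YY n" if "y : YY n" for c y using Yl[OF that Y0, of c] by (simp only: add_0_right)
  qed
  show "YY n \<subseteq> VV n 1" by (auto simp: YY_def)
  show "iop n 1 x : VV n 1" by (rule iop_VV[OF x])
  show "hop n 2 (tensor_brk g n 1 1 y z) : YY n" if "y : VV n 1" "z : VV n 1" for y z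
   using hop_VV[OF lop_VV[OF that]] hop_hop[OF lop_VV[OF that]] pop_hop[OF lop_VV[OF that]] by (simp add: YY_def)
  fix y z assume y: "y : VV n 1" and z: "z : VV n 1"
  let ?S = "supp y \<union> supp z \<union> supp y"
  note s = S[OF y z y]
  have b: "hop n 2 (tensor_brk g n 1 1 y z) e = qsum (- 1) (dupont_h n) ?S y z e"
   "hop n 2 (tensor_brk g n 1 1 z y) e = qsum (- 1) (dupont_h n) ?S z y e"
   "pop n 2 (tensor_brk g n 1 1 y z) I = qsum 0 (dupont_p n) ?S y z I"
   "pop n 2 (tensor_brk g n 1 1 z y) I = qsum 0 (dupont_p n) ?S z y I" for e
   by (rule hop_qsum[OF y z s] hop_qsum[OF z y s] pop_qsum[OF y z s] pop_qsum[OF z y s]; blast)+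
  show "hop n 2 (tensor_brk g n 1 1 y z) = hop n 2 (tensor_brk g n 1 1 z y)"
   by (rule ext) (unfold b(1,2), rule qsum_sym[OF klin_dupont_h s(2) y z])
  show "pop n 2 (tensor_brk g n 1 1 y z) I = pop n 2 (tensor_brk g n 1 1 z y) I"
   unfolding b(3,4) by (rule qsum_sym[OF klin_dupont_p s(2) y z])
 next
  fix c y y' z assume y: "y : VV n 1" and y': "y' : VV n 1" and z: "z : VV n 1"
  let ?S = "supp y \<union> supp y' \<union> supp z"
  note s = S[OF y y' z] and yy = lin[OF y y', of c]
  have sl: "supp (fs c y + y') \<subseteq> ?S" by (auto simp: supp_def fs_def)
  have b: "hop n 2 (tensor_brk g n 1 1 (fs c y + y') z) e = qsum (- 1) (dupont_h n) ?S (fs c y + y') z e"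
   "hop n 2 (tensor_brk g n 1 1 y z) e = qsum (- 1) (dupont_h n) ?S y z e"
   "hop n 2 (tensor_brk g n 1 1 y' z) e = qsum (- 1) (dupont_h n) ?S y' z e"
   "pop n 2 (tensor_brk g n 1 1 (fs c y + y') z) I = qsum 0 (dupont_p n) ?S (fs c y + y') z I"
   "pop n 2 (tensor_brk g n 1 1 y z) I = qsum 0 (dupont_p n) ?S y z I"
   "pop n 2 (tensor_brk g n 1 1 y' z) I = qsum 0 (dupont_p n) ?S y' z I" for e
   by (rule hop_qsum[OF yy z s sl] hop_qsum[OF y z s] hop_qsum[OF y' z s]
    pop_qsum[OF yy z s sl] pop_qsum[OF y z s] pop_qsum[OF y' z s]; blast)+
  show "hop n 2 (tensor_brk g n 1 1 (fs c y + y') z) = fs c (hop n 2 (tensor_brk g n 1 1 y z)) + hop n 2 (tensor_brk g n 1 1 y' z)"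
  proof
   have f: "(fs c p + q) e = scl g c (p e) + q e" for p q :: "fmono => 'v" and e by (simp add: fs_def)
   show "hop n 2 (tensor_brk g n 1 1 (fs c y + y') z) e = (fs c (hop n 2 (tensor_brk g n 1 1 y z)) + hop n 2 (tensor_brk g n 1 1 y' z)) e" for e
    unfolding f[of "hop n 2 (tensor_brk g n 1 1 y z)" "hop n 2 (tensor_brk g n 1 1 y' z)" e] b(1,2,3) by (rule qsum_lin[OF y y' z])
  qed
  show "pop n 2 (tensor_brk g n 1 1 (fs c y + y') z) I = scl g c (pop n 2 (tensor_brk g n 1 1 y z) I) + pop n 2 (tensor_brk g n 1 1 y' z) I"
   unfolding b(4,5,6) by (rule qsum_lin[OF y y' z])
 qed
qed

end

context complete_dg_lie begin

function JJ :: "nat => (nat set => 'v) => nat => (fmono => 'v)" where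
 "JJ n x k = (if k <= 1 then iop n 1 x
   else fs (- (1 / 2)) (\<Sum>r\<in>{1..<k}. hop n 2 (tensor_brk g n 1 1 (JJ n x r) (JJ n x (k - r)))))"
 by pat_completeness auto
termination by (relation "measure (%(n, x, k). k)") auto

declare JJ.simps [simp del]

lemma JJ_1: "JJ n x 1 = iop n 1 x" by (simp add: JJ.simps)
lemma JJ_ge: "2 <= k ==> JJ n x k = fs (- (1 / 2)) (\<Sum>r\<in>{1..<k}. hop n 2 (tensor_brk g n 1 1 (JJ n x r) (JJ n x (k - r))))"
 by (subst JJ.simps) simp

lemma JJ_VV: assumes x: "x : WW n" and "1 <= k" shows "JJ n x k : VV n 1"
proof -
 interpret q: quadratic_transfer fs "scl g" "VV n 1" "YY n" "%y z. hop n 2 (tensor_brk g n 1 1 y z)"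
  "%y z. pop n 2 (tensor_brk g n 1 1 y z) {}" "iop n 1 x" by (rule transfer_data[OF x])
 show ?thesis using q.J_V_Y[of "JJ n x" k, OF JJ_1 JJ_ge] assms(2) by blast
qed

lemma WW_gr: "x : WW n ==> x I : gr g (xdeg I)"
 using FTD(3)[of x "faces n" cdeg 1 I] by (simp add: xdeg_def)

lemma quad_ev:
 fixes F :: "'k form => ('c \<Rightarrow>\<^sub>0 'k)"
 assumes x: "x : WW n" and y: "!!r b. 1 <= r ==> r < k ==> y r b = ev n x r (U n r b)"
 shows "ev n x k (quad n k t F e) = scl g (1 / 2) (\<Sum>r\<in>{1..<k}. qsum t F (SU TYPE('k) n k) (y r) (y (k - r)) e)"
proof -
 note X = WW_gr[OF x]
 have b: "ev n x k (tbrk (U n r b) (U n (k - r) c)) = brk g (y r b) (y (k - r) c)" if r: "r : {1..<k}" for r b c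
 proof -
  have "ev n x (r + (k - r)) (tbrk (U n r b) (U n (k - r) c)) = brk g (ev n x r (U n r b)) (ev n x (k - r) (U n (k - r) c))"
   by (rule ev_brk[OF X U_lie U_lie]) (use r in auto)
  moreover have "y r b = ev n x r (U n r b)" "y (k - r) c = ev n x (k - r) (U n (k - r) c)"
   by (rule y; use r in auto)+
  ultimately show ?thesis using r by simp
 qed
 have s: "ev n x k (tscl c s) = scl g c (ev n x k s)" for c s by (rule ev_tscl[OF X])
 have m: "ev n x k (sum f A) = (\<Sum>i\<in>A. ev n x k (f i))" for f :: "'i => 'k tseries" and A by (rule ev_sum[OF X])
 have "ev n x k (quad n k t F e) = scl g (1 / 2) (\<Sum>r\<in>{1..<k}. \<Sum>b\<in>SU TYPE('k) n k. \<Sum>c\<in>SU TYPE('k) n k.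
   scl g (coef t F e b c) (ev n x k (tbrk (U n r b) (U n (k - r) c))))"
  unfolding quad_def s ev_sum[OF X] ..
 also have "... = scl g (1 / 2) (\<Sum>r\<in>{1..<k}. qsum t F (SU TYPE('k) n k) (y r) (y (k - r)) e)"
  unfolding qsum_def by (intro arg_cong[where f = "scl g (1 / 2)"] sum.cong refl) (simp only: b)
 finally show ?thesis .
qed

lemma supp_ev:
 assumes x: "x : WW n" and y: "!!b. y b = ev n x r (U n r b)" and r: "1 <= r" "r <= k"
 shows "supp y \<subseteq> SU TYPE('k) n k"
proof
 fix b assume b: "b : supp y"
 show "b : SU TYPE('k) n k"
 proof (rule ccontr)
  assume n: "b \<notin> SU TYPE('k) n k"
  have "(U n r b :: 'k tseries) = 0" by (rule SU(3)[OF r n])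
  then have "y b = 0" unfolding y using ev_0[OF WW_gr[OF x]] by simp
  then show False using b by (simp add: supp_def)
 qed
qed

lemma JJ_ev: assumes x: "x : WW n" shows "1 <= k ==> JJ n x k b = ev n x k (U n k b)"
proof (induction k arbitrary: b rule: less_induct)
 case (less k)
 note X = WW_gr[OF x]
 show ?case
 proof (cases "k = 1")
  case True
  have "ev n x 1 (U n 1 b) = (\<Sum>I\<in>faces n. scl g (lk (omega n I) b) (ev n x 1 (xi I)))"
   unfolding U_1 ev_sum[OF X] by (intro sum.cong refl ev_tscl[OF X])
  also have "... = (\<Sum>I\<in>faces n. scl g (sg (0 * (1 - cdeg I)) * lk (omega n I) b) (x I))"
   using ev_xi[OF X] by (intro sum.cong refl) simp
  also have "... = iop n 1 x b"
   unfolding iop_def by (rule tensor_op_sum[OF x homT_i finite_faces FTD(2)[OF x], symmetric])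
  finally show ?thesis unfolding True JJ_1 ..
 next
  case False
  then have k: "2 <= k" using less by simp
  have y: "JJ n x r b = ev n x r (U n r b)" if "1 <= r" "r < k" for r b using less.IH that by blast
  have s: "supp (JJ n x r) \<subseteq> SU TYPE('k) n k" if "1 <= r" "r < k" for r
   by (rule supp_ev[OF x y]) (use that in auto)
  have h: "hop n 2 (tensor_brk g n 1 1 (JJ n x r) (JJ n x (k - r))) b
   = qsum (- 1) (dupont_h n) (SU TYPE('k) n k) (JJ n x r) (JJ n x (k - r)) b" if "r : {1..<k}" for r
   by (rule hop_qsum[OF JJ_VV[OF x] JJ_VV[OF x] SU(1,2) s s]) (use that in auto)
  have "JJ n x k b = scl g (- (1 / 2)) (\<Sum>r\<in>{1..<k}. hop n 2 (tensor_brk g n 1 1 (JJ n x r) (JJ n x (k - r))) b)"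
   unfolding JJ_ge[OF k] by (simp add: fs_def sum_fun_app)
  also have "... = scl g (- (1 / 2)) (\<Sum>r\<in>{1..<k}. qsum (- 1) (dupont_h n) (SU TYPE('k) n k) (JJ n x r) (JJ n x (k - r)) b)"
   by (intro arg_cong[where f = "scl g (- (1 / 2))"] sum.cong refl h)
  also have "... = scl g (- 1) (ev n x k (quad n k (- 1) (dupont_h n) b))"
  proof -
   have q: "ev n x k (quad n k (- 1) (dupont_h n) b)
    = scl g (1 / 2) (\<Sum>r\<in>{1..<k}. qsum (- 1) (dupont_h n) (SU TYPE('k) n k) (JJ n x r) (JJ n x (k - r)) b)"
    by (rule quad_ev[OF x y])
   show ?thesis unfolding q by simp
  qed
  also have "... = ev n x k (tscl (- 1) (quad n k (- 1) (dupont_h n) b))" by (rule ev_tscl[OF X, symmetric])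
  also have "tscl (- 1) (quad n k (- 1) (dupont_h n) b) = (U n k b :: 'k tseries)"
   by (rule U_quad[OF k U_lie, symmetric])
  finally show ?thesis .
 qed
qed

lemma dxi_ev:
 assumes x: "x : WW n" and k: "2 <= k"
 shows "ev n x k (dxi n I) = - scl g (1 / 2) (\<Sum>r\<in>{1..<k}. pop n 2 (tensor_brk g n 1 1 (JJ n x r) (JJ n x (k - r))) I)"
proof -
 note X = WW_gr[OF x]
 have y: "JJ n x r b = ev n x r (U n r b)" if "1 <= r" "r < k" for r b using JJ_ev[OF x] that by blast
 have s: "supp (JJ n x r) \<subseteq> SU TYPE('k) n k" if "1 <= r" "r < k" for r
  by (rule supp_ev[OF x y]) (use that in auto)
 have h: "qsum 0 (dupont_p n) (SU TYPE('k) n k) (JJ n x r) (JJ n x (k - r)) I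
  = pop n 2 (tensor_brk g n 1 1 (JJ n x r) (JJ n x (k - r))) I" if "r : {1..<k}" for r
  by (rule pop_qsum[OF JJ_VV[OF x] JJ_VV[OF x] SU(1,2) s s, symmetric]) (use that in auto)
 have "ev n x k (dxi n I) = ev n x k (comp k (dxi n I))" by (rule ev_comp[OF X, symmetric])
 also have "... = ev n x k (tscl (- 1) (quad n k 0 (dupont_p n) I))" unfolding dxi_quad[OF k] ..
 also have "... = scl g (- 1) (ev n x k (quad n k 0 (dupont_p n) I))" by (rule ev_tscl[OF X])
 also have "... = - scl g (1 / 2) (\<Sum>r\<in>{1..<k}. qsum 0 (dupont_p n) (SU TYPE('k) n k) (JJ n x r) (JJ n x (k - r)) I)"
 proof -
  have q: "ev n x k (quad n k 0 (dupont_p n) I)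
   = scl g (1 / 2) (\<Sum>r\<in>{1..<k}. qsum 0 (dupont_p n) (SU TYPE('k) n k) (JJ n x r) (JJ n x (k - r)) I)"
   by (rule quad_ev[OF x y])
  show ?thesis unfolding q by simp
 qed
 also have "(\<Sum>r\<in>{1..<k}. qsum 0 (dupont_p n) (SU TYPE('k) n k) (JJ n x r) (JJ n x (k - r)) I)
  = (\<Sum>r\<in>{1..<k}. pop n 2 (tensor_brk g n 1 1 (JJ n x r) (JJ n x (k - r))) I)"
  by (intro sum.cong refl h)
 finally show ?thesis .
qed

lemma dxi_ev_1:
 assumes x: "x : WW n"
 shows "ev n x 1 (dxi n I) = - tensor_op g (faces n) cdeg cdeg 1 (C_d n) 1 x I"
proof -
 note X = WW_gr[OF x]
 have "ev n x 1 (dxi n I) = ev n x 1 (comp 1 (dxi n I))" by (rule ev_comp[OF X, symmetric])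
 also have "... = (\<Sum>J\<in>faces n. scl g (- (sg (xdeg J) * lk (C_d n J) I)) (ev n x 1 (xi J)))"
  unfolding dxi_1 ev_sum[OF X] by (intro sum.cong refl ev_tscl[OF X])
 also have "... = - (\<Sum>J\<in>faces n. scl g (sg (1 * (1 - cdeg J)) * lk (C_d n J) I) (x J))"
  using ev_xi[OF X] unfolding sum_negf[symmetric] by (intro sum.cong refl) (simp add: xdeg_def)
 also have "... = - tensor_op g (faces n) cdeg cdeg 1 (C_d n) 1 x I"
  by (rule arg_cong[where f = uminus], rule tensor_op_sum[OF x homT_Cd finite_faces FTD(2)[OF x], symmetric])
 finally show ?thesis .
qed

end

section \<open>Counting permutations\<close>

text \<open>
  Each of the elements of \<open>insert a Q\<close> is equally likely to come last.
\<close>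

lemma count_last:
 fixes S Q :: "nat set"
 assumes S: "finite S" and Q: "Q \<subseteq> S" "a : S" "a \<notin> Q"
 shows "card {si. si permutes S & (\<forall>p\<in>Q. inv si p < inv si a)} * (card Q + 1) = fact (card S)"
proof -
 let ?Q = "insert a Q"
 let ?P = "%x. {ta. ta permutes S & (\<forall>p\<in>?Q - {x}. ta p < ta x)}"
 have fQ: "finite ?Q" using finite_subset[OF Q(1) S] by simp
 have fp: "finite {ta. ta permutes S}" by (rule finite_permutations[OF S])
 have fP: "finite (?P x)" for x by (rule finite_subset[OF _ fp]) auto
 have inj: "ta p ~= ta q" if "ta permutes S" "p ~= q" for ta p q using permutes_inj[OF that(1)] that(2) by (auto dest: injD)
 have eq: "card (?P x) = card (?P a)" if x: "x : ?Q" for x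
 proof -
  let ?t = "Transposition.transpose a x"
  have t: "?t permutes S" using x Q by (intro permutes_swap_id) auto
  have *: "ta \<circ> ?t : ?P z" if "ta : ?P y" "y : {a, x}" "z = ?t y" for ta y z
  proof -
   have "(ta \<circ> ?t) p < (ta \<circ> ?t) z" if p: "p : ?Q - {z}" for p
   proof -
    have "?t p : ?Q - {y}" using p x \<open>z = ?t y\<close> \<open>y : {a, x}\<close> by (auto simp: transpose_def)
    then show ?thesis using \<open>ta : ?P y\<close> \<open>z = ?t y\<close> by simp
   qed
   then show ?thesis using \<open>ta : ?P y\<close> permutes_compose[OF t] by blast
  qed
  have tt: "(ta \<circ> ?t) \<circ> ?t = ta" for ta :: "nat => nat" by (simp add: fun_eq_iff)
  have "bij_betw (%ta. ta \<circ> ?t) (?P x) (?P a)"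
   by (rule bij_betw_byWitness[where f' = "%ta. ta \<circ> ?t"])
    (use tt *[of _ x a] *[of _ a x] in \<open>simp_all add: image_subset_iff\<close>)
  then show ?thesis by (rule bij_betw_same_card)
 qed
 have un: "{ta. ta permutes S} = (\<Union>x\<in>?Q. ?P x)"
 proof (intro set_eqI iffI)
  fix ta assume t: "ta : {ta. ta permutes S}"
  have "Max (ta ` ?Q) : ta ` ?Q" using fQ by (intro Max_in) auto
  then obtain x where "x : ?Q" "Max (ta ` ?Q) = ta x" by (rule imageE)
  then have x: "x : ?Q" "ta x = Max (ta ` ?Q)" by simp_all
  have "ta p < ta x" if "p : ?Q - {x}" for p
  proof -
   have "ta p <= ta x" unfolding x(2) using that fQ by (intro Max_ge) auto
   moreover have "ta p ~= ta x" using inj t that by auto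
   ultimately show ?thesis by simp
  qed
  then show "ta : (\<Union>x\<in>?Q. ?P x)" using t x(1) by blast
 qed auto
 have dj: "?P x \<inter> ?P y = {}" if "x : ?Q" "y : ?Q" "x ~= y" for x y
 proof (rule equals0I)
  fix ta assume "ta : ?P x \<inter> ?P y"
  then have "ta x < ta y" "ta y < ta x" using that by blast+
  then show False by simp
 qed
 have "fact (card S) = card {ta. ta permutes S}" using card_permutations[OF refl S] by simp
 also have "... = (\<Sum>x\<in>?Q. card (?P x))" unfolding un by (rule card_UN_disjoint[OF fQ]) (use fP dj in auto)
 also have "... = card ?Q * card (?P a)" using eq by simp
 also have "card (?P a) = card {si. si permutes S & (\<forall>p\<in>Q. inv si p < inv si a)}"
 proof (rule bij_betw_same_card[OF bij_betw_byWitness[where f = inv and f' = inv]])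
  have Qa: "?Q - {a} = Q" using Q by auto
  show "\<forall>ta\<in>?P a. inv (inv ta) = ta" "\<forall>ta\<in>{si. si permutes S & (\<forall>p\<in>Q. inv si p < inv si a)}. inv (inv ta) = ta"
   by (auto intro: permutes_inv_inv)
  show "inv ` ?P a \<subseteq> {si. si permutes S & (\<forall>p\<in>Q. inv si p < inv si a)}"
   unfolding Qa by (auto simp: permutes_inv permutes_inv_inv)
  show "inv ` {si. si permutes S & (\<forall>p\<in>Q. inv si p < inv si a)} \<subseteq> ?P a"
   unfolding Qa by (auto simp: permutes_inv permutes_inv_inv)
 qed
 finally show ?thesis using Q(3) finite_subset[OF Q(1) S] by (simp add: mult.commute)
qed

section \<open>Words with a zero letter\<close>

lemma klin_S: "klin (S_map f)" "klin (S_delta l)" "klin (S_perm si)" "klin (S_h1 h ip)" "klin (S_H h ip)"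
 by (simp_all add: S_map_def[abs_def] S_delta_def[abs_def] S_perm_def[abs_def] S_h1_def[abs_def] S_H_def[abs_def])

lemma S_perm_single:
 fixes w :: "'a letter list"
 assumes si: "si permutes {..<length w}"
  and d: "!!i j. i < length w ==> j < length w ==> i ~= j ==> sdeg (w ! i) * sdeg (w ! j) = 0"
 shows "S_perm si (sng w (1::'k::field_char_0)) = sng (map (%i. w ! si i) [0..<length w]) 1"
proof -
 have "sg (sdeg (w ! si i) * sdeg (w ! si j)) = (1::'k)" if "i < j" "j < length w" for i j
 proof -
  have "si i < length w" "si j < length w" using permutes_in_image[OF si, of i] permutes_in_image[OF si, of j] that by auto
  moreover have "si i ~= si j" using permutes_inj[OF si] that by (auto dest: injD)
  ultimately have z: "sdeg (w ! si i) * sdeg (w ! si j) = 0" by (rule d)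
  show ?thesis unfolding z by simp
 qed
 then have "(\<Prod>(i, j) | i < j & j < length w & si j < si i. sg (sdeg (w ! si i) * sdeg (w ! si j))) = (1::'k)"
  by (intro prod.neutral) auto
 then show ?thesis unfolding S_perm_def lin_single by simp
qed

lemma sum_single_const: "(\<Sum>i\<in>A. sng w (1::'k::field_char_0)) = sng w (of_nat (card A))"
 by (induction A rule: infinite_finite_induct) (simp_all flip: single_add)

context complete_dg_lie begin

text \<open>
  Such a word represents zero in the symmetric power; all the operators preserve this property, so
  it can be neglected.
\<close>

definition zw :: "nat => (fmono => 'v) letter list => bool" where
 "zw n w \<longleftrightarrow> (\<forall>l\<in>set w. snd l : VV n (fst l)) & (\<exists>l\<in>set w. snd l = 0)"

definition ZZ :: "nat => (fmono => 'v, 'k) words => bool" where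
 "ZZ n c \<longleftrightarrow> (\<forall>w\<in>ks c. zw n w)"

lemma ZZ_0: "ZZ n 0" by (simp add: ZZ_def)
lemma ZZ_add: "ZZ n c ==> ZZ n d ==> ZZ n (c + d)"
 unfolding ZZ_def using Poly_Mapping.keys_add[of c d] by blast
lemma ZZ_scale: "ZZ n c ==> ZZ n (cscale a c)"
 unfolding ZZ_def using keys_cscale_subset[of a c] by blast
lemma ZZ_sum: "(!!i. i : A ==> ZZ n (f i)) ==> ZZ n (sum f A)"
 by (induction A rule: infinite_finite_induct) (auto simp: ZZ_0 ZZ_add)
lemma ZZ_single: "zw n w ==> ZZ n (sng w a)" by (auto simp: ZZ_def split: if_splits)
lemma ZZ_lin: "(!!w. zw n w ==> ZZ n (f w)) ==> ZZ n c ==> ZZ n (lin f c)"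
 unfolding lin_def
proof (rule ZZ_sum, rule ZZ_scale)
 fix i assume f: "!!w. zw n w ==> ZZ n (f w)" and c: "ZZ n c" "i : ks c"
 have "zw n i" using c unfolding ZZ_def by blast
 then show "ZZ n (f i)" by (rule f)
qed

lemma scl_VV: "z : VV n D ==> (%m. scl g a (z m)) : VV n D"
 using FT_lin[of z "form_basis n" mdeg D 0 a] FT_zero[of "form_basis n" mdeg D] by simp

lemma tensor_brk_zero:
 assumes "z : VV n E" shows "tensor_brk g n D E 0 z = 0" "tensor_brk g n E D z 0 = 0"
proof -
 note s = FTD(1,2)[OF assms] and o = FT_zero[of "form_basis n" mdeg D]
 have z: "supp (0 :: fmono => 'v) \<subseteq> supp z" by (simp add: supp_def)
 show "tensor_brk g n D E 0 z = 0"
  unfolding fun_eq_iff tensor_brk_sum[OF o assms s z order_refl] using brk_zero_left[OF FTD(3)[OF assms]] by simp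
 show "tensor_brk g n E D z 0 = 0"
  unfolding fun_eq_iff tensor_brk_sum[OF assms o s order_refl z] using brk_zero_right[OF FTD(3)[OF assms]] by simp
qed

lemma V_l_ok: assumes "snd p : VV n (fst p)" "snd q : VV n (fst q)"
 shows "snd (V_l g n p q) : VV n (fst (V_l g n p q))" "snd p = 0 \<or> snd q = 0 ==> snd (V_l g n p q) = 0"
proof -
 show "snd (V_l g n p q) : VV n (fst (V_l g n p q))"
  using scl_VV[OF tensor_brk_FT(1)[OF assms]] by (simp add: V_l_def split_def)
 show "snd p = 0 \<or> snd q = 0 ==> snd (V_l g n p q) = 0"
 proof -
  assume "snd p = 0 \<or> snd q = 0"
  then have t: "tensor_brk g n (fst p) (fst q) (snd p) (snd q) = 0"
   using tensor_brk_zero(1)[OF assms(2)] tensor_brk_zero(2)[OF assms(1)] by (elim disjE) simp_all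
  show ?thesis unfolding V_l_def split_def snd_conv t by (simp add: zero_fun_def)
 qed
qed

lemma V_h_eq: "V_h g n (D, z) = (D - 1, hop n D z)" by (simp add: V_h_def hop_def)
lemma V_ip_eq: "(V_i g n \<circ> V_p g n) (D, z) = (D, iop n D (pop n D z))" by (simp add: V_i_def V_p_def iop_def pop_def)
lemma hop_0: "hop n D 0 = 0" unfolding hop_def by (rule tensor_op_zero[OF homT_h])
lemma pop_0: "pop n D 0 = 0" unfolding pop_def by (rule tensor_op_zero[OF homT_p])
lemma iop_0: "iop n D 0 = 0" unfolding iop_def by (rule tensor_op_zero[OF homT_i])

lemma V_h_ok: "snd p : VV n (fst p) ==> snd (V_h g n p) : VV n (fst (V_h g n p))"
 "snd p = 0 ==> snd (V_h g n p) = 0"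
 by (cases p; simp add: V_h_eq hop_VV hop_0)+

lemma V_ip_ok: "snd p : VV n (fst p) ==> snd ((V_i g n \<circ> V_p g n) p) : VV n (fst ((V_i g n \<circ> V_p g n) p))"
 "snd p = 0 ==> snd ((V_i g n \<circ> V_p g n) p) = 0"
proof -
 obtain D z where p: "p = (D, z)" by (cases p)
 show "snd ((V_i g n \<circ> V_p g n) p) : VV n (fst ((V_i g n \<circ> V_p g n) p))" if "snd p : VV n (fst p)"
  unfolding p V_ip_eq using tensor_op_FT[OF tensor_op_FT[OF _ homT_p] homT_i, of z n D] that by (simp add: p iop_def pop_def)
 show "snd ((V_i g n \<circ> V_p g n) p) = 0" if "snd p = 0"
  unfolding p V_ip_eq using that pop_0 iop_0 by (simp add: p)
qed

lemma ZZ_delta: assumes "ZZ n c" shows "ZZ n (S_delta (V_l g n) c)"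
 unfolding S_delta_def
proof (rule ZZ_lin[OF _ assms], intro ZZ_sum ZZ_single)
 fix w i j assume w: "zw n w" and ij: "j : {..<length w}" "i : {..<j}"
 then have s: "w ! i : set w" "w ! j : set w" by auto
 then have ok: "snd (w ! i) : VV n (fst (w ! i))" "snd (w ! j) : VV n (fst (w ! j))" using w by (auto simp: zw_def)
 obtain p where p: "p < length w" "snd (w ! p) = 0" using w by (auto simp: zw_def in_set_conv_nth)
 have "\<exists>l\<in>set (V_l g n (w ! i) (w ! j) # nths w (- {i, j})). snd l = 0"
 proof (cases "p = i \<or> p = j")
  case True
  then have "snd (w ! i) = 0 \<or> snd (w ! j) = 0" using p by blast
  then show ?thesis using V_l_ok(2)[OF ok] by simp
 next
  case False
  then have "w ! p : set (nths w (- {i, j}))" using p by (auto simp: set_nths)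
  then show ?thesis using p(2) by auto
 qed
 moreover have "\<forall>l\<in>set (V_l g n (w ! i) (w ! j) # nths w (- {i, j})). snd l : VV n (fst l)"
  using V_l_ok(1)[OF ok] w in_set_nthsD[of _ w "- {i, j}"] by (auto simp: zw_def)
 ultimately show "zw n (V_l g n (w ! i) (w ! j) # nths w (- {i, j}))" by (simp only: zw_def)
qed

lemma ZZ_perm: assumes "ZZ n c" "!!w. w : ks c ==> si permutes {..<length w}" shows "ZZ n (S_perm si c)"
 unfolding S_perm_def lin_def
proof (intro ZZ_sum ZZ_scale ZZ_single)
 fix w assume w: "w : ks c"
 have "zw n w" using assms(1) w by (simp add: ZZ_def)
 moreover have "set (map (%i. w ! si i) [0..<length w]) = set w"
 proof -
  have "set (map (%i. w ! si i) [0..<length w]) = (%i. w ! i) ` (si ` {..<length w})" by (auto simp: image_image atLeast0LessThan)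
  also have "si ` {..<length w} = {..<length w}" by (rule permutes_image[OF assms(2)[OF w]])
  also have "(%i. w ! i) ` {..<length w} = set w" by (auto simp: set_conv_nth)
  finally show ?thesis .
 qed
 ultimately show "zw n (map (%i. w ! si i) [0..<length w])" unfolding zw_def by simp
qed

lemma h1_word_ok:
 assumes "\<forall>l\<in>set w. snd l : VV n (fst l)"
 shows "\<forall>l\<in>set (take j w @ V_h g n q # map (V_i g n \<circ> V_p g n) (drop (Suc j) w)). l ~= V_h g n q --> snd l : VV n (fst l)"
 using assms V_ip_ok(1)[of _ n] by (auto dest!: in_set_takeD in_set_dropD simp del: comp_apply)

text \<open>
  A letter becomes zero when \<open>h\<close> is applied to an element of its kernel, or \<open>i
  p\<close> to an element of the kernel of \<open>p\<close>.
\<close>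

lemma zw_h1:
 assumes ok: "\<forall>l\<in>set w. snd l : VV n (fst l)" and j: "j < length w"
  and p: "p < length w" "p < j & snd (w ! p) = 0 \<or> p = j & snd (V_h g n (w ! p)) = 0 \<or> j < p & snd ((V_i g n \<circ> V_p g n) (w ! p)) = 0"
 shows "zw n (take j w @ V_h g n (w ! j) # map (V_i g n \<circ> V_p g n) (drop (Suc j) w))"
proof -
 let ?w = "take j w @ V_h g n (w ! j) # map (V_i g n \<circ> V_p g n) (drop (Suc j) w)"
 have lw: "length ?w = length w" using j by simp
 have e: "?w ! p = (if p < j then w ! p else if p = j then V_h g n (w ! p) else (V_i g n \<circ> V_p g n) (w ! p))"
  using j p(1) by (auto simp: nth_append nth_Cons' min_def simp del: comp_apply)
 have "snd (?w ! p) = 0" unfolding e using p(2) by auto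
 then have "\<exists>l\<in>set ?w. snd l = 0" using p(1) lw by (metis nth_mem)
 moreover have "snd (V_h g n (w ! j)) : VV n (fst (V_h g n (w ! j)))" using ok j by (intro V_h_ok(1)) simp
 then have "\<forall>l\<in>set ?w. snd l : VV n (fst l)" using h1_word_ok[OF ok, of j "w ! j"] by metis
 ultimately show ?thesis unfolding zw_def by blast
qed

lemma ZZ_h1: assumes "ZZ n c" shows "ZZ n (S_h1 (V_h g n) (V_i g n \<circ> V_p g n) c)"
 unfolding S_h1_def
proof (rule ZZ_lin[OF _ assms], intro ZZ_sum ZZ_single)
 fix w j assume w: "zw n w" and j: "j : {..<length w}"
 obtain p where p: "p < length w" "snd (w ! p) = 0" using w by (auto simp: zw_def in_set_conv_nth)
 show "zw n (take j w @ V_h g n (w ! j) # map (V_i g n \<circ> V_p g n) (drop (Suc j) w))"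
  by (rule zw_h1[of w n j p]) (use w j p V_h_ok(2)[of "w ! p"] V_ip_ok(2)[of "w ! p" n] in \<open>auto simp: zw_def simp del: comp_apply\<close>)
qed

lemma lin_keys_length:
 assumes "!!w u. w : ks c ==> u : ks (f w) ==> length u = N" "w : ks (lin f c)" shows "length w = N"
proof -
 have "\<exists>u\<in>ks c. w : ks (f u)"
 proof (rule ccontr)
  assume "\<not> ?thesis"
  then have "lk (lin f c) w = 0" unfolding lin_def lookup_sum by (intro sum.neutral) (auto simp: in_keys_iff)
  then show False using assms(2) by (simp add: in_keys_iff)
 qed
 then show ?thesis using assms(1) by blast
qed

lemma perm_length:
 assumes "!!u. u : ks c ==> length u = N" "w : ks (S_perm si c)" shows "length w = N"
 using assms(2) unfolding S_perm_def
 by (rule lin_keys_length[rotated]) (use assms(1) in \<open>auto split: if_splits\<close>)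

lemma h1_length:
 fixes c :: "('z, 'k) words"
 assumes "!!u. u : ks c ==> length u = N" "w : ks (S_h1 h ip c)" shows "length w = N"
 using assms(2) unfolding S_h1_def
proof (rule lin_keys_length[rotated])
 fix v u assume v: "v : ks c" and u: "u : ks (\<Sum>j<length v. sng (take j v @ h (v ! j) # map ip (drop (Suc j) v)) (sg (\<Sum>k<j. sdeg (v ! k)) :: 'k))"
 have "\<exists>j<length v. u : ks (sng (take j v @ h (v ! j) # map ip (drop (Suc j) v)) (sg (\<Sum>k<j. sdeg (v ! k)) :: 'k))"
 proof (rule ccontr)
  assume a: "\<not> ?thesis"
  have "lk (\<Sum>j<length v. sng (take j v @ h (v ! j) # map ip (drop (Suc j) v)) (sg (\<Sum>k<j. sdeg (v ! k)) :: 'k)) u = 0"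
   using a unfolding lookup_sum in_keys_iff by (intro sum.neutral) blast
  then show False using u by (simp add: in_keys_iff)
 qed
 then show "length u = N" using assms(1)[OF v] by (auto split: if_splits)
qed

lemma ZZ_H: assumes "ZZ n c" shows "ZZ n (S_H (V_h g n) (V_i g n \<circ> V_p g n) c)"
 unfolding S_H_def
proof (rule ZZ_lin[OF _ assms], intro ZZ_scale ZZ_sum)
 fix w si assume w: "zw n w" and si: "si : {si. si permutes {..<length w}}"
 have 1: "ZZ n (S_perm si (sng w 1))" by (rule ZZ_perm[OF ZZ_single[OF w]]) (use si in auto)
 have l1: "length u = length w" if "u : ks (S_perm si (sng w (1::'k)))" for u
  by (rule perm_length[OF _ that]) auto
 have l2: "length u = length w" if "u : ks (S_h1 (V_h g n) (V_i g n \<circ> V_p g n) (S_perm si (sng w (1::'k))))" for u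
  by (rule h1_length[OF l1 that])
 show "ZZ n (S_perm (inv si) (S_h1 (V_h g n) (V_i g n \<circ> V_p g n) (S_perm si (sng w 1))))"
  by (rule ZZ_perm[OF ZZ_h1[OF 1]]) (use l2 si permutes_inv in auto)
qed

definition eqz :: "nat => (fmono => 'v, 'k) words => (fmono => 'v, 'k) words => bool" where
 "eqz n c d \<longleftrightarrow> ZZ n (c - d)"

lemma eqz_sum: assumes "!!i. i : A ==> eqz n (f i) (h i)" shows "eqz n (sum f A) (sum h A)"
 unfolding eqz_def sum_subtractf[symmetric] by (rule ZZ_sum) (use assms in \<open>simp add: eqz_def\<close>)
lemma eqz_scale: "eqz n c d ==> eqz n (cscale a c) (cscale a d)"
 unfolding eqz_def using ZZ_scale[of n "c - d" a] by (simp add: P.scale_right_diff_distrib)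
lemma eqz_ZZ: "ZZ n c ==> eqz n c 0" by (simp add: eqz_def)
lemma eqz_refl: "eqz n c c" by (simp add: eqz_def ZZ_0)
definition vlin :: "('w => 'v) => ('w \<Rightarrow>\<^sub>0 'k) => 'v" where
 "vlin ph c = (\<Sum>w\<in>ks c. scl g (lk c w) (ph w))"

lemma vlin_superset: assumes "finite S" "ks c \<subseteq> S" shows "vlin ph c = (\<Sum>w\<in>S. scl g (lk c w) (ph w))"
 unfolding vlin_def by (rule sum.mono_neutral_left) (use assms in \<open>auto simp: in_keys_iff\<close>)
lemma vlin_add: "vlin ph (c + d) = vlin ph c + vlin ph d"
 using vlin_superset[of "ks c \<union> ks d" "c + d" ph] vlin_superset[of "ks c \<union> ks d" c ph]
  vlin_superset[of "ks c \<union> ks d" d ph] Poly_Mapping.keys_add[of c d]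
 by (simp add: lookup_add V.scale_left_distrib sum.distrib)
lemma vlin_scale: "vlin ph (cscale a c) = scl g a (vlin ph c)"
 using vlin_superset[of "ks c" "cscale a c" ph] keys_cscale_subset[of a c]
 by (simp add: vlin_def V.scale_sum_right)
lemma vlin_0: "vlin ph 0 = 0" by (simp add: vlin_def)
lemma vlin_sum: "vlin ph (sum f A) = (\<Sum>i\<in>A. vlin ph (f i))"
 by (induction A rule: infinite_finite_induct) (auto simp: vlin_0 vlin_add)
lemma vlin_single: "vlin ph (sng w a) = scl g a (ph w)"
 using vlin_superset[of "{w}" "sng w a" ph] by simp
lemma vlin_lin: "vlin ph (lin f c) = vlin (%w. vlin ph (f w)) c"
 unfolding lin_def vlin_sum vlin_scale vlin_def[of "%w. vlin ph (f w)"] ..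

lemma has_csum_cong:
 assumes e: "!!i. i : A ==> f i = h i" and c: "has_csum g d f A y" shows "has_csum g d h A y"
 unfolding has_csum_def
proof (intro conjI allI impI)
 show "y : gr g d" using c by (simp add: has_csum_def)
 fix m :: nat assume "1 <= m"
 then obtain S0 where S0: "finite S0" "S0 \<subseteq> A" "!!S. finite S & S0 \<subseteq> S & S \<subseteq> A ==> sum f S - y : fil g m d"
  using c unfolding has_csum_def by meson
 show "\<exists>S0. finite S0 & S0 \<subseteq> A & (\<forall>S. finite S & S0 \<subseteq> S & S \<subseteq> A --> sum h S - y : fil g m d)"
 proof (intro exI[of _ S0] conjI S0(1,2) allI impI)
  fix S assume S: "finite S & S0 \<subseteq> S & S \<subseteq> A"
  have "sum f S = sum h S" by (rule sum.cong[OF refl e]) (use S in auto)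
  then show "sum h S - y : fil g m d" using S0(3)[OF S] by simp
 qed
qed

lemma length_nths_pair: "i < j ==> j < length w ==> Suc (Suc (length (nths w (- {i, j})))) = length w"
proof -
 assume ij: "i < j" "j < length w"
 have "length (nths w (- {i, j})) = card ({..<length w} - {i, j})"
  unfolding length_nths by (rule arg_cong[where f = card]) auto
 also have "... = length w - card {i, j}" using ij by (subst card_Diff_subset) auto
 finally show ?thesis using ij by simp
qed

context
 fixes n :: nat and x :: "nat set => 'v" and I :: "nat set"
 assumes x: "x : WW n"
begin

interpretation qt: quadratic_transfer fs "scl g" "VV n 1" "YY n" "%y z. hop n 2 (tensor_brk g n 1 1 y z)"
  "%y z. pop n 2 (tensor_brk g n 1 1 y z) I" "iop n 1 x" by (rule transfer_data[OF x])

definition Lt :: "(fmono => 'v) option => (fmono => 'v) letter" where "Lt m = (1, qt.val m)"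

lemma marks_nth: "qt.marks (mset ms) ==> i < length ms ==> qt.val (ms ! i) : VV n 1 & hop n 1 (qt.val (ms ! i)) = 0
  & (ms ! i ~= None --> pop n 1 (qt.val (ms ! i)) = 0)"
proof (cases "ms ! i")
 case None
 then show ?thesis using iop_VV[OF x] hop_iop[OF x] by simp
next
 case (Some y)
 assume "qt.marks (mset ms)" "i < length ms"
 then have "y : YY n" using Some unfolding qt.marks_def by (metis nth_mem_mset)
 then show ?thesis using Some by (simp add: YY_def)
qed

text \<open>
  Modulo words with a zero letter, a permutation contributes only when all letters in the image of
  \<open>h\<close> precede the new bracket: then \<open>i p\<close> acts as the identity on the
  letters after it. The proportion of such permutations is \<open>1/(q+1)\<close>.
\<close>

lemma S_H_word:
 assumes z: "z : VV n 2" and ms: "qt.marks (mset ms)"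
 shows "eqz n (S_H (V_h g n) (V_i g n \<circ> V_p g n) (sng ((2, z) # map Lt ms) 1))
  (cscale (1 / of_nat (qt.qn (mset ms) + 1)) (sng ((1, hop n 2 z) # map Lt ms) 1))"
proof -
 let ?h = "V_h g n" and ?ip = "V_i g n \<circ> V_p g n"
 define w where "w = (2::int, z) # map Lt ms"
 define w' where "w' = (1::int, hop n 2 z) # map Lt ms"
 define N where "N = length w"
 define Q where "Q = Suc ` {i. i < length ms & ms ! i ~= None}"
 have cQ: "card Q = qt.qn (mset ms)"
  unfolding Q_def by (simp add: card_image qt.qn_def length_filter_conv_card flip: mset_filter)
 have N: "N = Suc (length ms)" "length w = N" "length w' = N" "0 < N" by (simp_all add: N_def w_def w'_def)
 have wS: "w ! i = Lt (ms ! (i - 1))" "w' ! i = w ! i" "i - 1 < length ms" if "0 < i" "i < N" for i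
  using that N(1) by (auto simp: w_def w'_def nth_Cons')
 have w0: "w ! 0 = (2, z)" "w' ! 0 = ?h (2, z)" by (simp_all add: w_def w'_def V_h_eq)
 have wok: "snd (w ! i) : VV n (fst (w ! i))" if "i < N" for i
  by (cases "i = 0") (use that w0 wS[of i] z marks_nth[OF ms] in \<open>auto simp: Lt_def\<close>)
 have hz: "snd (?h (w ! i)) = 0" if "0 < i" "i < N" for i
  using wS[OF that] marks_nth[OF ms] by (simp add: Lt_def V_h_eq)
 have sd: "sdeg (w ! i) = 0" if "0 < i" "i < N" for i using wS(1)[OF that] by (simp add: Lt_def sdeg_def)
 have key: "eqz n (S_perm (inv si) (S_h1 ?h ?ip (S_perm si (sng w 1)))) (if \<forall>p\<in>Q. inv si p < inv si 0 then sng w' 1 else 0)"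
  if si: "si permutes {..<N}" for si
 proof -
  let ?cond = "\<forall>p\<in>Q. inv si p < inv si 0"
  define v where "v = map (%i. w ! si i) [0..<N]"
  define j0 where "j0 = inv si 0"
  define T where "T = (if ?cond then sng (v[j0 := ?h (2, z)]) 1 else (0 :: (fmono => 'v, 'k) words))"
  have siN: "si i < N \<longleftrightarrow> i < N" "inv si i < N \<longleftrightarrow> i < N" for i
   using permutes_in_image[OF si, of i] permutes_in_image[OF permutes_inv[OF si], of i] by auto
  have sii: "si (inv si i) = i" "inv si (si i) = i" for i using permutes_inverses[OF si] by auto
  have j0: "j0 < N" "si j0 = 0" using siN(2) N(4) sii by (auto simp: j0_def)
  have nz: "0 < si i" if "i ~= j0" for i using that sii(2)[of i] by (metis gr0I j0_def)
  have lv: "length v = N" and vn: "v ! i = w ! si i" if "i < N" for i using that by (simp_all add: v_def)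
  have lv: "length v = N" by (simp add: v_def)
  have P1: "S_perm si (sng w (1::'k)) = sng v 1" unfolding v_def N(2)[symmetric]
  proof (rule S_perm_single)
   show "si permutes {..<length w}" using si N by simp
   fix i j assume "i < length w" "j < length w" "i ~= j"
   then show "sdeg (w ! i) * sdeg (w ! j) = 0" using sd[of i] sd[of j] N by (cases "i = 0") auto
  qed
  have vok: "\<forall>l\<in>set v. snd l : VV n (fst l)" using wok siN by (auto simp: v_def)
  have E: "eqz n (S_h1 ?h ?ip (sng v 1)) T"
  proof -
   have s: "S_h1 ?h ?ip (sng v 1) = (\<Sum>j<N. sng (take j v @ ?h (v ! j) # map ?ip (drop (Suc j) v)) (sg (\<Sum>k<j. sdeg (v ! k)) :: 'k))"
    unfolding S_h1_def lin_single lv by simp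
   have "eqz n (S_h1 ?h ?ip (sng v 1)) (\<Sum>j<N. if j = j0 then T else 0)"
    unfolding s
   proof (rule eqz_sum)
    fix j assume j: "j : {..<N}"
    show "eqz n (sng (take j v @ ?h (v ! j) # map ?ip (drop (Suc j) v)) (sg (\<Sum>k<j. sdeg (v ! k)) :: 'k)) (if j = j0 then T else 0)"
    proof (cases "j = j0")
     case False
     have "snd (?h (v ! j)) = 0" using hz[OF nz[OF False]] j siN vn by simp
     then have "zw n (take j v @ ?h (v ! j) # map ?ip (drop (Suc j) v))"
      by (intro zw_h1[OF vok, of j j]) (use j lv in auto)
     then show ?thesis using False by (simp add: eqz_ZZ ZZ_single)
    next
     case True
     have "(\<Sum>k<j0. sdeg (v ! k)) = 0"
     proof (rule sum.neutral, rule ballI)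
      fix k assume "k : {..<j0}"
      then show "sdeg (v ! k) = 0" using sd[OF nz[of k]] siN j0 vn[of k] by simp
     qed
     then have sgn: "sg (\<Sum>k<j0. sdeg (v ! k)) = (1::'k)" by simp
     have vj: "v ! j0 = (2, z)" using vn[OF j0(1)] j0 w0 by simp
     have "eqz n (sng (take j0 v @ ?h (2, z) # map ?ip (drop (Suc j0) v)) (1::'k)) T"
     proof (cases ?cond)
      case c: True
      have "map ?ip (drop (Suc j0) v) = drop (Suc j0) v"
      proof (rule map_idI)
       fix l assume "l : set (drop (Suc j0) v)"
       then obtain i where i: "i < length (drop (Suc j0) v)" "l = drop (Suc j0) v ! i" by (auto simp: in_set_conv_nth)
       define p where "p = Suc j0 + i"
       have p: "p < N" "j0 < p" "l = w ! si p" using i lv vn[of p] by (auto simp: p_def)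
       have "0 < si p" "si p < N" using nz[of p] p siN by auto
       note wp = wS[OF this]
       have "ms ! (si p - 1) = None"
       proof (rule ccontr)
        assume "\<not> ?thesis"
        then have "si p : Q" unfolding Q_def using wp(3) \<open>0 < si p\<close> by (intro image_eqI[of _ _ "si p - 1"]) auto
        then have "inv si (si p) < inv si 0" using c by blast
        then show False using sii p by (simp add: j0_def)
       qed
       then have "l = (1, iop n 1 x)" using p wp by (simp add: Lt_def)
       then show "?ip l = l" using pop_iop[OF x] V_ip_eq by simp
      qed
      then have "take j0 v @ ?h (2, z) # map ?ip (drop (Suc j0) v) = v[j0 := ?h (2, z)]"
       using upd_conv_take_nth_drop[of j0 v "?h (2, z)"] j0 lv by simp
      then show ?thesis using c by (simp add: T_def eqz_refl)
     next
      case False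
      then obtain q where q: "q : Q" "\<not> inv si q < inv si 0" by blast
      then have q1: "0 < q" "q < N" "ms ! (q - 1) ~= None" using N(1) by (auto simp: Q_def)
      have "inv si q ~= inv si 0"
      proof
       assume e: "inv si q = inv si 0"
       have "si (inv si q) = si (inv si 0)" unfolding e ..
       then show False using sii(1)[of q] sii(1)[of 0] q1(1) by linarith
      qed
      then have p: "j0 < inv si q" "inv si q < N" using q q1 siN by (auto simp: j0_def)
      have "v ! inv si q = (1, qt.val (ms ! (q - 1)))" using vn[OF p(2)] sii wS(1)[OF q1(1,2)] by (simp add: Lt_def)
      moreover have "pop n 1 (qt.val (ms ! (q - 1))) = 0" using marks_nth[OF ms wS(3)[OF q1(1,2)]] q1(3) by blast
      ultimately have "snd (?ip (v ! inv si q)) = 0" using V_ip_eq iop_0 by simp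
      then have "zw n (take j0 v @ ?h (v ! j0) # map ?ip (drop (Suc j0) v))"
       by (intro zw_h1[OF vok, of j0 "inv si q"]) (use p j0 lv in \<open>simp_all del: comp_apply\<close>)
      then show ?thesis using False unfolding vj T_def by (simp only: if_False eqz_ZZ ZZ_single)
     qed
     then show ?thesis unfolding True vj sgn by simp
    qed
   qed
   also have "(\<Sum>j<N. if j = j0 then T else 0) = T" using j0 by simp
   finally show ?thesis .
  qed
  have lu: "length u = N" if "u : ks (S_h1 ?h ?ip (sng v (1::'k)) - T)" for u
  proof -
   have "u : ks (S_h1 ?h ?ip (sng v (1::'k))) \<or> u : ks T"
    using subsetD[OF keys_diff that] by (simp only: Un_iff)
   then show ?thesis
   proof
    assume u: "u : ks (S_h1 ?h ?ip (sng v (1::'k)))"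
    show ?thesis by (rule h1_length[OF _ u]) (use lv in simp)
   next
    assume u: "u : ks T"
    have "T = 0 \<or> T = sng (v[j0 := ?h (2, z)]) 1" unfolding T_def by (simp only: split: if_split) blast
    then have "u = v[j0 := ?h (2, z)]" using u by (elim disjE) simp_all
    then show ?thesis using lv by simp
   qed
  qed
  have "ZZ n (S_perm (inv si) (S_h1 ?h ?ip (sng v 1) - T))"
   by (rule ZZ_perm) (use E lu permutes_inv[OF si] in \<open>simp_all only: eqz_def\<close>)
  then have "eqz n (S_perm (inv si) (S_h1 ?h ?ip (sng v 1))) (S_perm (inv si) T)"
   unfolding eqz_def klin_diff[OF klin_S(3)] .
  moreover have "S_perm (inv si) T = (if ?cond then sng w' 1 else 0)"
  proof (cases ?cond)
   case True
   let ?u = "v[j0 := ?h (2, z)]"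
   have u: "?u ! i = (if i = j0 then ?h (2, z) else w ! si i)" if "i < N" for i using that lv vn by (simp add: nth_list_update)
   have "sdeg (?u ! i) = 0" if "i < N" for i
    using u[OF that] sd[OF nz[of i]] siN that by (simp add: V_h_eq sdeg_def split: if_splits)
   then have "S_perm (inv si) (sng ?u (1::'k)) = sng (map (%i. ?u ! inv si i) [0..<length ?u]) 1"
    by (intro S_perm_single) (use lv permutes_inv[OF si] in simp_all)
   also have "map (%i. ?u ! inv si i) [0..<length ?u] = w'"
   proof (rule nth_equalityI)
    show "length (map (%i. ?u ! inv si i) [0..<length ?u]) = length w'" using lv N by simp
    fix i assume "i < length (map (%i. ?u ! inv si i) [0..<length ?u])"
    then have i: "i < N" using lv by simp
    have "inv si i = j0 \<longleftrightarrow> i = 0" using sii(1) unfolding j0_def by metis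
    then show "map (%i. ?u ! inv si i) [0..<length ?u] ! i = w' ! i"
     using i lv u[of "inv si i"] siN sii w0 wS(2)[of i] by auto
   qed
   finally show ?thesis using True by (simp add: T_def)
  next
   case False
   show ?thesis unfolding T_def if_not_P[OF False] by (rule klin_0[OF klin_S(3)])
  qed
  ultimately show ?thesis unfolding P1 by simp
 qed
 let ?P = "{si. si permutes {..<N}}"
 have "eqz n (S_H ?h ?ip (sng w 1)) (cscale (1 / fact N) (\<Sum>si\<in>?P. if \<forall>p\<in>Q. inv si p < inv si 0 then sng w' 1 else 0))"
  unfolding S_H_def lin_single N(2) P.scale_one
  by (intro eqz_scale eqz_sum key) simp
 also have "(\<Sum>si\<in>?P. if \<forall>p\<in>Q. inv si p < inv si 0 then sng w' 1 else 0)
  = cscale (of_nat (card {si. si permutes {..<N} & (\<forall>p\<in>Q. inv si p < inv si 0)})) (sng w' (1::'k))"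
 proof -
  have "(\<Sum>si\<in>?P. if \<forall>p\<in>Q. inv si p < inv si 0 then sng w' (1::'k) else 0)
   = (\<Sum>si\<in>{si\<in>?P. \<forall>p\<in>Q. inv si p < inv si 0}. sng w' 1)"
   by (rule sum.inter_filter[symmetric]) (simp add: finite_permutations)
  also have "{si\<in>?P. \<forall>p\<in>Q. inv si p < inv si 0} = {si. si permutes {..<N} & (\<forall>p\<in>Q. inv si p < inv si 0)}" by simp
  finally show ?thesis by (simp add: sum_single_const)
 qed
 also have "cscale (1 / fact N) ... = cscale (1 / of_nat (qt.qn (mset ms) + 1)) (sng w' (1::'k))"
 proof -
  define K where "K = card {si. si permutes {..<N} & (\<forall>p\<in>Q. inv si p < inv si 0)}"
  have "K * (card Q + 1) = fact (card {..<N})"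
   unfolding K_def by (rule count_last) (use N in \<open>auto simp: Q_def\<close>)
  then have "of_nat (K * (qt.qn (mset ms) + 1)) = (of_nat (fact N) :: 'k)" unfolding cQ by simp
  then have K: "of_nat K * of_nat (qt.qn (mset ms) + 1) = (fact N :: 'k)" by (simp only: of_nat_mult of_nat_fact)
  have nz: "of_nat (qt.qn (mset ms) + 1) ~= (0::'k)" by (simp only: of_nat_eq_0_iff)
  have "1 / F * a = 1 / q" if "a * q = F" "q ~= 0" "F ~= 0" for a q F :: 'k
   using that by (auto simp: field_simps)
  from this[OF K nz fact_nonzero] have "1 / fact N * of_nat K = (1 / of_nat (qt.qn (mset ms) + 1) :: 'k)" .
  then show ?thesis unfolding K_def[symmetric] P.scale_scale by simp
 qed
 finally show ?thesis unfolding w_def w'_def .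
qed

definition psi :: "(fmono => 'v, 'k) words => 'v" where
 "psi c = vlin (%u. if length u = 1 then snd (hd u) I else 0) (S_map (V_p g n) (S_delta (V_l g n) c))"

lemma psi_lin: "psi (c + d) = psi c + psi d" "psi (cscale a c) = scl g a (psi c)"
 by (simp_all add: psi_def klin_add[OF klin_S(2)] klin_add[OF klin_S(1)] klin_scale[OF klin_S(2)] klin_scale[OF klin_S(1)]
   vlin_add vlin_scale)

lemma psi_single: "psi (sng w 1) = (if length w = 2 then snd (V_p g n (V_l g n (w ! 0) (w ! 1))) I else 0)"
proof -
 let ?s = "%i j. sg (sdeg (w ! i) * (\<Sum>k<i. sdeg (w ! k)) + sdeg (w ! j) * (\<Sum>k\<in>{..<j} - {i}. sdeg (w ! k))) :: 'k"
 let ?o = "%u :: (nat set => 'v) letter list. if length u = 1 then snd (hd u) I else 0"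
 have "psi (sng w 1) = (\<Sum>j<length w. \<Sum>i<j. scl g (?s i j) (?o (map (V_p g n) (V_l g n (w ! i) (w ! j) # nths w (- {i, j})))))"
  unfolding psi_def S_delta_def lin_single P.scale_one klin_sum[OF klin_S(1)] vlin_sum
  unfolding S_map_def lin_single vlin_scale vlin_single by simp
 also have "... = (if length w = 2 then snd (V_p g n (V_l g n (w ! 0) (w ! 1))) I else 0)"
 proof (cases "length w = 2")
  case True
  have "nths w (- {0, 1}) = []" using length_nths_pair[of 0 1 w] True by simp
  moreover have "sum f ({..<Suc 0} - {0}) = 0" for f :: "nat => int" by (rule sum.neutral) auto
  ultimately show ?thesis using True by (simp add: numeral_2_eq_2)
 next
  case False
  have "?o (map (V_p g n) (V_l g n (w ! i) (w ! j) # nths w (- {i, j}))) = 0" if "i < j" "j < length w" for i j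
   using length_nths_pair[OF that] False by auto
  then show ?thesis using False by simp
 qed
 finally show ?thesis .
qed

lemma psi_ZZ: assumes "ZZ n c" shows "psi c = 0"
proof -
 have "ZZ n (S_delta (V_l g n) c)" by (rule ZZ_delta[OF assms])
 then have zw: "zw n w" if "w : ks (S_delta (V_l g n) c)" for w using that by (simp add: ZZ_def)
 have "scl g a (vlin (%u. if length u = 1 then snd (hd u) I else 0) (sng (map (V_p g n) w) 1)) = 0"
  if "w : ks (S_delta (V_l g n) c)" for w a
 proof (cases "length w = 1")
  case True
  then obtain l where w: "w = [l]" by (auto simp: length_Suc_conv)
  then have "snd l = 0" using zw[OF that] by (simp add: zw_def)
  then have "snd (V_p g n l) = 0" using pop_0 by (cases l) (simp add: V_p_def pop_def)
  then show ?thesis by (simp add: w vlin_single)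
 qed (simp add: vlin_single)
 then show ?thesis unfolding psi_def S_map_def vlin_lin by (subst vlin_def) (intro sum.neutral ballI)
qed

definition Phi :: "(fmono => 'v, 'k) words => (fmono => 'v, 'k) words" where
 "Phi c = - S_H (V_h g n) (V_i g n \<circ> V_p g n) (S_delta (V_l g n) c)"

lemma Phi_pow_lin: "(Phi ^^ k) (c + d) = (Phi ^^ k) c + (Phi ^^ k) d" "(Phi ^^ k) (cscale a c) = cscale a ((Phi ^^ k) c)"
 by (induction k) (simp_all add: Phi_def klin_add[OF klin_S(2)] klin_add[OF klin_S(5)] klin_scale[OF klin_S(2)] klin_scale[OF klin_S(5)])

definition TT :: "nat => (fmono => 'v, 'k) words => 'v" where "TT k c = psi ((Phi ^^ k) c)"

lemma TT_add: "TT k (c + d) = TT k c + TT k d" by (simp add: TT_def Phi_pow_lin psi_lin)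
lemma TT_scale: "TT k (cscale a c) = scl g a (TT k c)" by (simp add: TT_def Phi_pow_lin psi_lin)
lemma TT_0: "TT k 0 = 0" using TT_scale[of k 0 0] by simp
lemma TT_uminus: "TT k (- c) = - TT k c" using TT_scale[of k "- 1" c] by simp
lemma TT_sum: "TT k (sum f A) = (\<Sum>i\<in>A. TT k (f i))"
 by (induction A rule: infinite_finite_induct) (auto simp: TT_0 TT_add)
lemma TT_Suc: "TT (Suc k) c = TT k (Phi c)" by (simp add: TT_def funpow_swap1)

lemma TT_ZZ: assumes "ZZ n c" shows "TT k c = 0"
proof -
 have "ZZ n ((Phi ^^ k) c)"
 proof (induction k)
  case (Suc k)
  have "ZZ n (cscale (- 1) (S_H (V_h g n) (V_i g n \<circ> V_p g n) (S_delta (V_l g n) ((Phi ^^ k) c))))"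
   by (rule ZZ_scale[OF ZZ_H[OF ZZ_delta[OF Suc]]])
  moreover have "(Phi ^^ Suc k) c = cscale (- 1) (S_H (V_h g n) (V_i g n \<circ> V_p g n) (S_delta (V_l g n) ((Phi ^^ k) c)))"
   unfolding funpow.simps(2) o_apply Phi_def[of "(Phi ^^ k) c"] P.scale_minus_left P.scale_one ..
  ultimately show ?case by (simp only:)
 qed (simp add: assms)
 then show ?thesis unfolding TT_def by (rule psi_ZZ)
qed

lemma TT_eqz: "eqz n c d ==> TT k c = TT k d"
 using TT_ZZ[of "c - d" k] TT_add[of k "c - d" d] by (simp add: eqz_def)

lemma V_l_Lt: "V_l g n (Lt p) (Lt q) = (2, tensor_brk g n 1 1 (qt.val p) (qt.val q))"
 by (simp add: V_l_def Lt_def)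

text \<open>
  Each application of \<open>- H \<delta>\<close> shortens the word by one letter, so exactly one
  summand of the perturbation series reaches a word of length two, where \<open>\<delta>\<close>
  and the projection to one letter see it.
\<close>

lemma TT_marks:
 assumes "qt.marks (mset ms)"
 shows "TT k (sng (map Lt ms) 1) = (if length ms = Suc (Suc k) then qt.hv k (mset ms) else 0)"
 using assms
proof (induction k arbitrary: ms)
 case 0
 show ?case
 proof (cases "length ms = 2")
  case True
  then obtain p q where ms: "ms = [p, q]" by (auto simp: length_Suc_conv numeral_2_eq_2)
  have v: "qt.val p : VV n 1" "qt.val q : VV n 1" using marks_nth[OF 0, of 0] marks_nth[OF 0, of 1] by (simp_all add: ms)
  have "TT 0 (sng (map Lt ms) 1) = snd (V_p g n (V_l g n (map Lt ms ! 0) (map Lt ms ! 1))) I"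
   unfolding TT_def using psi_single[of "map Lt ms"] True by simp
  also have "... = pop n 2 (tensor_brk g n 1 1 (qt.val p) (qt.val q)) I"
   by (simp add: ms V_l_Lt) (simp add: V_p_def pop_def)
  also have "... = qt.hv 0 (mset ms)"
   using qt.pl_sym[OF v] V.scale_left_distrib[of "1 / 2" "1 / 2" "pop n 2 (tensor_brk g n 1 1 (qt.val p) (qt.val q)) I"]
   by (simp add: ms dsum_def V.scale_right_distrib)
  finally show ?thesis using True by simp
 qed (simp add: TT_def psi_single)
next
 case (Suc k)
 let ?N = "length ms"
 let ?F = "%p q R. scl g (1 / of_nat (qt.qn R + 1)) (qt.hv k (add_mset (Some (hop n 2 (tensor_brk g n 1 1 (qt.val p) (qt.val q)))) R))"
 have v: "qt.val (ms ! i) : VV n 1" if "i < ?N" for i using marks_nth[OF Suc.prems that] by blast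
 have t: "TT k (S_H (V_h g n) (V_i g n \<circ> V_p g n) (sng (V_l g n (map Lt ms ! i) (map Lt ms ! j) # nths (map Lt ms) (- {i, j})) 1))
   = (if ?N = Suc (Suc (Suc k)) then ?F (ms ! i) (ms ! j) (mset (nths ms (- {i, j}))) else 0)"
  if ij: "i < j" "j < ?N" for i j
 proof -
  let ?R = "nths ms (- {i, j})"
  let ?y = "hop n 2 (tensor_brk g n 1 1 (qt.val (ms ! i)) (qt.val (ms ! j)))"
  have vv: "qt.val (ms ! i) : VV n 1" "qt.val (ms ! j) : VV n 1" using v ij by auto
  have mR: "qt.marks (mset ?R)" using Suc.prems unfolding qt.marks_def by (auto dest: in_set_nthsD)
  have m: "qt.marks (mset (Some ?y # ?R))" using mR qt.hl_Y[OF vv] by (simp add: qt.marks_add)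
  have w: "V_l g n (map Lt ms ! i) (map Lt ms ! j) # nths (map Lt ms) (- {i, j})
   = (2, tensor_brk g n 1 1 (qt.val (ms ! i)) (qt.val (ms ! j))) # map Lt ?R"
   using ij by (simp add: V_l_Lt nths_map)
  have "TT k (S_H (V_h g n) (V_i g n \<circ> V_p g n) (sng (V_l g n (map Lt ms ! i) (map Lt ms ! j) # nths (map Lt ms) (- {i, j})) 1))
   = TT k (cscale (1 / of_nat (qt.qn (mset ?R) + 1)) (sng (map Lt (Some ?y # ?R)) 1))"
   unfolding w using TT_eqz[OF S_H_word[OF lop_VV[OF vv] mR]] by (simp add: Lt_def)
  also have "... = scl g (1 / of_nat (qt.qn (mset ?R) + 1)) (if length (Some ?y # ?R) = Suc (Suc k) then qt.hv k (mset (Some ?y # ?R)) else 0)"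
   unfolding TT_scale Suc.IH[OF m] ..
  also have "... = (if ?N = Suc (Suc (Suc k)) then ?F (ms ! i) (ms ! j) (mset ?R) else 0)"
   using length_nths_pair[OF ij] by auto
  finally show ?thesis .
 qed
 have sd: "sdeg (Lt m) = 0" for m by (simp add: Lt_def sdeg_def)
 have "S_delta (V_l g n) (sng (map Lt ms) (1::'k)) = (\<Sum>j<?N. \<Sum>i<j. sng (V_l g n (map Lt ms ! i) (map Lt ms ! j) # nths (map Lt ms) (- {i, j})) 1)"
  unfolding S_delta_def lin_single P.scale_one length_map by (intro sum.cong refl) (simp add: sd)
 then have "TT (Suc k) (sng (map Lt ms) 1) = - (\<Sum>j<?N. \<Sum>i<j. TT k (S_H (V_h g n) (V_i g n \<circ> V_p g n)
   (sng (V_l g n (map Lt ms ! i) (map Lt ms ! j) # nths (map Lt ms) (- {i, j})) 1)))"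
  unfolding TT_Suc Phi_def TT_uminus by (simp only: klin_sum[OF klin_S(5)] TT_sum)
 also have "... = - (\<Sum>j<?N. \<Sum>i<j. if ?N = Suc (Suc (Suc k)) then ?F (ms ! i) (ms ! j) (mset (nths ms (- {i, j}))) else 0)"
  by (intro arg_cong[where f = uminus] sum.cong refl t) auto
 also have "... = (if ?N = Suc (Suc (Suc k)) then qt.hv (Suc k) (mset ms) else 0)"
 proof (cases "?N = Suc (Suc (Suc k))")
  case True
  let ?G = "%p q R. if qt.val p : VV n 1 & qt.val q : VV n 1 then ?F p q R else 0"
  have "dsum ?F (mset ms) = dsum ?G (mset ms)"
  proof (rule dsum_cong)
   fix p q R assume M: "mset ms = add_mset p (add_mset q R)"
   have "qt.val p : VV n 1" "qt.val q : VV n 1"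
    using Suc.prems qt.val_V[of p "add_mset q R"] qt.val_V[of q R] unfolding M by (simp_all add: qt.marks_add)
   then show "?F p q R = ?G p q R" by simp
  qed
  also have "... = (\<Sum>j<?N. \<Sum>i<j. ?G (ms ! i) (ms ! j) (mset (nths ms (- {i, j})))) + (\<Sum>j<?N. \<Sum>i<j. ?G (ms ! i) (ms ! j) (mset (nths ms (- {i, j}))))"
   by (rule dsum_index) (auto simp: qt.hl_sym)
  also have "(\<Sum>j<?N. \<Sum>i<j. ?G (ms ! i) (ms ! j) (mset (nths ms (- {i, j})))) = (\<Sum>j<?N. \<Sum>i<j. ?F (ms ! i) (ms ! j) (mset (nths ms (- {i, j}))))"
   by (intro sum.cong refl) (use v in auto)
  finally have d: "dsum ?F (mset ms) = (\<Sum>j<?N. \<Sum>i<j. ?F (ms ! i) (ms ! j) (mset (nths ms (- {i, j})))) + (\<Sum>j<?N. \<Sum>i<j. ?F (ms ! i) (ms ! j) (mset (nths ms (- {i, j}))))" .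
  have half: "scl g (- (1 / 2)) (y + y) = - y" for y
   unfolding V.scale_right_distrib V.scale_left_distrib[symmetric] by simp
  show ?thesis unfolding qt.hv.simps d half if_P[OF True] ..
 qed simp
 finally show ?case .
qed

lemma W_l_hv: assumes N: "2 <= N" shows "W_l g n (replicate N (1, x)) I = qt.hv (N - 2) (replicate_mset N None)"
proof -
 let ?w = "replicate N (1::int, x)"
 have i: "S_map (V_i g n) (sng ?w (1::'k)) = sng (map Lt (replicate N None)) 1"
 proof -
  have "V_i g n (1, x) = Lt None" by (simp add: V_i_def Lt_def) (simp add: iop_def)
  then show ?thesis by (simp add: S_map_def)
 qed
 have m: "qt.marks (mset (replicate N None))" by (simp add: qt.marks_def)
 have P: "(%c. - S_H (V_h g n) (V_i g n \<circ> V_p g n) (S_delta (V_l g n) c)) = Phi" by (simp add: fun_eq_iff Phi_def)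
 have tm: "TT k (sng (replicate N (Lt None)) 1) = (if N = Suc (Suc k) then qt.hv k (replicate_mset N None) else 0)" for k
  using TT_marks[OF m, of k] by simp
 let ?t = "transfer_word (V_i g n) (V_p g n) (V_h g n) (V_l g n) ?w :: (nat set => 'v, 'k) words"
 have "W_l g n ?w I = (\<Sum>u | u : ks ?t & length u = 1. scl g (lk ?t u) (snd (hd u) I))"
  using N by (simp add: W_l_def Let_def)
 also have "... = vlin (%u. if length u = 1 then snd (hd u) I else 0) ?t"
  unfolding vlin_def by (rule sum.mono_neutral_cong_left) auto
 also have "... = psi (\<Sum>k<N. (Phi ^^ k) (sng (map Lt (replicate N None)) 1))"
  unfolding psi_def transfer_word_def P i by simp
 also have "... = (\<Sum>k<N. TT k (sng (map Lt (replicate N None)) 1))"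
 proof -
  have p0: "psi 0 = 0" using psi_lin(2)[of 0 0] by simp
  have "psi (sum f A) = (\<Sum>k\<in>A. psi (f k))" for f and A :: "nat set"
   by (induction A rule: infinite_finite_induct) (auto simp: p0 psi_lin)
  then show ?thesis by (simp add: TT_def)
 qed
 also have "... = (\<Sum>k<N. if k = N - 2 then qt.hv (N - 2) (mset (replicate N None)) else 0)"
  by (rule sum.cong[OF refl]) (use N in \<open>auto simp: tm\<close>)
 also have "... = qt.hv (N - 2) (replicate_mset N None)" using N by simp
 finally show ?thesis .
qed

lemma W_l_ev: assumes "2 <= N" shows "scl g (1 / fact N) (W_l g n (replicate N (1, x)) I) = - ev n x N (dxi n I)"
proof -
 have "scl g (1 / fact N) (qt.hv (N - 2) (replicate_mset N None))
  = scl g (1 / 2) (\<Sum>r\<in>{1..<N}. pop n 2 (tensor_brk g n 1 1 (JJ n x r) (JJ n x (N - r))) I)"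
  by (rule qt.transfer_equal_letters[OF JJ_1 JJ_ge assms])
 then show ?thesis unfolding W_l_hv[OF assms] dxi_ev[OF x assms] by simp
qed

lemma W_l_ev_1: "scl g (1 / fact 1) (W_l g n (replicate 1 (1, x)) I) = dif g (x I) - ev n x 1 (dxi n I)"
 unfolding dxi_ev_1[OF x] by (simp add: W_l_def W_d_def)

text \<open>
  Term by term, the Maurer--Cartan series is \<open>d x\<^sub>I\<close> minus the evaluation of
  the parts of \<open>d \<xi>\<^sub>I\<close>.
\<close>

lemma mc_equation:
 "has_csum g (2 - cdeg I) (%k. scl g (1 / fact k) (W_l g n (replicate k (1, x)) I)) {1..} 0
  \<longleftrightarrow> Fx n x (dxi n I) = dif g (x I)"
proof -
 let ?d = "xdeg I + 1"
 let ?u = "%k. (if k = 1 then dif g (x I) else 0) + scl g (- 1) (ev n x k (dxi n I))"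
 note X = WW_gr[OF x]
 have dI: "dif g (x I) : gr g ?d" by (rule dif_degree[OF X])
 have d: "2 - cdeg I = ?d" by (simp add: xdeg_def)
 have eq: "scl g (1 / fact k) (W_l g n (replicate k (1, x)) I) = ?u k" if "1 <= k" for k
  using W_l_ev[of k] W_l_ev_1 that by (cases "k = 1") auto
 have cong: "has_csum g ?d (%k. scl g (1 / fact k) (W_l g n (replicate k (1, x)) I)) {1..} 0 \<longleftrightarrow> has_csum g ?d ?u {1..} 0"
  using has_csum_cong[of "{1..}" "%k. scl g (1 / fact k) (W_l g n (replicate k (1, x)) I)" ?u ?d 0]
   has_csum_cong[of "{1..}" ?u "%k. scl g (1 / fact k) (W_l g n (replicate k (1, x)) I)" ?d 0] eq by auto
 have uf: "?u k : fil g k ?d" if "1 <= k" for k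
 proof -
  have "scl g (- 1) (ev n x k (dxi n I)) : fil g k ?d" by (rule fil_scl[OF that ev_mc_gr_fil[OF X dxi_mc_gr that]])
  moreover have "(if k = 1 then dif g (x I) else 0) : fil g k ?d" using dI that fil_one[of ?d] by simp
  ultimately show ?thesis by (rule fil_add[OF that, rotated])
 qed
 have l: "limto ?d ?u (dif g (x I) + scl g (- 1) (Fx n x (dxi n I)))"
  using dI fil_one[of ?d] by (intro limto_add limto_scl Fx_limto[OF X dxi_mc_gr] limto_single) simp_all
 have le: "limto ?d ?u 0 \<longleftrightarrow> dif g (x I) + scl g (- 1) (Fx n x (dxi n I)) = 0"
 proof
  assume "limto ?d ?u 0"
  then show "dif g (x I) + scl g (- 1) (Fx n x (dxi n I)) = 0" by (rule limto_unique[OF l])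
 next
  assume z: "dif g (x I) + scl g (- 1) (Fx n x (dxi n I)) = 0"
  show "limto ?d ?u 0" using l unfolding z .
 qed
 have hl: "has_csum g ?d ?u {1..} 0 \<longleftrightarrow> limto ?d ?u 0" by (rule has_csum_limto[OF uf])
 show ?thesis unfolding d cong hl le by auto
qed

end

lemma ctensor_WW: "ctensor g (faces n) cdeg 1 = WW n"
proof -
 have "finite {b. z b ~= 0}" if "\<forall>b. b \<notin> faces n --> z b = 0" for z :: "nat set => 'v"
  by (rule finite_subset[OF _ finite_faces[of n]]) (use that in auto)
 moreover have "finite {b : faces n. Q b}" for Q by (rule finite_subset[OF _ finite_faces[of n]]) auto
 ultimately show ?thesis unfolding ctensor_def FT_def by auto
qed

theorem MC_iff: "x : MC g n \<longleftrightarrow> x : WW n & (\<forall>I\<in>faces n. Fx n x (dxi n I) = dif g (x I))"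
 unfolding MC_def ctensor_WW using mc_equation by auto

end

section \<open>Faces over a word\<close>

text \<open>
  The words of faces lying letter by letter over a given word.
\<close>

fun fibl :: "nat => (nat => nat) => nat set list => nat set list set" where
 "fibl m ph [] = {[]}"
| "fibl m ph (I # w) = (%(J, v). J # v) ` (fib m ph I \<times> fibl m ph w)"

lemma finite_fibl [simp]: "finite (fibl m ph w)" by (induction w) auto

lemma fibl_Cons: "v : fibl m ph (I # w) \<longleftrightarrow> (\<exists>J u. v = J # u & J : fib m ph I & u : fibl m ph w)" by auto

lemma fib_faces: "I : faces n ==> J : fib m ph I ==> J : faces m & cdeg J = cdeg I"
 using fib_card[of J m ph I] by (auto simp: fib_def faces_def cdeg_def)

lemma fibl_props: "v : fibl m ph w ==> set w \<subseteq> faces n ==>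
  length v = length w & set v \<subseteq> faces m & map cdeg v = map cdeg w"
proof (induction w arbitrary: v)
 case (Cons I w)
 obtain J u where v: "v = J # u" "J : fib m ph I" "u : fibl m ph w" using Cons(2) unfolding fibl_Cons by blast
 then show ?case using Cons.IH[OF v(3)] Cons(3) fib_faces[OF _ v(2)] by auto
qed simp

lemma fibl_iff: "v : fibl m ph w \<longleftrightarrow> length v = length w & (\<forall>i<length w. v ! i : fib m ph (w ! i))"
proof (induction w arbitrary: v)
 case (Cons I w)
 show ?case
 proof (cases v)
  case Nil then show ?thesis by auto
 next
  case (Cons J u)
  have "v : fibl m ph (I # w) \<longleftrightarrow> J : fib m ph I & u : fibl m ph w" unfolding fibl_Cons Cons by auto
  then show ?thesis unfolding Cons.IH unfolding Cons by (auto simp: less_Suc_eq_0_disj)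
 qed
qed auto

lemma fibl_wdeg: assumes "v : fibl m ph w" "set w \<subseteq> faces n" shows "wdeg v = wdeg w" "eps v = (eps w :: 'k::field_char_0)"
proof -
 note p = fibl_props[OF assms]
 have c: "cdeg (v ! i) = cdeg (w ! i)" if "i < length w" for i
  using p that by (metis nth_map)
 have "map xdeg v = map xdeg w" using p unfolding xdeg_def by (auto intro!: nth_equalityI simp: c)
 then show "wdeg v = wdeg w" by (simp add: wdeg_def)
 show "eps v = (eps w :: 'k)" unfolding eps_def using p by (intro arg_cong[where f = sg]) (simp add: xdeg_def c)
qed

lemma sum_fibl_append: "(\<Sum>v\<in>fibl m ph (w1 @ w2). f v) = (\<Sum>u\<in>fibl m ph w1. \<Sum>v\<in>fibl m ph w2. f (u @ v) :: 'b::comm_monoid_add)"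
proof (induction w1 arbitrary: f)
 case (Cons I w)
 have inj: "inj_on (%(J, v). J # v) A" for A :: "(nat set \<times> nat set list) set" by (auto simp: inj_on_def)
 have ci: "sum h (fibl m ph (I # u)) = (\<Sum>J\<in>fib m ph I. \<Sum>v\<in>fibl m ph u. h (J # v))" for h :: "_ => 'b" and u
  unfolding fibl.simps sum.reindex[OF inj] sum.cartesian_product by (rule sum.cong) auto
 have "(\<Sum>v\<in>fibl m ph ((I # w) @ w2). f v) = (\<Sum>J\<in>fib m ph I. \<Sum>v\<in>fibl m ph (w @ w2). f (J # v))"
  unfolding append_Cons by (rule ci)
 also have "... = (\<Sum>J\<in>fib m ph I. \<Sum>u\<in>fibl m ph w. \<Sum>v\<in>fibl m ph w2. f (J # u @ v))"
  using Cons by simp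
 also have "... = (\<Sum>u\<in>fibl m ph (I # w). \<Sum>v\<in>fibl m ph w2. f (u @ v))"
  unfolding ci by simp
 finally show ?case .
qed simp

lemma sum_fibl_split:
 assumes "r <= length w"
 shows "(\<Sum>v\<in>fibl m ph w. f (take r v) (drop r v)) = (\<Sum>u\<in>fibl m ph (take r w). \<Sum>v\<in>fibl m ph (drop r w). f u v :: 'b::comm_monoid_add)"
proof -
 have "(\<Sum>v\<in>fibl m ph (take r w @ drop r w). f (take r v) (drop r v))
  = (\<Sum>u\<in>fibl m ph (take r w). \<Sum>v\<in>fibl m ph (drop r w). f (take r (u @ v)) (drop r (u @ v)))"
  by (rule sum_fibl_append)
 also have "... = (\<Sum>u\<in>fibl m ph (take r w). \<Sum>v\<in>fibl m ph (drop r w). f u v)"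
 proof (intro sum.cong refl)
  fix u v assume "u : fibl m ph (take r w)"
  then have "length u = r" using assms by (simp add: fibl_iff)
  then show "f (take r (u @ v)) (drop r (u @ v)) = f u v" by simp
 qed
 finally show ?thesis by simp
qed

section \<open>Naturality of the transferred operations\<close>

definition sgnop :: "'k::field_char_0 form => 'k form" where
 "sgnop al = lin (%m. sng m (sg (mdeg m - 1))) al"

lemma klin_sgnop: "klin sgnop" by (simp add: sgnop_def[abs_def])
lemma sbeta_sgnop: "sbeta al \<gamma> = sgnop al \<cdot> \<gamma>" by (simp add: sbeta_def sgnop_def)

lemma Om_sgnop: "al : Om (ix n) ==> sgnop al : Om (ix n)"
 unfolding sgnop_def lin_def by (rule Om_sum) (auto simp: Om_def split: if_splits)

lemma form_map_sgnop:
 assumes "al : Om (ix n)" shows "form_map m ph (sgnop al) = sgnop (form_map m ph (al :: 'k::field_char_0 form))"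
proof (rule klin_eqI[OF klin_comp[OF klin_form_map klin_sgnop] klin_comp[OF klin_sgnop klin_form_map]])
 fix x assume "x : ks al"
 then have x: "x : form_basis n" using assms by (auto simp: Om_keys)
 let ?be = "form_map m ph (sng x (1::'k))"
 have "sgnop ?be = (\<Sum>y\<in>ks ?be. cscale (lk ?be y) (cscale (sg (mdeg x - 1)) (sng y 1)))"
  unfolding sgnop_def lin_def
 proof (intro sum.cong refl)
  fix y assume "y : ks ?be"
  then have "mdeg y = mdeg x" using form_map_degree(2)[OF x] by (simp add: in_keys_iff)
  then show "cscale (lk ?be y) (sng y (sg (mdeg y - 1))) = cscale (lk ?be y) (cscale (sg (mdeg x - 1)) (sng y 1))" by simp
 qed
 also have "... = cscale (sg (mdeg x - 1)) (\<Sum>y\<in>ks ?be. cscale (lk ?be y) (sng y 1))"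
  unfolding P.scale_sum_right by (intro sum.cong refl) (simp add: mult.commute)
 also have "... = cscale (sg (mdeg x - 1)) ?be" unfolding single_decomp[symmetric] ..
 also have "... = form_map m ph (cscale (sg (mdeg x - 1)) (sng x 1))" by (rule form_map_rules(2)[symmetric])
 also have "... = form_map m ph (sgnop (sng x 1))" by (simp add: sgnop_def)
 finally show "form_map m ph (sgnop (sng x 1)) = sgnop ?be" ..
qed

definition XJ :: "nat => nat set list => 'k::field_char_0 form" where
 "XJ n w = (\<Sum>r\<in>{1..<length w}. sbeta (C_J n (take r w)) (C_J n (drop r w)))"

lemma Om_XJ: assumes "set w \<subseteq> faces n" shows "(XJ n w :: 'k::field_char_0 form) : Om (ix n)"
 unfolding XJ_def sbeta_sgnop
proof (intro Om_sum Om_wedge Om_sgnop)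
 fix r
 show "(C_J n (take r w) :: 'k form) : Om (ix n)"
  by (rule Om_C_J[of _ n "length (take r w)"]) (use assms in \<open>auto simp: words_def dest: in_set_takeD\<close>)
 show "(C_J n (drop r w) :: 'k form) : Om (ix n)"
  by (rule Om_C_J[of _ n "length (drop r w)"]) (use assms in \<open>auto simp: words_def dest: in_set_dropD\<close>)
qed

lemma form_map_XJ:
 assumes w: "set w \<subseteq> faces n"
  and IH: "!!u. length u < length w ==> set u \<subseteq> faces n ==> form_map m ph (C_J n u) = (\<Sum>v\<in>fibl m ph u. C_J m v :: 'k::field_char_0 form)"
 shows "form_map m ph (XJ n w) = (\<Sum>v\<in>fibl m ph w. XJ m v :: 'k form)"
proof -
 have "form_map m ph (sbeta (C_J n (take r w)) (C_J n (drop r w)) :: 'k form)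
  = (\<Sum>v\<in>fibl m ph w. sbeta (C_J m (take r v)) (C_J m (drop r v)))" if r: "r : {1..<length w}" for r
 proof -
  have s: "set (take r w) \<subseteq> faces n" "set (drop r w) \<subseteq> faces n" using w by (auto dest: in_set_takeD in_set_dropD)
  have lt: "length (take r w) < length w" "length (drop r w) < length w" using r by auto
  have o: "(C_J n (take r w) :: 'k form) : Om (ix n)" "(C_J n (drop r w) :: 'k form) : Om (ix n)"
   by (rule Om_C_J, use s in \<open>simp add: words_def\<close>)+
  have "form_map m ph (sbeta (C_J n (take r w)) (C_J n (drop r w)) :: 'k form)
   = sgnop (\<Sum>u\<in>fibl m ph (take r w). C_J m u) \<cdot> (\<Sum>v\<in>fibl m ph (drop r w). C_J m v)"
   unfolding sbeta_sgnop form_map_wedge[OF Om_sgnop[OF o(1)] o(2)] form_map_sgnop[OF o(1)]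
   unfolding IH[OF lt(1) s(1)] IH[OF lt(2) s(2)] ..
  also have "... = (\<Sum>u\<in>fibl m ph (take r w). \<Sum>v\<in>fibl m ph (drop r w). sbeta (C_J m u) (C_J m v))"
   unfolding klin_sum[OF klin_sgnop] wedge_sum sbeta_sgnop by (rule sum.swap)
  also have "... = (\<Sum>v\<in>fibl m ph w. sbeta (C_J m (take r v)) (C_J m (drop r v)))"
   by (rule sum_fibl_split[symmetric]) (use r in simp)
  finally show ?thesis .
 qed
 then have "form_map m ph (XJ n w) = (\<Sum>r\<in>{1..<length w}. \<Sum>v\<in>fibl m ph w. sbeta (C_J m (take r v)) (C_J m (drop r v)) :: 'k form)"
  unfolding XJ_def form_map_rules by (intro sum.cong refl)
 also have "... = (\<Sum>v\<in>fibl m ph w. \<Sum>r\<in>{1..<length w}. sbeta (C_J m (take r v)) (C_J m (drop r v)))" by (rule sum.swap)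
 also have "... = (\<Sum>v\<in>fibl m ph w. XJ m v)" unfolding XJ_def by (intro sum.cong refl) (simp_all add: fibl_iff)
 finally show ?thesis .
qed

lemma C_J_cases: "C_J n [] = 0" "C_J n [I] = omega n I" "2 <= length w ==> C_J n w = - dupont_h n (XJ n w)"
proof -
 show "C_J n [] = 0" "C_J n [I] = omega n I" by (subst C_J.simps; simp)+
 show "2 <= length w ==> C_J n w = - dupont_h n (XJ n w)" by (subst C_J.simps) (auto simp: XJ_def)
qed

lemma form_map_C_J:
 assumes ph: "simplex_map m n ph"
 shows "set w \<subseteq> faces n ==> form_map m ph (C_J n w) = (\<Sum>v\<in>fibl m ph w. C_J m v :: 'k::field_char_0 form)"
proof (induction "length w" arbitrary: w rule: less_induct)
 case less
 consider "w = []" | I where "w = [I]" | "2 <= length w" by (cases w rule: remdups_adj.cases) auto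
 then show ?case
 proof cases
  case 1 then show ?thesis by (simp add: C_J_cases form_map_rules)
 next
  case (2 I)
  have "inj_on (%J. [J]) A" for A :: "nat set set" by (auto simp: inj_on_def)
  moreover have "fibl m ph [I] = (%J. [J]) ` fib m ph I" by auto
  ultimately have "(\<Sum>v\<in>fibl m ph [I]. C_J m v :: 'k form) = (\<Sum>J\<in>fib m ph I. omega m J)"
   by (simp only: sum.reindex o_def C_J_cases)
  then show ?thesis using less(2) 2 facesD(1)[of I n] form_map_omega[OF ph, of I, where ?'k = 'k] by (simp add: C_J_cases)
 next
  case 3
  have f: "form_map m ph (XJ n w) = (\<Sum>v\<in>fibl m ph w. XJ m v :: 'k form)"
   by (rule form_map_XJ[OF less(2)]) (rule less(1))
  have "form_map m ph (C_J n w :: 'k form) = - dupont_h m (\<Sum>v\<in>fibl m ph w. XJ m v)"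
   unfolding C_J_cases(3)[OF 3] form_map_rules form_map_dupont_h[OF ph Om_XJ[OF less(2)]] f ..
  also have "... = (\<Sum>v\<in>fibl m ph w. C_J m v)"
   unfolding klin_sum[OF klin_dupont_h] sum_negf[symmetric]
   by (intro sum.cong refl C_J_cases(3)[symmetric]) (use 3 in \<open>simp add: fibl_iff\<close>)
  finally show ?thesis .
 qed
qed

text \<open>
  Applying a simplicial map to a product of Whitney forms replaces a word of faces by the sum of
  the words of faces over it.
\<close>

lemma C_b_natural:
 assumes ph: "simplex_map m n ph" and w: "set w \<subseteq> faces n" "w ~= []" and J: "J : faces m"
 shows "(\<Sum>v\<in>fibl m ph w. lk (C_b m v) J) = (if inj_on ph J then lk (C_b n w) (ph ` J) else (0::'k::field_char_0))"
proof (cases "length w = 1")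
 case True
 then obtain I where I: "w = [I]" "I : faces n" using w by (auto simp: length_Suc_conv)
 have inj: "inj_on (%J. [J]) A" for A :: "nat set set" by (auto simp: inj_on_def)
 have fl: "fibl m ph [I] = (%J. [J]) ` fib m ph I" by auto
 have b: "C_b k [K] = dupont_p k (dform (omega k K) :: 'k form)" for k K by (simp add: C_b_def C_d_def)
 have o: "(omega n I :: 'k form) : Om (ix n)" using facesD(1,2)[OF I(2)] by simp
 have "(\<Sum>v\<in>fibl m ph w. lk (C_b m v) J :: 'k) = lk (dupont_p m (form_map m ph (dform (omega n I)))) J"
  unfolding I(1) fl sum.reindex[OF inj] o_def b form_map_dform[OF o] form_map_omega[OF ph facesD(1)[OF I(2)]]
   klin_sum[OF klin_dform] klin_sum[OF klin_dupont_p] lookup_sum ..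
 then show ?thesis using dupont_p_form_map[OF ph _ J, of "dform (omega n I) :: 'k form"] o by (simp add: I(1) b)
next
 case False
 then have k: "2 <= length w" using w(2) by (cases w) (auto simp: Suc_le_eq)
 have b: "C_b k v = dupont_p k (XJ k v :: 'k form)" if "length v ~= 1" for k v using that by (simp add: C_b_def XJ_def)
 have f: "form_map m ph (XJ n w) = (\<Sum>v\<in>fibl m ph w. XJ m v :: 'k form)"
  by (rule form_map_XJ[OF w(1)]) (rule form_map_C_J[OF ph])
 have "(\<Sum>v\<in>fibl m ph w. lk (C_b m v) J :: 'k) = (\<Sum>v\<in>fibl m ph w. lk (dupont_p m (XJ m v)) J)"
  by (intro sum.cong refl) (use False in \<open>simp add: fibl_iff b\<close>)
 also have "... = lk (dupont_p m (form_map m ph (XJ n w))) J"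
  unfolding f klin_sum[OF klin_dupont_p] lookup_sum ..
 also have "... = (if inj_on ph J then lk (dupont_p n (XJ n w)) (ph ` J) else 0)"
  by (rule dupont_p_form_map[OF ph Om_XJ[OF w(1)] J])
 finally show ?thesis using b[OF False] by simp
qed

section \<open>The cosimplicial structure maps\<close>

lemma image_faces: assumes "simplex_map m n ph" "J : faces m" shows "ph ` J : faces n"
proof -
 have "ph j : {0..n}" if "j : J" for j
  using funcset_mem[OF simplex_mapD(1)[OF assms(1)], of j] assms(2) that by (auto simp: faces_def)
 then show ?thesis using assms(2) by (auto simp: faces_def)
qed

context
 fixes m n :: nat and ph :: "nat => nat"
 assumes ph: "simplex_map m n ph"
begin

lemma mc_map_fibl:
 "mc_map m n ph s = (%w. if set w \<subseteq> faces n then \<Sum>v\<in>fibl m ph w. s v else (0::'k::field_char_0))"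
proof
 fix w
 show "mc_map m n ph s w = (if set w \<subseteq> faces n then \<Sum>v\<in>fibl m ph w. s v else (0::'k))"
 proof (cases "set w \<subseteq> faces n")
  case w: True
  let ?V = "{v. set v \<subseteq> faces m & length v = length w}"
  let ?p = "%v. \<Prod>i<length w. lk (C_map m n ph (w ! i)) (v ! i) :: 'k"
  have fV: "finite ?V" by (rule finite_lists_length_eq[OF finite_faces])
  have sub: "fibl m ph w \<subseteq> ?V" using fibl_props[OF _ w] by blast
  have p1: "?p v = 1" if "v : fibl m ph w" for v
  proof (rule prod.neutral, rule ballI)
   fix i assume i: "i : {..<length w}"
   then have I: "w ! i : faces n" using w by auto
   have "v ! i : fib m ph (w ! i)" using that i by (simp add: fibl_iff)
   then show "lk (C_map m n ph (w ! i)) (v ! i) = (1::'k)"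
    using fib_faces[OF I] unfolding C_map_lookup[OF ph I] by (auto simp: fib_def)
  qed
  have p0: "?p v = 0" if "v : ?V" "v \<notin> fibl m ph w" for v
  proof -
   have "length v = length w" using that(1) by simp
   then have "\<exists>i<length w. v ! i \<notin> fib m ph (w ! i)" using that(2) unfolding fibl_iff by simp
   then obtain i where i: "i < length w" "v ! i \<notin> fib m ph (w ! i)" by blast
   then have I: "w ! i : faces n" using w by auto
   have "lk (C_map m n ph (w ! i)) (v ! i) = (0::'k)"
    unfolding C_map_lookup[OF ph I] using i(2) by (auto simp: fib_def faces_def)
   then show ?thesis using i(1) by (intro prod_zero) auto
  qed
  have "(\<Sum>v\<in>?V. s v * ?p v) = (\<Sum>v\<in>fibl m ph w. s v)"
  proof (rule sum.mono_neutral_cong_right[OF fV sub])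
   show "\<forall>v\<in>?V - fibl m ph w. s v * ?p v = 0"
   proof
    fix v assume "v : ?V - fibl m ph w"
    then have "?p v = 0" by (intro p0) blast+
    then show "s v * ?p v = 0" by (simp only: mult_zero_right)
   qed
   show "s v * ?p v = s v" if "v : fibl m ph w" for v unfolding p1[OF that] by simp
  qed
  then show ?thesis using w by (simp add: mc_map_def)
 qed (simp add: mc_map_def)
qed

lemma mc_map_add: "mc_map m n ph (s + t) = mc_map m n ph s + (mc_map m n ph t :: 'k::field_char_0 tseries)"
 by (auto simp: mc_map_fibl fun_eq_iff sum.distrib)
lemma mc_map_tscl: "mc_map m n ph (tscl c s) = tscl c (mc_map m n ph s :: 'k::field_char_0 tseries)"
 by (auto simp: mc_map_fibl fun_eq_iff tscl_def sum_distrib_left)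
lemma mc_map_0: "mc_map m n ph 0 = (0 :: 'k::field_char_0 tseries)"
 by (auto simp: mc_map_fibl fun_eq_iff)
lemma mc_map_comp: "comp k (mc_map m n ph s) = mc_map m n ph (comp k (s :: 'k::field_char_0 tseries))"
 by (auto simp: mc_map_fibl fun_eq_iff comp_def fibl_iff intro!: sum.cong sum.neutral)
lemma mc_map_low: "(!!w. length w < N ==> s w = 0) ==> length w < N ==> mc_map m n ph s w = (0 :: 'k::field_char_0)"
 by (auto simp: mc_map_fibl fibl_iff intro!: sum.neutral)

lemma mc_map_xi:
 assumes J: "J : faces m"
 shows "mc_map m n ph (xi J) = (if inj_on ph J then xi (ph ` J) else 0 :: 'k::field_char_0 tseries)"
proof
 fix w
 have "mc_map m n ph (xi J) w = (if set w \<subseteq> faces n & [J] : fibl m ph w then 1 else (0::'k))"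
  unfolding mc_map_fibl xi_def by (simp add: sum.delta)
 also have "[J] : fibl m ph w \<longleftrightarrow> inj_on ph J & w = [ph ` J]"
  using J by (cases w rule: remdups_adj.cases) (auto simp: fib_def faces_def)
 also have "set w \<subseteq> faces n & inj_on ph J & w = [ph ` J] \<longleftrightarrow> inj_on ph J & w = [ph ` J]"
  using image_faces[OF ph J] by auto
 finally show "mc_map m n ph (xi J) w = (if inj_on ph J then xi (ph ` J) else 0 :: 'k tseries) w"
  by (auto simp: xi_def)
qed

lemma mc_map_tbrk: "mc_map m n ph (tbrk s t) = tbrk (mc_map m n ph s) (mc_map m n ph t :: 'k::field_char_0 tseries)"
proof
 fix w
 show "mc_map m n ph (tbrk s t) w = tbrk (mc_map m n ph s) (mc_map m n ph t) w"
 proof (cases "set w \<subseteq> faces n")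
  case w: True
  have s: "set (take i w) \<subseteq> faces n" "set (drop i w) \<subseteq> faces n" for i using w by (auto dest: in_set_takeD in_set_dropD)
  have "mc_map m n ph (tbrk s t) w = (\<Sum>v\<in>fibl m ph w. \<Sum>i\<le>length w. s (take i v) * t (drop i v)
    - sg (wdeg (take i v) * wdeg (drop i v)) * t (take i v) * s (drop i v))"
   unfolding mc_map_fibl tbrk_def using w by (simp add: fibl_iff cong: sum.cong_simp)
  also have "... = (\<Sum>i\<le>length w. \<Sum>v\<in>fibl m ph w. s (take i v) * t (drop i v)
    - sg (wdeg (take i v) * wdeg (drop i v)) * t (take i v) * s (drop i v))" by (rule sum.swap)
  also have "... = tbrk (mc_map m n ph s) (mc_map m n ph t) w"
   unfolding tbrk_def
  proof (rule sum.cong[OF refl])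
   fix i assume i: "i : {..length w}"
   let ?A = "fibl m ph (take i w)" and ?B = "fibl m ph (drop i w)"
   have "(\<Sum>v\<in>fibl m ph w. s (take i v) * t (drop i v) - sg (wdeg (take i v) * wdeg (drop i v)) * t (take i v) * s (drop i v))
    = (\<Sum>u\<in>?A. \<Sum>v\<in>?B. s u * t v - sg (wdeg u * wdeg v) * t u * s v)"
    by (rule sum_fibl_split[where f = "%u v. s u * t v - sg (wdeg u * wdeg v) * t u * s v"]) (use i in simp)
   also have "... = (\<Sum>u\<in>?A. \<Sum>v\<in>?B. s u * t v - sg (wdeg (take i w) * wdeg (drop i w)) * t u * s v)"
    by (intro sum.cong refl) (simp add: fibl_wdeg(1)[OF _ s(1)] fibl_wdeg(1)[OF _ s(2)])
   also have "... = sum s ?A * sum t ?B - sg (wdeg (take i w) * wdeg (drop i w)) * sum t ?A * sum s ?B"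
   proof -
    have "c * sum t ?A * sum s ?B = (\<Sum>u\<in>?A. \<Sum>v\<in>?B. c * t u * s v)" for c
    proof -
     have d: "c * sum t ?A = (\<Sum>u\<in>?A. c * t u)" by (rule sum_distrib_left)
     show ?thesis unfolding d by (rule sum_product)
    qed
    then show ?thesis unfolding sum_subtractf sum_product[of s ?A t ?B] by simp
   qed
   finally show "(\<Sum>v\<in>fibl m ph w. s (take i v) * t (drop i v) - sg (wdeg (take i v) * wdeg (drop i v)) * t (take i v) * s (drop i v))
    = mc_map m n ph s (take i w) * mc_map m n ph t (drop i w)
     - sg (wdeg (take i w) * wdeg (drop i w)) * mc_map m n ph t (take i w) * mc_map m n ph s (drop i w)"
    unfolding mc_map_fibl using s by simp
  qed
  finally show ?thesis .
 next
  case False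
  have "\<not> set (take i w) \<subseteq> faces n \<or> \<not> set (drop i w) \<subseteq> faces n" for i
   using False by (metis append_take_drop_id set_append Un_least)
  then have p: "mc_map m n ph f (take i w) * mc_map m n ph h (drop i w) = (0::'k)" for f h i by (auto simp: mc_map_fibl)
  have "tbrk (mc_map m n ph s) (mc_map m n ph t) w = 0" unfolding tbrk_def mult.assoc p by simp
  then show ?thesis using False by (simp add: mc_map_fibl)
 qed
qed

lemma mc_map_lie_part: "lie_part m k d s ==> lie_part n k d (mc_map m n ph s :: 'k::field_char_0 tseries)"
proof (induction rule: lie_part.induct)
 case (gen J)
 show ?case
 proof (cases "inj_on ph J")
  case True
  have "ph ` J : faces n" by (rule image_faces[OF ph gen])
  moreover have "xdeg (ph ` J) = xdeg J" using card_image[OF True] by (simp add: xdeg_def cdeg_def)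
  ultimately show ?thesis unfolding mc_map_xi[OF gen] if_P[OF True] using lie_part.gen by metis
 qed (simp only: mc_map_xi[OF gen] if_False lie_part.zero)
qed (simp_all only: mc_map_add mc_map_tscl mc_map_0 mc_map_tbrk lie_part.intros)

lemma mc_map_mc_gr: assumes "s : mc_gr m d" shows "(mc_map m n ph s :: 'k::field_char_0 tseries) : mc_gr n d"
proof -
 have "mc_map m n ph s [] = 0" using assms by (simp add: mc_map_fibl mc_gr_def)
 moreover have "lie_part n k d (comp k (mc_map m n ph s))" if "1 <= k" for k
  unfolding mc_map_comp by (rule mc_map_lie_part) (use assms that in \<open>simp add: mc_gr_comp\<close>)
 ultimately show ?thesis unfolding mc_gr_comp by blast
qed

text \<open>
  On coefficients this is the naturality of the transferred operations.
\<close>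

lemma mc_map_dxi:
 assumes J: "J : faces m"
 shows "mc_map m n ph (dxi m J) = (if inj_on ph J then dxi n (ph ` J) else 0 :: 'k::field_char_0 tseries)"
proof
 fix w
 have e: "dxi k K v = (if v ~= [] & set v \<subseteq> faces k then - (sg (wdeg v) * eps v * lk (C_b k v) K) else (0::'k))" for k K v
 proof -
  have "(\<Sum>j<length v. xdeg (v ! j)) = wdeg v" by (simp add: wdeg_def sum_list_sum_nth atLeast0LessThan)
  then show ?thesis by (simp add: dxi_def eps_def sg_add)
 qed
 show "mc_map m n ph (dxi m J) w = (if inj_on ph J then dxi n (ph ` J) else 0 :: 'k tseries) w"
 proof (cases "w ~= [] & set w \<subseteq> faces n")
  case True
  then have w: "set w \<subseteq> faces n" "w ~= []" by auto
  have "mc_map m n ph (dxi m J) w = (\<Sum>v\<in>fibl m ph w. - (sg (wdeg w) * eps w * lk (C_b m v) J) :: 'k)"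
   unfolding mc_map_fibl if_P[OF w(1)]
  proof (intro sum.cong refl)
   fix v assume v: "v : fibl m ph w"
   have "v ~= [] & set v \<subseteq> faces m" using fibl_props[OF v w(1)] w(2) by auto
   then show "dxi m J v = - (sg (wdeg w) * eps w * lk (C_b m v) J :: 'k)"
    unfolding e fibl_wdeg[OF v w(1)] by simp
  qed
  also have "... = - (sg (wdeg w) * eps w * (if inj_on ph J then lk (C_b n w) (ph ` J) else 0))"
   unfolding C_b_natural[OF ph w J, symmetric] by (simp add: sum_distrib_left sum_negf)
  finally show ?thesis using w by (simp add: e)
 next
  case False
  then show ?thesis by (auto simp: mc_map_fibl e)
 qed
qed

end

section \<open>Morphisms and Maurer--Cartan elements\<close>

lemma dgl_hom_mc:
 assumes "f : dgl_hom (mc n) g"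
 shows "f : extensional (elts (mc n))" "!!d s. s : mc_gr n d ==> f s : gr g d"
  "!!d s t. s : mc_gr n d ==> t : mc_gr n d ==> f (s + t) = f s + f t"
  "!!d c s. s : mc_gr n d ==> f (tscl c s) = scl g c (f s)"
  "!!d s. s : mc_gr n d ==> f (mc_dif n s) = dif g (f s)"
  "!!d e s t. s : mc_gr n d ==> t : mc_gr n e ==> f (tbrk s t) = brk g (f s) (f t)"
  "!!N d s. 1 <= N ==> s : mc_gr n d ==> (!!w. length w < N ==> s w = 0) ==> f s : fil g N d"
 using assms unfolding dgl_hom_def mc_simps by blast+

lemma dgl_hom_mcI:
 assumes "f : extensional (elts (mc n))" "!!d s. s : mc_gr n d ==> f s : gr g d"
  "!!d s t. s : mc_gr n d ==> t : mc_gr n d ==> f (s + t) = f s + f t"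
  "!!d c s. s : mc_gr n d ==> f (tscl c s) = scl g c (f s)"
  "!!d s. s : mc_gr n d ==> f (mc_dif n s) = dif g (f s)"
  "!!d e s t. s : mc_gr n d ==> t : mc_gr n e ==> f (tbrk s t) = brk g (f s) (f t)"
  "!!N d s. 1 <= N ==> s : mc_gr n d ==> (!!w. length w < N ==> s w = 0) ==> f s : fil g N d"
 shows "f : dgl_hom (mc n) g"
 unfolding dgl_hom_def mc_simps using assms by auto

lemma elts_mc: "s : mc_gr n d ==> s : elts (mc n)" unfolding elts_def mc_simps by blast

context complete_dg_lie begin

lemma Fx_hom: assumes x: "x : MC g n" shows "Fx n x : dgl_hom (mc n) g"
proof -
 have W: "x : WW n" and eq: "!!I. I : faces n ==> Fx n x (dxi n I) = dif g (x I)" using x by (auto simp: MC_iff)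
 note X = WW_gr[OF W]
 show ?thesis
 proof (rule dgl_hom_mcI)
  show "Fx n x : extensional (elts (mc n))" by (auto simp: extensional_def Fx_def)
  show "Fx n x (mc_dif n s) = dif g (Fx n x s)" if "s : mc_gr n d" for s d
   by (rule Fx_mc_dif[OF X dxi_mc_gr _ that]) (rule eq)
  show "Fx n x s : fil g N d" if "1 <= N" "s : mc_gr n d" "!!w. length w < N ==> s w = 0" for s N d
   by (rule Fx_fil[OF X that])
  show "Fx n x (tbrk s t) = brk g (Fx n x s) (Fx n x t)" if "s : mc_gr n d" "t : mc_gr n e" for s t d e
   by (rule Fx_tbrk[OF X that])
 qed (fact Fx_gr[OF X] Fx_add[OF X] Fx_tscl[OF X])+
qed

lemma hom_to_MC_WW: assumes f: "f : dgl_hom (mc n) g" shows "hom_to_MC n f : WW n"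
proof (rule FTI[OF finite_faces[of n]])
 fix I
 show "hom_to_MC n f I ~= 0 ==> I : faces n" "hom_to_MC n f I ~= 0 ==> I : faces n"
  by (auto simp: hom_to_MC_def split: if_splits)
 show "hom_to_MC n f I : gr g (1 - cdeg I)"
  using dgl_hom_mc(2)[OF f mc_gr_xi] by (simp add: hom_to_MC_def xdeg_def)
qed

text \<open>
  A morphism is determined by its values on the generators.
\<close>

lemma hom_eq_Fx: assumes f: "f : dgl_hom (mc n) g" shows "f = Fx n (hom_to_MC n f)"
proof (rule extensionalityI)
 note W = hom_to_MC_WW[OF f]
 show "f : extensional (elts (mc n))" by (rule dgl_hom_mc(1)[OF f])
 show "Fx n (hom_to_MC n f) : extensional (elts (mc n))" by (auto simp: extensional_def Fx_def)
 fix s :: "'k tseries" assume "s : elts (mc n)"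
 then obtain d where s: "s : mc_gr n d" unfolding elts_def mc_simps by blast
 show "f s = Fx n (hom_to_MC n f) s"
 proof (rule Fx_unique[OF WW_gr[OF W] _ _ _ _ _ _ s])
  show "f (xi I) = hom_to_MC n f I" if "I : faces n" for I using that by (simp add: hom_to_MC_def)
 qed (fact dgl_hom_mc(2,3,4,6,7)[OF f])+
qed

lemma hom_to_MC_MC: assumes f: "f : dgl_hom (mc n) g" shows "hom_to_MC n f : MC g n"
 unfolding MC_iff
proof (intro conjI ballI hom_to_MC_WW[OF f])
 fix I assume I: "I : faces n"
 have "Fx n (hom_to_MC n f) (dxi n I) = f (mc_dif n (xi I))"
  unfolding hom_eq_Fx[OF f, symmetric] mc_dif_xi[OF I] ..
 also have "... = dif g (f (xi I))" by (rule dgl_hom_mc(5)[OF f mc_gr_xi[OF I]])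
 finally show "Fx n (hom_to_MC n f) (dxi n I) = dif g (hom_to_MC n f I)" using I by (simp add: hom_to_MC_def)
qed

lemma WW_zero: "x : WW n ==> I \<notin> faces n ==> x I = 0" by (auto simp: FT_def)

lemma hom_to_MC_Fx: assumes x: "x : WW n" shows "hom_to_MC n (Fx n x) = x"
 using Fx_xi[OF WW_gr[OF x]] WW_zero[OF x] by (auto simp: hom_to_MC_def fun_eq_iff)

lemma hom_to_MC_bij: "bij_betw (hom_to_MC n) (dgl_hom (mc n) g) (MC g n)"
proof (rule bij_betw_byWitness[where f' = "Fx n"])
 show "\<forall>f\<in>dgl_hom (mc n) g. Fx n (hom_to_MC n f) = f" using hom_eq_Fx by auto
 show "\<forall>x\<in>MC g n. hom_to_MC n (Fx n x) = x" using hom_to_MC_Fx by (auto simp: MC_iff)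
 show "hom_to_MC n ` dgl_hom (mc n) g \<subseteq> MC g n" using hom_to_MC_MC by auto
 show "Fx n ` MC g n \<subseteq> dgl_hom (mc n) g" using Fx_hom by auto
qed

lemma MC_act_eq:
 assumes ph: "simplex_map m n ph" and x: "x : WW n"
 shows "MC_act g m n ph x = (%J. if J : faces m & inj_on ph J then x (ph ` J) else 0)"
proof
 fix J
 have T: "homT (faces n) cdeg (faces m) cdeg 0 (C_map m n ph :: _ => _ \<Rightarrow>\<^sub>0 'k)"
  unfolding homT_def using C_map_lookup[OF ph, where ?'k = 'k] by (auto simp: cdeg_def card_image split: if_splits)
 have "MC_act g m n ph x J = (\<Sum>I\<in>faces n. scl g (sg (0 * (1 - cdeg I)) * lk (C_map m n ph I) J) (x I))"
  unfolding MC_act_def by (rule tensor_op_sum[OF x T finite_faces FTD(2)[OF x]])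
 also have "... = (\<Sum>I\<in>faces n. if ph ` J = I then if J : faces m & inj_on ph J then x I else 0 else 0)"
  by (rule sum.cong[OF refl]) (simp add: C_map_lookup[OF ph])
 also have "... = (if J : faces m & inj_on ph J then x (ph ` J) else 0)"
  using image_faces[OF ph, of J] by (auto simp: sum.delta')
 finally show "MC_act g m n ph x J = (if J : faces m & inj_on ph J then x (ph ` J) else 0)" .
qed

lemma MC_act_WW:
 assumes ph: "simplex_map m n ph" and x: "x : WW n" shows "MC_act g m n ph x : WW m"
proof (rule FTI[OF finite_faces[of m]])
 fix J
 show "MC_act g m n ph x J ~= 0 ==> J : faces m" "MC_act g m n ph x J ~= 0 ==> J : faces m"
  by (auto simp: MC_act_eq[OF assms] split: if_splits)
 show "MC_act g m n ph x J : gr g (1 - cdeg J)"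
  using FTD(3)[OF x, of "ph ` J"] by (cases "inj_on ph J") (simp_all add: MC_act_eq[OF assms] cdeg_def card_image)
qed

text \<open>
  Both sides are morphisms of complete graded Lie algebras with the same values on the generators.
\<close>

lemma Fx_mc_map:
 assumes ph: "simplex_map m n ph" and x: "x : WW n" and s: "s : mc_gr m d"
 shows "Fx n x (mc_map m n ph s) = Fx m (MC_act g m n ph x) s"
proof (rule Fx_unique[OF WW_gr[OF MC_act_WW[OF ph x]] _ _ _ _ _ _ s])
 note X = WW_gr[OF x] and M = mc_map_mc_gr[OF ph]
 show "Fx n x (mc_map m n ph s) : gr g d" if "s : mc_gr m d" for s d by (rule Fx_gr[OF X M[OF that]])
 show "Fx n x (mc_map m n ph (s + t)) = Fx n x (mc_map m n ph s) + Fx n x (mc_map m n ph t)"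
  if "s : mc_gr m d" "t : mc_gr m d" for s t d
  unfolding mc_map_add[OF ph] by (rule Fx_add[OF X M[OF that(1)] M[OF that(2)]])
 show "Fx n x (mc_map m n ph (tscl c s)) = scl g c (Fx n x (mc_map m n ph s))" if "s : mc_gr m d" for s c d
  unfolding mc_map_tscl[OF ph] by (rule Fx_tscl[OF X M[OF that]])
 show "Fx n x (mc_map m n ph (tbrk s t)) = brk g (Fx n x (mc_map m n ph s)) (Fx n x (mc_map m n ph t))"
  if "s : mc_gr m d" "t : mc_gr m e" for s t d e
  unfolding mc_map_tbrk[OF ph] by (rule Fx_tbrk[OF X M[OF that(1)] M[OF that(2)]])
 show "Fx n x (mc_map m n ph s) : fil g N d" if "1 <= N" "s : mc_gr m d" "!!w. length w < N ==> s w = 0" for N s d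
  by (rule Fx_fil[OF X that(1) M[OF that(2)]], rule mc_map_low[OF ph that(3)])
 show "Fx n x (mc_map m n ph (xi J)) = MC_act g m n ph x J" if J: "J : faces m" for J
 proof (cases "inj_on ph J")
  case True
  show ?thesis unfolding mc_map_xi[OF ph J] if_P[OF True] Fx_xi[OF X image_faces[OF ph J]]
   using J True by (simp add: MC_act_eq[OF ph x])
 next
  case False
  have "Fx n x 0 = 0" using Fx_lie_part[OF X lie_part.zero[of n 1 0]] ev_0[OF X] by simp
  then show ?thesis unfolding mc_map_xi[OF ph J] if_not_P[OF False] MC_act_eq[OF ph x] using False by (simp only: simp_thms if_False)
 qed
qed

text \<open>
  The equation for a face of the \<open>m\<close>-simplex is the image of an equation on the
  \<open>n\<close>-simplex, or trivial if the face degenerates.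
\<close>

lemma MC_act_MC:
 assumes ph: "simplex_map m n ph" and x: "x : MC g n" shows "MC_act g m n ph x : MC g m"
proof -
 have W: "x : WW n" and eq: "!!I. I : faces n ==> Fx n x (dxi n I) = dif g (x I)" using x by (auto simp: MC_iff)
 note X = WW_gr[OF W]
 show ?thesis unfolding MC_iff
 proof (intro conjI ballI MC_act_WW[OF ph W])
  fix J assume J: "J : faces m"
  have "Fx m (MC_act g m n ph x) (dxi m J) = Fx n x (mc_map m n ph (dxi m J))"
   by (rule Fx_mc_map[OF ph W dxi_mc_gr, symmetric])
  also have "... = dif g (MC_act g m n ph x J)"
  proof (cases "inj_on ph J")
   case True
   show ?thesis unfolding mc_map_dxi[OF ph J] if_P[OF True] eq[OF image_faces[OF ph J]]
    using J True by (simp add: MC_act_eq[OF ph W])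
  next
   case False
   have "Fx n x 0 = 0" using Fx_lie_part[OF X lie_part.zero[of n 1 0]] ev_0[OF X] by simp
   then show ?thesis unfolding mc_map_dxi[OF ph J] if_not_P[OF False] MC_act_eq[OF ph W] using False
    by (simp only: simp_thms if_False dif_0)
  qed
  finally show "Fx m (MC_act g m n ph x) (dxi m J) = dif g (MC_act g m n ph x J)" .
 qed
qed

lemma hom_act_Fx:
 assumes ph: "simplex_map m n ph" and f: "f : dgl_hom (mc n) g"
 shows "hom_act m n ph f = Fx m (MC_act g m n ph (hom_to_MC n f))"
proof (rule extensionalityI)
 show "hom_act m n ph f : extensional (elts (mc m))" unfolding hom_act_def by (rule compose_extensional)
 show "Fx m (MC_act g m n ph (hom_to_MC n f)) : extensional (elts (mc m))" by (auto simp: extensional_def Fx_def)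
 fix s :: "'k tseries" assume e: "s : elts (mc m)"
 then obtain d where s: "s : mc_gr m d" unfolding elts_def mc_simps by blast
 have "hom_act m n ph f s = f (mc_map m n ph s)" unfolding hom_act_def by (rule compose_eq[OF e])
 also have "... = Fx n (hom_to_MC n f) (mc_map m n ph s)" using hom_eq_Fx[OF f] by metis
 also have "... = Fx m (MC_act g m n ph (hom_to_MC n f)) s" by (rule Fx_mc_map[OF ph hom_to_MC_WW[OF f] s])
 finally show "hom_act m n ph f s = Fx m (MC_act g m n ph (hom_to_MC n f)) s" .
qed

lemma simplicial_MC: "simplicial_set (MC g) (MC_act g)"
proof -
 have comp: "MC_act g l m pz (MC_act g m n ph x) = MC_act g l n (ph \<circ> pz) x"
  if ph: "simplex_map m n ph" and pz: "simplex_map l m pz" and xM: "x : MC g n" for l m n ph pz x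
 proof -
 have x: "x : WW n" using xM by (simp add: MC_iff)
 have c: "simplex_map l n (ph \<circ> pz)"
  using ph pz by (fastforce simp: simplex_map_def monotone_on_def Pi_iff)
 show ?thesis
  unfolding MC_act_eq[OF pz MC_act_WW[OF ph x]] unfolding MC_act_eq[OF c x] MC_act_eq[OF ph x]
 proof
  fix J
  show "(if J : faces l & inj_on pz J then if pz ` J : faces m & inj_on ph (pz ` J) then x (ph ` pz ` J) else 0 else 0)
   = (if J : faces l & inj_on (ph \<circ> pz) J then x ((ph \<circ> pz) ` J) else 0)"
   using image_faces[OF pz, of J] comp_inj_on_iff[of pz J ph] inj_on_imageI2[of ph pz J] by (auto simp: image_comp)
 qed
 qed
 have ident: "MC_act g n n id x = x" if xM: "x : MC g n" for n x
 proof -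
 have x: "x : WW n" using xM by (simp add: MC_iff)
 have i: "simplex_map n n id" by (simp add: simplex_map_def monotone_on_def)
 show ?thesis unfolding MC_act_eq[OF i x] using WW_zero[OF x] by (auto simp: fun_eq_iff)
 qed
 have cong: "MC_act g m n ph x = MC_act g m n ph' x"
  if ph: "simplex_map m n ph" and ph': "simplex_map m n ph'" and e: "\<forall>j\<le>m. ph j = ph' j" and xM: "x : MC g n" for m n ph ph' x
 proof -
 have x: "x : WW n" using xM by (simp add: MC_iff)
 have "inj_on ph J = inj_on ph' J & ph ` J = ph' ` J" if "J : faces m" for J
 proof -
  have "ph j = ph' j" if "j : J" for j using \<open>J : faces m\<close> that e by (auto simp: faces_def)
  then show ?thesis by (auto cong: inj_on_cong image_cong)
 qed
 note h = this
 show ?thesis unfolding MC_act_eq[OF ph x] MC_act_eq[OF ph' x]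
 proof (rule ext)
  show "(if J : faces m & inj_on ph J then x (ph ` J) else 0) = (if J : faces m & inj_on ph' J then x (ph' ` J) else 0)" for J
   by (cases "J : faces m") (simp_all add: h)
 qed
 qed
 show ?thesis unfolding simplicial_set_def using MC_act_MC comp ident cong by blast
qed

end

text \<open>
  A levelwise injection into a simplicial set that is compatible with the operators forces the
  simplicial identities on its source.
\<close>

lemma simplicial_set_transport:
 assumes Y: "simplicial_set Y actY" and inj: "!!n. inj_on (F n) (X n)"
  and into: "!!n x. x : X n ==> F n x : Y n"
  and act: "!!m n ph x. simplex_map m n ph ==> x : X n ==> actX m n ph x : X m & F m (actX m n ph x) = actY m n ph (F n x)"
 shows "simplicial_set X actX"
proof -
 have i: "simplex_map n n id" for n by (simp add: simplex_map_def monotone_on_def)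
 have ident: "actX n n id x = x" if x: "x : X n" for n x
 proof (rule inj_onD[OF inj[of n]])
  have "actY n n id (F n x) = F n x" using Y into[OF x] unfolding simplicial_set_def by blast
  then show "F n (actX n n id x) = F n x" using act[OF i x] by simp
  show "actX n n id x : X n" "x : X n" using act[OF i x] x by auto
 qed
 have comp: "actX l m pz (actX m n ph x) = actX l n (ph \<circ> pz) x"
  if ph: "simplex_map m n ph" and pz: "simplex_map l m pz" and x: "x : X n" for l m n ph pz x
 proof (rule inj_onD[OF inj[of l]])
  have c: "simplex_map l n (ph \<circ> pz)"
   using ph pz by (fastforce simp: simplex_map_def monotone_on_def Pi_iff)
  note a = act[OF ph x] and b = act[OF pz conjunct1[OF act[OF ph x]]] and c' = act[OF c x]
  show "actX l m pz (actX m n ph x) : X l" "actX l n (ph \<circ> pz) x : X l" using b c' by auto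
  have "actY l m pz (actY m n ph (F n x)) = actY l n (ph \<circ> pz) (F n x)"
   using Y ph pz into[OF x] unfolding simplicial_set_def by blast
  then show "F l (actX l m pz (actX m n ph x)) = F l (actX l n (ph \<circ> pz) x)" using a b c' by simp
 qed
 have cong: "actX m n ph x = actX m n ph' x"
  if ph: "simplex_map m n ph" and ph': "simplex_map m n ph'" and e: "\<forall>j\<le>m. ph j = ph' j" and x: "x : X n" for m n ph ph' x
 proof (rule inj_onD[OF inj[of m]])
  show "actX m n ph x : X m" "actX m n ph' x : X m" using act[OF ph x] act[OF ph' x] by auto
  have "actY m n ph (F n x) = actY m n ph' (F n x)"
   using Y ph ph' e into[OF x] unfolding simplicial_set_def by blast
  then show "F m (actX m n ph x) = F m (actX m n ph' x)" using act[OF ph x] act[OF ph' x] by simp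
 qed
 show ?thesis unfolding simplicial_set_def using act comp ident cong by blast
qed

lemma dgl_hom_compose:
 fixes g :: "('k::field_char_0, 'v::ab_group_add) fdgl" and h :: "('k, 'w::ab_group_add) fdgl"
 assumes f: "f : dgl_hom g h" and u: "u : dgl_hom (mc n) g"
 shows "compose (elts (mc n)) f u : dgl_hom (mc n) h"
proof -
 note U = dgl_hom_mc[OF u]
 have c: "compose (elts (mc n)) f u s = f (u s)" if "s : mc_gr n d" for s d by (rule compose_eq[OF elts_mc[OF that]])
 have F: "!!d x. x : gr g d ==> f x : gr h d"
  "!!d x y. x : gr g d ==> y : gr g d ==> f (x + y) = f x + f y"
  "!!d c x. x : gr g d ==> f (scl g c x) = scl h c (f x)"
  "!!d x. x : gr g d ==> f (dif g x) = dif h (f x)"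
  "!!d e x y. x : gr g d ==> y : gr g e ==> f (brk g x y) = brk h (f x) (f y)"
  "!!N d x. 1 <= N ==> x : fil g N d ==> f x : fil h N d"
  using f unfolding dgl_hom_def by blast+
 show ?thesis
 proof (rule dgl_hom_mcI)
  show "compose (elts (mc n)) f u : extensional (elts (mc n))" by (rule compose_extensional)
  show "compose (elts (mc n)) f u s : gr h d" if "s : mc_gr n d" for s d
   unfolding c[OF that] by (rule F(1)[OF U(2)[OF that]])
  show "compose (elts (mc n)) f u (s + t) = compose (elts (mc n)) f u s + compose (elts (mc n)) f u t"
   if "s : mc_gr n d" "t : mc_gr n d" for s t d
   unfolding c[OF that(1)] c[OF that(2)] c[OF mc_gr_add[OF that]] U(3)[OF that] by (rule F(2)[OF U(2)[OF that(1)] U(2)[OF that(2)]])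
  show "compose (elts (mc n)) f u (tscl a s) = scl h a (compose (elts (mc n)) f u s)" if "s : mc_gr n d" for s a d
   unfolding c[OF that] c[OF mc_gr_tscl[OF that]] U(4)[OF that] by (rule F(3)[OF U(2)[OF that]])
  show "compose (elts (mc n)) f u (mc_dif n s) = dif h (compose (elts (mc n)) f u s)" if "s : mc_gr n d" for s d
   unfolding c[OF that] c[OF mc_dif_mc_gr[OF dxi_mc_gr that]] U(5)[OF that] by (rule F(4)[OF U(2)[OF that]])
  show "compose (elts (mc n)) f u (tbrk s t) = brk h (compose (elts (mc n)) f u s) (compose (elts (mc n)) f u t)"
   if "s : mc_gr n d" "t : mc_gr n e" for s t d e
   unfolding c[OF that(1)] c[OF that(2)] c[OF mc_gr_tbrk[OF that]] U(6)[OF that] by (rule F(5)[OF U(2)[OF that(1)] U(2)[OF that(2)]])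
  show "compose (elts (mc n)) f u s : fil h N d" if "1 <= N" "s : mc_gr n d" "!!w. length w < N ==> s w = 0" for N s d
   unfolding c[OF that(2)] by (rule F(6)[OF that(1) U(7)[OF that]])
 qed
qed

theorem theorem5p2:
  fixes g :: "('k::field_char_0, 'v::ab_group_add) fdgl"
  assumes "complete_dg_lie g"
  shows "simplicial_iso (\<lambda>n. dgl_hom (mc n) g) hom_act (MC g) (MC_act g) hom_to_MC \<and>
    (\<forall>(h :: ('k, 'w::ab_group_add) fdgl) f. complete_dg_lie h \<and> f \<in> dgl_hom g h \<longrightarrow>
      (\<forall>n. (\<forall>u\<in>dgl_hom (mc n) g. compose (elts (mc n)) f u \<in> dgl_hom (mc n) h) \<and>
           (\<forall>x\<in>MC g n. MC_map f x \<in> MC h n) \<and>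
           (\<forall>u\<in>dgl_hom (mc n) g.
              hom_to_MC n (compose (elts (mc n)) f u) = MC_map f (hom_to_MC n u))))"
proof -
 interpret G: complete_dg_lie g by (rule assms)
 have act: "hom_act m n ph u : dgl_hom (mc m) g & hom_to_MC m (hom_act m n ph u) = MC_act g m n ph (hom_to_MC n u)"
  if ph: "simplex_map m n ph" and u: "u : dgl_hom (mc n) g" for m n ph u
 proof -
  have M: "MC_act g m n ph (hom_to_MC n u) : MC g m" by (rule G.MC_act_MC[OF ph G.hom_to_MC_MC[OF u]])
  then have "MC_act g m n ph (hom_to_MC n u) : G.WW m" by (simp add: G.MC_iff)
  then show ?thesis unfolding G.hom_act_Fx[OF that] using G.Fx_hom[OF M] G.hom_to_MC_Fx by simp
 qed
 have "simplicial_set (%n. dgl_hom (mc n) g) hom_act"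
  by (rule simplicial_set_transport[OF G.simplicial_MC, where F = hom_to_MC])
   (use G.hom_to_MC_bij G.hom_to_MC_MC act in \<open>auto simp: bij_betw_def\<close>)
 then have iso: "simplicial_iso (%n. dgl_hom (mc n) g) hom_act (MC g) (MC_act g) hom_to_MC"
  unfolding simplicial_iso_def using G.simplicial_MC G.hom_to_MC_bij act by blast
 have nat: "hom_to_MC n (compose (elts (mc n)) f u) = MC_map f (hom_to_MC n u)"
  if f: "f : dgl_hom g h" and u: "u : dgl_hom (mc n) g" for h :: "('k, 'w) fdgl" and f u n
 proof
  fix I
  have "f (0 + 0) = f 0 + f 0" using f G.gr_0[of 0] unfolding dgl_hom_def by blast
  then have f0: "f 0 = 0" by simp
  show "hom_to_MC n (compose (elts (mc n)) f u) I = MC_map f (hom_to_MC n u) I"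
   using compose_eq[OF elts_mc[OF mc_gr_xi], where g = f and f = u] f0 by (simp add: hom_to_MC_def MC_map_def)
 qed
 have MCm: "MC_map f x : MC h n" if h: "complete_dg_lie h" and f: "f : dgl_hom g h" and x: "x : MC g n"
  for h :: "('k, 'w) fdgl" and f x n
 proof -
  note u = G.Fx_hom[OF x]
  have "hom_to_MC n (compose (elts (mc n)) f (G.Fx n x)) : MC h n"
   by (rule complete_dg_lie.hom_to_MC_MC[OF h dgl_hom_compose[OF f u]])
  moreover have "x : G.WW n" using x by (simp add: G.MC_iff)
  ultimately show ?thesis unfolding nat[OF f u] using G.hom_to_MC_Fx by simp
 qed
 show ?thesis using iso nat MCm dgl_hom_compose by blast
qed

end
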